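(* Let $\Omega\subset\mathbb{R}^d$ be a domain with non-empty boundary $\Gamma$. Assume $\Gamma$ is Ahlfors $s$-regular with $s\in(0,d)$. Further, if $s\in[d-1,d)$, assume there are $z\in\Gamma$ and $R>0$ such that $\Omega_{z,R}=\Omega\cap B(z;R)$ is $\Omega$-uniform. Finally let $h_0$ be the quadratic form $h_0(\varphi)=\sum_{k,l=1}^d\int_\Omega c_{kl}\,(\partial_k\varphi)(\partial_l\varphi)\,dx$ on $C_c^\infty(\Omega)$ and assume its coefficient matrix $C=(c_{kl})$ satisfies the following degeneracy condition for some $\delta\ge 0$: for each bounded non-empty subset $A\subset\Gamma$ there are $a,b,r>0$ such that $$a\,d_\Gamma(x)^\delta I\le C(x)\le b\,d_\Gamma(x)^\delta I$$ for almost all $x\in A_r$. Then $h_0$ is Markov unique, i.e. $h_D=h_N$, if and only if $\delta\ge 1+(s-(d-1))$.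
   Context: A domain is a non-empty open connected subset of $\mathbb{R}^d$. $d(x;y)$ is Euclidean distance, $B(x;r)$ the open Euclidean ball, $d_A(x)=\inf_{z\in A}d(x;z)$, and $A_r=\{x\in\overline\Omega: d_A(x)<r\}$ (since $C$ is defined on $\Omega$, conditions on $C(x)$ for $x\in A_r$ are read for $x\in A_r\cap\Omega$). Matrix inequalities are in the sense of order of symmetric matrices. Coefficients: $c_{kl}=c_{lk}\in L_\infty(\Omega)$ are real, $C(x)=(c_{kl}(x))>0$ for almost all $x\in\Omega$, and for each compact $K\subset\Omega$ there is $c_K>0$ with $C(x)\ge c_K I$ for almost all $x\in K$. The form $h_0$ on (real) $L_2(\Omega)$ with domain $C_c^\infty(\Omega)$ is then closable; $h_D$ denotes its closure. The form $h_N$ is $h_N(\varphi)=\int_\Omega\sum_{k,l}c_{kl}(\partial_k\varphi)(\partial_l\varphi)\,dx$ with domain $D(h_N)=\{\varphi\in W^{1,2}_{\rm loc}(\Omega):\sum_{k,l}c_{kl}(\partial_k\varphi)(\partial_l\varphi)+\varphi^2\in L_1(\Omega)\}$. Both are Dirichlet forms, and they are the smallest and largest Dirichlet form extensions of $h_0$; $h_0$ is Markov unique if $h_D$ is its only Dirichlet form extension, equivalently $h_D=h_N$. Ahlfors $s$-regularity of $\Gamma$ ($s>0$): there is a regular Borel measure $\mu$ on $\Gamma$ such that for each $A=\Gamma\cap B(x_0;R_0)$ with $x_0\in\Gamma$, $R_0>0$, there is $c>0$ with $c^{-1}r^s\le\mu(A\cap B(x;r))\le c\,r^s$ for all $x\in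 A$ and $r\in(0,2R_0)$. $\Omega_{z,R}$ is $\Omega$-uniform if there is $\sigma\ge1$ such that for all $x,y\in\Omega_{z,R}$ there is a rectifiable curve $\gamma:[0,1]\to\Omega$ with $\gamma(0)=x$, $\gamma(1)=y$, length at most $\sigma\,d(x;y)$, and $d_\Gamma(w)\ge\sigma^{-1}\min(d(x;w),d(w;y))$ for all $w\in\gamma([0,1])$. *)

theory Defs
  imports "HOL-Analysis.Analysis"
begin

section \<open>Geometry of the domain\<close>

definition is_domain :: "(real^'d) set \<Rightarrow> bool" where
  "is_domain \<Omega> \<longleftrightarrow> \<Omega> \<noteq> {} \<and> open \<Omega> \<and> connected \<Omega>"

definition boundary_layer :: "(real^'d) set \<Rightarrow> (real^'d) set \<Rightarrow> real \<Rightarrow> (real^'d) set" where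
  "boundary_layer \<Omega> A r = {x \<in> closure \<Omega>. infdist x A < r}"

definition regular_borel_measure_on :: "(real^'d) set \<Rightarrow> (real^'d) measure \<Rightarrow> bool" where
  "regular_borel_measure_on \<Gamma> \<mu> \<longleftrightarrow>
     sets \<mu> = sets (restrict_space borel \<Gamma>) \<and>
     (\<forall>B\<in>sets \<mu>.
        emeasure \<mu> B = (INF U \<in> {U. open U \<and> B \<subseteq> U}. emeasure \<mu> (U \<inter> \<Gamma>)) \<and>
        emeasure \<mu> B = (SUP K \<in> {K. compact K \<and> K \<subseteq> B}. emeasure \<mu> K))"

text \<open>The constant \<open>c\<close> may depend on the surface ball \<open>\<Gamma> \<inter> ball x0 R0\<close>.\<close>

definition ahlfors_regular :: "(real^'d) set \<Rightarrow> real \<Rightarrow> bool" where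
  "ahlfors_regular \<Gamma> s \<longleftrightarrow>
     (\<exists>\<mu>. regular_borel_measure_on \<Gamma> \<mu> \<and>
        (\<forall>x0\<in>\<Gamma>. \<forall>R0>0. \<exists>c>0. \<forall>x \<in> \<Gamma> \<inter> ball x0 R0. \<forall>r. 0 < r \<and> r < 2 * R0 \<longrightarrow>
           ennreal (inverse c * r powr s) \<le> emeasure \<mu> ((\<Gamma> \<inter> ball x0 R0) \<inter> ball x r) \<and>
           emeasure \<mu> ((\<Gamma> \<inter> ball x0 R0) \<inter> ball x r) \<le> ennreal (c * r powr s)))"

text \<open>Supremum of the lengths of inscribed polygons; a sorted list is a partition of \<open>{0..1}\<close>.\<close>

definition curve_length :: "(real \<Rightarrow> real^'d) \<Rightarrow> ennreal" where
  "curve_length \<gamma> = (SUP ts \<in> {ts. sorted ts \<and> set ts \<subseteq> {0..1}}.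
     ennreal (\<Sum>i<length ts - 1. dist (\<gamma> (ts ! i)) (\<gamma> (ts ! Suc i))))"

definition rectifiable_curve :: "(real \<Rightarrow> real^'d) \<Rightarrow> bool" where
  "rectifiable_curve \<gamma> \<longleftrightarrow> path \<gamma> \<and> curve_length \<gamma> < \<infinity>"

text \<open>The curves run in \<open>\<Omega>\<close>; only their end points are required to lie in the subset \<open>V\<close>.\<close>

definition uniform_in :: "(real^'d) set \<Rightarrow> (real^'d) set \<Rightarrow> bool" where
  "uniform_in \<Omega> V \<longleftrightarrow>
     (\<exists>\<sigma>\<ge>1. \<forall>x\<in>V. \<forall>y\<in>V. \<exists>\<gamma>.
        rectifiable_curve \<gamma> \<and> path_image \<gamma> \<subseteq> \<Omega> \<and> pathstart \<gamma> = x \<and> pathfinish \<gamma> = y \<and>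
        curve_length \<gamma> \<le> ennreal (\<sigma> * dist x y) \<and>
        (\<forall>w\<in>path_image \<gamma>. infdist w (frontier \<Omega>) \<ge> inverse \<sigma> * min (dist x w) (dist w y)))"

section \<open>Function spaces\<close>

text \<open>
  Elements of \<open>L\<^sub>2(\<Omega>)\<close> are represented by functions on the whole space, whose values off \<open>\<Omega>\<close> and
  on null sets are irrelevant; all sets of functions below except \<open>test_functions\<close> are
  closed under changing a function in this way.
\<close>

definition partial :: "'d \<Rightarrow> (real^'d \<Rightarrow> real) \<Rightarrow> real^'d \<Rightarrow> real" where
  "partial k f x = frechet_derivative f (at x) (axis k 1)"

primrec Ck :: "nat \<Rightarrow> (real^'d \<Rightarrow> real) \<Rightarrow> bool" where
  "Ck 0 f \<longleftrightarrow> continuous_on UNIV f"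
| "Ck (Suc n) f \<longleftrightarrow> (\<forall>x. f differentiable at x) \<and> (\<forall>k. Ck n (partial k f))"

definition test_functions :: "(real^'d) set \<Rightarrow> (real^'d \<Rightarrow> real) set" where
  "test_functions \<Omega> =
     {\<phi>. (\<forall>n. Ck n \<phi>) \<and> compact (closure {x. \<phi> x \<noteq> 0}) \<and> closure {x. \<phi> x \<noteq> 0} \<subseteq> \<Omega>}"

definition L2 :: "(real^'d) set \<Rightarrow> (real^'d \<Rightarrow> real) set" where
  "L2 \<Omega> = {u \<in> borel_measurable (lebesgue_on \<Omega>). integrable (lebesgue_on \<Omega>) (\<lambda>x. (u x)\<^sup>2)}"

definition L2_loc :: "(real^'d) set \<Rightarrow> (real^'d \<Rightarrow> real) set" where
  "L2_loc \<Omega> = {u \<in> borel_measurable (lebesgue_on \<Omega>).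
     \<forall>K. compact K \<and> K \<subseteq> \<Omega> \<longrightarrow> integrable (lebesgue_on K) (\<lambda>x. (u x)\<^sup>2)}"

definition L_infinity :: "(real^'d) set \<Rightarrow> (real^'d \<Rightarrow> real) set" where
  "L_infinity \<Omega> = {u \<in> borel_measurable (lebesgue_on \<Omega>).
     \<exists>M. AE x in lebesgue_on \<Omega>. \<bar>u x\<bar> \<le> M}"

text \<open>\<open>g\<close> is a version of the weak gradient of \<open>u\<close>, and \<open>u\<close> is in \<open>W\<^sup>1\<^sup>,\<^sup>2\<close> locally on \<open>\<Omega>\<close>.\<close>

definition W12_loc_gradient ::
  "(real^'d) set \<Rightarrow> (real^'d \<Rightarrow> real) \<Rightarrow> (real^'d \<Rightarrow> real^'d) \<Rightarrow> bool" where
  "W12_loc_gradient \<Omega> u g \<longleftrightarrow>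
     u \<in> L2_loc \<Omega> \<and> (\<forall>k. (\<lambda>x. g x $ k) \<in> L2_loc \<Omega>) \<and>
     (\<forall>k. \<forall>\<phi>\<in>test_functions \<Omega>.
        (LINT x|lebesgue_on \<Omega>. u x * partial k \<phi> x) = - (LINT x|lebesgue_on \<Omega>. g x $ k * \<phi> x))"

section \<open>Coefficients\<close>

text \<open>The order of the associated quadratic forms; it is used for symmetric matrices only.\<close>

definition matrix_le :: "real^'d^'d \<Rightarrow> real^'d^'d \<Rightarrow> bool" where
  "matrix_le A B \<longleftrightarrow> (\<forall>v. v \<bullet> (A *v v) \<le> v \<bullet> (B *v v))"

definition positive_definite :: "real^'d^'d \<Rightarrow> bool" where
  "positive_definite A \<longleftrightarrow> (\<forall>v. v \<noteq> 0 \<longrightarrow> v \<bullet> (A *v v) > 0)"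

definition admissible_coefficients :: "(real^'d) set \<Rightarrow> (real^'d \<Rightarrow> real^'d^'d) \<Rightarrow> bool" where
  "admissible_coefficients \<Omega> C \<longleftrightarrow>
     (\<forall>k l. (\<lambda>x. C x $ k $ l) \<in> L_infinity \<Omega>) \<and>
     (AE x in lebesgue_on \<Omega>. transpose (C x) = C x) \<and>
     (AE x in lebesgue_on \<Omega>. positive_definite (C x)) \<and>
     (\<forall>K. compact K \<and> K \<subseteq> \<Omega> \<longrightarrow>
        (\<exists>c>0. AE x in lebesgue_on K. matrix_le (c *\<^sub>R mat 1) (C x)))"

definition degenerate_at_boundary ::
  "(real^'d) set \<Rightarrow> (real^'d \<Rightarrow> real^'d^'d) \<Rightarrow> real \<Rightarrow> bool" where
  "degenerate_at_boundary \<Omega> C \<delta> \<longleftrightarrow>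
     (\<forall>A. A \<subseteq> frontier \<Omega> \<and> bounded A \<and> A \<noteq> {} \<longrightarrow>
        (\<exists>a>0. \<exists>b>0. \<exists>r>0. AE x in lebesgue_on \<Omega>. x \<in> boundary_layer \<Omega> A r \<longrightarrow>
           matrix_le ((a * infdist x (frontier \<Omega>) powr \<delta>) *\<^sub>R mat 1) (C x) \<and>
           matrix_le (C x) ((b * infdist x (frontier \<Omega>) powr \<delta>) *\<^sub>R mat 1)))"

section \<open>Quadratic forms\<close>

text \<open>
  A quadratic form on a subspace of \<open>L\<^sub>2(\<Omega>)\<close> is represented by its graph, so that equality of
  forms is equality of domains together with equality of values.
\<close>

definition h0 :: "(real^'d) set \<Rightarrow> (real^'d \<Rightarrow> real^'d^'d) \<Rightarrow> (real^'d \<Rightarrow> real) \<Rightarrow> real" where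
  "h0 \<Omega> C \<phi> = (\<Sum>k\<in>UNIV. \<Sum>l\<in>UNIV.
     LINT x|lebesgue_on \<Omega>. C x $ k $ l * partial k \<phi> x * partial l \<phi> x)"

text \<open>
  The closure of \<open>h0\<close> on \<open>test_functions \<Omega>\<close>: limits in \<open>L\<^sub>2\<close> of sequences that are Cauchy for \<open>h0\<close>.
\<close>

definition hD_form ::
  "(real^'d) set \<Rightarrow> (real^'d \<Rightarrow> real^'d^'d) \<Rightarrow> ((real^'d \<Rightarrow> real) \<times> real) set" where
  "hD_form \<Omega> C = {(u, q). u \<in> L2 \<Omega> \<and>
     (\<exists>\<phi>. (\<forall>n::nat. \<phi> n \<in> test_functions \<Omega>) \<and>
        (\<lambda>n. LINT x|lebesgue_on \<Omega>. (\<phi> n x - u x)\<^sup>2) \<longlonglongrightarrow> 0 \<and>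
        (\<forall>e>0. \<exists>N. \<forall>m\<ge>N. \<forall>n\<ge>N. h0 \<Omega> C (\<lambda>x. \<phi> m x - \<phi> n x) < e) \<and>
        (\<lambda>n. h0 \<Omega> C (\<phi> n)) \<longlonglongrightarrow> q)}"

definition hN_form ::
  "(real^'d) set \<Rightarrow> (real^'d \<Rightarrow> real^'d^'d) \<Rightarrow> ((real^'d \<Rightarrow> real) \<times> real) set" where
  "hN_form \<Omega> C = {(u, q). \<exists>g. W12_loc_gradient \<Omega> u g \<and>
     integrable (lebesgue_on \<Omega>)
       (\<lambda>x. (\<Sum>k\<in>UNIV. \<Sum>l\<in>UNIV. C x $ k $ l * g x $ k * g x $ l) + (u x)\<^sup>2) \<and>
     q = (LINT x|lebesgue_on \<Omega>. (\<Sum>k\<in>UNIV. \<Sum>l\<in>UNIV. C x $ k $ l * g x $ k * g x $ l))}"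

text \<open>
  Markov uniqueness: the minimal form \<open>hD_form\<close> and the maximal form \<open>hN_form\<close> coincide. It cannot
  be read as uniqueness among all Dirichlet forms that agree with \<open>h0\<close> on \<open>test_functions \<Omega>\<close>:
  imposing a Neumann condition on both sides of a slit inside \<open>\<Omega>\<close> (at a point, in dimension one)
  always gives another such form.
\<close>

definition markov_unique :: "(real^'d) set \<Rightarrow> (real^'d \<Rightarrow> real^'d^'d) \<Rightarrow> bool" where
  "markov_unique \<Omega> C \<longleftrightarrow> hD_form \<Omega> C = hN_form \<Omega> C"

end

theory Submission
  imports Defs
begin

text \<open>
  Only \<open>hN \<subseteq> hD\<close> depends on the degeneracy. Let \<open>\<Gamma>\<close> be the boundary. Ahlfors regularity gives the
  layer \<open>{d\<^sub>\<Gamma> < t}\<close> volume of order \<open>t\<^sup>d\<^sup>-\<^sup>s\<close>, so a cutoff at the scale \<open>t\<close> has energy of order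
  \<open>t\<close> to the power \<open>\<delta> - 2 + d - s\<close>. If the exponent is nonnegative, the average of \<open>N\<close>
  cutoffs at consecutive dyadic scales has energy of order \<open>1 / N\<close>. Multiplying with it the smooth
  bounded truncation \<open>a sin (u / a)\<close> of a function \<open>u\<close> in the domain of \<open>hN\<close>, and mollifying,
  approximates \<open>u\<close> by test functions.

  If the exponent is negative, a function equal to \<open>1\<close> near a boundary point \<open>z\<close> is in the domain of
  \<open>hN\<close> but cannot be approximated by functions vanishing near \<open>\<Gamma>\<close>: chains of balls run from a fixed
  ball to each point of \<open>\<Gamma>\<close> near \<open>z\<close>, along the curves of the uniformity condition or, if \<open>s < d - 1\<close>,
  because \<open>\<Gamma>\<close> is too thin to leave a complement of the closure of \<open>\<Omega>\<close>. Integrating the oscillation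
  along the chains against the Ahlfors measure bounds the energy from below.
\<close>

section \<open>Smooth functions\<close>

text \<open>At the critical exponent a single cutoff has energy of order 1, which is not enough; the
  gradients of dyadic cutoffs live on disjoint shells, so in an average of \<open>N\<close> of them
  the squares of the factors 1/N sum to 1/N. The degeneracy is controlled only near bounded pieces
  of the boundary, hence a second cutoff at infinity; its gradient is merely bounded, and the tail
  of u^2 makes its share of the energy small. The sine is bounded by \<open>a\<close> and by |u| and
  has a bounded smooth derivative, so classical chain rules suffice. In the converse, values on
  consecutive balls are compared through a common parameter \<open>h\<close> in the unit ball; this
  gives L1 bounds on the gradient and replaces a Poincare inequality. Link \<open>j\<close> costs
  2^(-j*eta/2) with eta = 2 - d + s - \<delta>, so eta > 0 makes the chain summable. Under
  uniformity the reciprocal of the degeneracy may fail to be integrable, and the chains stay at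
  distance of order 2^(-j) from the boundary. If s < d - 1, then \<delta> < 1 < d - s, the
  reciprocal is integrable and the balls may be centred on the boundary.\<close>

definition gradient :: "(real^'d \<Rightarrow> real) \<Rightarrow> real^'d \<Rightarrow> real^'d" where
  "gradient f x = (\<chi> k. partial k f x)"

lemma gradient_nth [simp]: "gradient f x $ k = partial k f x"
  by (simp add: gradient_def)

lemma partial_eqI: "(f has_derivative D) (at x) \<Longrightarrow> partial k f x = D (axis k 1)"
  by (simp add: partial_def frechet_derivative_at[symmetric])

lemma has_derivative_gradient:
  fixes f :: "real^'d \<Rightarrow> real"
  assumes "f differentiable (at x)"
  shows "(f has_derivative (\<lambda>h. gradient f x \<bullet> h)) (at x)"
proof -
  let ?D = "frechet_derivative f (at x)"
  have D: "(f has_derivative ?D) (at x)"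
    using assms frechet_derivative_works by blast
  have lin: "linear ?D"
    using D has_derivative_linear by blast
  have "?D h = gradient f x \<bullet> h" for h
  proof -
    have "?D h = ?D (\<Sum>i\<in>UNIV. (h $ i) *\<^sub>R axis i 1)"
      using basis_expansion[of h] by (simp add: scalar_mult_eq_scaleR)
    also have "\<dots> = (\<Sum>i\<in>UNIV. (h $ i) * ?D (axis i 1))"
      by (simp add: linear_sum[OF lin] linear_scale[OF lin])
    also have "\<dots> = gradient f x \<bullet> h"
      by (simp add: inner_vec_def gradient_def partial_def mult.commute)
    finally show ?thesis .
  qed
  then have "?D = (\<lambda>h. gradient f x \<bullet> h)" by auto
  with D show ?thesis by simp
qed

lemma Ck_Suc_differentiable: "Ck (Suc n) f \<Longrightarrow> f differentiable (at x)"
  by simp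

lemma Ck_partial: "Ck (Suc n) f \<Longrightarrow> Ck n (partial k f)"
  by simp

lemma Ck_SucD: "Ck (Suc n) f \<Longrightarrow> Ck n f"
proof (induction n arbitrary: f)
  case 0
  then show ?case
    by (auto simp: continuous_on_eq_continuous_at intro: differentiable_imp_continuous_within)
next
  case (Suc n)
  then show ?case by (metis Ck.simps(2))
qed

lemma Ck_continuous: "Ck n f \<Longrightarrow> continuous_on UNIV f"
proof (induction n)
  case (Suc n)
  then show ?case using Ck_SucD by blast
qed simp

lemma continuous_on_gradient: "Ck (Suc n) f \<Longrightarrow> continuous_on UNIV (gradient f)"
  unfolding gradient_def
  by (intro continuous_on_vec_lambda Ck_continuous[OF Ck_partial])

lemma Ck_const [simp]: "Ck n (\<lambda>x. c)"
proof (induction n arbitrary: c)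
  case (Suc n)
  have "partial k (\<lambda>x. c) = (\<lambda>x. 0)" for k :: 'a
    by (rule ext, subst partial_eqI[where D="\<lambda>h. 0"]) auto
  then show ?case using Suc by simp
qed simp

lemma partial_add:
  assumes "f differentiable (at x)" "g differentiable (at x)"
  shows "partial k (\<lambda>x. f x + g x) x = partial k f x + partial k g x"
  by (subst partial_eqI[OF has_derivative_add[OF has_derivative_gradient has_derivative_gradient]])
     (use assms in \<open>auto simp: inner_axis\<close>)

lemma partial_mult:
  assumes "f differentiable (at x)" "g differentiable (at x)"
  shows "partial k (\<lambda>x. f x * g x) x = partial k f x * g x + f x * partial k g x"
  by (subst partial_eqI[OF has_derivative_mult[OF has_derivative_gradient has_derivative_gradient]])
     (use assms in \<open>auto simp: inner_axis\<close>)

lemma partial_cmult: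
  assumes "f differentiable (at x)"
  shows "partial k (\<lambda>x. c * f x) x = c * partial k f x"
  by (subst partial_eqI[OF has_derivative_mult_right[OF has_derivative_gradient]])
     (use assms in \<open>auto simp: inner_axis\<close>)

lemma partial_diff:
  assumes "f differentiable (at x)" "g differentiable (at x)"
  shows "partial k (\<lambda>x. f x - g x) x = partial k f x - partial k g x"
  by (subst partial_eqI[OF has_derivative_diff[OF has_derivative_gradient has_derivative_gradient]])
     (use assms in \<open>auto simp: inner_axis\<close>)

lemma Ck_add: "Ck n f \<Longrightarrow> Ck n g \<Longrightarrow> Ck n (\<lambda>x. f x + g x)"
proof (induction n arbitrary: f g)
  case 0
  then show ?case by (auto intro: continuous_on_add)
next
  case (Suc n)
  have "partial k (\<lambda>x. f x + g x) = (\<lambda>x. partial k f x + partial k g x)" for k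
    using Suc.prems by (auto simp: partial_add)
  then show ?case using Suc by auto
qed

lemma Ck_mult: "Ck n f \<Longrightarrow> Ck n g \<Longrightarrow> Ck n (\<lambda>x. f x * g x)"
proof (induction n arbitrary: f g)
  case 0
  then show ?case by (auto intro: continuous_on_mult)
next
  case (Suc n)
  have "partial k (\<lambda>x. f x * g x) = (\<lambda>x. partial k f x * g x + f x * partial k g x)" for k
    using Suc.prems by (auto simp: partial_mult)
  moreover have "Ck n f" "Ck n g"
    using Suc.prems Ck_SucD by blast+
  ultimately show ?case using Suc.prems Suc.IH by (auto intro!: Ck_add)
qed

lemma Ck_cmult: "Ck n f \<Longrightarrow> Ck n (\<lambda>x. c * f x)"
  by (intro Ck_mult Ck_const)

lemma Ck_diff: "Ck n f \<Longrightarrow> Ck n g \<Longrightarrow> Ck n (\<lambda>x. f x - g x)"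
  using Ck_add[of n f "\<lambda>x. (-1) * g x"] Ck_cmult[of n g "-1"] by simp

lemma Ck_sum: "finite I \<Longrightarrow> (\<And>i. i \<in> I \<Longrightarrow> Ck n (f i)) \<Longrightarrow> Ck n (\<lambda>x. \<Sum>i\<in>I. f i x)"
  by (induction rule: finite_induct) (auto intro: Ck_add)

lemma Ck_nth: "Ck n (\<lambda>x. x $ i)"
proof (cases n)
  case (Suc m)
  have D: "((\<lambda>x::real^'a. x $ i) has_derivative (\<lambda>h. h $ i)) (at x)" for x
    by (intro bounded_linear_imp_has_derivative bounded_linear_vec_nth)
  have "partial k (\<lambda>x. x $ i) = (\<lambda>x. axis k 1 $ i)" for k
    using partial_eqI[OF D] by auto
  then show ?thesis using Suc D by (auto simp: differentiable_def)
qed (simp add: continuous_on_component)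

lemma partial_scale:
  assumes "f differentiable (at (c *\<^sub>R x))"
  shows "partial k (\<lambda>x. f (c *\<^sub>R x)) x = c * partial k f (c *\<^sub>R x)"
    and "(\<lambda>x. f (c *\<^sub>R x)) differentiable (at x)"
proof -
  have s: "((\<lambda>x. c *\<^sub>R x) has_derivative (\<lambda>h. c *\<^sub>R h)) (at x)"
    by (intro derivative_eq_intros) auto
  have D: "((\<lambda>x. f (c *\<^sub>R x)) has_derivative (\<lambda>h. gradient f (c *\<^sub>R x) \<bullet> (c *\<^sub>R h))) (at x)"
    using has_derivative_compose[OF s has_derivative_gradient[OF assms]] .
  show "partial k (\<lambda>x. f (c *\<^sub>R x)) x = c * partial k f (c *\<^sub>R x)"
    by (subst partial_eqI[OF D]) (simp add: inner_axis)
  show "(\<lambda>x. f (c *\<^sub>R x)) differentiable (at x)"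
    using D by (auto simp: differentiable_def)
qed

lemma Ck_scale: "Ck n f \<Longrightarrow> Ck n (\<lambda>x. f (c *\<^sub>R x))"
proof (induction n arbitrary: f)
  case 0
  then have "continuous_on UNIV f" by simp
  then have "continuous_on UNIV (f \<circ> (\<lambda>x. c *\<^sub>R x))"
    by (intro continuous_on_compose continuous_intros) (auto intro: continuous_on_subset)
  then show ?case by (simp add: o_def)
next
  case (Suc n)
  have "partial k (\<lambda>x. f (c *\<^sub>R x)) = (\<lambda>x. c * partial k f (c *\<^sub>R x))" for k
    using Suc.prems by (auto simp: partial_scale)
  then show ?case using Suc by (auto intro!: Ck_cmult partial_scale)
qed

text \<open>With \<open>F'\<close> merely continuous only one order can be concluded. Smoothness of
  all orders is proved by separate inductions for the outer functions that occur, the family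
  \<open>flat_exp\<close> and the pair of sine and cosine.\<close>

lemma Ck_one_compose:
  assumes F: "\<And>t. (F has_real_derivative F' t) (at t)" and cF: "continuous_on UNIV F'"
    and f: "Ck (Suc 0) f"
  shows "partial k (\<lambda>x. F (f x)) x = F' (f x) * partial k f x"
    and "Ck (Suc 0) (\<lambda>x. F (f x))"
proof -
  have D: "((\<lambda>x. F (f x)) has_derivative (\<lambda>h. F' (f x) * (gradient f x \<bullet> h))) (at x)" for x
    using has_derivative_compose[OF has_derivative_gradient[OF Ck_Suc_differentiable[OF f]]
        F[unfolded has_field_derivative_def]] by simp
  have P: "partial k (\<lambda>x. F (f x)) x = F' (f x) * partial k f x" for k x
    by (subst partial_eqI[OF D]) (simp add: inner_axis)
  then show "partial k (\<lambda>x. F (f x)) x = F' (f x) * partial k f x" .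
  have "continuous_on UNIV (\<lambda>x. F' (f x) * partial k f x)" for k
    by (intro continuous_on_mult continuous_on_compose2[OF cF] Ck_continuous[OF f]
        Ck_continuous[OF Ck_partial[OF f]]) auto
  moreover have "partial k (\<lambda>x. F (f x)) = (\<lambda>x. F' (f x) * partial k f x)" for k
    using P by auto
  ultimately show "Ck (Suc 0) (\<lambda>x. F (f x))"
    using D by (auto simp: differentiable_def)
qed

section \<open>A smooth bump function\<close>

text \<open>The powers in the denominator make the family closed, up to linear combinations, under
  differentiation; the single function exp(-1/t) would not be. All orders of smoothness then follow
  from one induction.\<close>

definition flat_exp :: "nat \<Rightarrow> real \<Rightarrow> real" where
  "flat_exp n t = (if t > 0 then exp (- (1 / t)) / t ^ n else 0)"

text \<open>One term of the exponential series gives exp(1/t) >= (1/t)^(n+2)/(n+2)!. A bound that is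
  quadratic in \<open>t\<close> is wanted because it forces the difference quotient at 0 to vanish
  in the limit.\<close>

lemma flat_exp_bound: "\<bar>flat_exp n t\<bar> \<le> fact (n + 2) * t\<^sup>2"
proof (cases "t > 0")
  case True
  have "(1 / t) ^ (n + 2) / fact (n + 2) \<le> exp (1 / t)"
    using True sum_le_suminf[OF summable_exp_generic[of "1/t"], of "{n + 2}"]
    by (simp add: exp_def divide_inverse mult.commute)
  then have "1 \<le> exp (1 / t) * (fact (n + 2) * t ^ (n + 2))"
    using True by (simp add: power_divide field_simps del: fact_Suc)
  then have "exp (- (1 / t)) * 1 \<le> exp (- (1/t)) * (exp (1 / t) * (fact (n + 2) * t ^ (n + 2)))"
    by (intro mult_left_mono) auto
  also have "\<dots> = fact (n + 2) * t ^ (n + 2)"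
    by (simp add: mult.assoc[symmetric] exp_minus del: fact_Suc)
  finally show ?thesis using True by (simp add: flat_exp_def power_add field_simps power2_eq_square del: fact_Suc)
qed (simp add: flat_exp_def)

lemma flat_exp_derivative:
  "(flat_exp n has_real_derivative flat_exp (n + 2) t - real n * flat_exp (n + 1) t) (at t)"
proof -
  consider "t > 0" | "t < 0" | "t = 0" by linarith
  then show ?thesis
  proof cases
    case 1
    have eq: "\<forall>\<^sub>F x in nhds t. flat_exp n x = exp (- (1 / x)) / x ^ n"
      using eventually_nhds_in_open[of "{0<..}" t] 1 by (auto elim!: eventually_mono simp: flat_exp_def)
    have "((\<lambda>x. exp (- (1 / x)) / x ^ n) has_real_derivative
       (exp (- (1/t)) * (1 / t\<^sup>2) * t ^ n - exp (- (1/t)) * (real n * t ^ (n - 1))) / (t ^ n * t ^ n)) (at t)"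
      using 1 by (auto intro!: derivative_eq_intros simp: power2_eq_square)
    also have "(exp (- (1/t)) * (1 / t\<^sup>2) * t ^ n - exp (- (1/t)) * (real n * t ^ (n - 1))) / (t ^ n * t ^ n)
      = flat_exp (n + 2) t - real n * flat_exp (n + 1) t"
      using 1 by (cases n) (auto simp: flat_exp_def field_simps power2_eq_square power_add)
    finally show ?thesis
      using DERIV_cong_ev[OF refl eq refl] by simp
  next
    case 2
    have eq: "\<forall>\<^sub>F x in nhds t. flat_exp n x = 0"
      using eventually_nhds_in_open[of "{..<0}" t] 2 by (auto elim!: eventually_mono simp: flat_exp_def)
    show ?thesis
      by (subst DERIV_cong_ev[OF refl eq refl]) (use 2 in \<open>simp add: flat_exp_def\<close>)
  next
    \<comment> \<open>At the origin the difference quotient is at most a constant times |h|, and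
      both terms of the claimed derivative are 0 there by the definition of
      \<open>flat_exp\<close>.\<close>
    case 3
    have "((\<lambda>h. flat_exp n h / h) \<longlongrightarrow> 0) (at 0)"
    proof (rule Lim_null_comparison)
      have "\<bar>flat_exp n h / h\<bar> \<le> fact (n + 2) * \<bar>h\<bar>" if "h \<noteq> 0" for h
        using that flat_exp_bound[of n h]
        by (simp add: abs_divide divide_le_eq mult.assoc power2_eq_square abs_mult_self_eq del: fact_Suc)
      then show "\<forall>\<^sub>F h in at 0. norm (flat_exp n h / h) \<le> fact (n + 2) * \<bar>h\<bar>"
        by (auto simp: eventually_at_filter intro!: always_eventually simp del: fact_Suc)
      show "((\<lambda>h::real. fact (n + 2) * \<bar>h\<bar>) \<longlongrightarrow> 0) (at 0)"
        by (auto intro!: tendsto_eq_intros simp del: fact_Suc)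
    qed
    then show ?thesis using 3 by (simp add: DERIV_def flat_exp_def)
  qed
qed

definition bump :: "real^'d \<Rightarrow> real" where
  "bump x = flat_exp 0 (1 - x \<bullet> x)"

text \<open>The induction on the order carries all exponents \<open>n\<close> of
  \<open>flat_exp\<close> at once, since differentiating the member \<open>n\<close> composed with 1
  - |x|^2 produces the members \<open>n + 1\<close> and \<open>n + 2\<close>.\<close>

lemma bump_smooth: "Ck n (bump :: real^'d \<Rightarrow> real)"
proof -
  define q :: "real^'d \<Rightarrow> real" where "q x = 1 - x \<bullet> x" for x
  have q: "Ck n q" for n
    unfolding q_def inner_vec_def by (simp, intro Ck_diff Ck_const Ck_sum Ck_mult Ck_nth) simp
  have "Ck m (\<lambda>x. flat_exp n (q x))" for m n
  proof (induction m arbitrary: n)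
    case 0
    have "continuous_on UNIV (flat_exp n)"
      by (rule DERIV_continuous_on, rule has_field_derivative_at_within, rule flat_exp_derivative)
    then show ?case
      using q[of 0] by (auto intro: continuous_on_compose2)
  next
    case (Suc m)
    have D: "((\<lambda>x. flat_exp n (q x)) has_derivative
        (\<lambda>h. (flat_exp (n + 2) (q x) - real n * flat_exp (n + 1) (q x)) * (gradient q x \<bullet> h))) (at x)" for x
      using has_derivative_compose[OF has_derivative_gradient[OF Ck_Suc_differentiable[OF q]]
        flat_exp_derivative[unfolded has_field_derivative_def]] by simp
    have "partial k (\<lambda>x. flat_exp n (q x)) =
       (\<lambda>x. (flat_exp (n + 2) (q x) - real n * flat_exp (n + 1) (q x)) * partial k q x)" for k
      by (rule ext, subst partial_eqI[OF D]) (simp add: inner_axis)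
    moreover have "Ck m (\<lambda>x. (flat_exp (n + 2) (q x) - real n * flat_exp (n + 1) (q x)) * partial k q x)" for k
      by (intro Ck_mult Ck_diff Ck_cmult Suc.IH Ck_partial[OF q])
    ultimately show ?case using D by (auto simp: differentiable_def simp del: One_nat_def)
  qed
  then show ?thesis by (simp add: bump_def[abs_def] q_def)
qed

lemma bump_nonneg: "bump x \<ge> 0"
  by (simp add: bump_def flat_exp_def)

lemma bump_nonzero_iff: "bump x \<noteq> 0 \<longleftrightarrow> norm x < 1"
proof -
  have "x \<bullet> x < 1 \<longleftrightarrow> norm x < 1"
    by (metis abs_norm_cancel abs_square_less_1 power2_norm_eq_inner)
  then show ?thesis by (simp add: bump_def flat_exp_def)
qed

section \<open>Compactly supported functions\<close>

lemma partial_zero_outside: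
  assumes "closed K" "\<And>x. x \<notin> K \<Longrightarrow> f x = 0" "x \<notin> K"
  shows "partial k f x = 0"
proof -
  have "(f has_derivative (\<lambda>h. 0)) (at x)"
    by (rule has_derivative_transform_within_open[of "\<lambda>x. 0" _ _ UNIV "- K"])
       (use assms in \<open>auto simp: open_Compl\<close>)
  then show ?thesis using partial_eqI by fastforce
qed

lemma gradient_zero_outside:
  assumes "closed K" "\<And>x. x \<notin> K \<Longrightarrow> f x = 0" "x \<notin> K"
  shows "gradient f x = 0"
  using partial_zero_outside[OF assms] by (simp add: vec_eq_iff)

lemma test_functionsI:
  assumes "\<And>n. Ck n \<phi>" "compact K" "K \<subseteq> \<Omega>" "\<And>x. x \<notin> K \<Longrightarrow> \<phi> x = 0"
  shows "\<phi> \<in> test_functions \<Omega>"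
proof -
  have "closure {x. \<phi> x \<noteq> 0} \<subseteq> K"
    using assms by (intro closure_minimal compact_imp_closed) auto
  moreover then have "compact (closure {x. \<phi> x \<noteq> 0})"
    using assms(2) compact_Int_closed[of K "closure {x. \<phi> x \<noteq> 0}"] by (simp add: Int_absorb1)
  ultimately show ?thesis using assms by (auto simp: test_functions_def)
qed

lemma test_functions_support:
  assumes "\<phi> \<in> test_functions \<Omega>"
  shows "\<exists>K. compact K \<and> K \<subseteq> \<Omega> \<and> (\<forall>x. x \<notin> K \<longrightarrow> \<phi> x = 0) \<and> (\<forall>k x. x \<notin> K \<longrightarrow> partial k \<phi> x = 0)"
proof (intro exI conjI allI impI)
  let ?K = "closure {x. \<phi> x \<noteq> 0}"
  show "compact ?K" "?K \<subseteq> \<Omega>" using assms by (auto simp: test_functions_def)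
  have *: "\<phi> x = 0" if "x \<notin> ?K" for x
    using that closure_subset[of "{x. \<phi> x \<noteq> 0}"] by auto
  then show "\<phi> x = 0" if "x \<notin> ?K" for x
    using that .
  show "partial k \<phi> x = 0" if "x \<notin> ?K" for k x
    by (rule partial_zero_outside[OF closed_closure * that])
qed

lemma test_functions_Ck: "\<phi> \<in> test_functions \<Omega> \<Longrightarrow> Ck n \<phi>"
  by (simp add: test_functions_def)

lemma test_functions_partial: "\<phi> \<in> test_functions \<Omega> \<Longrightarrow> partial k \<phi> \<in> test_functions \<Omega>"
proof -
  assume \<phi>: "\<phi> \<in> test_functions \<Omega>"
  obtain K where "compact K" "K \<subseteq> \<Omega>" "\<And>x. x \<notin> K \<Longrightarrow> \<phi> x = 0" "\<And>k x. x \<notin> K \<Longrightarrow> partial k \<phi> x = 0"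
    using test_functions_support[OF \<phi>] by blast
  then show ?thesis
    using Ck_partial[OF test_functions_Ck[OF \<phi>]] by (intro test_functionsI[of _ K]) auto
qed

lemma test_functions_mono: "\<Omega> \<subseteq> \<Omega>' \<Longrightarrow> \<phi> \<in> test_functions \<Omega> \<Longrightarrow> \<phi> \<in> test_functions \<Omega>'"
  by (auto simp: test_functions_def)

lemma test_functions_mult:
  assumes "\<phi> \<in> test_functions \<Omega>" "\<And>n. Ck n \<eta>"
  shows "(\<lambda>x. \<eta> x * \<phi> x) \<in> test_functions \<Omega>"
proof -
  obtain K where "compact K" "K \<subseteq> \<Omega>" "\<And>x. x \<notin> K \<Longrightarrow> \<phi> x = 0" "\<And>k x. x \<notin> K \<Longrightarrow> partial k \<phi> x = 0"
    using test_functions_support[OF assms(1)] by blast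
  then show ?thesis
    by (intro test_functionsI[of _ K] Ck_mult assms(2) test_functions_Ck[OF assms(1)]) auto
qed

lemma test_functions_diff:
  assumes "\<phi> \<in> test_functions \<Omega>" "\<psi> \<in> test_functions \<Omega>"
  shows "(\<lambda>x. \<phi> x - \<psi> x) \<in> test_functions \<Omega>"
proof -
  obtain K where "compact K" "K \<subseteq> \<Omega>" "\<And>x. x \<notin> K \<Longrightarrow> \<phi> x = 0" "\<And>k x. x \<notin> K \<Longrightarrow> partial k \<phi> x = 0"
    using test_functions_support[OF assms(1)] by blast
  moreover obtain L where "compact L" "L \<subseteq> \<Omega>" "\<And>x. x \<notin> L \<Longrightarrow> \<psi> x = 0" "\<And>k x. x \<notin> L \<Longrightarrow> partial k \<psi> x = 0"
    using test_functions_support[OF assms(2)] by blast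
  ultimately show ?thesis
    by (intro test_functionsI[of _ "K \<union> L"] Ck_diff)
       (auto intro: test_functions_Ck[OF assms(1)] test_functions_Ck[OF assms(2)])
qed

lemma compact_support_integrable:
  fixes f :: "'a::euclidean_space \<Rightarrow> 'b::euclidean_space"
  assumes "continuous_on UNIV f" "compact K" "\<And>x. x \<notin> K \<Longrightarrow> f x = 0"
  shows "integrable lborel f"
proof -
  have "integrable lborel (\<lambda>x. indicator K x *\<^sub>R f x)"
    using assms by (intro borel_integrable_compact) (auto intro: continuous_on_subset)
  also have "(\<lambda>x. indicator K x *\<^sub>R f x) = f"
    using assms by (auto simp: indicator_def)
  finally show ?thesis .
qed

lemma compact_support_bounded:
  fixes f :: "'a::euclidean_space \<Rightarrow> 'b::euclidean_space"
  assumes "continuous_on UNIV f" "compact K" "\<And>x. x \<notin> K \<Longrightarrow> f x = 0"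
  shows "\<exists>B>0. \<forall>x. norm (f x) \<le> B"
proof -
  have "compact (f ` K)"
    using assms by (auto intro: compact_continuous_image continuous_on_subset)
  then obtain B where "B > 0" "\<And>y. y \<in> f ` K \<Longrightarrow> norm y \<le> B"
    using compact_imp_bounded bounded_pos by metis
  then have "norm (f x) \<le> B" for x
    using assms(3)[of x] by (cases "x \<in> K") auto
  with \<open>B > 0\<close> show ?thesis by blast
qed

text \<open>Compactness gives uniform continuity on a ball only. The margin 1 around
  \<open>K\<close> handles pairs with a point outside that ball: being closer than 1, both points
  then lie off \<open>K\<close>.\<close>

lemma compact_support_uniform_continuity:
  fixes f :: "'a::euclidean_space \<Rightarrow> 'b::euclidean_space"
  assumes "continuous_on UNIV f" "compact K" "\<And>x. x \<notin> K \<Longrightarrow> f x = 0" "e > 0"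
  shows "\<exists>d>0. \<forall>x y. dist x y < d \<longrightarrow> norm (f x - f y) < e"
proof -
  obtain R where R: "R > 0" "\<And>x. x \<in> K \<Longrightarrow> norm x \<le> R"
    using compact_imp_bounded[OF assms(2)] bounded_pos by metis
  have "uniformly_continuous_on (cball 0 (R + 1)) f"
    using assms(1) by (intro compact_uniformly_continuous) (auto intro: continuous_on_subset)
  then obtain d where d: "d > 0"
    "\<And>x y. x \<in> cball 0 (R + 1) \<Longrightarrow> y \<in> cball 0 (R + 1) \<Longrightarrow> dist y x < d \<Longrightarrow> dist (f y) (f x) < e"
    using \<open>e > 0\<close> unfolding uniformly_continuous_on_def by metis
  have "norm (f x - f y) < e" if "dist x y < min d 1" for x y
  proof (cases "norm x \<le> R + 1 \<and> norm y \<le> R + 1")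
    case True
    then show ?thesis using d(2)[of y x] that by (simp add: dist_norm)
  next
    case False
    have "\<bar>norm x - norm y\<bar> < 1"
      using that norm_triangle_ineq3[of x y] by (simp add: dist_norm)
    then have "norm x > R" "norm y > R" using False by linarith+
    then have "f x = 0" "f y = 0" using R(2) assms(3) by (meson not_le)+
    then show ?thesis using \<open>e > 0\<close> by simp
  qed
  then show ?thesis using d(1) by (intro exI[of _ "min d 1"]) auto
qed

lemma line_derivative:
  assumes "Ck (Suc 0) f"
  shows "((\<lambda>t. f (p + t *\<^sub>R q)) has_real_derivative (gradient f (p + t *\<^sub>R q) \<bullet> q)) (at t)"
proof -
  have s: "((\<lambda>t. p + t *\<^sub>R q) has_derivative (\<lambda>h. h *\<^sub>R q)) (at t)"
    by (auto intro!: derivative_eq_intros)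
  have "((\<lambda>t. f (p + t *\<^sub>R q)) has_derivative (\<lambda>h. gradient f (p + t *\<^sub>R q) \<bullet> (h *\<^sub>R q))) (at t)"
    using has_derivative_compose[OF s has_derivative_gradient[OF Ck_Suc_differentiable[OF assms]]] .
  then show ?thesis
    by (simp add: has_field_derivative_def mult_commute_abs)
qed

lemma gradient_mvt:
  assumes "Ck (Suc 0) f"
  obtains \<xi> where "0 < \<xi>" "\<xi> < 1" "f (z + h) - f z = gradient f (z + \<xi> *\<^sub>R h) \<bullet> h"
  using MVT2[of 0 1 "\<lambda>t. f (z + t *\<^sub>R h)" "\<lambda>t. gradient f (z + t *\<^sub>R h) \<bullet> h"] line_derivative[OF assms, of z h]
  by auto

text \<open>By the mean value theorem the increment is the gradient at an intermediate point, and
  the gradient is uniformly continuous. Uniformity in \<open>z\<close> is the point: the remainder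
  can be integrated over \<open>z\<close>, both when a convolution is differentiated and when a
  difference quotient is integrated.\<close>

lemma gradient_remainder:
  assumes f: "Ck (Suc 0) f" "compact K" "\<And>x. x \<notin> K \<Longrightarrow> f x = 0" and "e > 0"
  shows "\<exists>d>0. \<forall>z h. norm h < d \<longrightarrow> \<bar>f (z + h) - f z - gradient f z \<bullet> h\<bar> \<le> e * norm h"
proof -
  obtain d where d: "d > 0" "\<And>x y. dist x y < d \<Longrightarrow> norm (gradient f x - gradient f y) < e"
    using compact_support_uniform_continuity[OF continuous_on_gradient[OF f(1)] f(2)
      gradient_zero_outside[OF compact_imp_closed[OF f(2)] f(3)] \<open>e > 0\<close>] by blast
  have "\<bar>f (z + h) - f z - gradient f z \<bullet> h\<bar> \<le> e * norm h" if "norm h < d" for z h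
  proof -
    obtain \<xi> where \<xi>: "0 < \<xi>" "\<xi> < 1" "f (z + h) - f z = gradient f (z + \<xi> *\<^sub>R h) \<bullet> h"
      using gradient_mvt[OF f(1)] .
    have "norm (\<xi> *\<^sub>R h) \<le> norm h" using \<xi> by (simp add: mult_left_le_one_le)
    then have "norm (gradient f (z + \<xi> *\<^sub>R h) - gradient f z) < e"
      using that by (intro d) (simp add: dist_norm)
    moreover have "\<bar>f (z + h) - f z - gradient f z \<bullet> h\<bar> = \<bar>(gradient f (z + \<xi> *\<^sub>R h) - gradient f z) \<bullet> h\<bar>"
      using \<xi>(3) by (simp add: inner_diff_left)
    moreover have "\<dots> \<le> norm (gradient f (z + \<xi> *\<^sub>R h) - gradient f z) * norm h"
      by (rule Cauchy_Schwarz_ineq2)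
    ultimately show ?thesis
      by (smt (verit) mult_right_mono norm_ge_zero)
  qed
  with d(1) show ?thesis by blast
qed

section \<open>Convolution with a test function\<close>

definition conv :: "(real^'d \<Rightarrow> real) \<Rightarrow> (real^'d \<Rightarrow> real) \<Rightarrow> real^'d \<Rightarrow> real" where
  "conv \<phi> f x = (LINT y|lborel. \<phi> (x - y) * f y)"

lemma integrable_bounded_mult:
  fixes f g :: "'a \<Rightarrow> real"
  assumes "integrable M f" "g \<in> borel_measurable M" "\<And>x. \<bar>g x\<bar> \<le> B"
  shows "integrable M (\<lambda>x. g x * f x)"
proof (rule Bochner_Integration.integrable_bound[where f="\<lambda>x. B * f x"])
  show "AE x in M. norm (g x * f x) \<le> norm (B * f x)"
  proof (rule AE_I2)
    fix x
    have "\<bar>g x\<bar> \<le> \<bar>B\<bar>" using assms(3)[of x] by linarith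
    then show "norm (g x * f x) \<le> norm (B * f x)"
      by (simp add: abs_mult mult_right_mono)
  qed
qed (use assms in auto)

lemma conv_integrable:
  assumes "\<phi> \<in> test_functions UNIV" "integrable lborel f"
  shows "integrable lborel (\<lambda>y. \<phi> (x - y) * f y)"
proof -
  have c: "continuous_on UNIV \<phi>" using Ck_continuous[OF test_functions_Ck[OF assms(1)]] .
  obtain K where "compact K" "\<And>x. x \<notin> K \<Longrightarrow> \<phi> x = 0"
    using test_functions_support[OF assms(1)] by blast
  then obtain B where "\<And>x. norm (\<phi> x) \<le> B"
    using compact_support_bounded[OF c] by blast
  moreover have "(\<lambda>y. \<phi> (x - y)) \<in> borel_measurable lborel"
    using borel_measurable_continuous_onI[OF c] by measurable
  ultimately show ?thesis
    using assms(2) by (intro integrable_bounded_mult[of _ _ _ B]) auto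
qed

lemma conv_continuous:
  assumes "\<phi> \<in> test_functions UNIV" "integrable lborel f"
  shows "continuous_on UNIV (conv \<phi> f)"
proof -
  have c: "continuous_on UNIV \<phi>" using Ck_continuous[OF test_functions_Ck[OF assms(1)]] .
  obtain K where K: "compact K" "\<And>x. x \<notin> K \<Longrightarrow> \<phi> x = 0"
    using test_functions_support[OF assms(1)] by blast
  define N where "N = (LINT y|lborel. \<bar>f y\<bar>)"
  have "\<exists>d>0. \<forall>x'. dist x' x < d \<longrightarrow> dist (conv \<phi> f x') (conv \<phi> f x) < e" if "e > 0" for e x
  proof -
    have N: "N \<ge> 0" by (simp add: N_def)
    \<comment> \<open>The denominator \<open>N + 1\<close> instead of \<open>N\<close> covers
      functions that vanish almost everywhere.\<close>
    then have eN: "e / (N + 1) > 0" using that by simp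
    obtain d where d: "d > 0" "\<And>x y. dist x y < d \<Longrightarrow> norm (\<phi> x - \<phi> y) < e / (N + 1)"
      using compact_support_uniform_continuity[OF c K eN] by blast
    have "dist (conv \<phi> f x') (conv \<phi> f x) < e" if "dist x' x < d" for x'
    proof -
      have "dist (conv \<phi> f x') (conv \<phi> f x) = \<bar>LINT y|lborel. (\<phi> (x' - y) - \<phi> (x - y)) * f y\<bar>"
        by (simp add: conv_def dist_real_def left_diff_distrib conv_integrable[OF assms])
      also have "\<dots> \<le> (LINT y|lborel. \<bar>(\<phi> (x' - y) - \<phi> (x - y)) * f y\<bar>)"
        by (rule integral_abs_bound)
      also have "\<dots> \<le> (LINT y|lborel. e / (N + 1) * \<bar>f y\<bar>)"
      proof (rule integral_mono)
        show "integrable lborel (\<lambda>y. \<bar>(\<phi> (x' - y) - \<phi> (x - y)) * f y\<bar>)"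
          using conv_integrable[OF assms] by (auto simp: left_diff_distrib)
        show "integrable lborel (\<lambda>y. e / (N + 1) * \<bar>f y\<bar>)" using assms(2) by auto
        show "\<bar>(\<phi> (x' - y) - \<phi> (x - y)) * f y\<bar> \<le> e / (N + 1) * \<bar>f y\<bar>" for y
          using d(2)[of "x' - y" "x - y"] that
          unfolding abs_mult by (intro mult_right_mono) (auto simp: dist_norm)
      qed
      also have "\<dots> = e * (N / (N + 1))" by (simp add: N_def)
      also have "\<dots> < e" using N \<open>e > 0\<close> by (simp add: field_simps)
      finally show ?thesis .
    qed
    then show ?thesis using d(1) by blast
  qed
  then show ?thesis unfolding continuous_on_iff by (auto simp: dist_commute)
qed

text \<open>The Taylor remainder of \<open>\<phi>\<close> is uniform, so it can be integrated
  against |f|, and all differentiation falls on \<open>\<phi>\<close>. This is what makes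
  convolutions of merely integrable functions smooth.\<close>

lemma conv_has_derivative:
  assumes "\<phi> \<in> test_functions UNIV" "integrable lborel f"
  shows "(conv \<phi> f has_derivative (\<lambda>h. (\<chi> k. conv (partial k \<phi>) f x) \<bullet> h)) (at x)"
proof -
  obtain K where K: "compact K" "\<And>x. x \<notin> K \<Longrightarrow> \<phi> x = 0"
    using test_functions_support[OF assms(1)] by blast
  define N where "N = (LINT y|lborel. \<bar>f y\<bar>)"
  have N: "N \<ge> 0" by (simp add: N_def)
  note [simp] = conv_integrable[OF assms] conv_integrable[OF test_functions_partial[OF assms(1)] assms(2)]
  have g: "integrable lborel (\<lambda>y. (gradient \<phi> (x - y) \<bullet> h) * f y)"
    "(\<chi> k. conv (partial k \<phi>) f x) \<bullet> h = (LINT y|lborel. (gradient \<phi> (x - y) \<bullet> h) * f y)" for h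
  proof -
    have eq: "(\<lambda>y. (gradient \<phi> (x - y) \<bullet> h) * f y) = (\<lambda>y. \<Sum>k\<in>UNIV. (partial k \<phi> (x - y) * f y) * h $ k)"
      by (rule ext) (simp add: inner_vec_def sum_distrib_left sum_distrib_right ac_simps)
    show "integrable lborel (\<lambda>y. (gradient \<phi> (x - y) \<bullet> h) * f y)"
      unfolding eq by simp
    show "(\<chi> k. conv (partial k \<phi>) f x) \<bullet> h = (LINT y|lborel. (gradient \<phi> (x - y) \<bullet> h) * f y)"
      unfolding eq by (simp add: inner_vec_def conv_def)
  qed
  have "\<exists>d>0. \<forall>y. norm (y - x) < d \<longrightarrow>
      norm (conv \<phi> f y - conv \<phi> f x - (\<chi> k. conv (partial k \<phi>) f x) \<bullet> (y - x)) \<le> e * norm (y - x)"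
    if "e > 0" for e
  proof -
    have eN: "e / (N + 1) > 0" using that N by simp
    obtain d where d: "d > 0"
      "\<And>z h. norm h < d \<Longrightarrow> \<bar>\<phi> (z + h) - \<phi> z - gradient \<phi> z \<bullet> h\<bar> \<le> e / (N + 1) * norm h"
      using gradient_remainder[OF test_functions_Ck[OF assms(1)] K eN] by blast
    have "norm (conv \<phi> f x' - conv \<phi> f x - (\<chi> k. conv (partial k \<phi>) f x) \<bullet> (x' - x)) \<le> e * norm (x' - x)"
      if "norm (x' - x) < d" for x'
    proof -
      have "norm (conv \<phi> f x' - conv \<phi> f x - (\<chi> k. conv (partial k \<phi>) f x) \<bullet> (x' - x)) =
        \<bar>LINT y|lborel. (\<phi> (x' - y) - \<phi> (x - y) - gradient \<phi> (x - y) \<bullet> (x' - x)) * f y\<bar>"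
        using g(1)[of "x' - x"]
        unfolding g(2) by (simp add: conv_def left_diff_distrib)
      also have "\<dots> \<le> (LINT y|lborel. \<bar>(\<phi> (x' - y) - \<phi> (x - y) - gradient \<phi> (x - y) \<bullet> (x' - x)) * f y\<bar>)"
        by (rule integral_abs_bound)
      also have "\<dots> \<le> (LINT y|lborel. (e / (N + 1) * norm (x' - x)) * \<bar>f y\<bar>)"
      proof (rule integral_mono)
        show "integrable lborel (\<lambda>y. \<bar>(\<phi> (x' - y) - \<phi> (x - y) - gradient \<phi> (x - y) \<bullet> (x' - x)) * f y\<bar>)"
          using g(1)[of "x' - x"] by (auto simp: left_diff_distrib)
        show "integrable lborel (\<lambda>y. (e / (N + 1) * norm (x' - x)) * \<bar>f y\<bar>)" using assms(2) by auto
        show "\<bar>(\<phi> (x' - y) - \<phi> (x - y) - gradient \<phi> (x - y) \<bullet> (x' - x)) * f y\<bar> \<le> (e / (N + 1) * norm (x' - x)) * \<bar>f y\<bar>" for y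
          using d(2)[OF that, of "x - y"]
          unfolding abs_mult by (intro mult_right_mono) (auto simp: algebra_simps)
      qed
      also have "\<dots> = (e * norm (x' - x)) * (N / (N + 1))" by (simp add: N_def)
      also have "\<dots> \<le> (e * norm (x' - x)) * 1"
        using N \<open>e > 0\<close> by (intro mult_left_mono) auto
      finally show ?thesis by simp
    qed
    then show ?thesis using d(1) by blast
  qed
  then show ?thesis
    unfolding has_derivative_at_alt by (auto intro: bounded_linear_inner_right)
qed

lemma partial_conv:
  assumes "\<phi> \<in> test_functions UNIV" "integrable lborel f"
  shows "partial k (conv \<phi> f) = conv (partial k \<phi>) f"
  by (rule ext, subst partial_eqI[OF conv_has_derivative[OF assms]]) (simp add: inner_axis)

lemma Ck_conv: "\<phi> \<in> test_functions UNIV \<Longrightarrow> integrable lborel f \<Longrightarrow> Ck n (conv \<phi> f)"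
proof (induction n arbitrary: \<phi>)
  case 0
  then show ?case using conv_continuous by simp
next
  case (Suc n)
  have "conv \<phi> f differentiable (at x)" for x
    using conv_has_derivative[OF Suc.prems] by (auto simp: differentiable_def)
  then show ?case using Suc by (simp add: partial_conv test_functions_partial)
qed

section \<open>Integration by parts\<close>

lemma lborel_translate:
  fixes f :: "'a::euclidean_space \<Rightarrow> real"
  assumes "f \<in> borel_measurable borel"
  shows "(LINT x|lborel. f (x + c)) = (LINT x|lborel. f x)"
    and "integrable lborel (\<lambda>x. f (x + c)) \<longleftrightarrow> integrable lborel f"
  using assms integral_distr[of "(+) c" lborel borel f] integrable_distr_eq[of "(+) c" lborel borel f]
  by (simp_all add: lborel_distr_plus add.commute)

text \<open>Translation invariance takes the place of iterated integration: a difference quotient of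
  \<open>f\<close> has integral exactly zero, and it is uniformly close to the partial derivative on
  a fixed ball outside of which both vanish.\<close>

lemma integral_partial_zero:
  assumes f: "Ck (Suc 0) f" "compact K" "\<And>x. x \<notin> K \<Longrightarrow> f x = 0"
  shows "(LINT x|lborel. partial k f x) = 0"
proof -
  obtain R where R: "R > 0" "\<And>x. x \<in> K \<Longrightarrow> norm x \<le> R"
    using compact_imp_bounded[OF f(2)] bounded_pos by metis
  define V where "V = measure lborel (cball 0 (R + 1) :: (real^'a) set)"
  have fi: "integrable lborel f"
    using compact_support_integrable[OF Ck_continuous[OF f(1)] f(2,3)] .
  have fm: "f \<in> borel_measurable borel"
    using borel_measurable_continuous_onI[OF Ck_continuous[OF f(1)]] .
  have pi: "integrable lborel (partial k f)"
    by (rule compact_support_integrable[OF Ck_continuous[OF Ck_partial[OF f(1)]] f(2)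
      partial_zero_outside[OF compact_imp_closed[OF f(2)] f(3)]])
  have "\<bar>LINT x|lborel. partial k f x\<bar> \<le> 0 + e" if "e > 0" for e
  proof -
    have V: "V \<ge> 0" by (simp add: V_def)
    then have eN: "e / (V + 1) > 0" using that by simp
    obtain d where d: "d > 0"
      "\<And>z h. norm h < d \<Longrightarrow> \<bar>f (z + h) - f z - gradient f z \<bullet> h\<bar> \<le> e / (V + 1) * norm h"
      using gradient_remainder[OF f eN] by blast
    \<comment> \<open>Being below 1, the shift keeps the support of the translate inside the ball of
      radius \<open>R + 1\<close>, whose volume is \<open>V\<close>; being below \<open>d\<close>,
      it makes the remainder estimate applicable.\<close>
    define t where "t = min d 1 / 2"
    have t: "0 < t" "t < d" "t < 1" using d(1) by (auto simp: t_def)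
    let ?h = "t *\<^sub>R axis k 1 :: real^'a"
    have nh: "norm ?h = t" using t by simp
    have ti: "integrable lborel (\<lambda>x. f (x + ?h))" using fi lborel_translate(2)[OF fm] by blast
    have "t * (LINT x|lborel. partial k f x) = (LINT x|lborel. t * partial k f x - (f (x + ?h) - f x))"
      using fi ti pi lborel_translate(1)[OF fm, of ?h] by simp
    also have "\<bar>\<dots>\<bar> \<le> (LINT x|lborel. \<bar>t * partial k f x - (f (x + ?h) - f x)\<bar>)"
      by (rule integral_abs_bound)
    also have "\<dots> \<le> (LINT x|lborel. (e / (V + 1) * t) * indicator (cball 0 (R + 1) :: (real^'a) set) x)"
    proof (rule integral_mono)
      show "integrable lborel (\<lambda>x. \<bar>t * partial k f x - (f (x + ?h) - f x)\<bar>)"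
        using fi ti pi by auto
      show "integrable lborel (\<lambda>x. (e / (V + 1) * t) * indicator (cball 0 (R + 1) :: (real^'a) set) x)"
        by (intro integrable_mult_right integrable_real_indicator) (simp, rule emeasure_lborel_cball_finite)
      show "\<bar>t * partial k f x - (f (x + ?h) - f x)\<bar> \<le> (e / (V + 1) * t) * indicator (cball 0 (R + 1)) x" for x
      proof (cases "norm x \<le> R + 1")
        case True
        have "gradient f x \<bullet> ?h = t * partial k f x" by (simp add: inner_axis)
        then show ?thesis using d(2)[of ?h x] nh t True by (simp add: abs_minus_commute)
      next
        case False
        have "norm x \<le> norm (x + ?h) + norm ?h" by (metis add_diff_cancel_right' norm_triangle_ineq4)
        then have "norm (x + ?h) > R" using False nh t by linarith
        then have "x + ?h \<notin> K" "x \<notin> K" using R False by force+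
        then show ?thesis
          using f(3) partial_zero_outside[OF compact_imp_closed[OF f(2)] f(3)] False by simp
      qed
    qed
    also have "\<dots> = e * (V / (V + 1)) * t" by (simp add: V_def)
    also have "\<dots> \<le> e * 1 * t"
      using V t \<open>e > 0\<close> by (intro mult_right_mono mult_left_mono) auto
    finally have "t * \<bar>LINT x|lborel. partial k f x\<bar> \<le> t * e"
      using t by (simp add: abs_mult mult.commute)
    then show ?thesis using t by simp
  qed
  then have "\<bar>LINT x|lborel. partial k f x\<bar> \<le> 0" by (rule field_le_epsilon)
  then show ?thesis by simp
qed

lemma integration_by_parts:
  assumes "Ck (Suc 0) u" "\<phi> \<in> test_functions \<Omega>"
  shows "(LINT x|lborel. u x * partial k \<phi> x) = - (LINT x|lborel. partial k u x * \<phi> x)"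
proof -
  obtain K where K: "compact K" "\<And>x. x \<notin> K \<Longrightarrow> \<phi> x = 0" "\<And>k x. x \<notin> K \<Longrightarrow> partial k \<phi> x = 0"
    using test_functions_support[OF assms(2)] by blast
  note \<phi> = test_functions_Ck[OF assms(2), of "Suc 0"]
  have "partial k (\<lambda>x. u x * \<phi> x) = (\<lambda>x. partial k u x * \<phi> x + u x * partial k \<phi> x)"
    using assms(1) \<phi> by (auto simp: partial_mult)
  moreover have "(LINT x|lborel. partial k (\<lambda>x. u x * \<phi> x) x) = 0"
    using K by (intro integral_partial_zero[where K=K] Ck_mult assms \<phi>) auto
  moreover have "integrable lborel (\<lambda>x. partial k u x * \<phi> x)" "integrable lborel (\<lambda>x. u x * partial k \<phi> x)"
    using K by (auto intro!: compact_support_integrable[where K=K] continuous_on_mult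
        Ck_continuous[OF Ck_partial[OF assms(1)]] Ck_continuous[OF assms(1)] Ck_continuous[OF \<phi>] Ck_continuous[OF Ck_partial[OF \<phi>]])
  ultimately show ?thesis by simp
qed

text \<open>The forms are integrals for Lebesgue measure on \<open>\<Omega>\<close>, while
  convolution, scaling and Fubini are carried out for \<open>lborel\<close> on the whole space; this
  lemma and \<open>lebesgue_on_eq_lborel\<close> connect the two.\<close>

lemma integral_lebesgue_on_lborel:
  fixes f :: "'a::euclidean_space \<Rightarrow> real"
  assumes "\<Omega> \<in> sets borel" "f \<in> borel_measurable borel" "\<And>x. x \<notin> \<Omega> \<Longrightarrow> f x = 0"
  shows "(LINT x|lebesgue_on \<Omega>. f x) = (LINT x|lborel. f x)"
proof -
  have "(LINT x|lebesgue_on \<Omega>. f x) = (LINT x|lebesgue. indicator \<Omega> x *\<^sub>R f x)"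
    using assms(1) by (intro integral_restrict_space) (auto intro: sets_completionI_sets)
  also have "(\<lambda>x. indicator \<Omega> x *\<^sub>R f x) = f"
    using assms(3) by (fastforce simp: indicator_def)
  finally show ?thesis
    using assms(2) by (simp add: integral_completion)
qed

section \<open>Continuity of translation\<close>

text \<open>Induction over integrable functions reduces the claim to the indicator of a set
  \<open>A\<close> of finite measure. There an open superset \<open>U\<close> of small excess is
  used: a point of \<open>A\<close> stays in \<open>U\<close> under small translations, so the
  volume that leaves \<open>U\<close> tends to zero by dominated convergence.\<close>

lemma L1_translation_continuous:
  fixes f :: "'a::euclidean_space \<Rightarrow> real"
  assumes "integrable lborel f" "e > 0"
  shows "\<forall>\<^sub>F h in at 0. (LINT x|lborel. \<bar>f (x + h) - f x\<bar>) < e"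
  using assms
proof (induction arbitrary: e rule: integrable_induct)
  case (base A c)
  then have A: "A \<in> sets borel" "emeasure lborel A < \<infinity>" by auto
  define e' where "e' = e / (4 * (\<bar>c\<bar> + 1))"
  have e': "e' > 0" using base by (simp add: e'_def)
  have "A \<in> sets lebesgue" using A(1) by (simp add: sets_completionI_sets)
  then obtain U where U: "open U" "A \<subseteq> U" "emeasure lebesgue (U - A) < ennreal e'"
    using sets_lebesgue_outer_open[OF _ e'] by metis
  have UA: "U - A \<in> sets borel" using U(1) A(1) by auto
  have UAe: "emeasure lborel (U - A) < ennreal e'"
    using U(3) UA by simp
  then have UA2: "emeasure lborel (U - A) < \<infinity>"
    by (rule order_less_trans) simp
  with UAe have "ennreal (measure lborel (U - A)) < ennreal e'"
    by (subst emeasure_eq_ennreal_measure[symmetric]) auto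
  then have UA3: "measure lborel (U - A) < e'"
    by (subst (asm) ennreal_less_iff) auto
  \<comment> \<open>The volume of the part of \<open>A\<close> that the translation by
    \<open>h\<close> carries out of \<open>U\<close>.\<close>
  define \<omega> :: "'a \<Rightarrow> real" where "\<omega> h = (LINT x|lborel. indicator A x * indicator (- U) (x + h))" for h :: 'a
  have mU: "- U \<in> sets borel" using U(1) by auto
  note [measurable] = A(1) mU
  have \<omega>m: "(\<lambda>x. indicator A x * indicator (- U) (x + h) :: real) \<in> borel_measurable borel" for h
    by measurable
  have \<omega>i: "integrable lborel (\<lambda>x. indicator A x * indicator (- U) (x + h) :: real)" for h
    by (rule Bochner_Integration.integrable_bound[where f="indicator A :: 'a \<Rightarrow> real"])
       (use A \<omega>m in \<open>auto simp: indicator_def\<close>)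
  have \<omega>0: "(\<omega> \<longlongrightarrow> 0) (at 0)"
    unfolding tendsto_at_iff_sequentially
  proof (intro allI impI)
    fix X :: "nat \<Rightarrow> 'a" assume X: "X \<longlonglongrightarrow> 0"
    have "(\<lambda>n. \<omega> (X n)) \<longlonglongrightarrow> integral\<^sup>L lborel (\<lambda>x::'a. 0::real)"
      unfolding \<omega>_def
    proof (rule integral_dominated_convergence[where w="indicator A"])
      show "AE x in lborel. (\<lambda>n. indicator A x * indicator (- U) (x + X n) :: real) \<longlonglongrightarrow> 0"
      proof (rule AE_I2)
        fix x :: 'a
        show "(\<lambda>n. indicator A x * indicator (- U) (x + X n) :: real) \<longlonglongrightarrow> 0"
        proof (cases "x \<in> A")
          case True
          have "(\<lambda>n. x + X n) \<longlonglongrightarrow> x" using tendsto_add[OF tendsto_const X, of x] by simp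
          then have "\<forall>\<^sub>F n in sequentially. x + X n \<in> U"
            using U True by (metis subsetD topological_tendstoD)
          then have "\<forall>\<^sub>F n in sequentially. (indicator A x * indicator (- U) (x + X n) :: real) = 0"
            by eventually_elim simp
          then show ?thesis by (rule tendsto_eventually)
        qed simp
      qed
    qed (use A \<omega>m in \<open>auto simp: indicator_def\<close>)
    then show "(\<omega> \<circ> X) \<longlonglongrightarrow> 0" by (simp add: o_def)
  qed
  then have ev1: "\<forall>\<^sub>F h in at 0. \<omega> h < e'" using e' order_tendstoD(2) by blast
  have "((\<lambda>h. \<omega> (- h)) \<longlongrightarrow> 0) (at 0)"
  proof -
    have "filterlim (\<lambda>h::'a. - h) (at 0) (at 0)"
      by (auto simp: filterlim_at eventually_at_filter intro!: tendsto_eq_intros)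
    with \<omega>0 show ?thesis by (rule filterlim_compose)
  qed
  then have ev2: "\<forall>\<^sub>F h in at 0. \<omega> (- h) < e'" using e' order_tendstoD(2) by blast
  from ev1 ev2 show ?case
  proof eventually_elim
    case (elim h)
    define I where "I = (\<lambda>x. indicator (U - A) x :: real)"
    have I: "integrable lborel I" "(LINT x|lborel. I x) < e'"
      using UA UA2 UA3 by (auto simp: I_def)
    have Im: "I \<in> borel_measurable borel" using UA by (auto simp: I_def)
    have Ih: "integrable lborel (\<lambda>x. I (x + h))" "(LINT x|lborel. I (x + h)) < e'"
      using I lborel_translate[OF Im, of h] by auto
    have Jm: "(\<lambda>x. indicator A x * indicator (- U) (x - h) :: real) \<in> borel_measurable borel"
      by measurable
    have J: "integrable lborel (\<lambda>x. indicator A (x + h) * indicator (- U) x :: real)"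
        "(LINT x|lborel. indicator A (x + h) * indicator (- U) x :: real) < e'"
      using lborel_translate[OF Jm, of h] \<omega>i[of "- h"] elim(2) by (auto simp: \<omega>_def)
    \<comment> \<open>If exactly one of \<open>x\<close> and \<open>x + h\<close> lies in
      \<open>A\<close>, the other one lies outside \<open>U\<close> or in \<open>U - A\<close>; the
      two roles of the points give four terms. The third integrates to \<open>\<omega> (- h)\<close>
      after a translation.\<close>
    have le: "\<bar>indicator A (x + h) - indicator A x\<bar> \<le>
       indicator A x * indicator (- U) (x + h) + I (x + h) + indicator A (x + h) * indicator (- U) x + I x" for x
      using U(2) by (auto simp: I_def indicator_def)
    have "(LINT x|lborel. \<bar>indicator A (x + h) *\<^sub>R c - indicator A x *\<^sub>R c\<bar>) =
        (LINT x|lborel. \<bar>c\<bar> * \<bar>indicator A (x + h) - indicator A x\<bar>)"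
      by (intro Bochner_Integration.integral_cong) (auto simp: indicator_def)
    also have "\<dots> = \<bar>c\<bar> * (LINT x|lborel. \<bar>indicator A (x + h) - indicator A x\<bar>)"
      by simp
    also have "(LINT x|lborel. \<bar>indicator A (x + h) - indicator A x\<bar>) \<le>
       (LINT x|lborel. indicator A x * indicator (- U) (x + h) + I (x + h) + indicator A (x + h) * indicator (- U) x + I x)"
    proof (rule Bochner_Integration.integral_mono)
      have "indicator A \<in> borel_measurable borel" "integrable lborel (indicator A :: 'a \<Rightarrow> real)"
        using A by auto
      then show "integrable lborel (\<lambda>x. \<bar>indicator A (x + h) - indicator A x :: real\<bar>)"
        using lborel_translate(2)[of "indicator A" h] by auto
      show "integrable lborel (\<lambda>x. indicator A x * indicator (- U) (x + h) + I (x + h) + indicator A (x + h) * indicator (- U) x + I x)"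
        using \<omega>i[of h] I Ih J by auto
    qed (use le in auto)
    also have "\<dots> = \<omega> h + (LINT x|lborel. I (x + h)) + (LINT x|lborel. indicator A (x + h) * indicator (- U) x) + (LINT x|lborel. I x)"
      unfolding \<omega>_def using \<omega>i[of h] I Ih J by simp
    also have "\<bar>c\<bar> * \<dots> \<le> \<bar>c\<bar> * (4 * e')"
      using elim(1) I Ih J by (intro mult_left_mono) auto
    also have "\<dots> = e * (\<bar>c\<bar> / (\<bar>c\<bar> + 1))"
      using abs_ge_zero[of c] unfolding e'_def by (simp add: divide_simps add_nonneg_eq_0_iff)
    also have "\<dots> < e" using base by (simp add: field_simps)
    finally show ?case by (simp add: mult_left_mono)
  qed
next
  case (add f g)
  have "\<forall>\<^sub>F h in at 0. (LINT x|lborel. \<bar>f (x + h) - f x\<bar>) < e / 2" "\<forall>\<^sub>F h in at 0. (LINT x|lborel. \<bar>g (x + h) - g x\<bar>) < e / 2"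
    using add.IH[OF half_gt_zero[OF add.prems]] by blast+
  then show ?case
  proof eventually_elim
    case (elim h)
    have i: "integrable lborel (\<lambda>x. f (x + h))" "integrable lborel (\<lambda>x. g (x + h))"
      using add.hyps lborel_translate(2)[of f h] lborel_translate(2)[of g h] by (auto dest: borel_measurable_integrable)
    have "(LINT x|lborel. \<bar>f (x + h) + g (x + h) - (f x + g x)\<bar>) \<le> (LINT x|lborel. \<bar>f (x + h) - f x\<bar> + \<bar>g (x + h) - g x\<bar>)"
      by (rule Bochner_Integration.integral_mono) (use add.hyps i in auto)
    also have "\<dots> = (LINT x|lborel. \<bar>f (x + h) - f x\<bar>) + (LINT x|lborel. \<bar>g (x + h) - g x\<bar>)"
      using add.hyps i by simp
    finally show ?case using elim by linarith
  qed
next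
  case (lim f s)
  have fm: "f \<in> borel_measurable borel" "s i \<in> borel_measurable borel" for i
    using lim.hyps by (auto dest: borel_measurable_integrable)
  have "(\<lambda>i. LINT x|lborel. \<bar>s i x - f x\<bar>) \<longlonglongrightarrow> integral\<^sup>L lborel (\<lambda>x::'a. 0::real)"
  proof (rule integral_dominated_convergence[where w="\<lambda>x. 3 * \<bar>f x\<bar>"])
    show "AE x in lborel. (\<lambda>i. \<bar>s i x - f x\<bar>) \<longlonglongrightarrow> 0"
    proof (rule AE_I2)
      fix x
      have "(\<lambda>i. s i x) \<longlonglongrightarrow> f x" using lim by simp
      then show "(\<lambda>i. \<bar>s i x - f x\<bar>) \<longlonglongrightarrow> 0"
        using LIM_zero tendsto_rabs_zero by blast
    qed
    show "AE x in lborel. norm \<bar>s i x - f x\<bar> \<le> 3 * \<bar>f x\<bar>" for i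
    proof (rule AE_I2)
      fix x
      have "\<bar>s i x\<bar> \<le> 2 * \<bar>f x\<bar>" using lim by simp
      then show "norm \<bar>s i x - f x\<bar> \<le> 3 * \<bar>f x\<bar>" by simp
    qed
  qed (use lim in \<open>auto dest: borel_measurable_integrable\<close>)
  then have "\<forall>\<^sub>F i in sequentially. (LINT x|lborel. \<bar>s i x - f x\<bar>) < e / 3"
    using lim.prems by (intro order_tendstoD(2)) auto
  then obtain i where i: "(LINT x|lborel. \<bar>s i x - f x\<bar>) < e / 3"
    using eventually_happens by force
  have "\<forall>\<^sub>F h in at 0. (LINT x|lborel. \<bar>s i (x + h) - s i x\<bar>) < e / 3"
    using lim.prems by (intro lim.IH) simp
  then show ?case
  proof eventually_elim
    case (elim h)
    have int: "integrable lborel (\<lambda>x. f (x + h))" "integrable lborel (\<lambda>x. s i (x + h))"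
      using lim.hyps lborel_translate(2)[OF fm(1), of h] lborel_translate(2)[OF fm(2), of i h] by auto
    have m: "(\<lambda>x. \<bar>s i x - f x\<bar>) \<in> borel_measurable borel" using fm by measurable
    have "(LINT x|lborel. \<bar>f (x + h) - f x\<bar>) \<le>
        (LINT x|lborel. \<bar>s i (x + h) - f (x + h)\<bar> + \<bar>s i (x + h) - s i x\<bar> + \<bar>s i x - f x\<bar>)"
      by (rule Bochner_Integration.integral_mono) (use lim.hyps int in auto)
    also have "\<dots> = (LINT x|lborel. \<bar>s i (x + h) - f (x + h)\<bar>) + (LINT x|lborel. \<bar>s i (x + h) - s i x\<bar>) + (LINT x|lborel. \<bar>s i x - f x\<bar>)"
      using lim.hyps int by simp
    also have "(LINT x|lborel. \<bar>s i (x + h) - f (x + h)\<bar>) = (LINT x|lborel. \<bar>s i x - f x\<bar>)"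
      using lborel_translate(1)[OF m, of h] by simp
    finally show ?case using elim i by linarith
  qed
qed

lemma square_diff_le: "(a - c)\<^sup>2 \<le> 3 * ((a - b)\<^sup>2 + (b - d)\<^sup>2 + (d - c)\<^sup>2)" for a b c d :: real
proof -
  have "3 * ((a - b)\<^sup>2 + (b - d)\<^sup>2 + (d - c)\<^sup>2) - (a - c)\<^sup>2 =
      ((a - b) - (b - d))\<^sup>2 + ((b - d) - (d - c))\<^sup>2 + ((a - b) - (d - c))\<^sup>2"
    by (simp add: power2_eq_square algebra_simps)
  also have "\<dots> \<ge> 0" by simp
  finally show ?thesis by simp
qed

lemma integrable_square_diff:
  fixes f g :: "'a \<Rightarrow> real"
  assumes "integrable M (\<lambda>x. (f x)\<^sup>2)" "integrable M (\<lambda>x. (g x)\<^sup>2)"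
    "f \<in> borel_measurable M" "g \<in> borel_measurable M"
  shows "integrable M (\<lambda>x. (f x - g x)\<^sup>2)"
proof (rule Bochner_Integration.integrable_bound[where f="\<lambda>x. 2 * ((f x)\<^sup>2 + (g x)\<^sup>2)"])
  have "(f x - g x)\<^sup>2 \<le> 2 * ((f x)\<^sup>2 + (g x)\<^sup>2)" for x
    using sum_squares_ge_zero[of "f x + g x" 0] by (simp add: power2_eq_square algebra_simps)
  then show "AE x in M. norm ((f x - g x)\<^sup>2) \<le> norm (2 * ((f x)\<^sup>2 + (g x)\<^sup>2))" by simp
qed (use assms in auto)

text \<open>Truncation at height \<open>n\<close> reduces this to the L1 statement: an increment of
  a function bounded by \<open>n\<close> is at most 2n, so its square is at most 2n times its
  absolute value, and truncation does not enlarge increments. The truncation error is small in L2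
  and invariant under translation.\<close>

lemma L2_translation_continuous:
  fixes f :: "'a::euclidean_space \<Rightarrow> real"
  assumes f: "integrable lborel f" "integrable lborel (\<lambda>x. (f x)\<^sup>2)" and "e > 0"
  shows "\<forall>\<^sub>F h in at 0. (LINT x|lborel. (f (x + h) - f x)\<^sup>2) < e"
proof -
  have fm [measurable]: "f \<in> borel_measurable borel" using f(1) by (auto dest: borel_measurable_integrable)
  define T where "T n x = max (- real n) (min (real n) (f x))" for n x
  have Tm [measurable]: "T n \<in> borel_measurable borel" for n unfolding T_def by measurable
  have Tsq: "(T n x)\<^sup>2 \<le> (f x)\<^sup>2" for n x
    by (subst abs_le_square_iff[symmetric]) (auto simp: T_def)
  have Ti: "integrable lborel (\<lambda>x. (T n x)\<^sup>2)" for n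
    by (rule Bochner_Integration.integrable_bound[OF f(2)]) (use Tsq in auto)
  have di: "integrable lborel (\<lambda>x. (f x - T n x)\<^sup>2)" for n
    by (rule integrable_square_diff) (use f Ti in auto)
  have dle: "(f x - T n x)\<^sup>2 \<le> (f x)\<^sup>2" for n x
    by (subst abs_le_square_iff[symmetric]) (auto simp: T_def)
  have "(\<lambda>n. LINT x|lborel. (f x - T n x)\<^sup>2) \<longlonglongrightarrow> integral\<^sup>L lborel (\<lambda>x::'a. 0::real)"
  proof (rule integral_dominated_convergence[where w="\<lambda>x. (f x)\<^sup>2"])
    show "AE x in lborel. (\<lambda>n. (f x - T n x)\<^sup>2) \<longlonglongrightarrow> 0"
    proof (rule AE_I2)
      fix x
      obtain N :: nat where N: "\<bar>f x\<bar> \<le> real N" using real_arch_simple by blast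
      have "(f x - T n x)\<^sup>2 = 0" if "n \<ge> N" for n
      proof -
        have "\<bar>f x\<bar> \<le> real n" using N that by linarith
        then show ?thesis by (auto simp: T_def)
      qed
      then have "\<forall>\<^sub>F n in sequentially. (f x - T n x)\<^sup>2 = 0"
        using eventually_sequentially by blast
      then show "(\<lambda>n. (f x - T n x)\<^sup>2) \<longlonglongrightarrow> 0" by (rule tendsto_eventually)
    qed
  qed (use dle f in auto)
  then have "\<forall>\<^sub>F n in sequentially. (LINT x|lborel. (f x - T n x)\<^sup>2) < e / 9"
    using \<open>e > 0\<close> by (intro order_tendstoD(2)) auto
  then obtain n where n: "(LINT x|lborel. (f x - T n x)\<^sup>2) < e / 9"
    using eventually_happens by force
  \<comment> \<open>Three terms of size e/9 and the factor 3 of \<open>square_diff_le\<close> give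
    \<open>e\<close>. The denominator has 2n + 1 instead of 2n to stay positive for n = 0.\<close>
  define e' where "e' = e / (9 * (2 * real n + 1))"
  have e': "e' > 0" using \<open>e > 0\<close> by (simp add: e'_def)
  from L1_translation_continuous[OF f(1) e'] show ?thesis
  proof eventually_elim
    case (elim h)
    have sh: "integrable lborel (\<lambda>x. (f (x + h))\<^sup>2)" "integrable lborel (\<lambda>x. (T n (x + h))\<^sup>2)" "integrable lborel (\<lambda>x. f (x + h))"
      using f Ti[of n] lborel_translate(2)[of "\<lambda>x. (f x)\<^sup>2" h] lborel_translate(2)[of "\<lambda>x. (T n x)\<^sup>2" h] lborel_translate(2)[of f h]
      by auto
    note isd = integrable_square_diff
    have a: "integrable lborel (\<lambda>x. (f (x + h) - T n (x + h))\<^sup>2)"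
      by (intro isd sh) auto
    have b: "integrable lborel (\<lambda>x. (T n (x + h) - T n x)\<^sup>2)"
      by (intro isd sh Ti) auto
    have c: "integrable lborel (\<lambda>x. (T n x - f x)\<^sup>2)"
      by (intro isd f Ti) auto
    have b_le: "(T n (x + h) - T n x)\<^sup>2 \<le> 2 * real n * \<bar>f (x + h) - f x\<bar>" for x
    proof -
      have "\<bar>T n (x + h) - T n x\<bar> \<le> 2 * real n" "\<bar>T n (x + h) - T n x\<bar> \<le> \<bar>f (x + h) - f x\<bar>"
        by (auto simp: T_def)
      then have "\<bar>T n (x + h) - T n x\<bar> * \<bar>T n (x + h) - T n x\<bar> \<le> 2 * real n * \<bar>f (x + h) - f x\<bar>"
        by (intro mult_mono) auto
      then show ?thesis by (simp add: power2_eq_square)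
    qed
    have "(LINT x|lborel. (f (x + h) - f x)\<^sup>2) \<le>
      (LINT x|lborel. 3 * ((f (x + h) - T n (x + h))\<^sup>2 + (T n (x + h) - T n x)\<^sup>2 + (T n x - f x)\<^sup>2))"
    proof (rule Bochner_Integration.integral_mono)
      show "integrable lborel (\<lambda>x. (f (x + h) - f x)\<^sup>2)" by (intro isd sh f) auto
      show "integrable lborel (\<lambda>x. 3 * ((f (x + h) - T n (x + h))\<^sup>2 + (T n (x + h) - T n x)\<^sup>2 + (T n x - f x)\<^sup>2))"
        using a b c by auto
    qed (rule square_diff_le)
    also have "\<dots> = 3 * ((LINT x|lborel. (f (x + h) - T n (x + h))\<^sup>2) + (LINT x|lborel. (T n (x + h) - T n x)\<^sup>2) + (LINT x|lborel. (T n x - f x)\<^sup>2))"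
      using a b c by simp
    also have "(LINT x|lborel. (f (x + h) - T n (x + h))\<^sup>2) = (LINT x|lborel. (f x - T n x)\<^sup>2)"
      using lborel_translate(1)[of "\<lambda>x. (f x - T n x)\<^sup>2" h] by simp
    also have "(LINT x|lborel. (T n x - f x)\<^sup>2) = (LINT x|lborel. (f x - T n x)\<^sup>2)"
      by (simp add: power2_commute)
    also have "(LINT x|lborel. (T n (x + h) - T n x)\<^sup>2) \<le> (LINT x|lborel. 2 * real n * \<bar>f (x + h) - f x\<bar>)"
      by (rule Bochner_Integration.integral_mono) (use b b_le sh f in auto)
    also have "\<dots> = 2 * real n * (LINT x|lborel. \<bar>f (x + h) - f x\<bar>)" by simp
    also have "\<dots> \<le> 2 * real n * e'" using elim by (intro mult_left_mono) auto
    also have "\<dots> \<le> e / 9 * (2 * real n / (2 * real n + 1))" by (simp add: e'_def mult.commute)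
    also have "\<dots> \<le> e / 9 * 1" using \<open>e > 0\<close> by (intro mult_left_mono) auto
    finally show ?case using n by simp
  qed
qed

section \<open>Mollifiers\<close>

lemma nn_integral_affine:
  fixes f :: "real^'d \<Rightarrow> ennreal"
  assumes "f \<in> borel_measurable borel" "c > 0"
  shows "(\<integral>\<^sup>+x. f x \<partial>lborel) = ennreal (c ^ CARD('d)) * (\<integral>\<^sup>+x. f (t + c *\<^sub>R x) \<partial>lborel)"
  using assms by (subst lborel_affine[of c t]) (auto simp: nn_integral_density nn_integral_distr nn_integral_cmult)

lemma lborel_scale:
  fixes f :: "real^'d \<Rightarrow> real"
  assumes "f \<in> borel_measurable borel" "c > 0"
  shows "(LINT x|lborel. f (c *\<^sub>R x)) = (LINT x|lborel. f x) / c ^ CARD('d)"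
proof -
  have "(LINT x|lborel. f x) = c ^ CARD('d) * (LINT x|lborel. f (c *\<^sub>R x))"
    using assms by (subst lborel_affine[of c 0]) (auto simp: integral_density integral_distr)
  then show ?thesis using assms by simp
qed

definition mollifier :: "real \<Rightarrow> real^'d \<Rightarrow> real" where
  "mollifier \<epsilon> x = inverse (\<epsilon> ^ CARD('d) * (LINT y|lborel. bump (y :: real^'d))) * bump (inverse \<epsilon> *\<^sub>R x)"

lemma bump_test_function: "bump \<in> test_functions UNIV"
  using bump_nonzero_iff by (intro test_functionsI[of _ "cball 0 1"] bump_smooth) force+

lemma test_function_measurable: "\<phi> \<in> test_functions \<Omega> \<Longrightarrow> \<phi> \<in> borel_measurable borel"
  using borel_measurable_continuous_onI Ck_continuous test_functions_Ck by blast

lemma test_function_integrable: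
  assumes "\<phi> \<in> test_functions \<Omega>"
  shows "integrable lborel \<phi>"
proof -
  obtain K where K: "compact K" "\<And>x. x \<notin> K \<Longrightarrow> \<phi> x = 0"
    using test_functions_support[OF assms] by blast
  then show ?thesis
    using compact_support_integrable[OF Ck_continuous[OF test_functions_Ck[OF assms]]] by blast
qed

lemma integral_bump_pos: "(LINT x|lborel. bump (x :: real^'d)) > 0"
proof -
  have "(LINT x|lborel. bump (x :: real^'d)) \<noteq> 0"
  proof
    assume "(LINT x|lborel. bump (x :: real^'d)) = 0"
    then have "AE x in lborel. bump (x :: real^'d) = 0"
      using integral_nonneg_eq_0_iff_AE[OF test_function_integrable[OF bump_test_function]] bump_nonneg by auto
    then have "AE x in lborel. x \<notin> ball (0 :: real^'d) 1"
      by eventually_elim (use bump_nonzero_iff in \<open>auto simp: dist_norm\<close>)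
    then have "emeasure lborel (ball (0 :: real^'d) 1) = 0"
      by (subst (asm) AE_iff_measurable[OF _ refl]) (simp_all add: ball_def)
    then show False
      using emeasure_lborel_ball_finite[of "0 :: real^'d" 1] content_ball_pos[of 1 "0 :: real^'d"]
      by (simp add: measure_def)
  qed
  moreover have "(LINT x|lborel. bump (x :: real^'d)) \<ge> 0"
    by (rule Bochner_Integration.integral_nonneg) (rule bump_nonneg)
  ultimately show ?thesis by linarith
qed

context
  fixes \<epsilon> :: real
  assumes \<epsilon>: "\<epsilon> > 0"
begin

lemma mollifier_nonneg: "mollifier \<epsilon> x \<ge> 0"
  using \<epsilon> bump_nonneg integral_bump_pos by (auto simp: mollifier_def intro!: mult_nonneg_nonneg)

lemma mollifier_zero: "norm x \<ge> \<epsilon> \<Longrightarrow> mollifier \<epsilon> x = 0"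
  using \<epsilon> bump_nonzero_iff[of "inverse \<epsilon> *\<^sub>R x"] by (auto simp: mollifier_def field_simps)

lemma mollifier_test_function: "mollifier \<epsilon> \<in> test_functions UNIV"
proof (rule test_functionsI[of _ "cball 0 \<epsilon>"])
  show "Ck n (mollifier \<epsilon>)" for n
    unfolding mollifier_def[abs_def] by (intro Ck_cmult Ck_scale bump_smooth)
  show "mollifier \<epsilon> x = 0" if "x \<notin> cball 0 \<epsilon>" for x
    using that by (intro mollifier_zero) simp
qed auto

lemma integral_mollifier: "(LINT x|lborel. mollifier \<epsilon> (x :: real^'d)) = 1"
  using \<epsilon> integral_bump_pos[where 'd='d]
  by (simp add: mollifier_def lborel_scale[OF test_function_measurable[OF bump_test_function]] field_simps)

text \<open>By scaling, a derivative costs 1/\<epsilon> while the mass stays 1. This is the origin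
  of the factor \<open>M / \<epsilon>\<close> in the gradient bounds for cutoffs.\<close>

lemma integral_partial_mollifier:
  "(LINT x|lborel. \<bar>partial k (mollifier \<epsilon>) (x :: real^'d)\<bar>)
     = ((LINT x|lborel. \<bar>partial k bump (x :: real^'d)\<bar>) / (LINT x|lborel. bump (x :: real^'d))) / \<epsilon>"
proof -
  define Z where "Z = \<epsilon> ^ CARD('d) * (LINT y|lborel. bump (y :: real^'d))"
  have Z: "Z > 0" using \<epsilon> integral_bump_pos by (auto simp: Z_def intro!: mult_pos_pos)
  have d: "bump differentiable (at x)" for x :: "real^'d"
    using bump_smooth Ck_Suc_differentiable by blast
  have "partial k (mollifier \<epsilon>) x = inverse Z * (inverse \<epsilon> * partial k bump (inverse \<epsilon> *\<^sub>R x))" for x :: "real^'d"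
    unfolding mollifier_def[abs_def] Z_def[symmetric]
    by (simp add: partial_cmult partial_scale d)
  then have "\<bar>partial k (mollifier \<epsilon>) x\<bar> = inverse Z * inverse \<epsilon> * \<bar>partial k bump (inverse \<epsilon> *\<^sub>R x)\<bar>" for x :: "real^'d"
    using Z \<epsilon> by (simp add: abs_mult)
  moreover have "(\<lambda>x. \<bar>partial k bump (x :: real^'d)\<bar>) \<in> borel_measurable borel"
    using test_function_measurable[OF test_functions_partial[OF bump_test_function]] by measurable
  ultimately show ?thesis
    using \<epsilon> lborel_scale[of "\<lambda>x. \<bar>partial k bump (x :: real^'d)\<bar>" "inverse \<epsilon>"]
    by (simp add: Z_def field_simps)
qed

end

lemma lborel_reflect:
  fixes f :: "'a::euclidean_space \<Rightarrow> real"
  assumes "f \<in> borel_measurable borel"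
  shows "(LINT h|lborel. f (x - h)) = (LINT h|lborel. f h)"
    and "integrable lborel (\<lambda>h. f (x - h)) \<longleftrightarrow> integrable lborel f"
proof -
  have "distr lborel borel (\<lambda>h::'a. x - h) = lborel"
    using lborel_affine[of "-1" x] by (simp add: density_1)
  then show "(LINT h|lborel. f (x - h)) = (LINT h|lborel. f h)"
    "integrable lborel (\<lambda>h. f (x - h)) \<longleftrightarrow> integrable lborel f"
    using assms integral_distr[of "\<lambda>h. x - h" lborel borel f] integrable_distr_eq[of "\<lambda>h. x - h" lborel borel f]
    by simp_all
qed

lemma conv_commute:
  fixes f :: "real^'d \<Rightarrow> real"
  assumes [measurable]: "\<phi> \<in> borel_measurable borel" "f \<in> borel_measurable borel"
  shows "conv \<phi> f x = (LINT h|lborel. \<phi> h * f (x - h))"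
  using lborel_reflect(1)[of "\<lambda>y. \<phi> (x - y) * f y" x] by (simp add: conv_def)

text \<open>Jensen's inequality for the probability density \<open>m\<close>, obtained from the
  nonnegativity of the variance. With a nonnegative integral on the right, a divergent second moment
  is covered as well.\<close>

lemma square_integral_le:
  fixes m G :: "'a \<Rightarrow> real"
  assumes m: "integrable M m" "(LINT x|M. m x) = 1" "\<And>x. m x \<ge> 0"
    and G: "G \<in> borel_measurable M" "integrable M (\<lambda>x. m x * G x)"
  shows "ennreal ((LINT x|M. m x * G x)\<^sup>2) \<le> (\<integral>\<^sup>+x. ennreal (m x * (G x)\<^sup>2) \<partial>M)"
proof (cases "(\<integral>\<^sup>+x. ennreal (m x * (G x)\<^sup>2) \<partial>M) = \<infinity>")
  case False
  have mm: "m \<in> borel_measurable M" using m(1) by (rule borel_measurable_integrable)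
  have i2: "integrable M (\<lambda>x. m x * (G x)\<^sup>2)"
    using False mm G(1) m(3) by (intro integrableI_bounded) (auto simp: top.not_eq_extremum)
  define c where "c = (LINT x|M. m x * G x)"
  have "0 \<le> (LINT x|M. m x * (G x - c)\<^sup>2)"
    using m(3) by (intro Bochner_Integration.integral_nonneg) auto
  also have "(\<lambda>x. m x * (G x - c)\<^sup>2) = (\<lambda>x. m x * (G x)\<^sup>2 - 2 * c * (m x * G x) + c\<^sup>2 * m x)"
    by (auto simp: power2_eq_square algebra_simps)
  also have "(LINT x|M. m x * (G x)\<^sup>2 - 2 * c * (m x * G x) + c\<^sup>2 * m x) = (LINT x|M. m x * (G x)\<^sup>2) - c\<^sup>2"
    using i2 G(2) m(1,2) by (simp add: c_def[symmetric] power2_eq_square)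
  finally have "c\<^sup>2 \<le> (LINT x|M. m x * (G x)\<^sup>2)" by simp
  moreover have "(\<integral>\<^sup>+x. ennreal (m x * (G x)\<^sup>2) \<partial>M) = ennreal (LINT x|M. m x * (G x)\<^sup>2)"
    using i2 m(3) by (intro nn_integral_eq_integral) auto
  ultimately show ?thesis by (simp add: c_def ennreal_leI)
qed simp

text \<open>By Jensen and Fubini the squared L2 error is at most an average over |h| < \<epsilon> of
  the squared L2 translation error of \<open>f\<close>. The conclusion holds for all small scales
  because several functions are later mollified with one common \<epsilon>.\<close>

lemma conv_mollifier_L2:
  fixes f :: "real^'d \<Rightarrow> real"
  assumes f: "integrable lborel f" "integrable lborel (\<lambda>x. (f x)\<^sup>2)" and "e > 0"
  shows "\<exists>\<epsilon>0>0. \<forall>\<epsilon>. 0 < \<epsilon> \<and> \<epsilon> < \<epsilon>0 \<longrightarrow>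
    integrable lborel (\<lambda>x. (conv (mollifier \<epsilon>) f x - f x)\<^sup>2) \<and>
    (LINT x|lborel. (conv (mollifier \<epsilon>) f x - f x)\<^sup>2) < e"
proof -
  have fm [measurable]: "f \<in> borel_measurable borel"
    using f(1) by (auto dest: borel_measurable_integrable)
  have "\<forall>\<^sub>F h in at 0. (LINT x|lborel. (f (x + h) - f x)\<^sup>2) < e / 2"
    using L2_translation_continuous[OF f half_gt_zero[OF \<open>e > 0\<close>]] .
  then obtain d where d: "d > 0" "\<And>h. h \<noteq> 0 \<Longrightarrow> norm h < d \<Longrightarrow> (LINT x|lborel. (f (x + h) - f x)\<^sup>2) < e / 2"
    unfolding eventually_at by auto
  have \<omega>: "(\<integral>\<^sup>+x. ennreal ((f (x - h) - f x)\<^sup>2) \<partial>lborel) \<le> ennreal (e / 2)" if "norm h < d" for h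
  proof (cases "h = 0")
    case False
    have "integrable lborel (\<lambda>x. (f (x + - h) - f x)\<^sup>2)"
      using lborel_translate(2)[of "\<lambda>x. (f x)\<^sup>2" "- h"] f by (intro integrable_square_diff) auto
    then have "(\<integral>\<^sup>+x. ennreal ((f (x - h) - f x)\<^sup>2) \<partial>lborel) = ennreal (LINT x|lborel. (f (x + - h) - f x)\<^sup>2)"
      by (subst nn_integral_eq_integral) auto
    then show ?thesis using d(2)[of "- h"] False that by (simp add: ennreal_leI)
  qed simp
  have "integrable lborel (\<lambda>x. (conv (mollifier \<epsilon>) f x - f x)\<^sup>2) \<and>
      (LINT x|lborel. (conv (mollifier \<epsilon>) f x - f x)\<^sup>2) < e" if \<epsilon>: "0 < \<epsilon>" "\<epsilon> < d" for \<epsilon>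
  proof -
    let ?m = "mollifier \<epsilon> :: real^'d \<Rightarrow> real"
    have mt: "?m \<in> test_functions UNIV" by (rule mollifier_test_function[OF \<epsilon>(1)])
    note [measurable] = test_function_measurable[OF mt]
    obtain K where K: "compact K" "\<And>x. x \<notin> K \<Longrightarrow> ?m x = 0"
      using test_functions_support[OF mt] by blast
    obtain B where B: "\<And>x. norm (?m x) \<le> B"
      using compact_support_bounded[OF Ck_continuous[OF test_functions_Ck[OF mt]] K] by blast
    have mi: "integrable lborel ?m" by (rule test_function_integrable[OF mt])
    have [measurable]: "conv ?m f \<in> borel_measurable borel"
      using conv_continuous[OF mt f(1)] by (rule borel_measurable_continuous_onI)
    have pw: "ennreal ((conv ?m f x - f x)\<^sup>2) \<le> (\<integral>\<^sup>+h. ennreal (?m h * (f (x - h) - f x)\<^sup>2) \<partial>lborel)" for x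
    proof -
      have i1: "integrable lborel (\<lambda>h. ?m h * f (x - h))"
        using lborel_reflect(2)[OF fm, of x] f(1) B by (intro integrable_bounded_mult[where B=B]) auto
      have "conv ?m f x - f x = (LINT h|lborel. ?m h * f (x - h)) - f x * (LINT h|lborel. ?m h)"
        by (simp add: conv_commute integral_mollifier[OF \<epsilon>(1)])
      also have "\<dots> = (LINT h|lborel. ?m h * (f (x - h) - f x))"
        using i1 mi by (simp add: right_diff_distrib mult.commute)
      finally have eq: "conv ?m f x - f x = (LINT h|lborel. ?m h * (f (x - h) - f x))" .
      show ?thesis
        unfolding eq
      proof (rule square_integral_le[OF mi integral_mollifier[OF \<epsilon>(1)] mollifier_nonneg[OF \<epsilon>(1)]])
        show "integrable lborel (\<lambda>h. ?m h * (f (x - h) - f x))"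
          using i1 mi by (simp add: right_diff_distrib)
      qed measurable
    qed
    have "(\<integral>\<^sup>+x. ennreal ((conv ?m f x - f x)\<^sup>2) \<partial>lborel) \<le>
        (\<integral>\<^sup>+x. (\<integral>\<^sup>+h. ennreal (?m h * (f (x - h) - f x)\<^sup>2) \<partial>lborel) \<partial>lborel)"
      by (rule nn_integral_mono) (rule pw)
    also have "\<dots> = (\<integral>\<^sup>+h. (\<integral>\<^sup>+x. ennreal (?m h * (f (x - h) - f x)\<^sup>2) \<partial>lborel) \<partial>lborel)"
      by (rule lborel_pair.Fubini') measurable
    also have "\<dots> \<le> (\<integral>\<^sup>+h. ennreal (?m h) * ennreal (e / 2) \<partial>lborel)"
    proof (rule nn_integral_mono)
      fix h :: "real^'d"
      have "(\<integral>\<^sup>+x. ennreal (?m h * (f (x - h) - f x)\<^sup>2) \<partial>lborel) = ennreal (?m h) * (\<integral>\<^sup>+x. ennreal ((f (x - h) - f x)\<^sup>2) \<partial>lborel)"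
        by (subst nn_integral_cmult[symmetric]) (auto simp: ennreal_mult mollifier_nonneg[OF \<epsilon>(1)])
      also have "\<dots> \<le> ennreal (?m h) * ennreal (e / 2)"
      proof (cases "norm h < \<epsilon>")
        case True
        then show ?thesis using \<omega>[of h] \<epsilon> by (intro mult_left_mono) auto
      next
        case False
        then show ?thesis using mollifier_zero[OF \<epsilon>(1), of h] by simp
      qed
      finally show "(\<integral>\<^sup>+x. ennreal (?m h * (f (x - h) - f x)\<^sup>2) \<partial>lborel) \<le> ennreal (?m h) * ennreal (e / 2)" .
    qed
    also have "\<dots> = ennreal (e / 2)"
      by (simp add: nn_integral_multc nn_integral_eq_integral[OF mi] integral_mollifier[OF \<epsilon>(1)] mollifier_nonneg[OF \<epsilon>(1)])
    finally have le: "(\<integral>\<^sup>+x. ennreal ((conv ?m f x - f x)\<^sup>2) \<partial>lborel) \<le> ennreal (e / 2)" .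
    then have i: "integrable lborel (\<lambda>x. (conv ?m f x - f x)\<^sup>2)"
      by (intro integrableI_bounded) (auto intro: order_le_less_trans)
    moreover have "(LINT x|lborel. (conv ?m f x - f x)\<^sup>2) \<le> e / 2"
      using le \<open>e > 0\<close> by (subst (asm) nn_integral_eq_integral[OF i]) (auto simp: ennreal_le_iff)
    ultimately show ?thesis using \<open>e > 0\<close> by simp
  qed
  with d(1) show ?thesis by blast
qed

section \<open>Smooth cutoff functions\<close>

lemma conv_indicator_inside:
  fixes A :: "(real^'d) set"
  assumes "\<phi> \<in> test_functions UNIV" "\<And>x. norm x > \<epsilon> \<Longrightarrow> \<phi> x = 0" "cball x \<epsilon> \<subseteq> A"
  shows "conv \<phi> (indicator A) x = (LINT y|lborel. \<phi> y)"
proof -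
  have "\<phi> (x - y) * indicator A y = \<phi> (x - y)" for y
    using assms(2)[of "x - y"] assms(3) by (cases "norm (x - y) > \<epsilon>") (auto simp: subset_eq dist_norm)
  then have eq: "(\<lambda>y. \<phi> (x - y) * indicator A y) = (\<lambda>y. \<phi> (x - y))" by blast
  show ?thesis
    unfolding conv_def eq by (rule lborel_reflect(1)[OF test_function_measurable[OF assms(1)]])
qed

lemma conv_indicator_outside:
  fixes A :: "(real^'d) set"
  assumes "\<And>x. norm x > \<epsilon> \<Longrightarrow> \<phi> x = 0" "cball x \<epsilon> \<inter> A = {}"
  shows "conv \<phi> (indicator A) x = 0"
proof -
  have "\<phi> (x - y) * indicator A y = 0" for y
    using assms(1)[of "x - y"] assms(2)
    by (cases "norm (x - y) > \<epsilon>") (auto simp: dist_norm indicator_def disjoint_iff)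
  then have eq: "(\<lambda>y. \<phi> (x - y) * indicator A y) = (\<lambda>y. 0)" by blast
  show ?thesis unfolding conv_def eq by simp
qed

lemma conv_indicator_bound:
  fixes A :: "(real^'d) set"
  assumes \<phi>: "\<phi> \<in> test_functions UNIV" and A: "A \<in> sets borel" "bounded A"
  shows "\<bar>conv \<phi> (indicator A) x\<bar> \<le> (LINT y|lborel. \<bar>\<phi> y\<bar>)"
proof -
  have Ai: "integrable lborel (indicator A :: _ \<Rightarrow> real)"
    using A emeasure_bounded_finite[OF A(2)] by (intro integrable_real_indicator) auto
  note [measurable] = test_function_measurable[OF \<phi>]
  have "\<bar>conv \<phi> (indicator A) x\<bar> \<le> (LINT y|lborel. \<bar>\<phi> (x - y) * indicator A y\<bar>)"
    unfolding conv_def by (rule integral_abs_bound)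
  also have "\<dots> \<le> (LINT y|lborel. \<bar>\<phi> (x - y)\<bar>)"
  proof (rule Bochner_Integration.integral_mono)
    show "integrable lborel (\<lambda>y. \<bar>\<phi> (x - y) * indicator A y\<bar>)"
      using conv_integrable[OF \<phi> Ai] by auto
    show "integrable lborel (\<lambda>y. \<bar>\<phi> (x - y)\<bar>)"
      using lborel_reflect(2)[OF test_function_measurable[OF \<phi>], of x] test_function_integrable[OF \<phi>] by auto
  qed (auto simp: indicator_def)
  also have "\<dots> = (LINT y|lborel. \<bar>\<phi> y\<bar>)"
    using lborel_reflect(1)[of "\<lambda>y. \<bar>\<phi> y\<bar>" x] by simp
  finally show ?thesis .
qed

text \<open>The indicator of \<open>A\<close> is mollified at scale \<epsilon>. Its gradient is
  bounded by L1 norms of derivatives of the mollifier, which are fixed multiples of 1/\<epsilon>;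
  hence one \<open>M\<close> for all sets and scales. The vanishing of the gradient is recorded too,
  because the shell arguments read off from it where a gradient can live.\<close>

lemma smooth_cutoff:
  "\<exists>M>0. \<forall>(A :: (real^'d) set) \<epsilon>. A \<in> sets borel \<and> bounded A \<and> \<epsilon> > 0 \<longrightarrow>
     (\<exists>c. (\<forall>n. Ck n c) \<and> (\<forall>x. 0 \<le> c x \<and> c x \<le> 1 \<and> norm (gradient c x) \<le> M / \<epsilon>) \<and>
       (\<forall>x. cball x \<epsilon> \<subseteq> A \<longrightarrow> c x = 1 \<and> gradient c x = 0) \<and>
       (\<forall>x. cball x \<epsilon> \<inter> A = {} \<longrightarrow> c x = 0 \<and> gradient c x = 0))"
proof -
  define M where "M = (\<Sum>k\<in>UNIV. (LINT x|lborel. \<bar>partial k bump (x :: real^'d)\<bar>) / (LINT x|lborel. bump (x :: real^'d))) + 1"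
  have "0 \<le> (\<Sum>k\<in>UNIV. (LINT x|lborel. \<bar>partial k bump (x :: real^'d)\<bar>) / (LINT x|lborel. bump (x :: real^'d)))"
    using integral_bump_pos by (intro sum_nonneg divide_nonneg_pos Bochner_Integration.integral_nonneg) auto
  then have M: "M > 0" by (simp add: M_def)
  have "\<exists>c. (\<forall>n. Ck n c) \<and> (\<forall>x. 0 \<le> c x \<and> c x \<le> 1 \<and> norm (gradient c x) \<le> M / \<epsilon>) \<and>
       (\<forall>x. cball x \<epsilon> \<subseteq> A \<longrightarrow> c x = 1 \<and> gradient c x = 0) \<and>
       (\<forall>x. cball x \<epsilon> \<inter> A = {} \<longrightarrow> c x = 0 \<and> gradient c x = 0)"
    if A: "A \<in> sets borel" "bounded A" and \<epsilon>: "\<epsilon> > 0" for A :: "(real^'d) set" and \<epsilon>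
  proof -
    let ?m = "mollifier \<epsilon> :: real^'d \<Rightarrow> real"
    define c where "c = conv ?m (indicator A)"
    have mt: "?m \<in> test_functions UNIV" by (rule mollifier_test_function[OF \<epsilon>])
    have m1: "(LINT y|lborel. ?m y) = 1" by (rule integral_mollifier[OF \<epsilon>])
    note mp = test_functions_partial[OF mt]
    have Ai: "integrable lborel (indicator A :: _ \<Rightarrow> real)"
      using A emeasure_bounded_finite[OF A(2)] by (intro integrable_real_indicator) auto
    have z: "?m x = 0" if "norm x > \<epsilon>" for x
      using mollifier_zero[OF \<epsilon>, of x] that by simp
    have zp: "partial k ?m x = 0" if "norm x > \<epsilon>" for x k
      by (rule partial_zero_outside[of "cball 0 \<epsilon>"]) (use that z in auto)
    have pc: "partial k c = conv (partial k ?m) (indicator A)" for k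
      unfolding c_def by (rule partial_conv[OF mt Ai])
    \<comment> \<open>The derivatives of the mollifier have total integral zero, so their
      convolution with the indicator vanishes wherever the whole kernel fits into
      \<open>A\<close>.\<close>
    have "(LINT x|lborel. partial k ?m x) = 0" for k
      by (rule integral_partial_zero[of _ "cball 0 \<epsilon>"]) (use z test_functions_Ck[OF mt, of "Suc 0"] in auto)
    then have in1: "c x = 1 \<and> gradient c x = 0" if "cball x \<epsilon> \<subseteq> A" for x
      using conv_indicator_inside[OF mt z that] conv_indicator_inside[OF mp zp that] m1
      by (simp add: c_def[symmetric] pc[symmetric] vec_eq_iff)
    have out: "c x = 0 \<and> gradient c x = 0" if "cball x \<epsilon> \<inter> A = {}" for x
    proof
      show "c x = 0" unfolding c_def by (rule conv_indicator_outside[OF z that])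
      have "partial k c x = 0" for k unfolding pc by (rule conv_indicator_outside[OF zp that])
      then show "gradient c x = 0" by (simp add: vec_eq_iff)
    qed
    have "c x \<ge> 0" for x
      unfolding c_def conv_def using mollifier_nonneg[OF \<epsilon>]
      by (intro Bochner_Integration.integral_nonneg mult_nonneg_nonneg) auto
    moreover have "c x \<le> 1" for x
      using conv_indicator_bound[OF mt A, of x] m1
      by (simp add: c_def mollifier_nonneg[OF \<epsilon>])
    moreover have "norm (gradient c x) \<le> M / \<epsilon>" for x
    proof -
      have "norm (gradient c x) \<le> (\<Sum>k\<in>UNIV. \<bar>partial k c x\<bar>)"
        using norm_le_l1_cart[of "gradient c x"] by simp
      also have "\<dots> \<le> (\<Sum>k\<in>UNIV. (LINT x|lborel. \<bar>partial k bump (x :: real^'d)\<bar>) / (LINT x|lborel. bump (x :: real^'d)) / \<epsilon>)"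
        using conv_indicator_bound[OF mp A, of _ x] unfolding pc integral_partial_mollifier[OF \<epsilon>]
        by (intro sum_mono) auto
      also have "\<dots> = (M - 1) / \<epsilon>"
        by (simp only: M_def sum_divide_distrib[symmetric] add_diff_cancel_right')
      also have "\<dots> \<le> M / \<epsilon>"
        using \<epsilon> by (intro divide_right_mono) auto
      finally show ?thesis .
    qed
    moreover have "Ck n c" for n unfolding c_def by (rule Ck_conv[OF mt Ai])
    ultimately show ?thesis using in1 out by blast
  qed
  with M show ?thesis by blast
qed

section \<open>Ahlfors regular sets\<close>

lemma layer_borel [measurable]: "{y \<in> ball x0 R. infdist y \<Gamma> < t} \<in> sets borel"
proof -
  have "open {y. infdist y \<Gamma> < t}"
    by (intro open_Collect_less continuous_intros)
  then have "open (ball x0 R \<inter> {y. infdist y \<Gamma> < t})" by (intro open_Int) auto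
  also have "ball x0 R \<inter> {y. infdist y \<Gamma> < t} = {y \<in> ball x0 R. infdist y \<Gamma> < t}" by auto
  finally show ?thesis by (rule borel_open)
qed

text \<open>Restricting the surface measure to one surface ball and pushing it forward to the
  ambient space yields a finite Borel measure, for which Fubini with Lebesgue measure is available.
  Finiteness is the upper Ahlfors bound for the ball about the centre \<open>z\<close>.\<close>

lemma ahlfors_measure:
  fixes \<Gamma> :: "(real^'d) set"
  assumes reg: "ahlfors_regular \<Gamma> s" and \<Gamma>: "closed \<Gamma>" and z: "z \<in> \<Gamma>" and R: "R > 0"
  shows "\<exists>\<nu> c. sets \<nu> = sets borel \<and> finite_measure \<nu> \<and> c > 0 \<and> (AE x in \<nu>. x \<in> \<Gamma> \<inter> ball z R) \<and>
    (\<forall>x\<in>\<Gamma> \<inter> ball z R. \<forall>r. 0 < r \<and> r < 2 * R \<longrightarrow>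
      ennreal (inverse c * r powr s) \<le> emeasure \<nu> (ball x r) \<and> emeasure \<nu> (ball x r) \<le> ennreal (c * r powr s))"
proof -
  obtain \<mu> where \<mu>: "regular_borel_measure_on \<Gamma> \<mu>"
    and "\<forall>x0\<in>\<Gamma>. \<forall>R0>0. \<exists>c>0. \<forall>x \<in> \<Gamma> \<inter> ball x0 R0. \<forall>r. 0 < r \<and> r < 2 * R0 \<longrightarrow>
           ennreal (inverse c * r powr s) \<le> emeasure \<mu> ((\<Gamma> \<inter> ball x0 R0) \<inter> ball x r) \<and>
           emeasure \<mu> ((\<Gamma> \<inter> ball x0 R0) \<inter> ball x r) \<le> ennreal (c * r powr s)"
    using reg unfolding ahlfors_regular_def by blast
  then obtain c where c: "c > 0"
    and cb: "\<And>x r. x \<in> \<Gamma> \<inter> ball z R \<Longrightarrow> 0 < r \<Longrightarrow> r < 2 * R \<Longrightarrow>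
           ennreal (inverse c * r powr s) \<le> emeasure \<mu> ((\<Gamma> \<inter> ball z R) \<inter> ball x r) \<and>
           emeasure \<mu> ((\<Gamma> \<inter> ball z R) \<inter> ball x r) \<le> ennreal (c * r powr s)"
    using z R by meson
  define A where "A = \<Gamma> \<inter> ball z R"
  have sets_\<mu>: "sets \<mu> = sets (restrict_space borel \<Gamma>)"
    using \<mu> unfolding regular_borel_measure_on_def by blast
  have space_\<mu>: "space \<mu> = \<Gamma>"
    using sets_eq_imp_space_eq[OF sets_\<mu>] by (simp add: space_restrict_space)
  have A: "A \<in> sets \<mu>"
    unfolding sets_\<mu> sets_restrict_space A_def by (intro image_eqI[of _ _ "ball z R"]) auto
  have "(\<lambda>x. x) \<in> restrict_space borel \<Gamma> \<rightarrow>\<^sub>M borel"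
    by (rule measurable_restrict_space1) simp
  then have "(\<lambda>x. x) \<in> \<mu> \<rightarrow>\<^sub>M borel"
    using measurable_cong_sets[OF sets_\<mu> refl] by blast
  then have id: "(\<lambda>x. x) \<in> restrict_space \<mu> A \<rightarrow>\<^sub>M borel"
    by (rule measurable_restrict_space1)
  have space_A: "space (restrict_space \<mu> A) = A"
    using space_\<mu> by (auto simp: space_restrict_space A_def)
  define \<nu> where "\<nu> = distr (restrict_space \<mu> A) borel (\<lambda>x. x)"
  have sets_\<nu>: "sets \<nu> = sets borel" by (simp add: \<nu>_def)
  have em: "emeasure \<nu> B = emeasure \<mu> (A \<inter> B)" if "B \<in> sets borel" for B
  proof -
    have "emeasure \<nu> B = emeasure (restrict_space \<mu> A) (B \<inter> A)"
      unfolding \<nu>_def using emeasure_distr[OF id that] by (simp add: space_A)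
    also have "\<dots> = emeasure \<mu> (B \<inter> A)"
      by (rule emeasure_restrict_space) (use A sets.sets_into_space in auto)
    finally show ?thesis by (simp add: Int_commute)
  qed
  have "emeasure \<nu> UNIV = emeasure \<mu> (A \<inter> ball z R)"
    using em[of UNIV] by (simp add: A_def Int_assoc)
  also have "\<dots> \<le> ennreal (c * R powr s)"
    using cb[of z R] z R by (simp add: A_def)
  finally have "finite_measure \<nu>"
    by (intro finite_measureI) (auto simp: \<nu>_def top_unique)
  moreover have "AE x in \<nu>. x \<in> A"
  proof -
    have "A \<in> sets borel" using \<Gamma> by (auto simp: A_def)
    then have Ab: "{x \<in> space borel. x \<in> A} \<in> sets borel" by simp
    have "AE x in restrict_space \<mu> A. x \<in> A" by (rule AE_I2) (simp add: space_A)
    then show ?thesis unfolding \<nu>_def by (subst AE_distr_iff[OF id Ab])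
  qed
  ultimately show ?thesis
    using sets_\<nu> c cb em[OF borel_open[OF open_ball]] unfolding A_def by metis
qed

text \<open>Double counting of pairs of a boundary point and a layer point at distance below 2t:
  from a layer point one sees boundary measure at least of order t^s, from a boundary point volume
  of order t^d, where d is the dimension. Fubini bounds the volume of the layer by a multiple of
  t^(d - s).\<close>

lemma boundary_layer_volume:
  fixes \<Gamma> :: "(real^'d) set" and T :: real
  assumes reg: "ahlfors_regular \<Gamma> s" and \<Gamma>: "closed \<Gamma>" "\<Gamma> \<noteq> {}"
  shows "\<exists>K>0. \<forall>t. 0 < t \<and> t \<le> T \<longrightarrow>
    emeasure lborel {y \<in> ball x0 R. infdist y \<Gamma> < t} \<le> ennreal (K * t powr (real CARD('d) - s))"
proof -
  obtain z where z: "z \<in> \<Gamma>" using \<Gamma>(2) by blast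
  \<comment> \<open>Large enough that the boundary point nearest to a point of the layer lies in
    \<open>ball z R'\<close>, and that \<open>t < 2 * R'\<close>, as the lower Ahlfors bound
    requires.\<close>
  define R' where "R' = dist z x0 + \<bar>R\<bar> + \<bar>T\<bar> + 1"
  have R': "R' > 0" by (simp add: R'_def add_nonneg_pos)
  obtain \<nu> c where \<nu>: "sets \<nu> = sets borel" "finite_measure \<nu>" "c > 0"
    and \<nu>b: "\<And>x r. x \<in> \<Gamma> \<inter> ball z R' \<Longrightarrow> 0 < r \<Longrightarrow> r < 2 * R' \<Longrightarrow>
      ennreal (inverse c * r powr s) \<le> emeasure \<nu> (ball x r)"
    using ahlfors_measure[OF reg \<Gamma>(1) z R'] by metis
  interpret \<nu>: finite_measure \<nu> by fact
  interpret P: pair_sigma_finite \<nu> lborel ..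
  note [measurable_cong] = \<nu>(1)
  define N where "N = measure \<nu> (space \<nu>)"
  define V where "V = unit_ball_vol (real CARD('d))"
  define K where "K = c * (N * (V * 2 ^ CARD('d))) + 1"
  have V: "V \<ge> 0" and N: "N \<ge> 0" by (auto simp: V_def N_def)
  then have K: "K > 0" using \<nu>(3) by (simp add: K_def add_nonneg_pos)
  have "emeasure lborel {y \<in> ball x0 R. infdist y \<Gamma> < t} \<le> ennreal (K * t powr (real CARD('d) - s))"
    if t: "0 < t" "t \<le> T" for t
  proof -
    define S where "S = {y \<in> ball x0 R. infdist y \<Gamma> < t}"
    have [measurable]: "S \<in> sets borel" unfolding S_def by (rule layer_borel)
    have low: "ennreal (inverse c * t powr s) * indicator S y \<le> emeasure \<nu> (ball y (2 * t))" for y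
    proof (cases "y \<in> S")
      case True
      obtain x where x: "x \<in> \<Gamma>" "infdist y \<Gamma> = dist y x"
        by (rule infdist_attains_inf[OF \<Gamma>, of y])
      with True have x: "x \<in> \<Gamma>" "dist y x < t" by (auto simp: S_def)
      have "dist z x \<le> dist z x0 + dist x0 y + dist y x"
        using dist_triangle[of z x x0] dist_triangle[of x0 x y] by linarith
      then have xA: "x \<in> \<Gamma> \<inter> ball z R'" using True x t by (auto simp: S_def R'_def)
      have "ennreal (inverse c * t powr s) \<le> emeasure \<nu> (ball x t)"
      proof (rule \<nu>b[OF xA])
        show "t < 2 * R'" using t zero_le_dist[of z x0] abs_ge_zero[of R] abs_of_pos[of T] unfolding R'_def by (smt (verit))
        show "0 < t" by (rule t)
      qed
      also have "\<dots> \<le> emeasure \<nu> (ball y (2 * t))"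
      proof (rule emeasure_mono)
        show "ball x t \<subseteq> ball y (2 * t)"
        proof
          fix w assume "w \<in> ball x t"
          then show "w \<in> ball y (2 * t)" using x(2) dist_triangle[of y w x] by simp
        qed
      qed (simp add: \<nu>(1))
      finally show ?thesis using True by simp
    qed simp
    have "ennreal (inverse c * t powr s) * emeasure lborel S = (\<integral>\<^sup>+y. ennreal (inverse c * t powr s) * indicator S y \<partial>lborel)"
      by (simp add: nn_integral_cmult)
    also have "\<dots> \<le> (\<integral>\<^sup>+y. emeasure \<nu> (ball y (2 * t)) \<partial>lborel)"
      by (rule nn_integral_mono) (rule low)
    also have "\<dots> = (\<integral>\<^sup>+y. (\<integral>\<^sup>+x. indicator {(x, y). dist x y < 2 * t} (x, y) \<partial>\<nu>) \<partial>lborel)"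
    proof (rule nn_integral_cong)
      fix y :: "real^'d"
      have "emeasure \<nu> (ball y (2 * t)) = (\<integral>\<^sup>+x. indicator (ball y (2 * t)) x \<partial>\<nu>)"
        by (rule nn_integral_indicator[symmetric]) (simp add: \<nu>(1))
      then show "emeasure \<nu> (ball y (2 * t)) = (\<integral>\<^sup>+x. indicator {(x, y). dist x y < 2 * t} (x, y) \<partial>\<nu>)"
        by (simp add: indicator_def dist_commute)
    qed
    also have "\<dots> = (\<integral>\<^sup>+x. (\<integral>\<^sup>+y. indicator {(x, y). dist x y < 2 * t} (x, y) \<partial>lborel) \<partial>\<nu>)"
      by (rule P.Fubini') measurable
    also have "\<dots> = (\<integral>\<^sup>+x. emeasure lborel (ball x (2 * t)) \<partial>\<nu>)"
    proof (rule nn_integral_cong)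
      fix x :: "real^'d"
      have "emeasure lborel (ball x (2 * t)) = (\<integral>\<^sup>+y. indicator (ball x (2 * t)) y \<partial>lborel)"
        by (rule nn_integral_indicator[symmetric]) simp
      then show "(\<integral>\<^sup>+y. indicator {(x, y). dist x y < 2 * t} (x, y) \<partial>lborel) = emeasure lborel (ball x (2 * t))"
        by (simp add: indicator_def)
    qed
    also have "\<dots> = (\<integral>\<^sup>+x. ennreal (V * (2 * t) ^ CARD('d)) \<partial>\<nu>)"
      using t by (simp add: emeasure_ball V_def)
    also have "\<dots> = ennreal (N * (V * (2 * t) ^ CARD('d)))"
      using V N t by (simp add: \<nu>.emeasure_eq_measure N_def ennreal_mult'[symmetric] mult.commute)
    finally have le: "ennreal (inverse c * t powr s) * emeasure lborel S \<le> ennreal (N * (V * (2 * t) ^ CARD('d)))" .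
    have fin: "emeasure lborel S < \<infinity>"
      by (rule emeasure_bounded_finite) (rule bounded_subset[of "ball x0 R"], auto simp: S_def)
    have "ennreal (inverse c * t powr s * measure lborel S) \<le> ennreal (N * (V * (2 * t) ^ CARD('d)))"
      using le fin \<nu>(3) by (simp add: emeasure_eq_ennreal_measure ennreal_mult)
    then have "inverse c * t powr s * measure lborel S \<le> N * (V * (2 * t) ^ CARD('d))"
      using N V t by (subst (asm) ennreal_le_iff) auto
    then have "c * (inverse c * t powr s * measure lborel S) \<le> c * (N * (V * (2 * t) ^ CARD('d)))"
      using \<nu>(3) by (intro mult_left_mono) auto
    then have "t powr s * measure lborel S \<le> c * (N * (V * (2 * t) ^ CARD('d)))"
      using \<nu>(3) by (simp add: mult.assoc[symmetric])
    also have "\<dots> = (K - 1) * t ^ CARD('d)"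
      by (simp add: K_def power_mult_distrib ac_simps)
    also have "t ^ CARD('d) = t powr s * t powr (real CARD('d) - s)"
      using t by (simp add: powr_realpow powr_add[symmetric])
    finally have "measure lborel S \<le> (K - 1) * t powr (real CARD('d) - s)"
      using t by (simp add: mult.left_commute)
    also have "\<dots> \<le> K * t powr (real CARD('d) - s)" by (intro mult_right_mono) auto
    finally show ?thesis
      using fin unfolding S_def[symmetric] by (simp add: emeasure_eq_ennreal_measure ennreal_leI)
  qed
  with K show ?thesis by blast
qed

text \<open>Layers around a bounded piece have volume tending to zero with their width, since the
  exponent d - s is positive. The lemma lets integrals over subsets of the closure be compared with
  integrals over the domain.\<close>

lemma ahlfors_null:
  fixes \<Gamma> :: "(real^'d) set"
  assumes reg: "ahlfors_regular \<Gamma> s" and \<Gamma>: "closed \<Gamma>" and s: "s < real CARD('d)"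
  shows "\<Gamma> \<in> null_sets lborel"
proof (cases "\<Gamma> = {}")
  case False
  have [measurable]: "\<Gamma> \<in> sets borel" using \<Gamma> by simp
  have "emeasure lborel (\<Gamma> \<inter> ball 0 (real n)) = 0" for n
  proof -
    obtain K where K: "K > 0" "\<And>t. 0 < t \<Longrightarrow> t \<le> 1 \<Longrightarrow>
      emeasure lborel {y \<in> ball 0 (real n). infdist y \<Gamma> < t} \<le> ennreal (K * t powr (real CARD('d) - s))"
      using boundary_layer_volume[OF reg \<Gamma> False, of 1 0 "real n"] by blast
    have "emeasure lborel (\<Gamma> \<inter> ball 0 (real n)) \<le> ennreal (K * inverse (real (Suc m)) powr (real CARD('d) - s))" for m
    proof -
      have "emeasure lborel (\<Gamma> \<inter> ball 0 (real n)) \<le> emeasure lborel {y \<in> ball 0 (real n). infdist y \<Gamma> < inverse (real (Suc m))}"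
        using layer_borel[of 0 "real n" \<Gamma> "inverse (real (Suc m))"] by (intro emeasure_mono) auto
      also have "\<dots> \<le> ennreal (K * inverse (real (Suc m)) powr (real CARD('d) - s))"
        by (intro K) (auto simp: field_simps)
      finally show ?thesis .
    qed
    moreover have "(\<lambda>m. ennreal (K * inverse (real (Suc m)) powr (real CARD('d) - s))) \<longlonglongrightarrow> ennreal (K * 0)"
    proof (intro tendsto_ennrealI tendsto_mult tendsto_const)
      have "filterlim (\<lambda>m. inverse (real (Suc m))) (at_right 0) sequentially"
        using LIMSEQ_inverse_real_of_nat by (auto simp: filterlim_at)
      then show "(\<lambda>m. inverse (real (Suc m)) powr (real CARD('d) - s)) \<longlonglongrightarrow> 0"
        using s LIMSEQ_inverse_real_of_nat by (intro tendsto_zero_powrI[where b="real CARD('d) - s"]) auto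
    qed
    ultimately have "emeasure lborel (\<Gamma> \<inter> ball 0 (real n)) \<le> ennreal (K * 0)"
      by (intro LIMSEQ_le_const[of _ "ennreal (K * 0)"]) auto
    then show ?thesis by simp
  qed
  then have "(\<Union>n. \<Gamma> \<inter> ball 0 (real n)) \<in> null_sets lborel"
    by (intro null_sets_UN) (auto intro!: null_setsI)
  moreover have "(\<Union>n. \<Gamma> \<inter> ball 0 (real n)) = \<Gamma>"
    using reals_Archimedean2 by auto
  ultimately show ?thesis by simp
qed simp

section \<open>Estimates along chains of balls\<close>

lemma line_estimate:
  fixes v :: "real^'d \<Rightarrow> real"
  assumes "Ck (Suc 0) v"
  shows "ennreal \<bar>v p - v (p + q)\<bar> \<le>
    (\<integral>\<^sup>+t. indicator {0..1} t * ennreal (norm (gradient v (p + t *\<^sub>R q)) * norm q) \<partial>lborel)"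
proof -
  define F where "F t = v (p + t *\<^sub>R q)" for t
  define f where "f t = gradient v (p + t *\<^sub>R q) \<bullet> q" for t
  have D: "(F has_real_derivative f t) (at t)" for t
    unfolding F_def f_def by (rule line_derivative[OF assms])
  have "continuous_on UNIV f"
    unfolding f_def
    by (intro continuous_intros continuous_on_compose2[OF continuous_on_gradient[OF assms]]) auto
  then have c: "isCont f t" for t
    by (simp add: continuous_on_eq_continuous_at)
  have "has_bochner_integral lborel (\<lambda>t. f t * indicator {0..1} t) (F 1 - F 0)"
    by (rule has_bochner_integral_FTC_Icc_real) (use D c in auto)
  then have i: "integrable lborel (\<lambda>t. f t * indicator {0..1} t)" "(LINT t|lborel. f t * indicator {0..1} t) = F 1 - F 0"
    by (auto simp: has_bochner_integral_iff)
  have "ennreal \<bar>v p - v (p + q)\<bar> = ennreal (norm (LINT t|lborel. f t * indicator {0..1} t))"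
    by (simp add: i(2) F_def abs_minus_commute)
  also have "\<dots> \<le> (\<integral>\<^sup>+t. ennreal (norm (f t * indicator {0..1} t)) \<partial>lborel)"
    by (rule integral_norm_bound_ennreal[OF i(1)])
  also have "\<dots> \<le> (\<integral>\<^sup>+t. indicator {0..1} t * ennreal (norm (gradient v (p + t *\<^sub>R q)) * norm q) \<partial>lborel)"
  proof (rule nn_integral_mono)
    fix t
    show "ennreal (norm (f t * indicator {0..1} t)) \<le> indicator {0..1} t * ennreal (norm (gradient v (p + t *\<^sub>R q)) * norm q)"
      using Cauchy_Schwarz_ineq2[of "gradient v (p + t *\<^sub>R q)" q]
      by (cases "t \<in> {0..1}") (auto simp: f_def abs_mult intro!: ennreal_leI)
  qed
  finally show ?thesis .
qed

lemma gradient_measurable: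
  assumes "Ck (Suc n) v"
  shows "gradient v \<in> borel_measurable borel"
  using borel_measurable_continuous_onI[OF continuous_on_gradient[OF assms]] .

text \<open>The point with parameter \<open>h\<close> moves along a segment from the first ball to
  the second, so the difference is bounded by the gradient integrated along it. At a fixed time
  \<open>h\<close> is mapped by a dilation of factor at least \<open>m\<close>, and the change of
  variables costs at most 1 over m to the dimension. No mean values of \<open>v\<close> occur, which
  is why such links can be concatenated.\<close>

lemma segment_estimate:
  fixes v :: "real^'d \<Rightarrow> real" and p q :: "real^'d"
  assumes v: "Ck (Suc 0) v" and m: "m > 0" "m \<le> \<alpha>" "m \<le> \<beta>" and D: "D \<in> sets borel"
    and sub: "\<And>t h. 0 \<le> t \<Longrightarrow> t \<le> 1 \<Longrightarrow> norm h < 1 \<Longrightarrow> (p + t *\<^sub>R (q - p)) + (\<alpha> + t * (\<beta> - \<alpha>)) *\<^sub>R h \<in> D"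
  shows "(\<integral>\<^sup>+h. indicator (ball 0 1) h * ennreal \<bar>v (p + \<alpha> *\<^sub>R h) - v (q + \<beta> *\<^sub>R h)\<bar> \<partial>lborel)
    \<le> ennreal ((dist p q + \<bar>\<alpha> - \<beta>\<bar>) / m ^ CARD('d)) * (\<integral>\<^sup>+y. indicator D y * ennreal (norm (gradient v y)) \<partial>lborel)"
proof -
  note [measurable] = gradient_measurable[OF v] D
  define L where "L = dist p q + \<bar>\<alpha> - \<beta>\<bar>"
  have L: "L \<ge> 0" by (simp add: L_def)
  define X where "X t h = (p + t *\<^sub>R (q - p)) + (\<alpha> + t * (\<beta> - \<alpha>)) *\<^sub>R h" for t and h :: "real^'d"
  define G where "G = (\<integral>\<^sup>+y. indicator D y * ennreal (norm (gradient v y)) \<partial>lborel)"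
  have le: "indicator (ball 0 1) h * ennreal \<bar>v (p + \<alpha> *\<^sub>R h) - v (q + \<beta> *\<^sub>R h)\<bar> \<le>
     (\<integral>\<^sup>+t. ennreal L * (indicator {0..1} t * (indicator D (X t h) * ennreal (norm (gradient v (X t h))))) \<partial>lborel)" for h
  proof (cases "norm h < 1")
    case True
    let ?q = "(q - p) + (\<beta> - \<alpha>) *\<^sub>R h"
    have X: "p + \<alpha> *\<^sub>R h + t *\<^sub>R ?q = X t h" for t
      by (simp add: X_def algebra_simps)
    have "q + \<beta> *\<^sub>R h = p + \<alpha> *\<^sub>R h + ?q" by (simp add: algebra_simps)
    then have "ennreal \<bar>v (p + \<alpha> *\<^sub>R h) - v (q + \<beta> *\<^sub>R h)\<bar> \<le>
      (\<integral>\<^sup>+t. indicator {0..1} t * ennreal (norm (gradient v (X t h)) * norm ?q) \<partial>lborel)"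
      using line_estimate[OF v, of "p + \<alpha> *\<^sub>R h" ?q] by (simp only: X)
    also have "\<dots> \<le> (\<integral>\<^sup>+t. ennreal L * (indicator {0..1} t * (indicator D (X t h) * ennreal (norm (gradient v (X t h))))) \<partial>lborel)"
    proof (rule nn_integral_mono)
      fix t :: real
      have "norm ?q \<le> norm (q - p) + \<bar>\<beta> - \<alpha>\<bar> * norm h"
        using norm_triangle_ineq[of "q - p" "(\<beta> - \<alpha>) *\<^sub>R h"] by simp
      also have "\<dots> \<le> norm (q - p) + \<bar>\<beta> - \<alpha>\<bar> * 1"
        using True by (intro add_left_mono mult_left_mono) auto
      finally have nq: "norm ?q \<le> L" by (simp add: L_def dist_norm norm_minus_commute abs_minus_commute)
      show "indicator {0..1} t * ennreal (norm (gradient v (X t h)) * norm ?q) \<le>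
         ennreal L * (indicator {0..1} t * (indicator D (X t h) * ennreal (norm (gradient v (X t h)))))"
      proof (cases "t \<in> {0..1}")
        case t: True
        then have "X t h \<in> D" using sub[of t h] True by (simp add: X_def)
        moreover have "norm (gradient v (X t h)) * norm ?q \<le> L * norm (gradient v (X t h))"
          using mult_left_mono[OF nq, of "norm (gradient v (X t h))"] by (simp add: mult.commute)
        ultimately show ?thesis
          using t L by (simp add: ennreal_mult'[symmetric] ennreal_leI)
      qed simp
    qed
    finally show ?thesis using True by simp
  qed simp
  have "(\<integral>\<^sup>+h. indicator (ball 0 1) h * ennreal \<bar>v (p + \<alpha> *\<^sub>R h) - v (q + \<beta> *\<^sub>R h)\<bar> \<partial>lborel) \<le>
     (\<integral>\<^sup>+h. (\<integral>\<^sup>+t. ennreal L * (indicator {0..1} t * (indicator D (X t h) * ennreal (norm (gradient v (X t h))))) \<partial>lborel) \<partial>lborel)"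
    by (rule nn_integral_mono) (rule le)
  also have "\<dots> = (\<integral>\<^sup>+t. (\<integral>\<^sup>+h. ennreal L * (indicator {0..1} t * (indicator D (X t h) * ennreal (norm (gradient v (X t h))))) \<partial>lborel) \<partial>lborel)"
    unfolding X_def by (rule lborel_pair.Fubini') measurable
  also have "\<dots> \<le> (\<integral>\<^sup>+t. ennreal (L / m ^ CARD('d)) * G * indicator {0..1::real} t \<partial>lborel)"
  proof (rule nn_integral_mono)
    fix t :: real
    show "(\<integral>\<^sup>+h. ennreal L * (indicator {0..1} t * (indicator D (X t h) * ennreal (norm (gradient v (X t h))))) \<partial>lborel)
      \<le> ennreal (L / m ^ CARD('d)) * G * indicator {0..1} t"
    proof (cases "t \<in> {0..1}")
      case True
      define l where "l = \<alpha> + t * (\<beta> - \<alpha>)"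
      \<comment> \<open>The radius at time \<open>t\<close> is a convex combination of
        \<open>\<alpha>\<close> and \<open>\<beta>\<close>, hence at least \<open>m\<close>.\<close>
      have "0 \<le> (1 - t) * (\<alpha> - m) + t * (\<beta> - m)" using True m by (intro add_nonneg_nonneg mult_nonneg_nonneg) auto
      then have l: "m \<le> l" by (simp add: l_def algebra_simps)
      then have l0: "l > 0" using m by simp
      define H where "H = (\<integral>\<^sup>+h. indicator D (X t h) * ennreal (norm (gradient v (X t h))) \<partial>lborel)"
      have "G = ennreal (l ^ CARD('d)) * H"
        unfolding G_def H_def X_def l_def[symmetric] by (rule nn_integral_affine[OF _ l0]) measurable
      then have "ennreal (m ^ CARD('d)) * H \<le> G"
        using l m by (auto intro!: mult_right_mono ennreal_leI power_mono)
      then have "ennreal (L / m ^ CARD('d)) * (ennreal (m ^ CARD('d)) * H) \<le> ennreal (L / m ^ CARD('d)) * G"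
        by (rule mult_left_mono) simp
      then have "ennreal L * H \<le> ennreal (L / m ^ CARD('d)) * G"
        using m(1) L by (simp add: mult.assoc[symmetric] ennreal_mult'[symmetric])
      moreover have "(\<integral>\<^sup>+h. ennreal L * (indicator {0..1} t * (indicator D (X t h) * ennreal (norm (gradient v (X t h))))) \<partial>lborel) = ennreal L * H"
        unfolding H_def X_def using True by (subst nn_integral_cmult[symmetric]) auto
      ultimately show ?thesis using True by simp
    qed simp
  qed
  also have "\<dots> = ennreal (L / m ^ CARD('d)) * G"
    by (simp add: nn_integral_cmult)
  finally show ?thesis by (simp add: L_def G_def)
qed

text \<open>All balls of the chain are parametrised by the same \<open>h\<close>, so the triangle
  inequality can be used pointwise in \<open>h\<close> before integrating.\<close>

lemma ball_difference_telescope: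
  fixes v :: "real^'d \<Rightarrow> real" and P :: "nat \<Rightarrow> real^'d" and \<rho> :: "nat \<Rightarrow> real"
  assumes [measurable]: "v \<in> borel_measurable borel" and "j \<le> J"
  shows "(\<integral>\<^sup>+h. indicator (ball 0 1) h * ennreal \<bar>v (P j + \<rho> j *\<^sub>R h) - v (P J + \<rho> J *\<^sub>R h)\<bar> \<partial>lborel) \<le>
    (\<Sum>i\<in>{j..<J}. \<integral>\<^sup>+h. indicator (ball 0 1) h * ennreal \<bar>v (P i + \<rho> i *\<^sub>R h) - v (P (Suc i) + \<rho> (Suc i) *\<^sub>R h)\<bar> \<partial>lborel)"
  using assms(2)
proof (induction J rule: dec_induct)
  case base
  then show ?case by simp
next
  case (step J)
  let ?f = "\<lambda>i k h. indicator (ball 0 1) h * ennreal \<bar>v (P i + \<rho> i *\<^sub>R h) - v (P k + \<rho> k *\<^sub>R h)\<bar>"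
  have [measurable]: "ball (0 :: real^'d) 1 \<in> sets borel" by simp
  have fm: "?f i k \<in> borel_measurable borel" for i k by measurable
  have "(\<integral>\<^sup>+h. ?f j (Suc J) h \<partial>lborel) \<le> (\<integral>\<^sup>+h. ?f j J h + ?f J (Suc J) h \<partial>lborel)"
  proof (rule nn_integral_mono)
    fix h :: "real^'d"
    have "ennreal \<bar>v (P j + \<rho> j *\<^sub>R h) - v (P (Suc J) + \<rho> (Suc J) *\<^sub>R h)\<bar> \<le>
      ennreal (\<bar>v (P j + \<rho> j *\<^sub>R h) - v (P J + \<rho> J *\<^sub>R h)\<bar> + \<bar>v (P J + \<rho> J *\<^sub>R h) - v (P (Suc J) + \<rho> (Suc J) *\<^sub>R h)\<bar>)"
      by (intro ennreal_leI) linarith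
    then show "?f j (Suc J) h \<le> ?f j J h + ?f J (Suc J) h"
      by (cases "h \<in> ball 0 1") (simp_all del: mem_ball)
  qed
  also have "\<dots> = (\<integral>\<^sup>+h. ?f j J h \<partial>lborel) + (\<integral>\<^sup>+h. ?f J (Suc J) h \<partial>lborel)"
    by (rule nn_integral_add) (use fm in auto)
  also have "\<dots> \<le> (\<Sum>i\<in>{j..<J}. \<integral>\<^sup>+h. ?f i (Suc i) h \<partial>lborel) + (\<integral>\<^sup>+h. ?f J (Suc J) h \<partial>lborel)"
    by (rule add_right_mono) (rule step.IH)
  also have "\<dots> = (\<Sum>i\<in>{j..<Suc J}. \<integral>\<^sup>+h. ?f i (Suc i) h \<partial>lborel)"
    using step.hyps by simp
  finally show ?case .
qed

text \<open>Cauchy-Schwarz between the weighted energy and the reciprocal weight, in the additive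
  form X <= X^2 + 1 with X = l w |grad v|. The parameter \<open>l\<close> balances the two
  integrals.\<close>

lemma weighted_gradient_bound:
  fixes v :: "real^'d \<Rightarrow> real"
  assumes v: "v \<in> test_functions (- \<Gamma>)" and \<Gamma>: "closed \<Gamma>" "\<Gamma> \<noteq> {}" and W: "W \<in> sets borel" and l: "l > 0"
    and E: "(\<integral>\<^sup>+y. indicator W y * ennreal (infdist y \<Gamma> powr \<delta> * (norm (gradient v y))\<^sup>2) \<partial>lborel) \<le> ennreal E" "E \<ge> 0"
    and K: "(\<integral>\<^sup>+y. indicator W y * ennreal (infdist y \<Gamma> powr (- \<delta>)) \<partial>lborel) \<le> ennreal (K * l\<^sup>2)" "K \<ge> 0"
  shows "(\<integral>\<^sup>+y. indicator W y * ennreal (norm (gradient v y)) \<partial>lborel) \<le> ennreal ((E + K) * l)"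
proof -
  have v1: "Ck (Suc 0) v" using test_functions_Ck[OF v] .
  note [measurable] = gradient_measurable[OF v1] W
  have [measurable]: "(\<lambda>y. infdist y \<Gamma>) \<in> borel_measurable borel"
    by (intro borel_measurable_continuous_onI continuous_intros)
  obtain S where S: "compact S" "S \<subseteq> - \<Gamma>" "\<And>k x. x \<notin> S \<Longrightarrow> partial k v x = 0"
    using test_functions_support[OF v] by blast
  have le: "norm (gradient v y) \<le> l * (infdist y \<Gamma> powr \<delta> * (norm (gradient v y))\<^sup>2) + infdist y \<Gamma> powr (- \<delta>) / l" for y
  proof (cases "y \<in> \<Gamma>")
    \<comment> \<open>On \<open>\<Gamma>\<close> the expressions for the weight and for its
      reciprocal are both 0, as \<open>0 powr x\<close> is 0; the pointwise bound then holds only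
      because the support of \<open>v\<close> avoids \<open>\<Gamma>\<close> and the gradient
      vanishes.\<close>
    case True
    then have "gradient v y = 0" using S by (auto simp: vec_eq_iff)
    then show ?thesis using l by simp
  next
    case False
    then have d: "infdist y \<Gamma> > 0"
      using \<Gamma> infdist_pos_not_in_closed by blast
    define w where "w = infdist y \<Gamma> powr \<delta>"
    have w: "w > 0" "infdist y \<Gamma> powr (- \<delta>) = 1 / w" using d by (auto simp: w_def powr_minus_divide)
    have "0 \<le> (l * w * norm (gradient v y) - 1)\<^sup>2 + (l * w * norm (gradient v y))" using l w by simp
    then have "l * w * norm (gradient v y) \<le> (l * w)\<^sup>2 * (norm (gradient v y))\<^sup>2 + 1"
      by (simp add: power2_eq_square algebra_simps)
    also have "\<dots> = l * w * (l * (w * (norm (gradient v y))\<^sup>2) + 1 / w / l)"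
      using l w by (simp add: field_simps power2_eq_square)
    finally have "norm (gradient v y) \<le> l * (w * (norm (gradient v y))\<^sup>2) + 1 / w / l"
      using l w by (subst (asm) mult_le_cancel_left_pos) auto
    then show ?thesis unfolding w(2) w_def .
  qed
  have "(\<integral>\<^sup>+y. indicator W y * ennreal (norm (gradient v y)) \<partial>lborel) \<le>
    (\<integral>\<^sup>+y. ennreal l * (indicator W y * ennreal (infdist y \<Gamma> powr \<delta> * (norm (gradient v y))\<^sup>2)) +
          ennreal (1 / l) * (indicator W y * ennreal (infdist y \<Gamma> powr (- \<delta>))) \<partial>lborel)"
  proof (rule nn_integral_mono)
    fix y
    have "ennreal (norm (gradient v y)) \<le> ennreal (l * (infdist y \<Gamma> powr \<delta> * (norm (gradient v y))\<^sup>2) + infdist y \<Gamma> powr (- \<delta>) / l)"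
      by (intro ennreal_leI le)
    also have "\<dots> = ennreal l * ennreal (infdist y \<Gamma> powr \<delta> * (norm (gradient v y))\<^sup>2) + ennreal (1 / l) * ennreal (infdist y \<Gamma> powr (- \<delta>))"
      using l by (simp add: ennreal_mult'[symmetric] ennreal_plus[symmetric] del: ennreal_plus)
    finally show "indicator W y * ennreal (norm (gradient v y)) \<le>
      ennreal l * (indicator W y * ennreal (infdist y \<Gamma> powr \<delta> * (norm (gradient v y))\<^sup>2)) +
          ennreal (1 / l) * (indicator W y * ennreal (infdist y \<Gamma> powr (- \<delta>)))"
      by (cases "y \<in> W") auto
  qed
  also have "\<dots> = ennreal l * (\<integral>\<^sup>+y. indicator W y * ennreal (infdist y \<Gamma> powr \<delta> * (norm (gradient v y))\<^sup>2) \<partial>lborel) +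
     ennreal (1 / l) * (\<integral>\<^sup>+y. indicator W y * ennreal (infdist y \<Gamma> powr (- \<delta>)) \<partial>lborel)"
    by (simp add: nn_integral_add nn_integral_cmult)
  also have "\<dots> \<le> ennreal l * ennreal E + ennreal (1 / l) * ennreal (K * l\<^sup>2)"
    by (intro add_mono mult_left_mono E K) auto
  also have "\<dots> = ennreal ((E + K) * l)"
    using l E(2) K(2) by (simp add: ennreal_mult'[symmetric] ennreal_plus[symmetric] power2_eq_square algebra_simps del: ennreal_plus)
  finally show ?thesis .
qed

text \<open>By Fubini a point \<open>y\<close> is counted with the weight
  \<open>emeasure \<nu> (ball y t)\<close>. If a boundary point \<open>x\<close> of the surface ball
  lies within \<open>t\<close> of \<open>y\<close>, that ball is contained in
  \<open>ball x (2 * t)\<close> and the upper Ahlfors bound applies; otherwise it is a null set of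
  \<open>\<nu>\<close>.\<close>

lemma integral_over_centres:
  fixes \<nu> :: "(real^'d) measure" and g :: "real^'d \<Rightarrow> ennreal"
  assumes \<nu>: "sets \<nu> = sets borel" "finite_measure \<nu>" "AE x in \<nu>. x \<in> \<Gamma> \<inter> ball z \<rho>"
    and up: "\<And>x r. x \<in> \<Gamma> \<inter> ball z \<rho> \<Longrightarrow> 0 < r \<Longrightarrow> r < 2 * \<rho> \<Longrightarrow> emeasure \<nu> (ball x r) \<le> ennreal (c * r powr s)"
    and t: "0 < t" "t < \<rho>" "t \<le> 1" and [measurable]: "g \<in> borel_measurable borel"
  shows "(\<integral>\<^sup>+x. (\<integral>\<^sup>+y. indicator (ball x t) y * g y \<partial>lborel) \<partial>\<nu>) \<le>
    ennreal (c * (2 * t) powr s) * (\<integral>\<^sup>+y. indicator {y \<in> ball z (\<rho> + 1). infdist y \<Gamma> < t} y * g y \<partial>lborel)"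
proof -
  interpret \<nu>: finite_measure \<nu> by fact
  interpret P: pair_sigma_finite \<nu> lborel ..
  note [measurable_cong] = \<nu>(1)
  note [measurable] = layer_borel
  have "(\<integral>\<^sup>+x. (\<integral>\<^sup>+y. indicator (ball x t) y * g y \<partial>lborel) \<partial>\<nu>) =
      (\<integral>\<^sup>+x. (\<integral>\<^sup>+y. indicator {(x, y). dist x y < t} (x, y) * g y \<partial>lborel) \<partial>\<nu>)"
    by (simp add: indicator_def)
  also have "\<dots> = (\<integral>\<^sup>+y. (\<integral>\<^sup>+x. indicator {(x, y). dist x y < t} (x, y) * g y \<partial>\<nu>) \<partial>lborel)"
    by (rule P.Fubini'[symmetric]) measurable
  also have "\<dots> \<le> (\<integral>\<^sup>+y. ennreal (c * (2 * t) powr s) * (indicator {y \<in> ball z (\<rho> + 1). infdist y \<Gamma> < t} y * g y) \<partial>lborel)"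
  proof (rule nn_integral_mono)
    fix y :: "real^'d"
    have "(\<integral>\<^sup>+x. indicator {(x, y). dist x y < t} (x, y) * g y \<partial>\<nu>) = (\<integral>\<^sup>+x. g y * indicator (ball y t) x \<partial>\<nu>)"
      by (intro nn_integral_cong) (auto simp: indicator_def dist_commute)
    also have "\<dots> = g y * emeasure \<nu> (ball y t)"
      by (rule nn_integral_cmult_indicator) (simp add: \<nu>(1))
    finally have eq: "(\<integral>\<^sup>+x. indicator {(x, y). dist x y < t} (x, y) * g y \<partial>\<nu>) = g y * emeasure \<nu> (ball y t)" .
    show "(\<integral>\<^sup>+x. indicator {(x, y). dist x y < t} (x, y) * g y \<partial>\<nu>) \<le>
       ennreal (c * (2 * t) powr s) * (indicator {y \<in> ball z (\<rho> + 1). infdist y \<Gamma> < t} y * g y)"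
    proof (cases "\<exists>x\<in>\<Gamma> \<inter> ball z \<rho>. dist x y < t")
      case True
      then obtain x where x: "x \<in> \<Gamma> \<inter> ball z \<rho>" "dist x y < t" by blast
      have "ball y t \<subseteq> ball x (2 * t)"
      proof
        fix w assume "w \<in> ball y t"
        then show "w \<in> ball x (2 * t)" using x(2) dist_triangle[of x w y] by simp
      qed
      then have "emeasure \<nu> (ball y t) \<le> emeasure \<nu> (ball x (2 * t))"
        by (intro emeasure_mono) (auto simp: \<nu>(1))
      also have "\<dots> \<le> ennreal (c * (2 * t) powr s)" using t by (intro up x) auto
      finally have "emeasure \<nu> (ball y t) \<le> ennreal (c * (2 * t) powr s)" .
      moreover have "y \<in> ball z (\<rho> + 1)" using x t dist_triangle[of z y x] by simp
      moreover have "infdist y \<Gamma> < t"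
        using infdist_le[of x \<Gamma> y] x by (simp add: dist_commute)
      ultimately show ?thesis unfolding eq by (simp add: mult.commute mult_left_mono)
    next
      case False
      from \<nu>(3) have "AE x in \<nu>. x \<notin> ball y t"
      proof eventually_elim
        case (elim x)
        with False have "\<not> dist x y < t" by blast
        then show ?case by (simp add: dist_commute)
      qed
      then have "emeasure \<nu> (ball y t) = 0"
        by (subst (asm) AE_iff_measurable[OF _ refl]) (simp_all add: \<nu>(1) sets_eq_imp_space_eq[OF \<nu>(1)] ball_def)
      then show ?thesis unfolding eq by simp
    qed
  qed
  also have "\<dots> = ennreal (c * (2 * t) powr s) * (\<integral>\<^sup>+y. indicator {y \<in> ball z (\<rho> + 1). infdist y \<Gamma> < t} y * g y \<partial>lborel)"
    by (rule nn_integral_cmult) measurable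
  finally show ?thesis .
qed

text \<open>The indicator of \<open>ball x t\<close> at \<open>y\<close> is the indicator of a Borel
  set of pairs, so measurability in the centre comes from joint measurability.\<close>

lemma centre_integral_measurable:
  fixes \<nu> :: "(real^'d) measure" and g :: "real^'d \<Rightarrow> ennreal"
  assumes [measurable_cong]: "sets \<nu> = sets borel" and [measurable]: "g \<in> borel_measurable borel"
  shows "(\<lambda>x. \<integral>\<^sup>+y. indicator (ball x t) y * g y \<partial>lborel) \<in> borel_measurable \<nu>"
proof -
  have "(\<lambda>x. \<integral>\<^sup>+y. indicator {(x, y). dist x y < t} (x, y) * g y \<partial>lborel) \<in> borel_measurable \<nu>"
    by measurable
  then show ?thesis by (simp add: indicator_def)
qed

lemma geometric_tail_le:
  fixes q :: real
  assumes "0 < q" "q < 1"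
  shows "(\<Sum>i\<in>{j..<J}. q ^ i) \<le> q ^ j / (1 - q)"
proof (cases "j \<le> J")
  case True
  then have "(\<Sum>i\<in>{j..<J}. q ^ i) * (1 - q) = q ^ j - q ^ J"
  proof (induction J rule: dec_induct)
    case (step n)
    then show ?case by (simp add: distrib_right) (simp add: algebra_simps)
  qed simp
  also have "\<dots> \<le> q ^ j" using assms by simp
  finally show ?thesis using assms by (simp add: field_simps)
qed (use assms in simp)

text \<open>Powers of the scale r collected by one link in dimension d: r^(1 - d) from the chain
  hypothesis, r^s from integrating over the centres, r^((d - s - \<delta>)/2) from Cauchy-Schwarz
  with the reciprocal weight. Their product is r^(\<eta>/2) with \<eta> > 0, so the links beyond
  \<open>j0\<close> form a small geometric tail. What matters in the statement is the order of the
  quantifiers: \<open>j0\<close> depends on \<open>E\<close> and \<open>e\<close> but not on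
  \<open>v\<close>.\<close>

lemma chain_capacity:
  fixes \<Gamma> :: "(real^'d) set" and \<nu> :: "(real^'d) measure" and P :: "nat \<Rightarrow> real^'d \<Rightarrow> real^'d" and D :: "nat \<Rightarrow> (real^'d) set"
  assumes \<Gamma>: "closed \<Gamma>" "\<Gamma> \<noteq> {}"
    and \<nu>: "sets \<nu> = sets borel" "finite_measure \<nu>" "AE x in \<nu>. x \<in> \<Gamma> \<inter> ball z \<rho>" and c: "c > 0"
    and up: "\<And>x r. x \<in> \<Gamma> \<inter> ball z \<rho> \<Longrightarrow> 0 < r \<Longrightarrow> r < 2 * \<rho> \<Longrightarrow> emeasure \<nu> (ball x r) \<le> ennreal (c * r powr s)"
    and pos: "\<rho> > 0" "L > 0" "\<kappa> > 0" "E \<ge> 0" "e > 0" "M \<ge> 0" "N \<ge> 0"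
    and \<delta>: "\<delta> < 2 - real CARD('d) + s"
    and D: "\<And>j. D j \<in> sets borel"
    and near: "\<And>x j. x \<in> \<Gamma> \<inter> ball z \<rho> \<Longrightarrow> j \<ge> j1 \<Longrightarrow> dist (P j x) x \<le> L * (1/2) ^ j"
    and chain: "\<And>x j v. x \<in> \<Gamma> \<inter> ball z \<rho> \<Longrightarrow> j \<ge> j1 \<Longrightarrow> Ck (Suc 0) v \<Longrightarrow>
      (\<integral>\<^sup>+h. indicator (ball 0 1) h *
         ennreal \<bar>v (P j x + (\<kappa> * (1/2) ^ j) *\<^sub>R h) - v (P (Suc j) x + (\<kappa> * (1/2) ^ Suc j) *\<^sub>R h)\<bar> \<partial>lborel)
      \<le> ennreal (M * ((1/2) ^ j) powr (1 - real CARD('d))) *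
         (\<integral>\<^sup>+y. indicator (D j \<inter> ball x (L * (1/2) ^ j)) y * ennreal (norm (gradient v y)) \<partial>lborel)"
    and weight: "\<And>j. j \<ge> j1 \<Longrightarrow>
      (\<integral>\<^sup>+y. indicator (D j \<inter> {y \<in> ball z (\<rho> + 1). infdist y \<Gamma> < L * (1/2) ^ j}) y * ennreal (infdist y \<Gamma> powr (- \<delta>)) \<partial>lborel)
      \<le> ennreal (N * ((1/2) ^ j) powr (real CARD('d) - s - \<delta>))"
  shows "\<exists>j0\<ge>j1. \<forall>v m. v \<in> test_functions (- \<Gamma>) \<longrightarrow>
    (\<forall>j\<ge>j0. (\<integral>\<^sup>+y. indicator (D j \<inter> {y \<in> ball z (\<rho> + 1). infdist y \<Gamma> < L * (1/2) ^ j}) y *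
        ennreal (infdist y \<Gamma> powr \<delta> * (norm (gradient v y))\<^sup>2) \<partial>lborel) \<le> ennreal E) \<longrightarrow>
    (\<forall>x\<in>\<Gamma> \<inter> ball z \<rho>. ennreal m \<le> (\<integral>\<^sup>+h. indicator (ball 0 1) h * ennreal \<bar>v (P j0 x + (\<kappa> * (1/2) ^ j0) *\<^sub>R h)\<bar> \<partial>lborel)) \<longrightarrow>
    ennreal m * emeasure \<nu> (space \<nu>) \<le> ennreal e"
proof -
  define r where "r j = (1/2 :: real) ^ j" for j :: nat
  have r: "r j > 0" for j by (simp add: r_def)
  have r0: "r \<longlonglongrightarrow> 0" unfolding r_def by (intro LIMSEQ_power_zero) simp
  define \<eta> where "\<eta> = 2 - real CARD('d) + s - \<delta>"
  define q where "q = (1/2 :: real) powr (\<eta> / 2)"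
  have q: "0 < q" "q < 1" using \<delta> powr_less_mono2[of "\<eta> / 2" "1/2" 1] by (auto simp: q_def \<eta>_def)
  define K where "K = M * (c * (2 * L) powr s) * (E + N)"
  have K: "K \<ge> 0" using pos c by (simp add: K_def)
  have "(\<lambda>j. K * (q ^ j / (1 - q))) \<longlonglongrightarrow> K * (0 / (1 - q))"
    using q by (intro tendsto_intros LIMSEQ_power_zero) auto
  then have "\<forall>\<^sub>F j in sequentially. K * (q ^ j / (1 - q)) < e"
    using pos by (intro order_tendstoD(2)) auto
  moreover have "(\<lambda>j. L * r j) \<longlonglongrightarrow> L * 0" by (intro tendsto_intros r0)
  then have "\<forall>\<^sub>F j in sequentially. L * r j < min \<rho> 1"
    using pos by (intro order_tendstoD(2)) auto
  moreover have "\<forall>\<^sub>F j in sequentially. j \<ge> j1" by (rule eventually_ge_at_top)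
  ultimately have "\<forall>\<^sub>F j in sequentially. K * (q ^ j / (1 - q)) < e \<and> L * r j < min \<rho> 1 \<and> j \<ge> j1"
    by eventually_elim auto
  \<comment> \<open>The bound by \<open>min \<rho> 1\<close> makes the radii at this and all later
    scales admissible in \<open>integral_over_centres\<close>.\<close>
  then obtain j0 where j0: "K * (q ^ j0 / (1 - q)) < e" "L * r j0 < min \<rho> 1" "j0 \<ge> j1"
    using eventually_happens by force
  have rj: "L * r j < \<rho>" "L * r j \<le> 1" if "j \<ge> j0" for j
  proof -
    have "r j \<le> r j0" using that by (simp add: r_def power_decreasing)
    then have "L * r j \<le> L * r j0" using pos by simp
    with j0(2) show "L * r j < \<rho>" "L * r j \<le> 1" by auto
  qed
  have "ennreal m * emeasure \<nu> (space \<nu>) \<le> ennreal e"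
    if v: "v \<in> test_functions (- \<Gamma>)"
      and en: "\<And>j. j \<ge> j0 \<Longrightarrow> (\<integral>\<^sup>+y. indicator (D j \<inter> {y \<in> ball z (\<rho> + 1). infdist y \<Gamma> < L * r j}) y *
        ennreal (infdist y \<Gamma> powr \<delta> * (norm (gradient v y))\<^sup>2) \<partial>lborel) \<le> ennreal E"
      and low: "\<And>x. x \<in> \<Gamma> \<inter> ball z \<rho> \<Longrightarrow> ennreal m \<le>
        (\<integral>\<^sup>+h. indicator (ball 0 1) h * ennreal \<bar>v (P j0 x + (\<kappa> * r j0) *\<^sub>R h)\<bar> \<partial>lborel)"
    for v m
  proof -
    have v1: "Ck (Suc 0) v" using test_functions_Ck[OF v] .
    note [measurable] = gradient_measurable[OF v1] D
    obtain S where S: "compact S" "S \<subseteq> - \<Gamma>" "\<And>x. x \<notin> S \<Longrightarrow> v x = 0"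
      using test_functions_support[OF v] by blast
    have "S \<inter> \<Gamma> = {}" using S(2) by auto
    then obtain d where d: "d > 0" "\<forall>x\<in>S. \<forall>y\<in>\<Gamma>. d \<le> dist x y"
      using separate_compact_closed[OF S(1) \<Gamma>(1)] by blast
    have "(\<lambda>j. (L + \<kappa>) * r j) \<longlonglongrightarrow> (L + \<kappa>) * 0" by (intro tendsto_intros r0)
    then have "\<forall>\<^sub>F j in sequentially. (L + \<kappa>) * r j < d"
      using d by (intro order_tendstoD(2)) auto
    moreover have "\<forall>\<^sub>F j in sequentially. j \<ge> j0" by (rule eventually_ge_at_top)
    ultimately have "\<forall>\<^sub>F j in sequentially. (L + \<kappa>) * r j < d \<and> j \<ge> j0" by eventually_elim auto
    \<comment> \<open>The end \<open>J\<close> of the chain may depend on \<open>v\<close>: it is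
      taken so late that the last ball misses the support of \<open>v\<close>, and the telescoped
      difference is then \<open>v\<close> on the first ball alone. The final bound no longer
      contains \<open>J\<close>.\<close>
    then obtain J where J: "(L + \<kappa>) * r J < d" "J \<ge> j0" using eventually_happens by force
    define g where "g i y = indicator (D i) y * ennreal (norm (gradient v y))" for i y
    have [measurable]: "g i \<in> borel_measurable borel" for i unfolding g_def by measurable
    define F where "F i x = (\<integral>\<^sup>+y. indicator (ball x (L * r i)) y * g i y \<partial>lborel)" for i x
    have Fm: "F i \<in> borel_measurable \<nu>" for i
      unfolding F_def by (rule centre_integral_measurable[OF \<nu>(1)]) measurable
    define a where "a i = ennreal (M * r i powr (1 - real CARD('d)))" for i
    have 1: "ennreal m \<le> (\<Sum>i\<in>{j0..<J}. a i * F i x)" if x: "x \<in> \<Gamma> \<inter> ball z \<rho>" for x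
    proof -
      have z: "v (P J x + (\<kappa> * r J) *\<^sub>R h) = 0" if "norm h < 1" for h
      proof (rule S(3))
        have "dist (P J x + (\<kappa> * r J) *\<^sub>R h) x \<le> dist (P J x) x + norm ((\<kappa> * r J) *\<^sub>R h)"
          using norm_triangle_ineq[of "P J x - x" "(\<kappa> * r J) *\<^sub>R h"] by (simp add: dist_norm algebra_simps)
        also have "norm ((\<kappa> * r J) *\<^sub>R h) \<le> \<kappa> * r J"
          using that pos r[of J] by (simp add: mult_left_le)
        also have "dist (P J x) x + \<kappa> * r J \<le> (L + \<kappa>) * r J"
          using near[OF x, of J] J(2) j0(3) by (simp add: r_def algebra_simps)
        finally have "dist (P J x + (\<kappa> * r J) *\<^sub>R h) x < d" using J(1) by simp
        then show "P J x + (\<kappa> * r J) *\<^sub>R h \<notin> S" using d(2) x by force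
      qed
      have "ennreal m \<le> (\<integral>\<^sup>+h. indicator (ball 0 1) h * ennreal \<bar>v (P j0 x + (\<kappa> * r j0) *\<^sub>R h)\<bar> \<partial>lborel)"
        by (rule low[OF x])
      also have "\<dots> = (\<integral>\<^sup>+h. indicator (ball 0 1) h * ennreal \<bar>v (P j0 x + (\<kappa> * r j0) *\<^sub>R h) - v (P J x + (\<kappa> * r J) *\<^sub>R h)\<bar> \<partial>lborel)"
        by (intro nn_integral_cong) (auto simp: indicator_def z)
      also have "\<dots> \<le> (\<Sum>i\<in>{j0..<J}. \<integral>\<^sup>+h. indicator (ball 0 1) h *
          ennreal \<bar>v (P i x + (\<kappa> * r i) *\<^sub>R h) - v (P (Suc i) x + (\<kappa> * r (Suc i)) *\<^sub>R h)\<bar> \<partial>lborel)"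
        by (rule ball_difference_telescope[OF test_function_measurable[OF v] J(2)])
      also have "\<dots> \<le> (\<Sum>i\<in>{j0..<J}. a i * F i x)"
      proof (rule sum_mono)
        fix i assume i: "i \<in> {j0..<J}"
        have "indicator (D i \<inter> ball x (L * (1/2) ^ i)) y * ennreal (norm (gradient v y)) = indicator (ball x (L * r i)) y * g i y" for y
          by (auto simp: indicator_def g_def r_def)
        then show "(\<integral>\<^sup>+h. indicator (ball 0 1) h *
          ennreal \<bar>v (P i x + (\<kappa> * r i) *\<^sub>R h) - v (P (Suc i) x + (\<kappa> * r (Suc i)) *\<^sub>R h)\<bar> \<partial>lborel) \<le> a i * F i x"
          using chain[OF x _ v1, of i] i j0(3) unfolding a_def F_def r_def[symmetric] by simp
      qed
      finally show ?thesis .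
    qed
    have "ennreal m * emeasure \<nu> (space \<nu>) = (\<integral>\<^sup>+x. ennreal m \<partial>\<nu>)" by simp
    also have "\<dots> \<le> (\<integral>\<^sup>+x. (\<Sum>i\<in>{j0..<J}. a i * F i x) \<partial>\<nu>)"
    proof (rule nn_integral_mono_AE)
      show "AE x in \<nu>. ennreal m \<le> (\<Sum>i\<in>{j0..<J}. a i * F i x)"
        using \<nu>(3) by eventually_elim (rule 1)
    qed
    also have "\<dots> = (\<Sum>i\<in>{j0..<J}. a i * (\<integral>\<^sup>+x. F i x \<partial>\<nu>))"
      using Fm by (simp add: nn_integral_sum nn_integral_cmult)
    also have "\<dots> \<le> (\<Sum>i\<in>{j0..<J}. ennreal (K * q ^ i))"
    proof (rule sum_mono)
      fix i assume "i \<in> {j0..<J}"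
      then have i: "i \<ge> j0" by simp
      \<comment> \<open>The balancing parameter of \<open>weighted_gradient_bound\<close>, chosen so
        that its square is the order of the integral of the reciprocal weight at scale
        \<open>r i\<close>.\<close>
      define l where "l = r i powr ((real CARD('d) - s - \<delta>) / 2)"
      have l: "l > 0" "l\<^sup>2 = r i powr (real CARD('d) - s - \<delta>)"
        using r[of i] by (auto simp: l_def power2_eq_square powr_add[symmetric])
      define W where "W = D i \<inter> {y \<in> ball z (\<rho> + 1). infdist y \<Gamma> < L * r i}"
      have W: "W \<in> sets borel" unfolding W_def using D layer_borel by blast
      have "(\<integral>\<^sup>+x. F i x \<partial>\<nu>) \<le> ennreal (c * (2 * (L * r i)) powr s) *
          (\<integral>\<^sup>+y. indicator {y \<in> ball z (\<rho> + 1). infdist y \<Gamma> < L * r i} y * g i y \<partial>lborel)"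
        unfolding F_def using pos r[of i] rj[OF i]
        by (intro integral_over_centres[OF \<nu> up]) auto
      also have "(\<lambda>y. indicator {y \<in> ball z (\<rho> + 1). infdist y \<Gamma> < L * r i} y * g i y) = (\<lambda>y. indicator W y * ennreal (norm (gradient v y)))"
        by (rule ext) (auto simp: W_def g_def indicator_def)
      also have "(\<integral>\<^sup>+y. indicator W y * ennreal (norm (gradient v y)) \<partial>lborel) \<le> ennreal ((E + N) * l)"
      proof (rule weighted_gradient_bound[OF v \<Gamma> W l(1) _ pos(4)])
        show "(\<integral>\<^sup>+y. indicator W y * ennreal (infdist y \<Gamma> powr \<delta> * (norm (gradient v y))\<^sup>2) \<partial>lborel) \<le> ennreal E"
          unfolding W_def by (rule en[OF i])
        show "(\<integral>\<^sup>+y. indicator W y * ennreal (infdist y \<Gamma> powr (- \<delta>)) \<partial>lborel) \<le> ennreal (N * l\<^sup>2)"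
          unfolding W_def l(2) using weight[of i] i j0(3) by (simp add: r_def)
      qed (use pos in simp)
      finally have "(\<integral>\<^sup>+x. F i x \<partial>\<nu>) \<le> ennreal (c * (2 * (L * r i)) powr s) * ennreal ((E + N) * l)"
        by (simp add: mult_left_mono)
      then have "a i * (\<integral>\<^sup>+x. F i x \<partial>\<nu>) \<le> a i * (ennreal (c * (2 * (L * r i)) powr s) * ennreal ((E + N) * l))"
        by (rule mult_left_mono) simp
      also have "\<dots> = ennreal (M * r i powr (1 - real CARD('d)) * (c * (2 * (L * r i)) powr s * ((E + N) * l)))"
        using pos c l by (simp add: a_def ennreal_mult')
      also have "M * r i powr (1 - real CARD('d)) * (c * (2 * (L * r i)) powr s * ((E + N) * l)) =
          K * (r i powr (1 - real CARD('d)) * r i powr s * l)"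
        using pos r[of i] by (simp add: K_def powr_mult)
      also have "r i powr (1 - real CARD('d)) * r i powr s * l = r i powr (\<eta> / 2)"
        by (simp add: l_def powr_add[symmetric] \<eta>_def field_simps)
      also have "r i powr (\<eta> / 2) = q ^ i"
        by (simp add: r_def q_def powr_realpow[symmetric] powr_powr mult.commute)
      finally show "a i * (\<integral>\<^sup>+x. F i x \<partial>\<nu>) \<le> ennreal (K * q ^ i)" .
    qed
    also have "\<dots> = ennreal (K * (\<Sum>i\<in>{j0..<J}. q ^ i))"
      using K q by (simp add: sum_ennreal sum_distrib_left)
    also have "\<dots> \<le> ennreal (K * (q ^ j0 / (1 - q)))"
      by (intro ennreal_leI mult_left_mono geometric_tail_le q K)
    also have "\<dots> \<le> ennreal e" using j0(1) by (intro ennreal_leI) simp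
    finally show ?thesis .
  qed
  then show ?thesis using j0(3) unfolding r_def by blast
qed

section \<open>Chains of balls towards the boundary\<close>

text \<open>Between consecutive dyadic distances the weight is at most its value at the lower end,
  and the volume is at most that of the layer at the upper end. The resulting series is geometric
  with ratio 2^(\<delta> - (d - s)) < 1, where d is the dimension.\<close>

lemma weight_integral_dyadic:
  fixes \<Gamma> :: "(real^'d) set"
  assumes reg: "ahlfors_regular \<Gamma> s" and \<Gamma>: "closed \<Gamma>" "\<Gamma> \<noteq> {}"
    and \<delta>: "0 \<le> \<delta>" "\<delta> < real CARD('d) - s" and "T > 0"
  shows "\<exists>K\<ge>0. \<forall>t. 0 < t \<and> t \<le> T \<longrightarrow>
    (\<integral>\<^sup>+y. indicator {y \<in> ball z R. infdist y \<Gamma> < t} y * ennreal (infdist y \<Gamma> powr (- \<delta>)) \<partial>lborel)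
      \<le> ennreal (K * t powr (real CARD('d) - s - \<delta>))"
proof -
  obtain K where K: "K > 0" "\<And>t. 0 < t \<Longrightarrow> t \<le> T \<Longrightarrow>
    emeasure lborel {y \<in> ball z R. infdist y \<Gamma> < t} \<le> ennreal (K * t powr (real CARD('d) - s))"
    using boundary_layer_volume[OF reg \<Gamma>, of T z R] by blast
  define \<eta> where "\<eta> = real CARD('d) - s - \<delta>"
  define q where "q = (1/2 :: real) powr \<eta>"
  have q: "0 < q" "q < 1" using \<delta> powr_less_mono2[of \<eta> "1/2" 1] by (auto simp: q_def \<eta>_def)
  have "(\<integral>\<^sup>+y. indicator {y \<in> ball z R. infdist y \<Gamma> < t} y * ennreal (infdist y \<Gamma> powr (- \<delta>)) \<partial>lborel)
      \<le> ennreal ((2 powr \<delta> * K / (1 - q)) * t powr \<eta>)" if t: "0 < t" "t \<le> T" for t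
  proof -
    define r where "r k = t * (1/2) ^ k" for k :: nat
    have r: "0 < r k" "r k \<le> T" for k
    proof -
      have "r k \<le> t" using t mult_left_le[of "(1/2) ^ k" t] by (simp add: r_def power_le_one)
      then show "r k \<le> T" using t by linarith
      show "0 < r k" using t by (simp add: r_def)
    qed
    define S where "S k = {y \<in> ball z R. infdist y \<Gamma> < r k}" for k
    have [measurable]: "S k \<in> sets borel" for k unfolding S_def by (rule layer_borel)
    have le: "indicator {y \<in> ball z R. infdist y \<Gamma> < t} y * ennreal (infdist y \<Gamma> powr (- \<delta>)) \<le>
       (\<Sum>k. ennreal ((r (Suc k)) powr (- \<delta>)) * indicator (S k) y)" for y
    proof (cases "y \<in> ball z R \<and> infdist y \<Gamma> < t \<and> infdist y \<Gamma> > 0")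
      case True
      have "r \<longlonglongrightarrow> t * 0" unfolding r_def by (intro tendsto_intros LIMSEQ_power_zero) simp
      then have "\<forall>\<^sub>F k in sequentially. r k < infdist y \<Gamma>"
        using True by (intro order_tendstoD(2)[of _ "t * 0"]) auto
      then obtain k0 where k0: "r k0 < infdist y \<Gamma>" using eventually_happens by force
      \<comment> \<open>The first dyadic level not above the distance of \<open>y\<close>. It is not
        0 because the distance is below \<open>t\<close>, and its predecessor \<open>i\<close>
        indexes a layer \<open>S i\<close> containing \<open>y\<close> on which the term of the
        series dominates the weight.\<close>
      define k where "k = (LEAST k. r k \<le> infdist y \<Gamma>)"
      have k: "r k \<le> infdist y \<Gamma>" unfolding k_def by (rule LeastI[of _ k0]) (use k0 in simp)
      have "k \<noteq> 0" using k True by (auto simp: r_def intro: ccontr)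
      then obtain i where i: "k = Suc i" using not0_implies_Suc by blast
      have "\<not> r i \<le> infdist y \<Gamma>" using not_less_Least[of i "\<lambda>k. r k \<le> infdist y \<Gamma>"] i by (simp add: k_def)
      then have yi: "y \<in> S i" using True by (simp add: S_def)
      have "indicator {y \<in> ball z R. infdist y \<Gamma> < t} y * ennreal (infdist y \<Gamma> powr (- \<delta>)) = ennreal (infdist y \<Gamma> powr (- \<delta>))"
        using True by simp
      also have "\<dots> \<le> ennreal ((r (Suc i)) powr (- \<delta>))"
        using k i r[of "Suc i"] \<delta> by (intro ennreal_leI powr_mono2') auto
      also have "\<dots> = (\<Sum>k\<in>{i}. ennreal ((r (Suc k)) powr (- \<delta>)) * indicator (S k) y)" using yi by simp
      also have "\<dots> \<le> (\<Sum>k. ennreal ((r (Suc k)) powr (- \<delta>)) * indicator (S k) y)"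
        by (rule sum_le_suminf) auto
      finally show ?thesis .
    next
      \<comment> \<open>At distance zero the integrand is 0 by the convention
        \<open>0 powr x = 0\<close>; outside the layer the indicator vanishes.\<close>
      case False
      then have "indicator {y \<in> ball z R. infdist y \<Gamma> < t} y * ennreal (infdist y \<Gamma> powr (- \<delta>)) = 0"
        using infdist_nonneg[of y \<Gamma>] by (auto simp: indicator_def)
      then show ?thesis by (simp only: zero_le)
    qed
    have "(\<integral>\<^sup>+y. indicator {y \<in> ball z R. infdist y \<Gamma> < t} y * ennreal (infdist y \<Gamma> powr (- \<delta>)) \<partial>lborel)
       \<le> (\<integral>\<^sup>+y. (\<Sum>k. ennreal ((r (Suc k)) powr (- \<delta>)) * indicator (S k) y) \<partial>lborel)"
      by (rule nn_integral_mono) (rule le)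
    also have "\<dots> = (\<Sum>k. ennreal ((r (Suc k)) powr (- \<delta>)) * emeasure lborel (S k))"
      by (subst nn_integral_suminf) (auto simp: nn_integral_cmult_indicator)
    also have "\<dots> \<le> (\<Sum>k. ennreal ((2 powr \<delta> * K * t powr \<eta>) * q ^ k))"
    proof (rule suminf_le)
      fix k
      have "ennreal ((r (Suc k)) powr (- \<delta>)) * emeasure lborel (S k) \<le> ennreal ((r (Suc k)) powr (- \<delta>)) * ennreal (K * r k powr (real CARD('d) - s))"
        unfolding S_def by (intro mult_left_mono K r) auto
      also have "\<dots> = ennreal (r (Suc k) powr (- \<delta>) * (K * r k powr (real CARD('d) - s)))"
        by (simp add: ennreal_mult')
      also have "r (Suc k) powr (- \<delta>) * (K * r k powr (real CARD('d) - s)) = 2 powr \<delta> * K * (r k powr (- \<delta>) * r k powr (real CARD('d) - s))"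
      proof -
        have "r (Suc k) = (1/2) * r k" by (simp add: r_def)
        moreover have "(1/2 :: real) powr (- \<delta>) = 2 powr \<delta>" by (simp add: powr_divide powr_minus)
        ultimately have "r (Suc k) powr (- \<delta>) = 2 powr \<delta> * r k powr (- \<delta>)"
          using powr_mult[of "1/2" "r k" "- \<delta>"] r(1)[of k] by metis
        then show ?thesis by simp
      qed
      also have "r k powr (- \<delta>) * r k powr (real CARD('d) - s) = r k powr \<eta>"
        by (simp add: powr_add[symmetric] \<eta>_def)
      also have "r k powr \<eta> = t powr \<eta> * q ^ k"
        using t by (simp add: r_def powr_mult q_def powr_realpow[symmetric] powr_powr mult.commute)
      finally show "ennreal ((r (Suc k)) powr (- \<delta>)) * emeasure lborel (S k) \<le> ennreal ((2 powr \<delta> * K * t powr \<eta>) * q ^ k)"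
        by (simp add: mult.assoc)
    qed auto
    also have "\<dots> = ennreal ((2 powr \<delta> * K * t powr \<eta>) * (1 / (1 - q)))"
      using q K(1) by (intro suminf_ennreal_eq sums_mult geometric_sums) auto
    finally show ?thesis by (simp add: mult.commute mult.left_commute)
  qed
  then show ?thesis using K q unfolding \<eta>_def
    by (intro exI[of _ "2 powr \<delta> * K / (1 - q)"]) auto
qed

lemma emeasure_lborel_translate:
  fixes S :: "'a::euclidean_space set"
  assumes "S \<in> sets borel"
  shows "emeasure lborel {h. c + h \<in> S} = emeasure lborel S"
proof -
  have "emeasure lborel S = emeasure (distr lborel borel ((+) c)) S" by (simp add: lborel_distr_plus)
  also have "\<dots> = emeasure lborel ((+) c -` S)" using assms by (subst emeasure_distr) auto
  finally show ?thesis by (simp add: vimage_def)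
qed

text \<open>A set of codimension above one cannot separate. If a ball lay outside the closure, every
  parallel segment from a ball in the domain to it would cross the frontier. The parameters
  \<open>h\<close> of these segments fill a fixed volume, yet they are covered by about
  \<open>N\<close> translates of a layer of width of order 1/N, whose total volume is of order N^(1
  - (d - s)) and tends to 0.\<close>

lemma complement_of_thin_boundary:
  fixes \<Omega> :: "(real^'d) set"
  assumes \<Omega>: "is_domain \<Omega>" and ne: "frontier \<Omega> \<noteq> {}"
    and reg: "ahlfors_regular (frontier \<Omega>) s" and s: "s < real CARD('d) - 1"
  shows "\<Omega> \<union> frontier \<Omega> = UNIV"
proof (rule ccontr)
  assume "\<Omega> \<union> frontier \<Omega> \<noteq> UNIV"
  then obtain u where u: "u \<notin> closure \<Omega>"
    using closure_Un_frontier[of \<Omega>] by auto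
  obtain p where p: "p \<in> \<Omega>" using \<Omega> by (auto simp: is_domain_def)
  have "open \<Omega>" using \<Omega> by (simp add: is_domain_def)
  then obtain e1 where e1: "e1 > 0" "ball p e1 \<subseteq> \<Omega>" using p open_contains_ball by metis
  obtain e2 where e2: "e2 > 0" "ball u e2 \<subseteq> - closure \<Omega>"
    using u open_contains_ball[of "- closure \<Omega>"] by auto
  define b where "b = min e1 e2"
  define e where "e = u - p"
  define R where "R = norm e + b"
  have b: "b > 0" using e1 e2 by (simp add: b_def)
  obtain K where K: "K > 0" "\<And>t. 0 < t \<Longrightarrow> t \<le> 1 \<Longrightarrow>
    emeasure lborel {y \<in> ball p R. infdist y (frontier \<Omega>) < t} \<le> ennreal (K * t powr (real CARD('d) - s))"
    using boundary_layer_volume[OF reg frontier_closed ne, of 1 p R] by blast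
  have e0: "e \<noteq> 0" using p u closure_subset by (auto simp: e_def)
  define V where "V = measure lborel (ball (0 :: real^'d) b)"
  have V: "V > 0" using b by (simp add: V_def content_ball_pos)
  define a where "a = real CARD('d) - s - 1"
  have a: "a > 0" using s by (simp add: a_def)
  define Q where "Q = 2 * K * (2 * norm e) powr (real CARD('d) - s)"
  have bound: "V \<le> Q * (inverse (real N)) powr a" if N: "N > 0" "real N \<ge> 2 * norm e" for N :: nat
  proof -
    \<comment> \<open>Twice the spacing of the grid on the segment, so that after rounding a
      crossing point down to the grid the layer is still reached with strict inequality.\<close>
    define t where "t = 2 * norm e / real N"
    have t: "0 < t" "t \<le> 1" using N e0 by (auto simp: t_def)
    define S where "S = {y \<in> ball p R. infdist y (frontier \<Omega>) < t}"
    have S: "S \<in> sets borel" unfolding S_def by (rule layer_borel)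
    define c where "c k = p + (real k / real N) *\<^sub>R e" for k
    have sub: "ball 0 b \<subseteq> (\<Union>k\<in>{..N}. {h. c k + h \<in> S})"
    proof
      fix h :: "real^'d" assume "h \<in> ball 0 b"
      then have h: "norm h < b" by simp
      let ?seg = "closed_segment (p + h) (u + h)"
      have "p + h \<in> \<Omega>" using e1 h by (intro subsetD[OF e1(2)]) (auto simp: b_def dist_norm)
      moreover have "u + h \<notin> \<Omega>"
        using subsetD[OF e2(2), of "u + h"] h closure_subset[of \<Omega>] by (auto simp: b_def dist_norm)
      ultimately have "?seg \<inter> frontier \<Omega> \<noteq> {}"
        by (intro connected_Int_frontier) auto
      then obtain \<tau> where \<tau>: "0 \<le> \<tau>" "\<tau> \<le> 1" "(1 - \<tau>) *\<^sub>R (p + h) + \<tau> *\<^sub>R (u + h) \<in> frontier \<Omega>"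
        by (auto simp: in_segment)
      have "(1 - \<tau>) *\<^sub>R (p + h) + \<tau> *\<^sub>R (u + h) = p + \<tau> *\<^sub>R e + h"
        by (simp add: e_def algebra_simps)
      with \<tau>(3) have g: "p + \<tau> *\<^sub>R e + h \<in> frontier \<Omega>" by simp
      define k where "k = nat \<lfloor>\<tau> * real N\<rfloor>"
      have k: "real k \<le> \<tau> * real N" "\<tau> * real N < real k + 1"
        using \<tau> by (auto simp: k_def)
      have "\<tau> * real N \<le> 1 * real N" using \<tau> by (intro mult_right_mono) auto
      then have "real k \<le> real N" using k(1) by linarith
      moreover have "\<tau> < (real k + 1) / real N" "real k / real N \<le> \<tau>"
        using k N by (simp_all add: pos_less_divide_eq pos_divide_le_eq)
      ultimately have kN: "real k / real N \<le> 1" "\<tau> - real k / real N \<le> 1 / real N" "0 \<le> \<tau> - real k / real N"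
        using N by (simp_all add: add_divide_distrib)
      have "dist (c k + h) (p + \<tau> *\<^sub>R e + h) = (\<tau> - real k / real N) * norm e"
      proof -
        have "c k + h - (p + \<tau> *\<^sub>R e + h) = - ((\<tau> - real k / real N) *\<^sub>R e)"
          by (simp add: c_def algebra_simps)
        then show ?thesis using kN(3) by (simp add: dist_norm)
      qed
      also have "\<dots> \<le> 1 / real N * norm e" using kN by (intro mult_right_mono) auto
      also have "\<dots> < t" using e0 N by (simp add: t_def divide_strict_right_mono)
      finally have "infdist (c k + h) (frontier \<Omega>) < t"
        using infdist_le[OF g, of "c k + h"] by simp
      moreover have "c k + h \<in> ball p R"
      proof -
        have "p - (c k + h) = - ((real k / real N) *\<^sub>R e + h)" by (simp add: c_def)
        then have "dist p (c k + h) = norm ((real k / real N) *\<^sub>R e + h)"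
          unfolding dist_norm by (metis norm_minus_cancel)
        also have "\<dots> \<le> (real k / real N) * norm e + norm h"
          using norm_triangle_ineq[of "(real k / real N) *\<^sub>R e" h] by simp
        also have "\<dots> < 1 * norm e + b"
          using kN h by (intro add_le_less_mono mult_right_mono) auto
        finally show ?thesis by (simp add: R_def)
      qed
      moreover have "k \<le> N"
        using kN(1) N by simp
      ultimately show "h \<in> (\<Union>k\<in>{..N}. {h. c k + h \<in> S})" by (auto simp: S_def)
    qed
    have mS: "{h. c k + h \<in> S} \<in> sets lborel" for k
      using S by measurable
    have "ennreal V = emeasure lborel (ball (0 :: real^'d) b)"
      unfolding V_def using emeasure_lborel_ball_finite[of "0 :: real^'d" b]
      by (intro emeasure_eq_ennreal_measure[symmetric]) auto
    also have "\<dots> \<le> emeasure lborel (\<Union>k\<in>{..N}. {h. c k + h \<in> S})"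
      using mS by (intro emeasure_mono sub) auto
    also have "\<dots> \<le> (\<Sum>k\<in>{..N}. emeasure lborel {h. c k + h \<in> S})"
      using mS by (intro emeasure_subadditive_finite) auto
    also have "\<dots> = (\<Sum>k\<in>{..N}. emeasure lborel S)"
      by (intro sum.cong refl emeasure_lborel_translate S)
    also have "\<dots> \<le> (\<Sum>k\<in>{..N}. ennreal (K * t powr (real CARD('d) - s)))"
      unfolding S_def by (intro sum_mono K t)
    also have "\<dots> = ennreal (\<Sum>k\<in>{..N}. K * t powr (real CARD('d) - s))"
      using K by (intro sum_ennreal) auto
    finally have "V \<le> (\<Sum>k\<in>{..N}. K * t powr (real CARD('d) - s))"
      using K by (subst (asm) ennreal_le_iff) (auto intro!: sum_nonneg)
    also have "\<dots> = (real N + 1) * (K * t powr (real CARD('d) - s))" by simp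
    also have "\<dots> \<le> (2 * real N) * (K * t powr (real CARD('d) - s))"
      using N K by (intro mult_right_mono) auto
    also have "t = (2 * norm e) * inverse (real N)" by (simp add: t_def divide_inverse)
    also have "(2 * real N) * (K * ((2 * norm e) * inverse (real N)) powr (real CARD('d) - s)) = Q * (real N * inverse (real N) powr (real CARD('d) - s))"
      by (simp add: powr_mult Q_def)
    also have "real N * inverse (real N) powr (real CARD('d) - s) = inverse (real N) powr a"
      unfolding a_def powr_diff using N by (simp add: divide_inverse)
    finally show ?thesis .
  qed
  have "(\<lambda>N. Q * inverse (real N) powr a) \<longlonglongrightarrow> Q * 0"
    using a by (intro tendsto_mult tendsto_const tendsto_zero_powrI[where b=a] lim_inverse_n) auto
  moreover have "\<forall>\<^sub>F N in sequentially. V \<le> Q * inverse (real N) powr a"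
  proof -
    obtain N0 :: nat where N0: "2 * norm e \<le> real N0" using real_arch_simple by blast
    have "\<forall>\<^sub>F N in sequentially. N \<ge> max 1 N0" by (rule eventually_ge_at_top)
    then show ?thesis
    proof eventually_elim
      case (elim N)
      then show ?case using N0 by (intro bound) auto
    qed
  qed
  ultimately have "V \<le> Q * 0"
    by (intro tendsto_le[OF sequentially_bot _ tendsto_const]) auto
  then show False using V by simp
qed

text \<open>The ball about \<open>w\<close> with radius the distance to the frontier is connected,
  meets \<open>\<Omega>\<close> and misses the frontier, so it cannot leave
  \<open>\<Omega>\<close>.\<close>

lemma inside_of_ball:
  fixes \<Omega> :: "'a::real_normed_vector set"
  assumes "w \<in> \<Omega>" "dist w y < infdist w (frontier \<Omega>)"
  shows "y \<in> \<Omega>"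
proof (rule ccontr)
  assume "y \<notin> \<Omega>"
  have c: "connected (ball w (infdist w (frontier \<Omega>)))"
    by (rule convex_connected[OF convex_ball])
  have "infdist w (frontier \<Omega>) > 0" using assms(2) zero_le_dist[of w y] by linarith
  then have "ball w (infdist w (frontier \<Omega>)) \<inter> \<Omega> \<noteq> {}"
    using assms(1) centre_in_ball by blast
  moreover have "ball w (infdist w (frontier \<Omega>)) - \<Omega> \<noteq> {}" using \<open>y \<notin> \<Omega>\<close> assms(2) by auto
  ultimately have "ball w (infdist w (frontier \<Omega>)) \<inter> frontier \<Omega> \<noteq> {}"
    using connected_Int_frontier[OF c] by blast
  then obtain x where "x \<in> frontier \<Omega>" "dist w x < infdist w (frontier \<Omega>)" by auto
  then show False using infdist_le[of x "frontier \<Omega>" w] by simp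
qed

section \<open>Consequences of the uniformity condition: interior points at every scale and tubes of
  balls along curves\<close>

definition uniform_with :: "(real^'d) set \<Rightarrow> (real^'d) set \<Rightarrow> real \<Rightarrow> bool" where
  "uniform_with \<Omega> V \<sigma> \<longleftrightarrow> \<sigma> \<ge> 1 \<and>
     (\<forall>x\<in>V. \<forall>y\<in>V. \<exists>\<gamma>. path \<gamma> \<and> path_image \<gamma> \<subseteq> \<Omega> \<and> pathstart \<gamma> = x \<and> pathfinish \<gamma> = y \<and>
        curve_length \<gamma> \<le> ennreal (\<sigma> * dist x y) \<and>
        (\<forall>w\<in>path_image \<gamma>. infdist w (frontier \<Omega>) \<ge> inverse \<sigma> * min (dist x w) (dist w y)))"

lemma uniform_in_imp: "uniform_in \<Omega> V \<Longrightarrow> \<exists>\<sigma>. uniform_with \<Omega> V \<sigma>"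
  unfolding uniform_in_def uniform_with_def rectifiable_curve_def by blast

lemma curve_length_grid:
  assumes "N > 0"
  shows "ennreal (\<Sum>i<N. dist (\<gamma> (real i / real N)) (\<gamma> (real (Suc i) / real N))) \<le> curve_length \<gamma>"
proof -
  define ts where "ts = map (\<lambda>i. real i / real N) [0..<Suc N]"
  have len: "length ts - 1 = N" by (simp add: ts_def)
  have nth: "ts ! i = real i / real N" if "i \<le> N" for i
    using that unfolding ts_def by (subst nth_map) (auto simp: nth_append less_Suc_eq_le simp del: upt_Suc)
  have "sorted ts"
    unfolding ts_def sorted_map by (rule sorted_wrt_mono_rel[of _ "(\<le>)"]) (use assms in \<open>auto simp: divide_right_mono simp del: upt_Suc\<close>)
  moreover have "set ts \<subseteq> {0..1}" using assms by (auto simp: ts_def simp del: upt_Suc)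
  ultimately have ts: "ts \<in> {ts. sorted ts \<and> set ts \<subseteq> {0..1}}" by simp
  have "(\<Sum>i<N. dist (\<gamma> (real i / real N)) (\<gamma> (real (Suc i) / real N))) = (\<Sum>i<length ts - 1. dist (\<gamma> (ts ! i)) (\<gamma> (ts ! Suc i)))"
    unfolding len by (rule sum.cong) (auto simp: nth)
  then show ?thesis unfolding curve_length_def using ts by (simp add: SUP_upper2)
qed

lemma curve_length_dist:
  assumes "0 \<le> \<tau>" "\<tau> \<le> 1"
  shows "ennreal (dist (\<gamma> 0) (\<gamma> \<tau>)) \<le> curve_length \<gamma>"
proof -
  have "[0, \<tau>] \<in> {ts. sorted ts \<and> set ts \<subseteq> {0..1}}" using assms by auto
  then have "ennreal (\<Sum>i<length [0, \<tau>] - 1. dist (\<gamma> ([0, \<tau>] ! i)) (\<gamma> ([0, \<tau>] ! Suc i))) \<le> curve_length \<gamma>"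
    unfolding curve_length_def by (rule SUP_upper)
  then show ?thesis by simp
qed

text \<open>The curve from a point near \<open>x\<close> to the fixed interior point
  \<open>y\<close> must at some time be at distance exactly \<open>t\<close> from its start, and
  there both distances in the uniformity condition are at least \<open>t\<close>.\<close>

lemma uniform_corkscrew:
  fixes \<Omega> :: "(real^'d) set"
  assumes u: "uniform_with \<Omega> (\<Omega> \<inter> ball z R) \<sigma>" and x: "x \<in> frontier \<Omega>" "dist z x < R / 2"
    and y: "y \<in> \<Omega> \<inter> ball z R" and t: "0 < t" "4 * t \<le> infdist y (frontier \<Omega>)" "8 * t \<le> R"
  shows "\<exists>w\<in>\<Omega> \<inter> ball z R. dist w x \<le> 2 * t \<and> t / \<sigma> \<le> infdist w (frontier \<Omega>)"
proof -
  have \<sigma>: "\<sigma> \<ge> 1" using u by (simp add: uniform_with_def)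
  have "x \<in> closure \<Omega>" using x(1) by (simp add: frontier_def)
  then obtain x' where x': "x' \<in> \<Omega>" "dist x' x < t"
    using closure_approachable t(1) by metis
  have xR: "x' \<in> \<Omega> \<inter> ball z R"
    using x' x(2) t dist_triangle[of z x' x] by (simp add: dist_commute)
  obtain \<gamma> where \<gamma>: "path \<gamma>" "path_image \<gamma> \<subseteq> \<Omega>" "pathstart \<gamma> = x'" "pathfinish \<gamma> = y"
    "\<And>w. w \<in> path_image \<gamma> \<Longrightarrow> infdist w (frontier \<Omega>) \<ge> inverse \<sigma> * min (dist x' w) (dist w y)"
    using u xR y unfolding uniform_with_def by metis
  \<comment> \<open>The reserve of 4t makes the curve end more than 3t away from its start, so it
    crosses the sphere of radius \<open>t\<close> and is then still at least \<open>t\<close> away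
    from its end.\<close>
  have xy: "4 * t \<le> dist y x" using infdist_le[OF x(1), of y] t(2) by linarith
  have x'y: "3 * t < dist x' y" using xy x'(2) dist_triangle[of y x x'] by (simp add: dist_commute)
  have "connected (dist x' ` path_image \<gamma>)"
    using \<gamma>(1) by (intro connected_continuous_image continuous_intros connected_path_image)
  moreover have "0 \<in> dist x' ` path_image \<gamma>"
    using \<gamma>(3) pathstart_in_path_image[of \<gamma>] by (force intro!: image_eqI[of _ _ x'])
  moreover have "dist x' y \<in> dist x' ` path_image \<gamma>"
    using \<gamma>(4) pathfinish_in_path_image[of \<gamma>] by (intro imageI) auto
  ultimately have "t \<in> dist x' ` path_image \<gamma>"
    using connected_contains_Icc[of "dist x' ` path_image \<gamma>" 0 "dist x' y"] t(1) x'y by auto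
  then obtain w where w: "w \<in> path_image \<gamma>" "dist x' w = t" by auto
  have "t \<le> dist w y" using x'y w(2) dist_triangle[of x' y w] t(1) by linarith
  then have "inverse \<sigma> * t \<le> infdist w (frontier \<Omega>)" using \<gamma>(5)[OF w(1)] w(2) by (simp add: min_def)
  then have 1: "t / \<sigma> \<le> infdist w (frontier \<Omega>)" by (simp add: divide_inverse mult.commute)
  have 2: "dist w x \<le> 2 * t" using w(2) x'(2) dist_triangle[of w x x'] by (simp add: dist_commute)
  have "dist z w < R" using 2 x(2) t dist_triangle[of z w x] by (simp add: dist_commute)
  then show ?thesis using 1 2 w(1) \<gamma>(2) by auto
qed

lemma dist_add_add: "dist p (p + u + w) = norm (u + w)" for p u w :: "'a::real_normed_vector"
proof -
  have "p - (p + u + w) = - (u + w)" by simp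
  then show ?thesis unfolding dist_norm by (metis norm_minus_cancel)
qed

text \<open>A ball of radius \<open>\<kappa> * t\<close> is moved along the uniform curve and then
  halved in place. The number of links depends on the curve and is not controlled, but each link
  costs its own length divided by a fixed power of the radius, so the sum sees only the length of
  the curve, which is at most \<open>4 * \<sigma> * t\<close>.\<close>

lemma uniform_chain_step:
  fixes \<Omega> :: "(real^'d) set" and v :: "real^'d \<Rightarrow> real" and \<sigma> :: real
  assumes u: "uniform_with \<Omega> V \<sigma>" and op: "open \<Omega>" and w: "w1 \<in> V" "w2 \<in> V" and t: "t > 0"
    and wx: "dist w1 x \<le> 2 * t" "dist w2 x \<le> 2 * t"
    and wd: "t / \<sigma> \<le> infdist w1 (frontier \<Omega>)" "t / (2 * \<sigma>) \<le> infdist w2 (frontier \<Omega>)"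
    and v: "Ck (Suc 0) v" and \<kappa>: "\<kappa> = 1 / (16 * \<sigma>\<^sup>2)"
  shows "(\<integral>\<^sup>+h. indicator (ball 0 1) h * ennreal \<bar>v (w1 + (\<kappa> * t) *\<^sub>R h) - v (w2 + (\<kappa> * (t / 2)) *\<^sub>R h)\<bar> \<partial>lborel)
    \<le> ennreal ((4 * \<sigma> / \<kappa> ^ CARD('d) + (\<kappa> / 2) / (\<kappa> / 2) ^ CARD('d)) * t powr (1 - real CARD('d))) *
       (\<integral>\<^sup>+y. indicator ({y \<in> \<Omega>. \<kappa> * t \<le> infdist y (frontier \<Omega>)} \<inter> ball x ((4 * \<sigma> + 3) * t)) y * ennreal (norm (gradient v y)) \<partial>lborel)"
proof -
  have \<sigma>: "\<sigma> \<ge> 1" using u by (simp add: uniform_with_def)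
  have \<sigma>2: "\<sigma> \<le> \<sigma>\<^sup>2" using \<sigma> by (simp add: power2_eq_square)
  \<comment> \<open>A lower bound for the distance of the whole curve to the boundary. At distance
    at least t/(4\<sigma>) from both ends it is the uniformity condition; nearer to an end it is
    inherited from that end, whose own distance is at least t/(2\<sigma>). The radius
    \<open>\<kappa> * t\<close> equals b/4.\<close>
  define b where "b = t / (4 * \<sigma>\<^sup>2)"
  have b: "b > 0" "b \<le> t / (4 * \<sigma>)" "b \<le> t / 4"
  proof -
    show "b > 0" using \<sigma> t by (auto simp: b_def)
    show "b \<le> t / (4 * \<sigma>)" unfolding b_def using \<sigma> \<sigma>2 t by (intro divide_left_mono) auto
    also have "\<dots> \<le> t / 4" using \<sigma> t by (intro divide_left_mono) auto
    finally show "b \<le> t / 4" .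
  qed
  have kb: "\<kappa> * t = b / 4" using \<sigma> by (simp add: \<kappa> b_def)
  have k0: "\<kappa> > 0" using \<sigma> by (simp add: \<kappa>)
  define D where "D = {y \<in> \<Omega>. \<kappa> * t \<le> infdist y (frontier \<Omega>)} \<inter> ball x ((4 * \<sigma> + 3) * t)"
  have D: "D \<in> sets borel"
  proof -
    have "closed {y. \<kappa> * t \<le> infdist y (frontier \<Omega>)}" by (intro closed_Collect_le continuous_intros)
    then have "\<Omega> \<inter> {y. \<kappa> * t \<le> infdist y (frontier \<Omega>)} \<inter> ball x ((4 * \<sigma> + 3) * t) \<in> sets borel"
      using op by (intro sets.Int) auto
    also have "\<Omega> \<inter> {y. \<kappa> * t \<le> infdist y (frontier \<Omega>)} \<inter> ball x ((4 * \<sigma> + 3) * t) = D" by (auto simp: D_def)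
    finally show ?thesis .
  qed
  define G where "G = (\<integral>\<^sup>+y. indicator D y * ennreal (norm (gradient v y)) \<partial>lborel)"
  obtain \<gamma> where \<gamma>: "path \<gamma>" "path_image \<gamma> \<subseteq> \<Omega>" "pathstart \<gamma> = w1" "pathfinish \<gamma> = w2"
    "curve_length \<gamma> \<le> ennreal (\<sigma> * dist w1 w2)"
    "\<And>w. w \<in> path_image \<gamma> \<Longrightarrow> infdist w (frontier \<Omega>) \<ge> inverse \<sigma> * min (dist w1 w) (dist w w2)"
    using u w unfolding uniform_with_def by metis
  have "dist w1 w2 \<le> 4 * t" using wx dist_triangle[of w1 w2 x] by (simp add: dist_commute)
  then have "\<sigma> * dist w1 w2 \<le> \<sigma> * (4 * t)" using \<sigma> by (intro mult_left_mono) auto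
  then have "ennreal (\<sigma> * dist w1 w2) \<le> ennreal (4 * \<sigma> * t)"
    by (intro ennreal_leI) (simp add: mult.assoc mult.left_commute)
  with \<gamma>(5) have len: "curve_length \<gamma> \<le> ennreal (4 * \<sigma> * t)"
    by (rule order_trans)
  have far: "b \<le> infdist w (frontier \<Omega>)" if w: "w \<in> path_image \<gamma>" for w
  proof (cases "t / (4 * \<sigma>) \<le> min (dist w1 w) (dist w w2)")
    case True
    have "b = inverse \<sigma> * (t / (4 * \<sigma>))" using \<sigma> by (simp add: b_def power2_eq_square field_simps)
    also have "\<dots> \<le> inverse \<sigma> * min (dist w1 w) (dist w w2)"
      using True \<sigma> by (intro mult_left_mono) auto
    finally show ?thesis using \<gamma>(6)[OF w] by linarith
  next
    case False
    have h: "t / (2 * \<sigma>) - t / (4 * \<sigma>) = t / (4 * \<sigma>)" "t / \<sigma> \<ge> t / (2 * \<sigma>)" using \<sigma> t by (auto simp: field_simps)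
    from False consider "dist w1 w < t / (4 * \<sigma>)" | "dist w w2 < t / (4 * \<sigma>)" by linarith
    then have "t / (4 * \<sigma>) \<le> infdist w (frontier \<Omega>)"
    proof cases
      case 1
      then show ?thesis using infdist_triangle[of w1 "frontier \<Omega>" w] wd(1) h by linarith
    next
      case 2
      then show ?thesis using infdist_triangle[of w2 "frontier \<Omega>" w] wd(2) h by (simp add: dist_commute)
    qed
    then show ?thesis using b(2) by linarith
  qed
  have close: "dist w x \<le> (4 * \<sigma> + 2) * t" if w: "w \<in> path_image \<gamma>" for w
  proof -
    obtain \<tau> where \<tau>: "0 \<le> \<tau>" "\<tau> \<le> 1" "w = \<gamma> \<tau>" using w by (auto simp: path_image_def)
    have "ennreal (dist w1 w) \<le> ennreal (4 * \<sigma> * t)"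
      using curve_length_dist[OF \<tau>(1,2), of \<gamma>] \<gamma>(3) \<tau>(3) len unfolding pathstart_def by auto
    then have "dist w1 w \<le> 4 * \<sigma> * t" using \<sigma> t by (subst (asm) ennreal_le_iff) auto
    then show ?thesis using wx(1) dist_triangle[of w x w1] by (simp add: dist_commute algebra_simps)
  qed
  \<comment> \<open>A step below b/4 and a radius of at most b/4 stay within b/2 of the curve. This
    leaves distance at least b/2 to the boundary, more than the \<open>\<kappa> * t\<close> demanded
    in \<open>D\<close>.\<close>
  have inD: "y \<in> D" if w: "w \<in> path_image \<gamma>" and y: "dist w y \<le> b / 2" for w y
  proof -
    have "w \<in> \<Omega>" using \<gamma>(2) w by blast
    moreover have "dist w y < infdist w (frontier \<Omega>)" using y far[OF w] b(1) by linarith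
    ultimately have "y \<in> \<Omega>" by (rule inside_of_ball)
    moreover have "\<kappa> * t \<le> infdist y (frontier \<Omega>)"
      using infdist_triangle[of w "frontier \<Omega>" y] far[OF w] y b(1) kb by (simp add: dist_commute)
    moreover have "dist x y < (4 * \<sigma> + 3) * t"
    proof -
      have "dist x y \<le> (4 * \<sigma> + 2) * t + b / 2"
        using dist_triangle[of x y w] close[OF w] y by (simp add: dist_commute)
      also have "\<dots> < (4 * \<sigma> + 3) * t" using b t by (simp add: algebra_simps)
      finally show ?thesis .
    qed
    ultimately show ?thesis by (simp add: D_def)
  qed
  have "uniformly_continuous_on {0..1} \<gamma>"
    using \<gamma>(1) unfolding path_def by (intro compact_uniformly_continuous) auto
  then obtain d where d: "d > 0" "\<And>a a'. a \<in> {0..1} \<Longrightarrow> a' \<in> {0..1} \<Longrightarrow> dist a' a < d \<Longrightarrow> dist (\<gamma> a') (\<gamma> a) < b / 4"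
    unfolding uniformly_continuous_on_def using b(1) by (metis divide_pos_pos zero_less_numeral)
  obtain n where n: "inverse (real (Suc n)) < d" using reals_Archimedean[OF d(1)] by blast
  define N where "N = Suc n"
  have N: "N > 0" "1 / real N < d" using n by (auto simp: N_def inverse_eq_divide)
  have pt: "\<gamma> (real i / real N) \<in> path_image \<gamma>" if "i \<le> N" for i
    using that N by (auto simp: path_image_def)
  have step: "dist (\<gamma> (real i / real N)) (\<gamma> (real (Suc i) / real N)) < b / 4" if "i < N" for i
  proof (rule d(2))
    show "real (Suc i) / real N \<in> {0..1}" "real i / real N \<in> {0..1}" using that N by auto
    have "dist (real i / real N) (real (Suc i) / real N) = 1 / real N"
      by (simp add: dist_real_def diff_divide_distrib[symmetric])
    then show "dist (real i / real N) (real (Suc i) / real N) < d" using N by simp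
  qed
  \<comment> \<open>Index \<open>Suc N\<close> repeats the end point \<open>w2\<close>, now with
    half the radius: the last link changes only the radius.\<close>
  define P where "P i = (if i \<le> N then \<gamma> (real i / real N) else w2)" for i
  define \<rho> where "\<rho> i = (if i \<le> N then \<kappa> * t else \<kappa> * (t / 2))" for i
  have vm: "v \<in> borel_measurable borel"
    using borel_measurable_continuous_onI[OF Ck_continuous[OF v]] .
  have P0: "P 0 = w1" "P (Suc N) = w2" "P N = w2" "\<rho> 0 = \<kappa> * t" "\<rho> (Suc N) = \<kappa> * (t / 2)" "\<rho> N = \<kappa> * t"
    using \<gamma>(3,4) N by (auto simp: P_def \<rho>_def pathstart_def pathfinish_def)
  let ?F = "\<lambda>i. \<integral>\<^sup>+h. indicator (ball 0 1) h * ennreal \<bar>v (P i + \<rho> i *\<^sub>R h) - v (P (Suc i) + \<rho> (Suc i) *\<^sub>R h)\<bar> \<partial>lborel"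
  have F1: "?F i \<le> ennreal (dist (\<gamma> (real i / real N)) (\<gamma> (real (Suc i) / real N)) / (\<kappa> * t) ^ CARD('d)) * G" if i: "i < N" for i
  proof -
    let ?p = "\<gamma> (real i / real N)" and ?q = "\<gamma> (real (Suc i) / real N)"
    have "(\<integral>\<^sup>+h. indicator (ball 0 1) h * ennreal \<bar>v (?p + (\<kappa> * t) *\<^sub>R h) - v (?q + (\<kappa> * t) *\<^sub>R h)\<bar> \<partial>lborel)
      \<le> ennreal ((dist ?p ?q + \<bar>\<kappa> * t - \<kappa> * t\<bar>) / (\<kappa> * t) ^ CARD('d)) * G"
      unfolding G_def
    proof (rule segment_estimate[OF v _ _ _ D])
      fix \<tau> :: real and h :: "real^'d" assume \<tau>: "0 \<le> \<tau>" "\<tau> \<le> 1" "norm h < 1"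
      show "?p + \<tau> *\<^sub>R (?q - ?p) + (\<kappa> * t + \<tau> * (\<kappa> * t - \<kappa> * t)) *\<^sub>R h \<in> D"
      proof (rule inD[OF pt])
        have "dist ?p (?p + \<tau> *\<^sub>R (?q - ?p) + (\<kappa> * t + \<tau> * (\<kappa> * t - \<kappa> * t)) *\<^sub>R h) = norm (\<tau> *\<^sub>R (?q - ?p) + (\<kappa> * t) *\<^sub>R h)"
          by (simp only: dist_add_add diff_self mult_zero_right add_0_right)
        also have "\<dots> \<le> \<tau> * dist ?p ?q + (\<kappa> * t) * norm h"
          using norm_triangle_ineq[of "\<tau> *\<^sub>R (?q - ?p)" "(\<kappa> * t) *\<^sub>R h"] \<tau> k0 t
          by (simp add: dist_norm norm_minus_commute abs_mult)
        also have "\<dots> \<le> 1 * (b / 4) + (b / 4) * 1"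
          using \<tau> step[OF i] b kb by (intro add_mono mult_mono) auto
        finally show "dist ?p (?p + \<tau> *\<^sub>R (?q - ?p) + (\<kappa> * t + \<tau> * (\<kappa> * t - \<kappa> * t)) *\<^sub>R h) \<le> b / 2" by simp
      qed (use i in simp)
    qed (use k0 t in auto)
    then show ?thesis using i by (simp add: P_def \<rho>_def)
  qed
  have F2: "?F N \<le> ennreal ((\<kappa> * (t / 2)) / (\<kappa> * (t / 2)) ^ CARD('d)) * G"
  proof -
    have "(\<integral>\<^sup>+h. indicator (ball 0 1) h * ennreal \<bar>v (w2 + (\<kappa> * t) *\<^sub>R h) - v (w2 + (\<kappa> * (t / 2)) *\<^sub>R h)\<bar> \<partial>lborel)
      \<le> ennreal ((dist w2 w2 + \<bar>\<kappa> * t - \<kappa> * (t / 2)\<bar>) / (\<kappa> * (t / 2)) ^ CARD('d)) * G"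
      unfolding G_def
    proof (rule segment_estimate[OF v _ _ _ D])
      fix \<tau> :: real and h :: "real^'d" assume \<tau>: "0 \<le> \<tau>" "\<tau> \<le> 1" "norm h < 1"
      have l: "\<bar>\<kappa> * t + \<tau> * (\<kappa> * (t / 2) - \<kappa> * t)\<bar> \<le> b / 4"
      proof -
        have eq: "\<kappa> * t + \<tau> * (\<kappa> * (t / 2) - \<kappa> * t) = (b / 4) * (1 - \<tau> / 2)"
          using kb by (simp add: algebra_simps)
        have le: "(b / 4) * (1 - \<tau> / 2) \<le> (b / 4) * 1" using \<tau> b by (intro mult_left_mono) auto
        have nn: "0 \<le> (b / 4) * (1 - \<tau> / 2)" using \<tau> b by (intro mult_nonneg_nonneg) auto
        show ?thesis unfolding eq abs_of_nonneg[OF nn] using le by simp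
      qed
      have "w2 \<in> path_image \<gamma>" using \<gamma>(4) pathfinish_in_path_image by blast
      then show "w2 + \<tau> *\<^sub>R (w2 - w2) + (\<kappa> * t + \<tau> * (\<kappa> * (t / 2) - \<kappa> * t)) *\<^sub>R h \<in> D"
      proof (rule inD)
        have "dist w2 (w2 + \<tau> *\<^sub>R (w2 - w2) + (\<kappa> * t + \<tau> * (\<kappa> * (t / 2) - \<kappa> * t)) *\<^sub>R h) = \<bar>\<kappa> * t + \<tau> * (\<kappa> * (t / 2) - \<kappa> * t)\<bar> * norm h"
          by (simp add: dist_norm)
        also have "\<dots> \<le> (b / 4) * 1" using l \<tau> b by (intro mult_mono) auto
        finally show "dist w2 (w2 + \<tau> *\<^sub>R (w2 - w2) + (\<kappa> * t + \<tau> * (\<kappa> * (t / 2) - \<kappa> * t)) *\<^sub>R h) \<le> b / 2" using b by simp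
      qed
    qed (use k0 t in auto)
    moreover have "\<bar>\<kappa> * t - \<kappa> * (t / 2)\<bar> = \<kappa> * (t / 2)" using k0 t by simp
    ultimately show ?thesis unfolding P0 by (simp only: dist_self add_0_left)
  qed
  let ?c = "(\<kappa> * t) ^ CARD('d)"
  have c: "?c > 0" using k0 t by simp
  have "(\<integral>\<^sup>+h. indicator (ball 0 1) h * ennreal \<bar>v (w1 + (\<kappa> * t) *\<^sub>R h) - v (w2 + (\<kappa> * (t / 2)) *\<^sub>R h)\<bar> \<partial>lborel) \<le> (\<Sum>i\<in>{0..<Suc N}. ?F i)"
    using ball_difference_telescope[OF vm, of 0 "Suc N" P \<rho>] unfolding P0 by simp
  also have "\<dots> = (\<Sum>i<N. ?F i) + ?F N" by (simp add: lessThan_atLeast0)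
  also have "\<dots> \<le> (\<Sum>i<N. ennreal (dist (\<gamma> (real i / real N)) (\<gamma> (real (Suc i) / real N)) / ?c) * G) + ennreal ((\<kappa> * (t / 2)) / (\<kappa> * (t / 2)) ^ CARD('d)) * G"
    by (intro add_mono sum_mono F1 F2) auto
  also have "(\<Sum>i<N. ennreal (dist (\<gamma> (real i / real N)) (\<gamma> (real (Suc i) / real N)) / ?c) * G) =
      ennreal ((\<Sum>i<N. dist (\<gamma> (real i / real N)) (\<gamma> (real (Suc i) / real N))) / ?c) * G"
    using c by (subst sum_distrib_right[symmetric], subst sum_ennreal) (auto simp: sum_divide_distrib)
  also have "\<dots> \<le> ennreal (4 * \<sigma> * t / ?c) * G"
  proof (intro mult_right_mono ennreal_leI divide_right_mono)
    have "ennreal (\<Sum>i<N. dist (\<gamma> (real i / real N)) (\<gamma> (real (Suc i) / real N))) \<le> ennreal (4 * \<sigma> * t)"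
      using curve_length_grid[OF N(1), of \<gamma>] len by (rule order_trans)
    then show "(\<Sum>i<N. dist (\<gamma> (real i / real N)) (\<gamma> (real (Suc i) / real N))) \<le> 4 * \<sigma> * t"
      using \<sigma> t by (subst (asm) ennreal_le_iff) auto
  qed (use c in auto)
  also have "ennreal (4 * \<sigma> * t / ?c) * G + ennreal ((\<kappa> * (t / 2)) / (\<kappa> * (t / 2)) ^ CARD('d)) * G =
     ennreal (4 * \<sigma> * t / ?c + (\<kappa> * (t / 2)) / (\<kappa> * (t / 2)) ^ CARD('d)) * G"
    using \<sigma> t k0 by (subst ennreal_plus) (auto simp: distrib_right)
  also have "4 * \<sigma> * t / ?c + (\<kappa> * (t / 2)) / (\<kappa> * (t / 2)) ^ CARD('d) =
    (4 * \<sigma> / \<kappa> ^ CARD('d) + (\<kappa> / 2) / (\<kappa> / 2) ^ CARD('d)) * (t / t ^ CARD('d))"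
  proof -
    have "\<kappa> * (t / 2) = (\<kappa> / 2) * t" by simp
    then show ?thesis
      using k0 t by (simp only: power_mult_distrib distrib_right times_divide_times_eq)
  qed
  also have "t / t ^ CARD('d) = t powr (1 - real CARD('d))"
    using t by (simp add: powr_diff powr_realpow)
  finally show ?thesis unfolding G_def D_def by (simp add: add_right_mono)
qed

text \<open>
  \<open>P j x\<close> is the centre of the \<open>j\<close>-th ball of a chain converging to the boundary point \<open>x\<close>. The set
  \<open>D j\<close> contains the sets swept between consecutive balls; the last condition bounds the integral
  of the reciprocal of the degeneracy over it, which for \<open>D j = UNIV\<close> may diverge.
\<close>

definition chains_to_boundary ::
  "(real^'d) set \<Rightarrow> real \<Rightarrow> real \<Rightarrow> real^'d \<Rightarrow> real \<Rightarrow> real \<Rightarrow> real \<Rightarrow> real \<Rightarrow> real \<Rightarrow> nat \<Rightarrow>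
    (nat \<Rightarrow> real^'d \<Rightarrow> real^'d) \<Rightarrow> (nat \<Rightarrow> (real^'d) set) \<Rightarrow> bool" where
  "chains_to_boundary \<Omega> s \<delta> z \<rho> L \<kappa> M N j1 P D \<longleftrightarrow>
    (\<forall>j. D j \<in> sets borel \<and> D j \<subseteq> closure \<Omega>) \<and>
    (\<forall>x\<in>frontier \<Omega> \<inter> ball z \<rho>. \<forall>j\<ge>j1.
       dist (P j x) x \<le> L * (1/2) ^ j \<and> ball (P j x) (\<kappa> * (1/2) ^ j) \<subseteq> closure \<Omega> \<and>
       (\<forall>v. Ck (Suc 0) v \<longrightarrow>
         (\<integral>\<^sup>+h. indicator (ball 0 1) h *
           ennreal \<bar>v (P j x + (\<kappa> * (1/2) ^ j) *\<^sub>R h) - v (P (Suc j) x + (\<kappa> * (1/2) ^ Suc j) *\<^sub>R h)\<bar> \<partial>lborel)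
         \<le> ennreal (M * ((1/2) ^ j) powr (1 - real CARD('d))) *
           (\<integral>\<^sup>+y. indicator (D j \<inter> ball x (L * (1/2) ^ j)) y * ennreal (norm (gradient v y)) \<partial>lborel))) \<and>
    (\<forall>j\<ge>j1.
      (\<integral>\<^sup>+y. indicator (D j \<inter> {y \<in> ball z (\<rho> + 1). infdist y (frontier \<Omega>) < L * (1/2) ^ j}) y *
        ennreal (infdist y (frontier \<Omega>) powr (- \<delta>)) \<partial>lborel)
      \<le> ennreal (N * ((1/2) ^ j) powr (real CARD('d) - s - \<delta>)))"

text \<open>The closure of the domain is the whole space here, so the balls are centred at the
  boundary point itself and only their radii shrink. From s < d - 1 and the upper bound on \<delta>
  one gets \<delta> < 1 < d - s; the reciprocal weight is then integrable over full layers and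
  \<open>UNIV\<close> can serve as \<open>D j\<close>.\<close>

lemma chains_thin_boundary:
  fixes \<Omega> :: "(real^'d) set"
  assumes \<Omega>: "is_domain \<Omega>" "frontier \<Omega> \<noteq> {}" and reg: "ahlfors_regular (frontier \<Omega>) s"
    and s: "s < real CARD('d) - 1" and \<delta>: "0 \<le> \<delta>" "\<delta> < 2 - real CARD('d) + s" and z: "z \<in> frontier \<Omega>"
  shows "\<exists>N\<ge>0. chains_to_boundary \<Omega> s \<delta> z 1 1 1 (2 ^ CARD('d)) N 0 (\<lambda>j x. x) (\<lambda>j. UNIV)"
proof -
  have cl: "closure \<Omega> = UNIV"
    using complement_of_thin_boundary[OF \<Omega> reg s] closure_Un_frontier[of \<Omega>] by simp
  have "\<delta> < real CARD('d) - s" using s \<delta> by linarith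
  then obtain N where N: "N \<ge> 0" "\<And>t. 0 < t \<Longrightarrow> t \<le> 1 \<Longrightarrow>
    (\<integral>\<^sup>+y. indicator {y \<in> ball z 2. infdist y (frontier \<Omega>) < t} y * ennreal (infdist y (frontier \<Omega>) powr (- \<delta>)) \<partial>lborel)
      \<le> ennreal (N * t powr (real CARD('d) - s - \<delta>))"
    using weight_integral_dyadic[OF reg frontier_closed \<Omega>(2) \<delta>(1), of 1 z 2] by auto
  have "(\<integral>\<^sup>+h. indicator (ball 0 1) h * ennreal \<bar>v (x + t *\<^sub>R h) - v (x + (t / 2) *\<^sub>R h)\<bar> \<partial>lborel)
       \<le> ennreal (2 ^ CARD('d) * t powr (1 - real CARD('d))) *
           (\<integral>\<^sup>+y. indicator (ball x t) y * ennreal (norm (gradient v y)) \<partial>lborel)"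
    if v: "Ck (Suc 0) v" and t: "t > 0" for v :: "real^'d \<Rightarrow> real" and x t
  proof -
    have "(\<integral>\<^sup>+h. indicator (ball 0 1) h * ennreal \<bar>v (x + t *\<^sub>R h) - v (x + (t / 2) *\<^sub>R h)\<bar> \<partial>lborel)
      \<le> ennreal ((dist x x + \<bar>t - t / 2\<bar>) / (t / 2) ^ CARD('d)) * (\<integral>\<^sup>+y. indicator (ball x t) y * ennreal (norm (gradient v y)) \<partial>lborel)"
    proof (rule segment_estimate[OF v])
      fix \<tau> :: real and h :: "real^'d" assume \<tau>: "0 \<le> \<tau>" "\<tau> \<le> 1" "norm h < 1"
      have eq: "t + \<tau> * (t / 2 - t) = t * (1 - \<tau> / 2)" by (simp add: algebra_simps)
      have nn: "0 < t * (1 - \<tau> / 2)" using \<tau> t by (intro mult_pos_pos) auto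
      have "dist x (x + \<tau> *\<^sub>R (x - x) + (t + \<tau> * (t / 2 - t)) *\<^sub>R h) = t * (1 - \<tau> / 2) * norm h"
        unfolding eq using nn by (simp add: dist_norm)
      also have "\<dots> < t * (1 - \<tau> / 2) * 1" using \<tau> nn by (intro mult_strict_left_mono) auto
      also have "\<dots> \<le> t" using \<tau> t by (simp add: mult_left_le)
      finally show "x + \<tau> *\<^sub>R (x - x) + (t + \<tau> * (t / 2 - t)) *\<^sub>R h \<in> ball x t" by simp
    qed (use t in auto)
    also have "\<dots> \<le> ennreal (2 ^ CARD('d) * t powr (1 - real CARD('d))) * (\<integral>\<^sup>+y. indicator (ball x t) y * ennreal (norm (gradient v y)) \<partial>lborel)"
    proof (intro mult_right_mono ennreal_leI)
      have "(dist x x + \<bar>t - t / 2\<bar>) / (t / 2) ^ CARD('d) = 2 ^ CARD('d) * (t powr (1 - real CARD('d)) / 2)"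
        using t by (simp add: power_divide powr_diff powr_realpow mult.commute)
      also have "\<dots> \<le> 2 ^ CARD('d) * t powr (1 - real CARD('d))" by (intro mult_left_mono) auto
      finally show "(dist x x + \<bar>t - t / 2\<bar>) / (t / 2) ^ CARD('d) \<le> 2 ^ CARD('d) * t powr (1 - real CARD('d))" .
    qed simp
    finally show ?thesis .
  qed
  from this[of _ "(1/2) ^ j" for j] have
    "(\<integral>\<^sup>+h. indicator (ball 0 1) h * ennreal \<bar>v (x + ((1/2) ^ j) *\<^sub>R h) - v (x + ((1/2) ^ Suc j) *\<^sub>R h)\<bar> \<partial>lborel)
       \<le> ennreal (2 ^ CARD('d) * ((1/2) ^ j) powr (1 - real CARD('d))) *
           (\<integral>\<^sup>+y. indicator (ball x ((1/2) ^ j)) y * ennreal (norm (gradient v y)) \<partial>lborel)"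
    if "Ck (Suc 0) v" for v :: "real^'d \<Rightarrow> real" and x j
    using that by simp
  moreover have "(\<integral>\<^sup>+y. indicator {y \<in> ball z 2. infdist y (frontier \<Omega>) < (1/2) ^ j} y * ennreal (infdist y (frontier \<Omega>) powr (- \<delta>)) \<partial>lborel)
      \<le> ennreal (N * ((1/2) ^ j) powr (real CARD('d) - s - \<delta>))" for j
    by (rule N(2)) (auto simp: power_le_one)
  ultimately have "chains_to_boundary \<Omega> s \<delta> z 1 1 1 (2 ^ CARD('d)) N 0 (\<lambda>j x. x) (\<lambda>j. UNIV)"
    unfolding chains_to_boundary_def by (simp add: cl del: power_Suc mem_ball)
  then show ?thesis using N(1) by blast
qed

text \<open>At each scale the centre is a point whose distance to the boundary is comparable to its
  distance to \<open>x\<close>, and consecutive centres are joined along a uniform curve. The swept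
  sets keep distance of order 2^(-j) from the boundary; this bounds the reciprocal weight on them
  and reduces the last condition to the volume of layers, for every \<delta> >= 0.\<close>

lemma chains_uniform:
  fixes \<Omega> :: "(real^'d) set"
  assumes \<Omega>: "is_domain \<Omega>" "frontier \<Omega> \<noteq> {}" and reg: "ahlfors_regular (frontier \<Omega>) s"
    and \<delta>: "0 \<le> \<delta>" and z: "z \<in> frontier \<Omega>" and R: "R > 0" and u: "uniform_in \<Omega> (\<Omega> \<inter> ball z R)"
  shows "\<exists>\<rho> L \<kappa> M N j1 P D. \<rho> > 0 \<and> L > 0 \<and> \<kappa> > 0 \<and> M \<ge> 0 \<and> N \<ge> 0 \<and> chains_to_boundary \<Omega> s \<delta> z \<rho> L \<kappa> M N j1 P D"
proof -
  have op: "open \<Omega>" using \<Omega>(1) by (simp add: is_domain_def)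
  obtain \<sigma> where u: "uniform_with \<Omega> (\<Omega> \<inter> ball z R) \<sigma>" using uniform_in_imp[OF u] by blast
  have \<sigma>: "\<sigma> \<ge> 1" using u by (simp add: uniform_with_def)
  define \<rho> where "\<rho> = R / 2"
  define L where "L = 4 * \<sigma> + 3"
  define \<kappa> where "\<kappa> = 1 / (16 * \<sigma>\<^sup>2)"
  define M where "M = 4 * \<sigma> / \<kappa> ^ CARD('d) + (\<kappa> / 2) / (\<kappa> / 2) ^ CARD('d)"
  have pos: "\<rho> > 0" "L > 0" "\<kappa> > 0" using R \<sigma> by (auto simp: \<rho>_def L_def \<kappa>_def)
  have M: "M \<ge> 0" using pos \<sigma> by (simp add: M_def)
  have "z \<in> closure \<Omega>" using z by (simp add: frontier_def)
  then obtain y0 where y0: "y0 \<in> \<Omega> \<inter> ball z R" using closure_approachable R by (metis IntI dist_commute mem_ball)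
  have "y0 \<notin> frontier \<Omega>" using y0 op by (simp add: frontier_def interior_open)
  then have d0: "infdist y0 (frontier \<Omega>) > 0"
    using infdist_pos_not_in_closed[OF frontier_closed \<Omega>(2)] by blast
  have "(\<lambda>j. (1/2 :: real) ^ j) \<longlonglongrightarrow> 0" by (intro LIMSEQ_power_zero) simp
  then have "\<forall>\<^sub>F j in sequentially. (1/2 :: real) ^ j < min (infdist y0 (frontier \<Omega>) / 4) (R / 8)"
    using d0 R by (intro order_tendstoD(2)) auto
  \<comment> \<open>The two bounds are the smallness conditions of \<open>uniform_corkscrew\<close>,
    with \<open>y0\<close> as the fixed interior point.\<close>
  then obtain j1 where j1: "\<And>j. j \<ge> j1 \<Longrightarrow> (1/2 :: real) ^ j < min (infdist y0 (frontier \<Omega>) / 4) (R / 8)"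
    by (auto simp: eventually_sequentially)
  \<comment> \<open>An arbitrary choice in \<open>x\<close> serves: what is later integrated over
    \<open>x\<close> are integrals over balls about \<open>x\<close>, not values at
    \<open>P j x\<close>.\<close>
  define P where "P j x = (SOME w. w \<in> \<Omega> \<inter> ball z R \<and> dist w x \<le> 2 * (1/2) ^ j \<and> (1/2) ^ j / \<sigma> \<le> infdist w (frontier \<Omega>))" for j :: nat and x
  have P: "P j x \<in> \<Omega> \<inter> ball z R \<and> dist (P j x) x \<le> 2 * (1/2) ^ j \<and> (1/2) ^ j / \<sigma> \<le> infdist (P j x) (frontier \<Omega>)"
    if "x \<in> frontier \<Omega> \<inter> ball z \<rho>" "j \<ge> j1" for x j
  proof -
    have "\<exists>w\<in>\<Omega> \<inter> ball z R. dist w x \<le> 2 * (1/2) ^ j \<and> (1/2) ^ j / \<sigma> \<le> infdist w (frontier \<Omega>)"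
      using that j1[OF that(2)] by (intro uniform_corkscrew[OF u _ _ y0]) (auto simp: \<rho>_def)
    then have "\<exists>w. w \<in> \<Omega> \<inter> ball z R \<and> dist w x \<le> 2 * (1/2) ^ j \<and> (1/2) ^ j / \<sigma> \<le> infdist w (frontier \<Omega>)"
      by blast
    then show ?thesis unfolding P_def by (rule someI_ex)
  qed
  define D where "D j = {y \<in> \<Omega>. \<kappa> * (1/2) ^ j \<le> infdist y (frontier \<Omega>)}" for j :: nat
  have Db: "D j \<in> sets borel" for j
  proof -
    have "closed {y. \<kappa> * (1/2) ^ j \<le> infdist y (frontier \<Omega>)}" by (intro closed_Collect_le continuous_intros)
    then have "\<Omega> \<inter> {y. \<kappa> * (1/2) ^ j \<le> infdist y (frontier \<Omega>)} \<in> sets borel"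
      using op by (intro sets.Int) auto
    also have "\<Omega> \<inter> {y. \<kappa> * (1/2) ^ j \<le> infdist y (frontier \<Omega>)} = D j" by (auto simp: D_def)
    finally show ?thesis .
  qed
  obtain K where K: "K > 0" "\<And>t. 0 < t \<Longrightarrow> t \<le> L \<Longrightarrow>
    emeasure lborel {y \<in> ball z (\<rho> + 1). infdist y (frontier \<Omega>) < t} \<le> ennreal (K * t powr (real CARD('d) - s))"
    using boundary_layer_volume[OF reg frontier_closed \<Omega>(2), of L z "\<rho> + 1"] by blast
  \<comment> \<open>The largest possible weight on \<open>D j\<close> times the volume bound for the
    layer of width L 2^(-j), with all powers of 2^(-j) split off.\<close>
  define N where "N = \<kappa> powr (- \<delta>) * (K * L powr (real CARD('d) - s))"
  have N: "N \<ge> 0" using K by (simp add: N_def)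
  have "chains_to_boundary \<Omega> s \<delta> z \<rho> L \<kappa> M N j1 P D"
    unfolding chains_to_boundary_def
  proof (intro conjI ballI allI impI)
    fix j
    show "D j \<in> sets borel" by (rule Db)
    show "D j \<subseteq> closure \<Omega>" using closure_subset by (auto simp: D_def)
  next
    fix x j assume x: "x \<in> frontier \<Omega> \<inter> ball z \<rho>" and j: "j1 \<le> j"
    let ?t = "(1/2 :: real) ^ j"
    have t: "?t > 0" by simp
    note Pj = P[OF x j]
    show "dist (P j x) x \<le> L * ?t"
    proof -
      have "2 * ?t \<le> L * ?t" using \<sigma> t by (intro mult_right_mono) (auto simp: L_def)
      then show ?thesis using Pj by linarith
    qed
    have "\<kappa> \<le> 1 / \<sigma>"
    proof -
      have "\<sigma> * 1 \<le> 16 * \<sigma>\<^sup>2" using \<sigma> by (simp add: power2_eq_square)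
      then show ?thesis unfolding \<kappa>_def using \<sigma> by (intro divide_left_mono) auto
    qed
    then have kt: "\<kappa> * ?t \<le> ?t / \<sigma>" using mult_right_mono[of \<kappa> "1/\<sigma>" ?t] by simp
    have "ball (P j x) (\<kappa> * ?t) \<subseteq> \<Omega>"
    proof
      fix y assume "y \<in> ball (P j x) (\<kappa> * ?t)"
      then have *: "dist (P j x) y < infdist (P j x) (frontier \<Omega>)" using kt Pj by simp
      have "P j x \<in> \<Omega>" using Pj by simp
      then show "y \<in> \<Omega>" using * by (rule inside_of_ball)
    qed
    then show "ball (P j x) (\<kappa> * ?t) \<subseteq> closure \<Omega>" using closure_subset by blast
    fix v :: "real^'d \<Rightarrow> real" assume v: "Ck (Suc 0) v"
    have j': "j1 \<le> Suc j" using j by simp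
    note Pj' = P[OF x j']
    have 1: "P j x \<in> \<Omega> \<inter> ball z R" "P (Suc j) x \<in> \<Omega> \<inter> ball z R"
      using Pj Pj' by blast+
    have 2: "dist (P j x) x \<le> 2 * ?t" "?t / \<sigma> \<le> infdist (P j x) (frontier \<Omega>)"
      using Pj by blast+
    have "2 * (1/2 :: real) ^ Suc j \<le> 2 * ?t" by simp
    then have 3: "dist (P (Suc j) x) x \<le> 2 * ?t"
      using Pj' by linarith
    have "?t / (2 * \<sigma>) = (1/2) ^ Suc j / \<sigma>" by simp
    then have 4: "?t / (2 * \<sigma>) \<le> infdist (P (Suc j) x) (frontier \<Omega>)"
      using Pj' by linarith
    have half: "?t / 2 = (1/2) ^ Suc j" by simp
    show "(\<integral>\<^sup>+h. indicator (ball 0 1) h *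
           ennreal \<bar>v (P j x + (\<kappa> * (1/2) ^ j) *\<^sub>R h) - v (P (Suc j) x + (\<kappa> * (1/2) ^ Suc j) *\<^sub>R h)\<bar> \<partial>lborel)
         \<le> ennreal (M * ((1/2) ^ j) powr (1 - real CARD('d))) *
           (\<integral>\<^sup>+y. indicator (D j \<inter> ball x (L * (1/2) ^ j)) y * ennreal (norm (gradient v y)) \<partial>lborel)"
      using uniform_chain_step[OF u op 1 t 2(1) 3 2(2) 4 v \<kappa>_def]
      unfolding M_def D_def L_def half .
  next
    fix j assume j: "j1 \<le> j"
    let ?t = "(1/2 :: real) ^ j"
    have t: "0 < ?t" "?t \<le> 1" by (auto simp: power_le_one)
    define W where "W = {y \<in> ball z (\<rho> + 1). infdist y (frontier \<Omega>) < L * ?t}"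
    have W: "W \<in> sets borel" unfolding W_def by (rule layer_borel)
    have "(\<integral>\<^sup>+y. indicator (D j \<inter> W) y * ennreal (infdist y (frontier \<Omega>) powr (- \<delta>)) \<partial>lborel) \<le>
       (\<integral>\<^sup>+y. ennreal ((\<kappa> * ?t) powr (- \<delta>)) * indicator W y \<partial>lborel)"
    proof (rule nn_integral_mono)
      fix y
      show "indicator (D j \<inter> W) y * ennreal (infdist y (frontier \<Omega>) powr (- \<delta>)) \<le> ennreal ((\<kappa> * ?t) powr (- \<delta>)) * indicator W y"
      proof (cases "y \<in> D j \<inter> W")
        case True
        then have "infdist y (frontier \<Omega>) powr (- \<delta>) \<le> (\<kappa> * ?t) powr (- \<delta>)"
          using \<delta> pos t by (intro powr_mono2') (auto simp: D_def)
        then show ?thesis using True by (simp add: ennreal_leI)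
      qed simp
    qed
    also have "\<dots> = ennreal ((\<kappa> * ?t) powr (- \<delta>)) * emeasure lborel W"
      by (rule nn_integral_cmult_indicator) (use W in simp)
    also have "\<dots> \<le> ennreal ((\<kappa> * ?t) powr (- \<delta>)) * ennreal (K * (L * ?t) powr (real CARD('d) - s))"
      unfolding W_def using t pos by (intro mult_left_mono K) (auto simp: mult_left_le)
    also have "\<dots> = ennreal ((\<kappa> * ?t) powr (- \<delta>) * (K * (L * ?t) powr (real CARD('d) - s)))"
      using K by (simp add: ennreal_mult')
    also have "(\<kappa> * ?t) powr (- \<delta>) * (K * (L * ?t) powr (real CARD('d) - s)) = N * (?t powr (- \<delta>) * ?t powr (real CARD('d) - s))"
      by (simp only: powr_mult N_def ac_simps)
    also have "?t powr (- \<delta>) * ?t powr (real CARD('d) - s) = ?t powr (real CARD('d) - s - \<delta>)"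
      by (simp add: powr_add[symmetric])
    finally show "(\<integral>\<^sup>+y. indicator (D j \<inter> {y \<in> ball z (\<rho> + 1). infdist y (frontier \<Omega>) < L * ?t}) y *
        ennreal (infdist y (frontier \<Omega>) powr (- \<delta>)) \<partial>lborel)
      \<le> ennreal (N * ?t powr (real CARD('d) - s - \<delta>))" unfolding W_def .
  qed
  then show ?thesis using pos M N by blast
qed

section \<open>The energy forms\<close>

lemma quadratic_form_sum:
  fixes A :: "real^'d^'d"
  shows "v \<bullet> (A *v v) = (\<Sum>k\<in>UNIV. \<Sum>l\<in>UNIV. A $ k $ l * v $ k * v $ l)"
  by (simp add: inner_vec_def matrix_vector_mult_def sum_distrib_left ac_simps)

lemma quadratic_form_scalar: "v \<bullet> ((c *\<^sub>R mat 1) *v v) = c * (norm v)\<^sup>2" for v :: "real^'d"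
  unfolding scaleR_matrix_vector_assoc[symmetric] by (simp add: power2_norm_eq_inner)

lemma degenerate_at_boundaryD:
  fixes C :: "real^'d \<Rightarrow> real^'d^'d"
  assumes "degenerate_at_boundary \<Omega> C \<delta>" "A \<subseteq> frontier \<Omega>" "bounded A" "A \<noteq> {}"
  shows "\<exists>a b r. a > 0 \<and> b > 0 \<and> r > 0 \<and> (AE x in lebesgue_on \<Omega>. x \<in> boundary_layer \<Omega> A r \<longrightarrow>
           (\<forall>v. a * infdist x (frontier \<Omega>) powr \<delta> * (norm v)\<^sup>2 \<le> v \<bullet> (C x *v v) \<and>
                v \<bullet> (C x *v v) \<le> b * infdist x (frontier \<Omega>) powr \<delta> * (norm v)\<^sup>2))"
proof -
  have "\<exists>a>0. \<exists>b>0. \<exists>r>0. AE x in lebesgue_on \<Omega>. x \<in> boundary_layer \<Omega> A r \<longrightarrow>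
           matrix_le ((a * infdist x (frontier \<Omega>) powr \<delta>) *\<^sub>R mat 1) (C x) \<and>
           matrix_le (C x) ((b * infdist x (frontier \<Omega>) powr \<delta>) *\<^sub>R mat 1)"
    using assms unfolding degenerate_at_boundary_def by simp
  then show ?thesis
    unfolding matrix_le_def quadratic_form_scalar by (simp add: all_conj_distrib)
qed

lemma measurable_lebesgue_on:
  assumes "f \<in> borel_measurable borel"
  shows "f \<in> borel_measurable (lebesgue_on \<Omega>)"
  using assms by (intro measurable_restrict_space1 measurable_completion) simp

lemma integrable_lebesgue_on:
  fixes f :: "'a::euclidean_space \<Rightarrow> real"
  assumes "integrable lborel f" "\<Omega> \<in> sets borel"
  shows "integrable (lebesgue_on \<Omega>) f"
proof -
  have "integrable lebesgue f"
    using assms(1) by (subst integrable_completion) (auto dest: borel_measurable_integrable)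
  then have "integrable lebesgue (\<lambda>x. indicator \<Omega> x *\<^sub>R f x)"
    using assms(2) by (intro integrable_mult_indicator) (auto intro: sets_completionI_sets)
  then show ?thesis
    using assms(2) by (subst integrable_restrict_space) (auto intro: sets_completionI_sets)
qed

lemma L_infinity_integrable_mult:
  assumes c: "c \<in> L_infinity \<Omega>" and f: "integrable (lebesgue_on \<Omega>) f"
  shows "integrable (lebesgue_on \<Omega>) (\<lambda>x. c x * f x)"
proof -
  obtain M where M: "AE x in lebesgue_on \<Omega>. \<bar>c x\<bar> \<le> M"
    and cm: "c \<in> borel_measurable (lebesgue_on \<Omega>)" using c by (auto simp: L_infinity_def)
  show ?thesis
  proof (rule Bochner_Integration.integrable_bound[where f="\<lambda>x. M * f x"])
    show "AE x in lebesgue_on \<Omega>. norm (c x * f x) \<le> norm (M * f x)"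
      using M
    proof eventually_elim
      case (elim x)
      then have "\<bar>c x\<bar> \<le> \<bar>M\<bar>" by linarith
      then show ?case by (simp add: abs_mult mult_right_mono)
    qed
  qed (use f cm in \<open>auto dest: borel_measurable_integrable\<close>)
qed

lemma energy_integrable:
  fixes C :: "real^'d \<Rightarrow> real^'d^'d"
  assumes C: "admissible_coefficients \<Omega> C"
    and g: "\<And>k l. integrable (lebesgue_on \<Omega>) (\<lambda>x. g x $ k * g x $ l)"
  shows "integrable (lebesgue_on \<Omega>) (\<lambda>x. g x \<bullet> (C x *v g x))"
    and "(LINT x|lebesgue_on \<Omega>. g x \<bullet> (C x *v g x)) =
      (\<Sum>k\<in>UNIV. \<Sum>l\<in>UNIV. LINT x|lebesgue_on \<Omega>. C x $ k $ l * g x $ k * g x $ l)"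
proof -
  have i: "integrable (lebesgue_on \<Omega>) (\<lambda>x. C x $ k $ l * g x $ k * g x $ l)" for k l
    using L_infinity_integrable_mult[OF _ g, of "\<lambda>x. C x $ k $ l" k l] C
    by (simp add: admissible_coefficients_def mult.assoc)
  show "integrable (lebesgue_on \<Omega>) (\<lambda>x. g x \<bullet> (C x *v g x))"
    unfolding quadratic_form_sum by (intro Bochner_Integration.integrable_sum i)
  show "(LINT x|lebesgue_on \<Omega>. g x \<bullet> (C x *v g x)) =
      (\<Sum>k\<in>UNIV. \<Sum>l\<in>UNIV. LINT x|lebesgue_on \<Omega>. C x $ k $ l * g x $ k * g x $ l)"
    unfolding quadratic_form_sum
    by (simp add: Bochner_Integration.integral_sum Bochner_Integration.integrable_sum i)
qed

lemma test_gradient_integrable: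
  fixes \<phi> :: "real^'d \<Rightarrow> real"
  assumes "\<phi> \<in> test_functions UNIV" "\<Omega> \<in> sets borel"
  shows "integrable (lebesgue_on \<Omega>) (\<lambda>x. gradient \<phi> x $ k * gradient \<phi> x $ l)"
proof -
  have "(\<lambda>x. partial k \<phi> x * partial l \<phi> x) \<in> test_functions UNIV"
    using test_functions_Ck[OF test_functions_partial[OF assms(1)]]
    by (intro test_functions_mult test_functions_partial assms)
  then show ?thesis
    using integrable_lebesgue_on[OF test_function_integrable assms(2)] by simp
qed

lemma h0_energy:
  fixes C :: "real^'d \<Rightarrow> real^'d^'d"
  assumes C: "admissible_coefficients \<Omega> C" and \<phi>: "\<phi> \<in> test_functions UNIV" and \<Omega>: "open \<Omega>"
  shows "integrable (lebesgue_on \<Omega>) (\<lambda>x. gradient \<phi> x \<bullet> (C x *v gradient \<phi> x))"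
    and "h0 \<Omega> C \<phi> = (LINT x|lebesgue_on \<Omega>. gradient \<phi> x \<bullet> (C x *v gradient \<phi> x))"
  using energy_integrable[OF C test_gradient_integrable[OF \<phi> borel_open[OF \<Omega>]]]
  unfolding h0_def by simp_all

lemma test_function_L2_loc:
  assumes "\<phi> \<in> test_functions UNIV"
  shows "\<phi> \<in> L2_loc \<Omega>"
proof -
  have "(\<lambda>x. \<phi> x * \<phi> x) \<in> test_functions UNIV"
    using test_functions_Ck[OF assms] by (intro test_functions_mult assms)
  then have "integrable (lebesgue_on K) (\<lambda>x. (\<phi> x)\<^sup>2)" if "compact K" for K
    using integrable_lebesgue_on[OF test_function_integrable, of "\<lambda>x. \<phi> x * \<phi> x" UNIV K] that
    by (simp add: power2_eq_square compact_imp_closed)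
  then show ?thesis
    using measurable_lebesgue_on[OF test_function_measurable[OF assms]] by (simp add: L2_loc_def)
qed

lemma test_function_weak_identity:
  assumes u: "Ck (Suc 0) u" and \<phi>: "\<phi> \<in> test_functions \<Omega>" and \<Omega>: "open \<Omega>"
  shows "(LINT x|lebesgue_on \<Omega>. u x * partial k \<phi> x) = - (LINT x|lebesgue_on \<Omega>. partial k u x * \<phi> x)"
proof -
  obtain K where K: "K \<subseteq> \<Omega>" "\<And>x. x \<notin> K \<Longrightarrow> \<phi> x = 0" "\<And>k x. x \<notin> K \<Longrightarrow> partial k \<phi> x = 0"
    using test_functions_support[OF \<phi>] by blast
  have [measurable]: "u \<in> borel_measurable borel" "partial k u \<in> borel_measurable borel"
    using borel_measurable_continuous_onI[OF Ck_continuous[OF u]]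
      borel_measurable_continuous_onI[OF Ck_continuous[OF Ck_partial[OF u]]] by auto
  note [measurable] = test_function_measurable[OF \<phi>] test_function_measurable[OF test_functions_partial[OF \<phi>]]
  have "(LINT x|lebesgue_on \<Omega>. u x * partial k \<phi> x) = (LINT x|lborel. u x * partial k \<phi> x)"
    using K \<Omega> by (intro integral_lebesgue_on_lborel) auto
  moreover have "(LINT x|lebesgue_on \<Omega>. partial k u x * \<phi> x) = (LINT x|lborel. partial k u x * \<phi> x)"
    using K \<Omega> by (intro integral_lebesgue_on_lborel) auto
  ultimately show ?thesis using integration_by_parts[OF u \<phi>] by simp
qed

text \<open>The functions here may be nonzero at the boundary, which is how a candidate for
  separating the two forms is obtained. Their energy is finite because the coefficients are
  bounded.\<close>

lemma test_function_in_hN: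
  assumes C: "admissible_coefficients \<Omega> C" and \<psi>: "\<psi> \<in> test_functions UNIV" and \<Omega>: "open \<Omega>"
  shows "(\<psi>, LINT x|lebesgue_on \<Omega>. gradient \<psi> x \<bullet> (C x *v gradient \<psi> x)) \<in> hN_form \<Omega> C"
proof -
  have W: "W12_loc_gradient \<Omega> \<psi> (gradient \<psi>)"
    using test_function_L2_loc[OF \<psi>] test_function_L2_loc[OF test_functions_partial[OF \<psi>]]
      test_function_weak_identity[OF test_functions_Ck[OF \<psi>] _ \<Omega>]
    by (simp add: W12_loc_gradient_def)
  moreover have "(\<lambda>x. \<psi> x * \<psi> x) \<in> test_functions UNIV"
    using test_functions_Ck[OF \<psi>] by (intro test_functions_mult \<psi>)
  then have "integrable (lebesgue_on \<Omega>) (\<lambda>x. (\<psi> x)\<^sup>2)"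
    using integrable_lebesgue_on[OF test_function_integrable borel_open[OF \<Omega>]] by (simp add: power2_eq_square)
  ultimately have "integrable (lebesgue_on \<Omega>) (\<lambda>x. gradient \<psi> x \<bullet> (C x *v gradient \<psi> x) + (\<psi> x)\<^sup>2)"
    using h0_energy(1)[OF C \<psi> \<Omega>] by (intro Bochner_Integration.integrable_add) auto
  with W show ?thesis
    unfolding hN_form_def quadratic_form_sum mem_Collect_eq prod.case
    by (intro exI[of _ "gradient \<psi>"] conjI refl)
qed

text \<open>Since the frontier is a null set, a subset of the closure of \<open>\<Omega>\<close>
  loses nothing when it is cut down to \<open>\<Omega>\<close>. The balls and swept sets of the
  chains are only known to lie in the closure.\<close>

lemma nn_integral_le_lebesgue_on:
  fixes f :: "real^'d \<Rightarrow> ennreal"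
  assumes \<Omega>: "open \<Omega>" and null: "frontier \<Omega> \<in> null_sets lborel" and S: "S \<in> sets borel" "S \<subseteq> closure \<Omega>"
    and f: "f \<in> borel_measurable borel" and le: "AE x in lebesgue_on \<Omega>. x \<in> S \<longrightarrow> f x \<le> g x"
  shows "(\<integral>\<^sup>+x. indicator S x * f x \<partial>lborel) \<le> (\<integral>\<^sup>+x. g x \<partial>lebesgue_on \<Omega>)"
proof -
  have O: "\<Omega> \<inter> space lebesgue \<in> sets lebesgue" using \<Omega> by (auto intro: sets_completionI_sets)
  have "(\<integral>\<^sup>+x. indicator S x * f x \<partial>lborel) = (\<integral>\<^sup>+x. indicator S x * f x \<partial>lebesgue)"
    by (simp add: nn_integral_completion)
  also have "\<dots> \<le> (\<integral>\<^sup>+x. g x * indicator \<Omega> x \<partial>lebesgue)"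
  proof (rule nn_integral_mono_AE)
    have "frontier \<Omega> \<in> null_sets lebesgue" using null by (rule null_sets_completionI)
    then have "AE x in lebesgue. x \<notin> frontier \<Omega>" by (rule AE_not_in)
    moreover have "AE x in lebesgue. x \<in> \<Omega> \<longrightarrow> x \<in> S \<longrightarrow> f x \<le> g x"
      using le O by (simp add: AE_restrict_space_iff)
    ultimately show "AE x in lebesgue. indicator S x * f x \<le> g x * indicator \<Omega> x"
    proof eventually_elim
      case (elim x)
      then show ?case
        using S(2) closure_Un_frontier[of \<Omega>] by (cases "x \<in> S") auto
    qed
  qed
  also have "\<dots> = (\<integral>\<^sup>+x. g x \<partial>lebesgue_on \<Omega>)"
    by (rule nn_integral_restrict_space[OF O, symmetric])
  finally show ?thesis .
qed

lemma plateau_exists: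
  fixes z :: "real^'d"
  shows "\<exists>\<psi>\<in>test_functions UNIV. \<forall>y. dist z y < R \<longrightarrow> \<psi> y = 1"
proof -
  let ?A = "ball z (R + 1)"
  have A: "?A \<in> sets borel \<and> bounded ?A \<and> (1 :: real) > 0" by simp
  have "\<exists>c. (\<forall>n. Ck n c) \<and> (\<forall>x. cball x 1 \<subseteq> ?A \<longrightarrow> c x = 1) \<and> (\<forall>x. cball x 1 \<inter> ?A = {} \<longrightarrow> c x = 0)"
    using smooth_cutoff
    apply (elim exE conjE)
    apply (erule allE[where x="?A"], erule allE[where x=1], erule impE[OF _ A])
    apply (elim exE conjE)
    by blast
  then obtain \<psi> where \<psi>s: "\<And>n. Ck n \<psi>" and \<psi>1: "\<And>x. cball x 1 \<subseteq> ?A \<Longrightarrow> \<psi> x = 1"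
    and \<psi>0: "\<And>x. cball x 1 \<inter> ?A = {} \<Longrightarrow> \<psi> x = 0"
    by blast
  have one: "\<psi> y = 1" if "dist z y < R" for y
  proof (rule \<psi>1)
    show "cball y 1 \<subseteq> ?A"
    proof
      fix w assume "w \<in> cball y 1"
      then show "w \<in> ?A" using that dist_triangle[of z w y] by simp
    qed
  qed
  have "\<psi> \<in> test_functions UNIV"
  proof (rule test_functionsI[of _ "cball z (R + 2)"])
    fix x assume x: "x \<notin> cball z (R + 2)"
    show "\<psi> x = 0"
    proof (rule \<psi>0)
      show "cball x 1 \<inter> ?A = {}"
      proof (rule ccontr)
        assume "cball x 1 \<inter> ?A \<noteq> {}"
        then obtain w where "dist x w \<le> 1" "dist z w < R + 1" by auto
        then show False using x dist_triangle[of z x w] by (simp add: dist_commute)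
      qed
    qed
  qed (use \<psi>s in auto)
  with one show ?thesis by blast
qed

section \<open>Necessity of the degeneracy condition\<close>

text \<open>If the plateau \<open>\<psi>\<close> belonged to the minimal form, its approximants
  would vanish near the boundary, have bounded energy and be close to 1 in mean on the first ball of
  every chain. \<open>chain_capacity\<close> excludes this. As its \<open>j0\<close> is fixed before
  the approximant is chosen, L2 convergence is needed only on balls of one fixed radius.\<close>

lemma capacity_obstruction:
  fixes \<Omega> :: "(real^'d) set" and C :: "real^'d \<Rightarrow> real^'d^'d"
  assumes \<Omega>: "is_domain \<Omega>" "frontier \<Omega> \<noteq> {}" and s: "s < real CARD('d)" and reg: "ahlfors_regular (frontier \<Omega>) s"
    and C: "admissible_coefficients \<Omega> C" and deg: "degenerate_at_boundary \<Omega> C \<delta>"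
    and \<delta>: "\<delta> < 2 - real CARD('d) + s" and z: "z \<in> frontier \<Omega>"
    and pos: "\<rho> > 0" "L > 0" "\<kappa> > 0" "M \<ge> 0" "N \<ge> 0"
    and ch: "chains_to_boundary \<Omega> s \<delta> z \<rho> L \<kappa> M N j1 P D"
  shows "\<not> markov_unique \<Omega> C"
proof
  assume "markov_unique \<Omega> C"
  then have eq: "hN_form \<Omega> C \<subseteq> hD_form \<Omega> C" by (simp add: markov_unique_def)
  have op: "open \<Omega>" using \<Omega>(1) by (simp add: is_domain_def)
  define \<Gamma> where "\<Gamma> = frontier \<Omega>"
  have \<Gamma>: "closed \<Gamma>" "\<Gamma> \<noteq> {}" using \<Omega>(2) by (auto simp: \<Gamma>_def)
  have disj: "\<Omega> \<subseteq> - \<Gamma>" using op by (auto simp: \<Gamma>_def frontier_def interior_open)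
  have null: "frontier \<Omega> \<in> null_sets lborel" by (rule ahlfors_null[OF reg frontier_closed s])
  obtain \<nu> c where \<nu>: "sets \<nu> = sets borel" "finite_measure \<nu>" "AE x in \<nu>. x \<in> \<Gamma> \<inter> ball z \<rho>" and c: "c > 0"
    and \<nu>b: "\<And>x r. x \<in> \<Gamma> \<inter> ball z \<rho> \<Longrightarrow> 0 < r \<Longrightarrow> r < 2 * \<rho> \<Longrightarrow>
      ennreal (inverse c * r powr s) \<le> emeasure \<nu> (ball x r) \<and> emeasure \<nu> (ball x r) \<le> ennreal (c * r powr s)"
    using ahlfors_measure[OF reg frontier_closed z pos(1)] unfolding \<Gamma>_def by (elim exE conjE) blast
  interpret \<nu>: finite_measure \<nu> by fact
  define m0 where "m0 = measure \<nu> (space \<nu>)"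
  have m0: "m0 > 0"
  proof -
    have "0 < ennreal (inverse c * \<rho> powr s)" using c pos by simp
    also have "\<dots> \<le> emeasure \<nu> (ball z \<rho>)" using \<nu>b[of z \<rho>] z pos by (simp add: \<Gamma>_def)
    also have "\<dots> \<le> emeasure \<nu> (space \<nu>)" by (rule emeasure_space)
    finally show ?thesis by (simp add: m0_def \<nu>.emeasure_eq_measure)
  qed
  define \<omega> where "\<omega> = measure lborel (ball (0 :: real^'d) 1)"
  have \<omega>: "\<omega> > 0" by (simp add: \<omega>_def content_ball_pos)
  have \<omega>e: "emeasure lborel (ball (0 :: real^'d) 1) = ennreal \<omega>"
    unfolding \<omega>_def using emeasure_lborel_ball_finite[of "0 :: real^'d" 1]
    by (intro emeasure_eq_ennreal_measure) auto
  \<comment> \<open>The balls of all chains lie within \<open>\<rho> + L + \<kappa>\<close> of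
    \<open>z\<close>, and \<open>\<psi>\<close> equals 1 out to \<open>R - 1\<close>, which exceeds
    this.\<close>
  define R where "R = \<rho> + L + \<kappa> + 2"
  obtain \<psi> where \<psi>t: "\<psi> \<in> test_functions UNIV" and one: "\<And>y. dist z y < R - 1 \<Longrightarrow> \<psi> y = 1"
    using plateau_exists[of z "R - 1"] by blast
  obtain q where "(\<psi>, q) \<in> hN_form \<Omega> C" using test_function_in_hN[OF C \<psi>t op] by blast
  then have "(\<psi>, q) \<in> hD_form \<Omega> C" using eq by blast
  then obtain \<phi> where \<phi>: "\<And>n. \<phi> n \<in> test_functions \<Omega>"
    and \<phi>L: "(\<lambda>n. LINT x|lebesgue_on \<Omega>. (\<phi> n x - \<psi> x)\<^sup>2) \<longlonglongrightarrow> 0"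
    and \<phi>q: "(\<lambda>n. h0 \<Omega> C (\<phi> n)) \<longlonglongrightarrow> q"
    unfolding hD_form_def by blast
  have \<phi>U: "\<phi> n \<in> test_functions UNIV" and \<phi>\<Gamma>: "\<phi> n \<in> test_functions (- \<Gamma>)" for n
    using test_functions_mono[OF _ \<phi>] disj by auto
  \<comment> \<open>A point of \<open>ball z (\<rho> + 1)\<close> at distance below 1 from the
    boundary has its nearest boundary point in this bounded set, so the degeneracy bound for the set
    applies to it.\<close>
  define A where "A = \<Gamma> \<inter> ball z (\<rho> + 2)"
  have A: "A \<subseteq> frontier \<Omega>" "bounded A" "A \<noteq> {}"
    using z pos by (auto simp: A_def \<Gamma>_def bounded_Int)
  then obtain a b r0 where ab: "a > 0" "b > 0" "r0 > 0"
    and layer: "AE x in lebesgue_on \<Omega>. x \<in> boundary_layer \<Omega> A r0 \<longrightarrow>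
           (\<forall>v. a * infdist x (frontier \<Omega>) powr \<delta> * (norm v)\<^sup>2 \<le> v \<bullet> (C x *v v) \<and>
                v \<bullet> (C x *v v) \<le> b * infdist x (frontier \<Omega>) powr \<delta> * (norm v)\<^sup>2)"
    using degenerate_at_boundaryD[OF deg] by blast
  have posdef: "AE x in lebesgue_on \<Omega>. positive_definite (C x)"
    using C by (simp add: admissible_coefficients_def)
  define W where "W t = {y \<in> ball z (\<rho> + 1). infdist y \<Gamma> < t}" for t
  have W: "W t \<in> sets borel" for t unfolding W_def by (rule layer_borel)
  \<comment> \<open>Late approximants have energy below |q| + 1, and near \<open>A\<close> the
    coefficients dominate \<open>a\<close> times the weight.\<close>
  define E where "E = (\<bar>q\<bar> + 1) / a"
  have E: "E \<ge> 0" using ab by (simp add: E_def)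
  have energy: "(\<integral>\<^sup>+y. indicator (S \<inter> W t) y * ennreal (infdist y \<Gamma> powr \<delta> * (norm (gradient (\<phi> n) y))\<^sup>2) \<partial>lborel) \<le> ennreal E"
    if S: "S \<in> sets borel" "S \<subseteq> closure \<Omega>" and t: "t \<le> min 1 r0" and n: "h0 \<Omega> C (\<phi> n) \<le> \<bar>q\<bar> + 1" for S t n
  proof -
    let ?g = "gradient (\<phi> n)"
    have [measurable]: "?g \<in> borel_measurable borel" "(\<lambda>y. infdist y \<Gamma>) \<in> borel_measurable borel"
      using gradient_measurable[OF test_functions_Ck[OF \<phi>]]
      by (auto intro!: borel_measurable_continuous_onI continuous_intros)
    have "(\<integral>\<^sup>+y. indicator (S \<inter> W t) y * ennreal (infdist y \<Gamma> powr \<delta> * (norm (?g y))\<^sup>2) \<partial>lborel) \<le>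
      (\<integral>\<^sup>+y. ennreal ((?g y \<bullet> (C y *v ?g y)) / a) \<partial>lebesgue_on \<Omega>)"
    proof (rule nn_integral_le_lebesgue_on[OF op null])
      show "S \<inter> W t \<in> sets borel" using S W by blast
      show "S \<inter> W t \<subseteq> closure \<Omega>" using S by blast
      show "(\<lambda>y. ennreal (infdist y \<Gamma> powr \<delta> * (norm (?g y))\<^sup>2)) \<in> borel_measurable borel" by measurable
      have sp: "AE x in lebesgue_on \<Omega>. x \<in> \<Omega>" by (rule AE_I2) (simp add: space_restrict_space)
      from layer sp show "AE y in lebesgue_on \<Omega>. y \<in> S \<inter> W t \<longrightarrow>
         ennreal (infdist y \<Gamma> powr \<delta> * (norm (?g y))\<^sup>2) \<le> ennreal ((?g y \<bullet> (C y *v ?g y)) / a)"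
      proof eventually_elim
        case (elim y)
        show ?case
        proof
          assume y: "y \<in> S \<inter> W t"
          obtain x where x: "x \<in> \<Gamma>" "infdist y \<Gamma> = dist y x"
            by (rule infdist_attains_inf[OF \<Gamma>, of y])
          have d: "dist y x < min 1 r0" using y t x(2) by (simp add: W_def)
          then have "x \<in> A" using y x(1) dist_triangle[of z x y] by (simp add: A_def W_def)
          then have "infdist y A < r0" using infdist_le[of x A y] d by simp
          then have "y \<in> boundary_layer \<Omega> A r0"
            using elim(2) closure_subset by (auto simp: boundary_layer_def)
          then have "a * infdist y (frontier \<Omega>) powr \<delta> * (norm (?g y))\<^sup>2 \<le> ?g y \<bullet> (C y *v ?g y)"
            using elim(1) by blast
          then have "a * (infdist y \<Gamma> powr \<delta> * (norm (?g y))\<^sup>2) \<le> ?g y \<bullet> (C y *v ?g y)"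
            by (simp add: \<Gamma>_def mult.assoc)
          then show "ennreal (infdist y \<Gamma> powr \<delta> * (norm (?g y))\<^sup>2) \<le> ennreal ((?g y \<bullet> (C y *v ?g y)) / a)"
            using ab by (intro ennreal_leI) (simp add: pos_le_divide_eq mult.commute)
        qed
      qed
    qed
    also have "\<dots> = ennreal (LINT y|lebesgue_on \<Omega>. (?g y \<bullet> (C y *v ?g y)) / a)"
    proof (rule nn_integral_eq_integral)
      show "integrable (lebesgue_on \<Omega>) (\<lambda>y. (?g y \<bullet> (C y *v ?g y)) / a)"
        using h0_energy(1)[OF C \<phi>U op] by simp
      show "AE y in lebesgue_on \<Omega>. 0 \<le> (?g y \<bullet> (C y *v ?g y)) / a"
        using posdef
      proof eventually_elim
        case (elim y)
        have "0 \<le> ?g y \<bullet> (C y *v ?g y)"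
          using elim unfolding positive_definite_def by (cases "?g y = 0") (auto intro: less_imp_le)
        then show ?case using ab by simp
      qed
    qed
    also have "\<dots> = ennreal (h0 \<Omega> C (\<phi> n) / a)" using h0_energy(2)[OF C \<phi>U op] by simp
    also have "\<dots> \<le> ennreal E" using n ab by (intro ennreal_leI) (simp add: E_def divide_right_mono)
    finally show ?thesis .
  qed
  have "(\<lambda>j. L * (1/2 :: real) ^ j) \<longlonglongrightarrow> L * 0" by (intro tendsto_intros LIMSEQ_power_zero) simp
  then have "\<forall>\<^sub>F j in sequentially. L * (1/2 :: real) ^ j < min 1 r0"
    using ab by (intro order_tendstoD(2)) auto
  then obtain j2 where j2: "\<And>j. j \<ge> j2 \<Longrightarrow> L * (1/2 :: real) ^ j < min 1 r0"
    by (auto simp: eventually_sequentially)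
  \<comment> \<open>Half of the value \<omega>/2 times \<open>m0\<close> that the lower bound on the
    first balls forces.\<close>
  define e where "e = \<omega> / 2 * m0 / 2"
  have e: "e > 0" using \<omega> m0 by (simp add: e_def)
  have up: "emeasure \<nu> (ball x r) \<le> ennreal (c * r powr s)"
    if "x \<in> \<Gamma> \<inter> ball z \<rho>" "0 < r" "r < 2 * \<rho>" for x r using \<nu>b that by blast
  have chD: "D j \<in> sets borel" "D j \<subseteq> closure \<Omega>" for j
    using ch unfolding chains_to_boundary_def by blast+
  have chn: "dist (P j x) x \<le> L * (1/2) ^ j" "ball (P j x) (\<kappa> * (1/2) ^ j) \<subseteq> closure \<Omega>"
    if "x \<in> \<Gamma> \<inter> ball z \<rho>" "j \<ge> j1" for x j
    using ch that unfolding chains_to_boundary_def \<Gamma>_def by blast+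
  have "\<exists>j0\<ge>max j1 j2. \<forall>v m. v \<in> test_functions (- \<Gamma>) \<longrightarrow>
    (\<forall>j\<ge>j0. (\<integral>\<^sup>+y. indicator (D j \<inter> {y \<in> ball z (\<rho> + 1). infdist y \<Gamma> < L * (1/2) ^ j}) y *
        ennreal (infdist y \<Gamma> powr \<delta> * (norm (gradient v y))\<^sup>2) \<partial>lborel) \<le> ennreal E) \<longrightarrow>
    (\<forall>x\<in>\<Gamma> \<inter> ball z \<rho>. ennreal m \<le> (\<integral>\<^sup>+h. indicator (ball 0 1) h * ennreal \<bar>v (P j0 x + (\<kappa> * (1/2) ^ j0) *\<^sub>R h)\<bar> \<partial>lborel)) \<longrightarrow>
    ennreal m * emeasure \<nu> (space \<nu>) \<le> ennreal e"
  proof (rule chain_capacity[OF \<Gamma> \<nu> c up pos(1-3) E e pos(4,5) \<delta> chD(1)])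
    fix x j and v :: "real^'d \<Rightarrow> real" assume xj: "x \<in> \<Gamma> \<inter> ball z \<rho>" "max j1 j2 \<le> j" and v: "Ck (Suc 0) v"
    show "(\<integral>\<^sup>+h. indicator (ball 0 1) h *
         ennreal \<bar>v (P j x + (\<kappa> * (1/2) ^ j) *\<^sub>R h) - v (P (Suc j) x + (\<kappa> * (1/2) ^ Suc j) *\<^sub>R h)\<bar> \<partial>lborel)
      \<le> ennreal (M * ((1/2) ^ j) powr (1 - real CARD('d))) *
         (\<integral>\<^sup>+y. indicator (D j \<inter> ball x (L * (1/2) ^ j)) y * ennreal (norm (gradient v y)) \<partial>lborel)"
      using ch xj v unfolding chains_to_boundary_def \<Gamma>_def by (meson max.bounded_iff)
  next
    fix j assume "max j1 j2 \<le> j"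
    then show "(\<integral>\<^sup>+y. indicator (D j \<inter> {y \<in> ball z (\<rho> + 1). infdist y \<Gamma> < L * (1/2) ^ j}) y * ennreal (infdist y \<Gamma> powr (- \<delta>)) \<partial>lborel)
      \<le> ennreal (N * ((1/2) ^ j) powr (real CARD('d) - s - \<delta>))"
      using ch unfolding chains_to_boundary_def \<Gamma>_def by (meson max.bounded_iff)
  next
    fix x j assume "x \<in> \<Gamma> \<inter> ball z \<rho>" "max j1 j2 \<le> j"
    then show "dist (P j x) x \<le> L * (1/2) ^ j" using chn(1)[of x j] by simp
  qed
  then obtain j0 where j0: "j0 \<ge> max j1 j2" and main: "\<And>v m. v \<in> test_functions (- \<Gamma>) \<Longrightarrow>
    (\<And>j. j \<ge> j0 \<Longrightarrow> (\<integral>\<^sup>+y. indicator (D j \<inter> {y \<in> ball z (\<rho> + 1). infdist y \<Gamma> < L * (1/2) ^ j}) y *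
        ennreal (infdist y \<Gamma> powr \<delta> * (norm (gradient v y))\<^sup>2) \<partial>lborel) \<le> ennreal E) \<Longrightarrow>
    (\<And>x. x \<in> \<Gamma> \<inter> ball z \<rho> \<Longrightarrow> ennreal m \<le> (\<integral>\<^sup>+h. indicator (ball 0 1) h * ennreal \<bar>v (P j0 x + (\<kappa> * (1/2) ^ j0) *\<^sub>R h)\<bar> \<partial>lborel)) \<Longrightarrow>
    ennreal m * emeasure \<nu> (space \<nu>) \<le> ennreal e"
    by (elim exE conjE) blast
  define k where "k = \<kappa> * (1/2) ^ j0"
  have k: "0 < k" "k \<le> \<kappa>" using pos by (auto simp: k_def mult_left_le power_le_one)
  \<comment> \<open>Rescaling \<open>ball (P j0 x) k\<close> to the unit ball divides by k to the
    dimension, so the squared L2 error becomes at most \<omega>/16. Multiplied by 4 and added to the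
    \<omega>/4 of the elementary inequality below, it uses up half of \<omega>.\<close>
  define \<tau> where "\<tau> = \<omega> * k ^ CARD('d) / 16"
  have \<tau>: "\<tau> > 0" using \<omega> k by (simp add: \<tau>_def)
  have "\<forall>\<^sub>F n in sequentially. (LINT x|lebesgue_on \<Omega>. (\<phi> n x - \<psi> x)\<^sup>2) < \<tau>"
    using \<phi>L \<tau> by (rule order_tendstoD(2))
  moreover have "\<forall>\<^sub>F n in sequentially. h0 \<Omega> C (\<phi> n) < \<bar>q\<bar> + 1"
    by (rule order_tendstoD(2)[OF \<phi>q]) simp
  ultimately have "\<forall>\<^sub>F n in sequentially. (LINT x|lebesgue_on \<Omega>. (\<phi> n x - \<psi> x)\<^sup>2) < \<tau> \<and> h0 \<Omega> C (\<phi> n) < \<bar>q\<bar> + 1"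
    by eventually_elim auto
  then obtain n where n: "(LINT x|lebesgue_on \<Omega>. (\<phi> n x - \<psi> x)\<^sup>2) < \<tau>" "h0 \<Omega> C (\<phi> n) < \<bar>q\<bar> + 1"
    using eventually_happens by force
  define f where "f x = \<phi> n x - \<psi> x" for x
  have ft: "f \<in> test_functions UNIV" unfolding f_def by (rule test_functions_diff[OF \<phi>U \<psi>t])
  note [measurable] = test_function_measurable[OF ft] test_function_measurable[OF \<phi>U]
  have fL: "(\<integral>\<^sup>+x. ennreal ((f x)\<^sup>2) \<partial>lebesgue_on \<Omega>) \<le> ennreal \<tau>"
  proof -
    have "(\<lambda>x. f x * f x) \<in> test_functions UNIV"
      using test_functions_Ck[OF ft] by (intro test_functions_mult ft)
    then have "integrable (lebesgue_on \<Omega>) (\<lambda>x. (f x)\<^sup>2)"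
      using integrable_lebesgue_on[OF test_function_integrable borel_open[OF op]] by (simp add: power2_eq_square)
    then show ?thesis
      using n(1) by (subst nn_integral_eq_integral) (auto simp: f_def intro: ennreal_leI)
  qed
  have low: "ennreal (\<omega> / 2) \<le> (\<integral>\<^sup>+h. indicator (ball 0 1) h * ennreal \<bar>\<phi> n (P j0 x + k *\<^sub>R h)\<bar> \<partial>lborel)"
    if x: "x \<in> \<Gamma> \<inter> ball z \<rho>" for x
  proof -
    let ?I = "\<integral>\<^sup>+h. indicator (ball 0 1) h * ennreal \<bar>\<phi> n (P j0 x + k *\<^sub>R h)\<bar> \<partial>lborel"
    let ?B = "ball (P j0 x) k"
    have near: "dist (P j0 x) x \<le> L * (1/2) ^ j0" "?B \<subseteq> closure \<Omega>"
      using chn[OF x, of j0] j0 by (auto simp: k_def simp del: mem_ball)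
    have nL: "dist (P j0 x) x \<le> L"
    proof -
      have "L * (1/2) ^ j0 \<le> L" using pos by (simp add: mult_left_le power_le_one)
      then show ?thesis using near(1) by linarith
    qed
    \<comment> \<open>With f = \<phi> - \<psi> and \<psi> = 1 on the ball, 1 <= |\<phi>| + |f|; the
      second summand is linearised by |f| <= 1/4 + 4 f^2.\<close>
    have pw: "indicator (ball 0 1) h * ennreal 1 \<le> indicator (ball 0 1) h * ennreal \<bar>\<phi> n (P j0 x + k *\<^sub>R h)\<bar> +
       (ennreal (1/4) * indicator (ball 0 1) h + ennreal 4 * (indicator ?B (P j0 x + k *\<^sub>R h) * ennreal ((f (P j0 x + k *\<^sub>R h))\<^sup>2)))" for h
    proof (cases "h \<in> ball 0 1")
      case True
      let ?y = "P j0 x + k *\<^sub>R h"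
      have kh: "norm (k *\<^sub>R h) < k" using True k by simp
      have yB: "?y \<in> ?B" using kh by (simp add: dist_norm)
      have "dist z ?y < R - 1"
      proof -
        have "dist (P j0 x) ?y < k" using yB by (simp only: mem_ball)
        moreover have "dist z x < \<rho>" using x by simp
        moreover have "dist x (P j0 x) \<le> L" using nL by (simp only: dist_commute)
        ultimately show ?thesis
          using dist_triangle[of z ?y x] dist_triangle[of x ?y "P j0 x"] k(2) unfolding R_def by linarith
      qed
      then have p1: "\<psi> ?y = 1" by (rule one)
      have "0 \<le> (2 * \<bar>f ?y\<bar> - 1/2)\<^sup>2" by simp
      then have "\<bar>f ?y\<bar> \<le> 1/4 + 4 * (f ?y)\<^sup>2" by (simp add: power2_eq_square algebra_simps abs_mult_self_eq)
      then have "1 \<le> \<bar>\<phi> n ?y\<bar> + (1/4 + 4 * (f ?y)\<^sup>2)" using p1 by (simp add: f_def)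
      then have "ennreal 1 \<le> ennreal (\<bar>\<phi> n ?y\<bar> + (1/4 + 4 * (f ?y)\<^sup>2))" by (rule ennreal_leI)
      also have "\<dots> = ennreal \<bar>\<phi> n ?y\<bar> + (ennreal (1/4) + ennreal 4 * ennreal ((f ?y)\<^sup>2))"
        by (simp add: ennreal_mult')
      finally show ?thesis using True yB by (simp del: mem_ball)
    qed simp
    define T where "T = (\<integral>\<^sup>+h. indicator ?B (P j0 x + k *\<^sub>R h) * ennreal ((f (P j0 x + k *\<^sub>R h))\<^sup>2) \<partial>lborel)"
    have [measurable]: "?B \<in> sets borel" "ball (0 :: real^'d) 1 \<in> sets borel" by auto
    have "ennreal (k ^ CARD('d)) * T = (\<integral>\<^sup>+y. indicator ?B y * ennreal ((f y)\<^sup>2) \<partial>lborel)"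
      unfolding T_def using k(1) by (subst nn_integral_affine[of _ k "P j0 x"]) auto
    also have "\<dots> \<le> (\<integral>\<^sup>+y. ennreal ((f y)\<^sup>2) \<partial>lebesgue_on \<Omega>)"
      by (rule nn_integral_le_lebesgue_on[OF op null]) (use near in auto)
    also have "\<dots> \<le> ennreal \<tau>" by (rule fL)
    finally have "ennreal (k ^ CARD('d)) * T \<le> ennreal \<tau>" .
    then have "ennreal (1 / k ^ CARD('d)) * (ennreal (k ^ CARD('d)) * T) \<le> ennreal (1 / k ^ CARD('d)) * ennreal \<tau>"
      by (rule mult_left_mono) simp
    then have T: "T \<le> ennreal (\<omega> / 16)"
      using k(1) \<omega> by (simp add: mult.assoc[symmetric] ennreal_mult'[symmetric] \<tau>_def)
    have "ennreal \<omega> = (\<integral>\<^sup>+h. indicator (ball (0 :: real^'d) 1) h * ennreal 1 \<partial>lborel)"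
      by (simp add: \<omega>e)
    also have "\<dots> \<le> (\<integral>\<^sup>+h. indicator (ball 0 1) h * ennreal \<bar>\<phi> n (P j0 x + k *\<^sub>R h)\<bar> +
       (ennreal (1/4) * indicator (ball 0 1) h + ennreal 4 * (indicator ?B (P j0 x + k *\<^sub>R h) * ennreal ((f (P j0 x + k *\<^sub>R h))\<^sup>2))) \<partial>lborel)"
      by (rule nn_integral_mono) (rule pw)
    also have "\<dots> = ?I + (ennreal (1/4) * ennreal \<omega> + ennreal 4 * T)"
      unfolding T_def by (simp add: nn_integral_add nn_integral_cmult \<omega>e del: mem_ball)
    also have "\<dots> \<le> ?I + (ennreal (1/4) * ennreal \<omega> + ennreal 4 * ennreal (\<omega> / 16))"
      by (intro add_left_mono mult_left_mono T) auto
    also have "ennreal (1/4) * ennreal \<omega> = ennreal (1/4 * \<omega>)"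
      by (rule ennreal_mult'[symmetric]) simp
    also have "ennreal 4 * ennreal (\<omega> / 16) = ennreal (4 * (\<omega> / 16))"
      by (rule ennreal_mult'[symmetric]) simp
    also have "ennreal (1/4 * \<omega>) + ennreal (4 * (\<omega> / 16)) = ennreal (1/4 * \<omega> + 4 * (\<omega> / 16))"
      using \<omega> by (intro ennreal_plus[symmetric]) auto
    also have "1/4 * \<omega> + 4 * (\<omega> / 16) = \<omega> / 2" by simp
    finally have I: "ennreal \<omega> \<le> ?I + ennreal (\<omega> / 2)" .
    show ?thesis
    proof (cases ?I)
      case (real i)
      then have "ennreal \<omega> \<le> ennreal (i + \<omega> / 2)" using I \<omega> by simp
      then have "\<omega> / 2 \<le> i" using \<omega> real(1) by (subst (asm) ennreal_le_iff) auto
      then show ?thesis unfolding real(2) by (rule ennreal_leI)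
    qed simp
  qed
  have "ennreal (\<omega> / 2) * emeasure \<nu> (space \<nu>) \<le> ennreal e"
  proof (rule main[OF \<phi>\<Gamma>[of n]])
    fix j assume j: "j \<ge> j0"
    show "(\<integral>\<^sup>+y. indicator (D j \<inter> {y \<in> ball z (\<rho> + 1). infdist y \<Gamma> < L * (1/2) ^ j}) y *
        ennreal (infdist y \<Gamma> powr \<delta> * (norm (gradient (\<phi> n) y))\<^sup>2) \<partial>lborel) \<le> ennreal E"
      unfolding W_def[symmetric]
    proof (rule energy[OF chD])
      show "L * (1/2) ^ j \<le> min 1 r0" using j2[of j] j j0 by simp
      show "h0 \<Omega> C (\<phi> n) \<le> \<bar>q\<bar> + 1" using n(2) by simp
    qed
  next
    fix x assume "x \<in> \<Gamma> \<inter> ball z \<rho>"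
    then show "ennreal (\<omega> / 2) \<le> (\<integral>\<^sup>+h. indicator (ball 0 1) h * ennreal \<bar>\<phi> n (P j0 x + (\<kappa> * (1/2) ^ j0) *\<^sub>R h)\<bar> \<partial>lborel)"
      using low unfolding k_def by blast
  qed
  moreover have "ennreal (\<omega> / 2) * emeasure \<nu> (space \<nu>) = ennreal (\<omega> / 2 * m0)"
    unfolding \<nu>.emeasure_eq_measure m0_def[symmetric] using \<omega> by (intro ennreal_mult'[symmetric]) auto
  ultimately have "\<omega> / 2 * m0 \<le> e"
    using e by (metis ennreal_le_iff less_imp_le)
  then show False using \<omega> m0 by (simp add: e_def)
qed

section \<open>Convergence of energies\<close>

text \<open>Nonnegativity of the form at \<open>e *\<^sub>R a - b\<close>. The free weight
  \<open>e\<close> gives the triangle inequality of the energy seminorm at the level of integrands,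
  without square roots.\<close>

lemma quadratic_split:
  fixes A :: "real^'d^'d"
  assumes nn: "\<And>v. 0 \<le> v \<bullet> (A *v v)" and e: "e > 0"
  shows "(a + b) \<bullet> (A *v (a + b)) \<le> (1 + e) * (a \<bullet> (A *v a)) + (1 + 1 / e) * (b \<bullet> (A *v b))"
proof -
  have lin: "A *v (e *\<^sub>R a - b) = e *\<^sub>R (A *v a) - A *v b"
    by (simp add: matrix_vector_mult_diff_distrib linear_scale[OF matrix_vector_mul_linear])
  have "0 \<le> (e *\<^sub>R a - b) \<bullet> (A *v (e *\<^sub>R a - b))" by (rule nn)
  also have "\<dots> = e * (e * (a \<bullet> (A *v a))) - e * (a \<bullet> (A *v b) + b \<bullet> (A *v a)) + b \<bullet> (A *v b)"
    unfolding lin by (simp add: inner_diff_left inner_diff_right algebra_simps)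
  finally have "e * (a \<bullet> (A *v b) + b \<bullet> (A *v a)) \<le> e * (e * (a \<bullet> (A *v a)) + b \<bullet> (A *v b) / e)"
    using e by (simp add: distrib_left)
  then have "a \<bullet> (A *v b) + b \<bullet> (A *v a) \<le> e * (a \<bullet> (A *v a)) + b \<bullet> (A *v b) / e"
    using e by simp
  moreover have "(a + b) \<bullet> (A *v (a + b)) = a \<bullet> (A *v a) + (a \<bullet> (A *v b) + b \<bullet> (A *v a)) + b \<bullet> (A *v b)"
    by (simp add: matrix_vector_right_distrib inner_add_left inner_add_right)
  ultimately show ?thesis by (simp add: distrib_right)
qed

lemma positive_definite_nonneg: "positive_definite A \<Longrightarrow> 0 \<le> v \<bullet> (A *v v)"
  unfolding positive_definite_def by (cases "v = 0") (auto intro: less_imp_le)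

text \<open>The form attains a positive minimum on the unit sphere. The constant belongs to one
  matrix; it gives control at a single point, not uniformly over the domain.\<close>

lemma positive_definite_lower:
  fixes A :: "real^'d^'d"
  assumes "positive_definite A"
  shows "\<exists>c>0. \<forall>v. c * (norm v)\<^sup>2 \<le> v \<bullet> (A *v v)"
proof -
  have "continuous_on (sphere (0 :: real^'d) 1) (\<lambda>v. v \<bullet> (A *v v))"
    by (intro continuous_intros linear_continuous_on linear_linear[THEN iffD2] matrix_vector_mul_linear)
  moreover have "sphere (0 :: real^'d) 1 \<noteq> {}" by simp
  ultimately obtain w where w: "w \<in> sphere 0 1" "\<And>v. v \<in> sphere 0 1 \<Longrightarrow> w \<bullet> (A *v w) \<le> v \<bullet> (A *v v)"
    using continuous_attains_inf[OF compact_sphere] by blast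
  have "w \<noteq> 0" using w(1) by auto
  then have "w \<bullet> (A *v w) > 0" using assms by (simp add: positive_definite_def)
  moreover have "(w \<bullet> (A *v w)) * (norm v)\<^sup>2 \<le> v \<bullet> (A *v v)" for v
  proof (cases "v = 0")
    case False
    define u where "u = (1 / norm v) *\<^sub>R v"
    have u: "u \<in> sphere 0 1" "v = norm v *\<^sub>R u" using False by (auto simp: u_def)
    have "v \<bullet> (A *v v) = (norm v *\<^sub>R u) \<bullet> (A *v (norm v *\<^sub>R u))" using u(2) by simp
    also have "\<dots> = (norm v)\<^sup>2 * (u \<bullet> (A *v u))"
      by (simp add: linear_scale[OF matrix_vector_mul_linear] power2_eq_square del: norm_scaleR)
    finally show ?thesis using w(2)[OF u(1)] by (simp add: mult.commute mult_right_mono)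
  qed simp
  ultimately show ?thesis by blast
qed

lemma integral_tendsto_of_energy:
  fixes B :: "'a \<Rightarrow> real^'d^'d" and g :: "'a \<Rightarrow> real^'d" and G :: "nat \<Rightarrow> 'a \<Rightarrow> real^'d"
  assumes pd: "AE x in M. positive_definite (B x)"
    and g: "integrable M (\<lambda>x. g x \<bullet> (B x *v g x))"
    and G: "\<And>n. integrable M (\<lambda>x. G n x \<bullet> (B x *v G n x))"
    and D: "\<And>n. integrable M (\<lambda>x. (G n x - g x) \<bullet> (B x *v (G n x - g x)))"
    and lim: "(\<lambda>n. LINT x|M. (G n x - g x) \<bullet> (B x *v (G n x - g x))) \<longlonglongrightarrow> 0"
  shows "(\<lambda>n. LINT x|M. G n x \<bullet> (B x *v G n x)) \<longlonglongrightarrow> (LINT x|M. g x \<bullet> (B x *v g x))"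
proof -
  define y where "y = (LINT x|M. g x \<bullet> (B x *v g x))"
  define X where "X n = (LINT x|M. G n x \<bullet> (B x *v G n x))" for n
  define d where "d n = (LINT x|M. (G n x - g x) \<bullet> (B x *v (G n x - g x)))" for n
  have y0: "0 \<le> y" unfolding y_def
    by (rule integral_nonneg_AE) (use pd in eventually_elim, rule positive_definite_nonneg)
  have up: "X n \<le> (1 + e) * y + (1 + 1 / e) * d n" if e: "e > 0" for e n
  proof -
    have "X n \<le> (LINT x|M. (1 + e) * (g x \<bullet> (B x *v g x)) + (1 + 1 / e) * ((G n x - g x) \<bullet> (B x *v (G n x - g x))))"
      unfolding X_def
    proof (rule integral_mono_AE)
      show "AE x in M. G n x \<bullet> (B x *v G n x) \<le> (1 + e) * (g x \<bullet> (B x *v g x)) + (1 + 1 / e) * ((G n x - g x) \<bullet> (B x *v (G n x - g x)))"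
        using pd
      proof eventually_elim
        case (elim x)
        show ?case using quadratic_split[OF positive_definite_nonneg[OF elim] e, of "g x" "G n x - g x"] by simp
      qed
    qed (use g G D in auto)
    then show ?thesis using g D by (simp add: y_def d_def)
  qed
  have low: "y \<le> (1 + e) * X n + (1 + 1 / e) * d n" if e: "e > 0" for e n
  proof -
    have "y \<le> (LINT x|M. (1 + e) * (G n x \<bullet> (B x *v G n x)) + (1 + 1 / e) * ((G n x - g x) \<bullet> (B x *v (G n x - g x))))"
      unfolding y_def
    proof (rule integral_mono_AE)
      show "AE x in M. g x \<bullet> (B x *v g x) \<le> (1 + e) * (G n x \<bullet> (B x *v G n x)) + (1 + 1 / e) * ((G n x - g x) \<bullet> (B x *v (G n x - g x)))"
        using pd
      proof eventually_elim
        case (elim x)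
        have m: "A *v (- v) = - (A *v v)" for A :: "real^'d^'d" and v
          by (rule linear_neg[OF matrix_vector_mul_linear])
        have "(g x - G n x) \<bullet> (B x *v (g x - G n x)) = (G n x - g x) \<bullet> (B x *v (G n x - g x))"
        proof -
          have e1: "g x - G n x = - (G n x - g x)" by simp
          show ?thesis unfolding e1 m inner_minus_left inner_minus_right minus_minus ..
        qed
        then show ?case using quadratic_split[OF positive_definite_nonneg[OF elim] e, of "G n x" "g x - G n x"] by simp
      qed
    qed (use g G D in auto)
    then show ?thesis using G D by (simp add: X_def d_def)
  qed
  have "X \<longlonglongrightarrow> y"
    unfolding LIMSEQ_iff
  proof (intro allI impI)
    fix \<epsilon> :: real assume \<epsilon>: "\<epsilon> > 0"
    \<comment> \<open>\<open>Y\<close> bounds \<open>y\<close> and, once the upper estimate is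
      known, also \<open>X n\<close>; so the single choice e Y = \<epsilon>/4 absorbs the error term
      in both directions.\<close>
    define Y where "Y = y + \<epsilon> + 1"
    have Y: "Y > 0" using y0 \<epsilon> by (simp add: Y_def)
    define e where "e = \<epsilon> / (4 * Y)"
    have e: "e > 0" using Y \<epsilon> by (simp add: e_def)
    have ey: "e * Y = \<epsilon> / 4" using Y by (simp add: e_def)
    define k where "k n = (1 + 1 / e) * d n" for n
    have "k \<longlonglongrightarrow> (1 + 1 / e) * 0"
      using lim unfolding k_def d_def by (intro tendsto_mult tendsto_const)
    then have "\<forall>\<^sub>F n in sequentially. k n < \<epsilon> / 4"
      using \<epsilon> by (intro order_tendstoD(2)) auto
    then obtain n0 where n0: "\<And>n. n \<ge> n0 \<Longrightarrow> k n < \<epsilon> / 4"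
      by (auto simp: eventually_sequentially)
    have "norm (X n - y) < \<epsilon>" if n: "n \<ge> n0" for n
    proof -
      have "e * y \<le> e * Y" using e \<epsilon> by (intro mult_left_mono) (auto simp: Y_def)
      moreover have "X n \<le> y + e * y + k n" using up[OF e, of n] unfolding k_def by (simp add: distrib_right)
      ultimately have 1: "X n < y + \<epsilon>" using n0[OF n] ey \<epsilon> by linarith
      then have "e * X n \<le> e * Y" using e by (intro mult_left_mono) (auto simp: Y_def)
      moreover have "y \<le> X n + e * X n + k n" using low[OF e, of n] unfolding k_def by (simp add: distrib_right)
      ultimately have "y < X n + \<epsilon>" using n0[OF n] ey \<epsilon> by linarith
      with 1 show ?thesis by simp
    qed
    then show "\<exists>no. \<forall>n\<ge>no. norm (X n - y) < \<epsilon>" by blast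
  qed
  then show ?thesis unfolding X_def y_def .
qed

lemma L2_product:
  fixes f h :: "'a \<Rightarrow> real"
  assumes f: "f \<in> borel_measurable M" "integrable M (\<lambda>x. (f x)\<^sup>2)"
    and h: "h \<in> borel_measurable M" "integrable M (\<lambda>x. (h x)\<^sup>2)"
  shows "integrable M (\<lambda>x. f x * h x)"
    and "e > 0 \<Longrightarrow> \<bar>LINT x|M. f x * h x\<bar> \<le> e * (LINT x|M. (h x)\<^sup>2) + (LINT x|M. (f x)\<^sup>2) / e"
proof -
  have pw: "\<bar>f x * h x\<bar> \<le> e * (h x)\<^sup>2 + (f x)\<^sup>2 / e" if e: "e > 0" for e x
  proof -
    have "0 \<le> (e * \<bar>h x\<bar> - \<bar>f x\<bar>)\<^sup>2 + e * \<bar>h x\<bar> * \<bar>f x\<bar>" using e by simp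
    then have "e * \<bar>f x * h x\<bar> \<le> e * (e * (h x)\<^sup>2) + (f x)\<^sup>2"
      by (simp add: power2_eq_square algebra_simps abs_mult)
    also have "\<dots> = e * (e * (h x)\<^sup>2 + (f x)\<^sup>2 / e)" using e by (simp add: distrib_left)
    finally show ?thesis using e by simp
  qed
  show i: "integrable M (\<lambda>x. f x * h x)"
  proof (rule Bochner_Integration.integrable_bound[where f="\<lambda>x. 1 * (h x)\<^sup>2 + (f x)\<^sup>2 / 1"])
    show "AE x in M. norm (f x * h x) \<le> norm (1 * (h x)\<^sup>2 + (f x)\<^sup>2 / 1)"
      using pw[of 1] by (intro AE_I2) force
  qed (use f h in auto)
  show "\<bar>LINT x|M. f x * h x\<bar> \<le> e * (LINT x|M. (h x)\<^sup>2) + (LINT x|M. (f x)\<^sup>2) / e" if e: "e > 0"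
  proof -
    have "\<bar>LINT x|M. f x * h x\<bar> \<le> (LINT x|M. \<bar>f x * h x\<bar>)" by (rule integral_abs_bound)
    also have "\<dots> \<le> (LINT x|M. e * (h x)\<^sup>2 + (f x)\<^sup>2 / e)"
      by (rule Bochner_Integration.integral_mono) (use i f h pw[OF e] in auto)
    also have "\<dots> = e * (LINT x|M. (h x)\<^sup>2) + (LINT x|M. (f x)\<^sup>2) / e" using f h by simp
    finally show ?thesis .
  qed
qed

lemma L2_tendsto_zero:
  fixes f :: "nat \<Rightarrow> 'a \<Rightarrow> real" and h :: "'a \<Rightarrow> real"
  assumes f: "\<And>n. f n \<in> borel_measurable M" "\<And>n. integrable M (\<lambda>x. (f n x)\<^sup>2)"
    and lim: "(\<lambda>n. LINT x|M. (f n x)\<^sup>2) \<longlonglongrightarrow> 0"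
    and h: "h \<in> borel_measurable M" "integrable M (\<lambda>x. (h x)\<^sup>2)"
  shows "(\<lambda>n. LINT x|M. f n x * h x) \<longlonglongrightarrow> 0"
  unfolding LIMSEQ_iff
proof (intro allI impI)
  fix \<epsilon> :: real assume \<epsilon>: "\<epsilon> > 0"
  define H where "H = (LINT x|M. (h x)\<^sup>2)"
  have H: "H \<ge> 0" by (simp add: H_def)
  define e where "e = \<epsilon> / (2 * (H + 1))"
  have e: "e > 0" using \<epsilon> H by (simp add: e_def)
  have eH: "e * H < \<epsilon> / 2"
  proof -
    have "e * H < e * (H + 1)" using e by simp
    also have "\<dots> = \<epsilon> / 2" using H by (simp add: e_def field_simps)
    finally show ?thesis .
  qed
  have "\<forall>\<^sub>F n in sequentially. (LINT x|M. (f n x)\<^sup>2) < e * (\<epsilon> / 2)"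
    using lim e \<epsilon> by (intro order_tendstoD(2)) auto
  then obtain n0 where n0: "\<And>n. n \<ge> n0 \<Longrightarrow> (LINT x|M. (f n x)\<^sup>2) < e * (\<epsilon> / 2)"
    by (auto simp: eventually_sequentially)
  have "norm ((LINT x|M. f n x * h x) - 0) < \<epsilon>" if "n \<ge> n0" for n
  proof -
    have "(LINT x|M. (f n x)\<^sup>2) / e < \<epsilon> / 2" using n0[OF that] e by (simp add: divide_less_eq mult.commute)
    then show ?thesis
      using L2_product(2)[OF f(1)[of n] f(2)[of n] h e] eH
      unfolding H_def real_norm_def diff_0_right by linarith
  qed
  then show "\<exists>no. \<forall>n\<ge>no. norm ((LINT x|M. f n x * h x) - 0) < \<epsilon>" by blast
qed

lemma integrable_lebesgue_on_subset:
  fixes f :: "'a::euclidean_space \<Rightarrow> real"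
  assumes "integrable (lebesgue_on \<Omega>) f" "\<Omega> \<in> sets lebesgue" "K \<in> sets lebesgue" "K \<subseteq> \<Omega>"
  shows "integrable (lebesgue_on K) f"
proof -
  have "set_integrable lebesgue \<Omega> f"
    using assms by (simp add: integrable_restrict_space set_integrable_def)
  then have "set_integrable lebesgue K f" by (rule set_integrable_subset[OF _ assms(3,4)])
  then show ?thesis using assms by (simp add: integrable_restrict_space set_integrable_def)
qed

lemma integral_lebesgue_on_subset:
  fixes f :: "'a::euclidean_space \<Rightarrow> real"
  assumes "\<Omega> \<in> sets lebesgue" "K \<in> sets lebesgue" "K \<subseteq> \<Omega>" "\<And>x. x \<notin> K \<Longrightarrow> f x = 0"
  shows "(LINT x|lebesgue_on \<Omega>. f x) = (LINT x|lebesgue_on K. f x)"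
proof -
  have "(\<lambda>x. indicator \<Omega> x *\<^sub>R f x) = (\<lambda>x. indicator K x *\<^sub>R f x)"
    using assms(3,4) by (fastforce simp: indicator_def)
  then show ?thesis using assms by (simp add: integral_restrict_space)
qed

lemma integral_lebesgue_on_subset_le:
  fixes f g :: "'a::euclidean_space \<Rightarrow> real"
  assumes O: "\<Omega> \<in> sets lebesgue" "K \<in> sets lebesgue" "K \<subseteq> \<Omega>"
    and g: "integrable (lebesgue_on \<Omega>) g" "AE x in lebesgue_on \<Omega>. 0 \<le> g x"
    and f: "f \<in> borel_measurable (lebesgue_on K)" "AE x in lebesgue_on K. 0 \<le> f x \<and> f x \<le> g x"
  shows "integrable (lebesgue_on K) f" "(LINT x|lebesgue_on K. f x) \<le> (LINT x|lebesgue_on \<Omega>. g x)"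
proof -
  have gK: "integrable (lebesgue_on K) g" by (rule integrable_lebesgue_on_subset[OF g(1) O])
  show fK: "integrable (lebesgue_on K) f"
  proof (rule Bochner_Integration.integrable_bound[OF gK f(1)])
    show "AE x in lebesgue_on K. norm (f x) \<le> norm (g x)"
      using f(2) by eventually_elim auto
  qed
  have "(LINT x|lebesgue_on K. f x) \<le> (LINT x|lebesgue_on K. g x)"
  proof (rule integral_mono_AE[OF fK gK])
    show "AE x in lebesgue_on K. f x \<le> g x" using f(2) by eventually_elim auto
  qed
  also have "\<dots> = (LINT x|lebesgue. indicator K x *\<^sub>R g x)" using O by (simp add: integral_restrict_space)
  also have "\<dots> \<le> (LINT x|lebesgue. indicator \<Omega> x *\<^sub>R g x)"
  proof (rule integral_mono_AE)
    have "AE x in lebesgue. x \<in> \<Omega> \<longrightarrow> 0 \<le> g x" using g(2) O by (simp add: AE_restrict_space_iff)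
    then show "AE x in lebesgue. indicator K x *\<^sub>R g x \<le> indicator \<Omega> x *\<^sub>R g x"
      by eventually_elim (use O(3) in \<open>auto simp: indicator_def\<close>)
  qed (use g(1) gK O in \<open>simp_all add: integrable_restrict_space\<close>)
  also have "\<dots> = (LINT x|lebesgue_on \<Omega>. g x)" using O by (simp add: integral_restrict_space)
  finally show "(LINT x|lebesgue_on K. f x) \<le> (LINT x|lebesgue_on \<Omega>. g x)" .
qed

section \<open>Completeness of the energy, and the minimal form as a restriction of the maximal
  one\<close>

lemma energy_measurable:
  fixes C :: "real^'d \<Rightarrow> real^'d^'d"
  assumes C: "admissible_coefficients \<Omega> C" and g: "\<And>k. (\<lambda>x. g x $ k) \<in> borel_measurable (lebesgue_on \<Omega>)"
  shows "(\<lambda>x. g x \<bullet> (C x *v g x)) \<in> borel_measurable (lebesgue_on \<Omega>)"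
proof -
  have "(\<lambda>x. C x $ k $ l) \<in> borel_measurable (lebesgue_on \<Omega>)" for k l
    using C by (auto simp: admissible_coefficients_def L_infinity_def)
  then show ?thesis unfolding quadratic_form_sum using g
    by (intro borel_measurable_sum borel_measurable_times) auto
qed

lemma lower_bound_on_compact:
  fixes C :: "real^'d \<Rightarrow> real^'d^'d"
  assumes C: "admissible_coefficients \<Omega> C" and K: "compact K" "K \<subseteq> \<Omega>"
  shows "\<exists>c>0. AE x in lebesgue_on K. \<forall>v. c * (norm v)\<^sup>2 \<le> v \<bullet> (C x *v v)"
proof -
  have "\<exists>c>0. AE x in lebesgue_on K. matrix_le (c *\<^sub>R mat 1) (C x)"
    using C K unfolding admissible_coefficients_def by simp
  then show ?thesis unfolding matrix_le_def quadratic_form_scalar .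
qed

lemma measurable_vec_nth:
  fixes f :: "'a \<Rightarrow> real^'d"
  assumes "f \<in> borel_measurable M"
  shows "(\<lambda>x. f x $ k) \<in> borel_measurable M"
proof -
  have "(\<lambda>v :: real^'d. v $ k) \<in> borel_measurable borel"
    by (intro borel_measurable_continuous_onI continuous_on_component continuous_on_id)
  then show ?thesis by (rule measurable_compose[OF assms])
qed

lemma summable_increments_convergent:
  fixes g :: "nat \<Rightarrow> 'a::banach"
  assumes "\<And>k. norm (g (Suc k) - g k) \<le> B * q ^ k" "0 < q" "q < 1"
  shows "convergent g"
proof -
  have "summable (\<lambda>k. B * q ^ k)" using assms by (intro summable_mult summable_geometric) auto
  then have "summable (\<lambda>k. g (Suc k) - g k)"
    by (rule summable_comparison_test[rotated]) (use assms(1) in auto)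
  then have "(\<lambda>n. \<Sum>k<n. g (Suc k) - g k) \<longlonglongrightarrow> (\<Sum>k. g (Suc k) - g k)" by (rule summable_LIMSEQ)
  then have "(\<lambda>n. (g n - g 0) + g 0) \<longlonglongrightarrow> (\<Sum>k. g (Suc k) - g k) + g 0"
    unfolding sum_lessThan_telescope by (intro tendsto_add tendsto_const)
  then show ?thesis by (auto simp: convergent_def)
qed

text \<open>
  A rapidly Cauchy sequence of gradients converges almost everywhere because the positive definite
  matrix controls the increments at each point.
\<close>

lemma energy_complete:
  fixes B :: "'a \<Rightarrow> real^'d^'d" and G :: "nat \<Rightarrow> 'a \<Rightarrow> real^'d"
  assumes pd: "AE x in M. positive_definite (B x)"
    and G: "\<And>n. G n \<in> borel_measurable M"
    and Qm: "\<And>f. f \<in> borel_measurable M \<Longrightarrow> (\<lambda>x. f x \<bullet> (B x *v f x)) \<in> borel_measurable M"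
    and i: "\<And>m n. integrable M (\<lambda>x. (G m x - G n x) \<bullet> (B x *v (G m x - G n x)))"
    and c: "\<And>m n. n \<le> m \<Longrightarrow> (LINT x|M. (G m x - G n x) \<bullet> (B x *v (G m x - G n x))) \<le> (1/4) ^ n"
  shows "\<exists>g. g \<in> borel_measurable M \<and> (\<forall>n. integrable M (\<lambda>x. (G n x - g x) \<bullet> (B x *v (G n x - g x))) \<and>
     (LINT x|M. (G n x - g x) \<bullet> (B x *v (G n x - g x))) \<le> (1/4) ^ n)"
proof -
  define Q where "Q x v = v \<bullet> (B x *v v)" for x v
  have Qnn: "AE x in M. \<forall>v. 0 \<le> Q x v"
    using pd by eventually_elim (auto simp: Q_def intro: positive_definite_nonneg)
  have Qc: "isCont (Q x) v" for x v
    unfolding Q_def by (intro continuous_intros linear_continuous_at linear_linear[THEN iffD2] matrix_vector_mul_linear)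
  \<comment> \<open>The n-th increment has integral at most 4^(-n), so the sum weighted by 2^n is
    still integrable and hence finite almost everywhere. At such a point the n-th increment is at
    most a constant times 2^(-n), and its norm at most a constant times the square root of
    this.\<close>
  define u where "u n x = Q x (G (Suc n) x - G n x)" for n x
  have u: "integrable M (u n)" "(LINT x|M. u n x) \<le> (1/4) ^ n" for n
    using i[of "Suc n" n] c[of n "Suc n"] by (simp_all add: u_def[abs_def] Q_def)
  have um [measurable]: "u n \<in> borel_measurable M" for n
    using u(1) by (rule borel_measurable_integrable)
  have unn: "AE x in M. 0 \<le> u n x" for n
    using Qnn by eventually_elim (simp add: u_def)
  have "(\<integral>\<^sup>+x. (\<Sum>n. ennreal (2 ^ n * u n x)) \<partial>M) = (\<Sum>n. \<integral>\<^sup>+x. ennreal (2 ^ n * u n x) \<partial>M)"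
    by (rule nn_integral_suminf) measurable
  also have "\<dots> \<le> (\<Sum>n. ennreal ((1/2) ^ n))"
  proof (rule suminf_le)
    fix n
    have "(\<integral>\<^sup>+x. ennreal (2 ^ n * u n x) \<partial>M) = ennreal (LINT x|M. 2 ^ n * u n x)"
      by (rule nn_integral_eq_integral) (use u(1)[of n] unn[of n] in auto)
    also have "\<dots> \<le> ennreal (2 ^ n * (1/4) ^ n)"
      using u(2)[of n] by (intro ennreal_leI) simp
    also have "(2 :: real) ^ n * (1/4) ^ n = (1/2) ^ n" by (simp add: power_mult_distrib[symmetric])
    finally show "(\<integral>\<^sup>+x. ennreal (2 ^ n * u n x) \<partial>M) \<le> ennreal ((1/2) ^ n)" .
  qed auto
  also have "\<dots> = ennreal (1 / (1 - 1/2))" by (intro suminf_ennreal_eq geometric_sums) auto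
  finally have "(\<integral>\<^sup>+x. (\<Sum>n. ennreal (2 ^ n * u n x)) \<partial>M) \<noteq> \<infinity>"
    using ennreal_less_top[of "1 / (1 - 1/2)"] by (auto simp: top_unique)
  then have fin: "AE x in M. (\<Sum>n. ennreal (2 ^ n * u n x)) \<noteq> \<infinity>"
    by (intro nn_integral_PInf_AE) auto
  have "AE x in M. convergent (\<lambda>n. G n x)"
    using fin pd Qnn
  proof eventually_elim
    case (elim x)
    obtain a where a: "a > 0" "\<And>v. a * (norm v)\<^sup>2 \<le> Q x v"
      using positive_definite_lower[OF elim(2)] unfolding Q_def by blast
    define S where "S = enn2real (\<Sum>n. ennreal (2 ^ n * u n x))"
    have Se: "(\<Sum>n. ennreal (2 ^ n * u n x)) = ennreal S"
      using elim(1) by (simp add: S_def less_top)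
    have S0: "S \<ge> 0" by (simp add: S_def)
    have uS: "2 ^ n * u n x \<le> S" for n
    proof -
      have "ennreal (2 ^ n * u n x) = (\<Sum>k\<in>{n}. ennreal (2 ^ k * u k x))" by simp
      also have "\<dots> \<le> (\<Sum>k. ennreal (2 ^ k * u k x))" by (rule sum_le_suminf) auto
      finally show ?thesis unfolding Se using S0 by (subst (asm) ennreal_le_iff) auto
    qed
    define q where "q = sqrt (1/2 :: real)"
    have q: "0 < q" "q < 1" "q\<^sup>2 = 1/2" by (auto simp: q_def real_sqrt_lt_1_iff)
    show ?case
    proof (rule summable_increments_convergent[OF _ q(1,2)])
      fix n
      have "(q ^ n)\<^sup>2 = (q\<^sup>2) ^ n" by (simp only: power_mult[symmetric] mult.commute)
      then have q2: "(q ^ n)\<^sup>2 = (1/2) ^ n" by (simp only: q(3))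
      have "a * (norm (G (Suc n) x - G n x))\<^sup>2 \<le> u n x" using a(2) by (simp add: u_def)
      also have "\<dots> \<le> S * (1/2) ^ n" using uS[of n] by (simp add: field_simps)
      finally have "(norm (G (Suc n) x - G n x))\<^sup>2 \<le> S / a * (1/2) ^ n" using a(1) by (simp add: field_simps)
      also have "\<dots> = (sqrt (S / a) * q ^ n)\<^sup>2" using S0 a(1) by (simp add: power_mult_distrib q2)
      finally show "norm (G (Suc n) x - G n x) \<le> sqrt (S / a) * q ^ n"
        by (rule power2_le_imp_le) (use S0 a(1) q in simp)
    qed
  qed
  define g where "g x = lim (\<lambda>n. G n x)" for x
  have gm [measurable]: "g \<in> borel_measurable M" unfolding g_def using G by (rule borel_measurable_lim_metric)
  have lim: "AE x in M. (\<lambda>n. G n x) \<longlonglongrightarrow> g x"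
    using \<open>AE x in M. convergent (\<lambda>n. G n x)\<close> by eventually_elim (simp add: g_def convergent_LIMSEQ_iff)
  \<comment> \<open>Fatou's lemma in \<open>m\<close>: the form is continuous in the vector, so the
    energy density of \<open>G n - g\<close> is the limit of those of
    \<open>G n - G m\<close>.\<close>
  have res: "integrable M (\<lambda>x. Q x (G n x - g x)) \<and> (LINT x|M. Q x (G n x - g x)) \<le> (1/4) ^ n" for n
  proof -
    have mm: "(\<lambda>x. Q x (G n x - g x)) \<in> borel_measurable M"
      unfolding Q_def using G gm by (intro Qm borel_measurable_diff)
    have mk: "(\<lambda>x. Q x (G n x - G m x)) \<in> borel_measurable M" for m
      unfolding Q_def using G by (intro Qm borel_measurable_diff)
    have sym: "Q x (G n x - G m x) = Q x (G m x - G n x)" for x m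
    proof -
      have e: "G n x - G m x = - (G m x - G n x)" by simp
      have m: "A *v (- v) = - (A *v v)" for A :: "real^'d^'d" and v
        by (rule linear_neg[OF matrix_vector_mul_linear])
      show ?thesis unfolding Q_def e m inner_minus_left inner_minus_right minus_minus ..
    qed
    have "(\<integral>\<^sup>+x. ennreal (Q x (G n x - g x)) \<partial>M) = (\<integral>\<^sup>+x. liminf (\<lambda>m. ennreal (Q x (G n x - G m x))) \<partial>M)"
    proof (rule nn_integral_cong_AE)
      show "AE x in M. ennreal (Q x (G n x - g x)) = liminf (\<lambda>m. ennreal (Q x (G n x - G m x)))"
        using lim
      proof eventually_elim
        case (elim x)
        have "(\<lambda>m. Q x (G n x - G m x)) \<longlonglongrightarrow> Q x (G n x - g x)"
          by (rule isCont_tendsto_compose[OF Qc]) (intro tendsto_diff tendsto_const elim)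
        then have "(\<lambda>m. ennreal (Q x (G n x - G m x))) \<longlonglongrightarrow> ennreal (Q x (G n x - g x))" by (rule tendsto_ennrealI)
        then show ?case by (simp add: lim_imp_Liminf)
      qed
    qed
    also have "\<dots> \<le> liminf (\<lambda>m. \<integral>\<^sup>+x. ennreal (Q x (G n x - G m x)) \<partial>M)"
      using mk by (intro nn_integral_liminf) auto
    also have "\<dots> \<le> liminf (\<lambda>m. ennreal ((1/4) ^ n))"
    proof (rule Liminf_mono)
      show "\<forall>\<^sub>F m in sequentially. (\<integral>\<^sup>+x. ennreal (Q x (G n x - G m x)) \<partial>M) \<le> ennreal ((1/4) ^ n)"
        using eventually_ge_at_top[of n]
      proof eventually_elim
        case (elim m)
        have "(\<integral>\<^sup>+x. ennreal (Q x (G n x - G m x)) \<partial>M) = ennreal (LINT x|M. Q x (G m x - G n x))"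
          unfolding sym by (rule nn_integral_eq_integral) (use i[of m n] Qnn in \<open>auto simp: Q_def elim!: eventually_mono\<close>)
        also have "\<dots> \<le> ennreal ((1/4) ^ n)" using c[OF elim] by (intro ennreal_leI) (simp add: Q_def)
        finally show ?case .
      qed
    qed
    also have "\<dots> = ennreal ((1/4) ^ n)" by (simp add: Liminf_const)
    finally have le: "(\<integral>\<^sup>+x. ennreal (Q x (G n x - g x)) \<partial>M) \<le> ennreal ((1/4) ^ n)" .
    have nn: "AE x in M. 0 \<le> Q x (G n x - g x)" using Qnn by eventually_elim auto
    have int: "integrable M (\<lambda>x. Q x (G n x - g x))"
    proof (rule integrableI_nonneg[OF mm nn])
      show "(\<integral>\<^sup>+x. ennreal (Q x (G n x - g x)) \<partial>M) < \<infinity>"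
        by (rule order_le_less_trans[OF le]) simp
    qed
    moreover have "(LINT x|M. Q x (G n x - g x)) \<le> (1/4) ^ n"
      using le unfolding nn_integral_eq_integral[OF int nn] by (subst (asm) ennreal_le_iff) auto
    ultimately show ?thesis by blast
  qed
  show ?thesis
  proof (intro exI[of _ g] conjI gm)
    show "\<forall>n. integrable M (\<lambda>x. (G n x - g x) \<bullet> (B x *v (G n x - g x))) \<and>
     (LINT x|M. (G n x - g x) \<bullet> (B x *v (G n x - g x))) \<le> (1/4) ^ n"
      using res unfolding Q_def by blast
  qed
qed

text \<open>Completeness yields a limit \<open>g\<close> of the gradients along a fast subsequence.
  It is the weak gradient of \<open>u\<close> because the coefficients are bounded below on each
  compact set: the gradients converge there in L2 and the weak identity passes to the limit. The
  values of the forms agree since the energies converge.\<close>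

lemma hD_subset_hN:
  fixes C :: "real^'d \<Rightarrow> real^'d^'d"
  assumes \<Omega>: "open \<Omega>" and C: "admissible_coefficients \<Omega> C"
  shows "hD_form \<Omega> C \<subseteq> hN_form \<Omega> C"
proof
  fix p assume "p \<in> hD_form \<Omega> C"
  then obtain u q \<phi> where p: "p = (u, q)" and uL: "u \<in> L2 \<Omega>"
    and \<phi>: "\<And>n. \<phi> n \<in> test_functions \<Omega>"
    and \<phi>L: "(\<lambda>n. LINT x|lebesgue_on \<Omega>. (\<phi> n x - u x)\<^sup>2) \<longlonglongrightarrow> 0"
    and cauchy: "\<forall>e>0. \<exists>N. \<forall>m\<ge>N. \<forall>n\<ge>N. h0 \<Omega> C (\<lambda>x. \<phi> m x - \<phi> n x) < e"
    and \<phi>q: "(\<lambda>n. h0 \<Omega> C (\<phi> n)) \<longlonglongrightarrow> q"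
    unfolding hD_form_def by blast
  have \<phi>U: "\<phi> n \<in> test_functions UNIV" for n using test_functions_mono[OF _ \<phi>] by auto
  have O: "\<Omega> \<in> sets borel" "\<Omega> \<in> sets lebesgue" using \<Omega> by (auto intro: sets_completionI_sets)
  let ?M = "lebesgue_on \<Omega>"
  have pd: "AE x in ?M. positive_definite (C x)" using C by (simp add: admissible_coefficients_def)
  have um: "u \<in> borel_measurable ?M" and ui: "integrable ?M (\<lambda>x. (u x)\<^sup>2)" using uL by (auto simp: L2_def)
  have "\<forall>k. \<exists>N. \<forall>m\<ge>N. \<forall>n\<ge>N. h0 \<Omega> C (\<lambda>x. \<phi> m x - \<phi> n x) < (1/4) ^ k"
    using cauchy by simp
  then obtain N0 where N0: "\<And>k m n. m \<ge> N0 k \<Longrightarrow> n \<ge> N0 k \<Longrightarrow> h0 \<Omega> C (\<lambda>x. \<phi> m x - \<phi> n x) < (1/4) ^ k"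
    by metis
  \<comment> \<open>The sum makes \<open>r k\<close> at least \<open>N0 k\<close> and nondecreasing
    in \<open>k\<close> whatever the order of the values of \<open>N0\<close>; the added
    \<open>k\<close> makes it strictly increasing.\<close>
  define r where "r k = (\<Sum>i\<le>k. N0 i) + k" for k
  have rN: "r k \<ge> N0 k" for k
    unfolding r_def by (intro trans_le_add1 member_le_sum) auto
  have rmono: "strict_mono r" by (rule strict_monoI_Suc) (simp add: r_def)
  define \<psi> where "\<psi> k = \<phi> (r k)" for k
  have \<psi>: "\<psi> k \<in> test_functions \<Omega>" "\<psi> k \<in> test_functions UNIV" for k by (simp_all add: \<psi>_def \<phi> \<phi>U)
  have \<psi>L: "(\<lambda>k. LINT x|?M. (\<psi> k x - u x)\<^sup>2) \<longlonglongrightarrow> 0"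
    using LIMSEQ_subseq_LIMSEQ[OF \<phi>L rmono] by (simp add: o_def \<psi>_def)
  have \<psi>q: "(\<lambda>k. h0 \<Omega> C (\<psi> k)) \<longlonglongrightarrow> q"
    using LIMSEQ_subseq_LIMSEQ[OF \<phi>q rmono] by (simp add: o_def \<psi>_def)
  define G where "G k = gradient (\<psi> k)" for k
  have Gm: "G k \<in> borel_measurable ?M" for k
    unfolding G_def by (intro measurable_lebesgue_on gradient_measurable[OF test_functions_Ck[OF \<psi>(1)]])
  have Gd: "gradient (\<lambda>x. \<psi> m x - \<psi> n x) = (\<lambda>x. G m x - G n x)" for m n
    using Ck_Suc_differentiable[OF test_functions_Ck[OF \<psi>(1)]]
    by (auto simp: G_def vec_eq_iff partial_diff)
  note en = h0_energy[OF C test_functions_diff[OF \<psi>(2) \<psi>(2)] \<Omega>, unfolded Gd]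
  have "\<exists>g. g \<in> borel_measurable ?M \<and> (\<forall>n. integrable ?M (\<lambda>x. (G n x - g x) \<bullet> (C x *v (G n x - g x))) \<and>
     (LINT x|?M. (G n x - g x) \<bullet> (C x *v (G n x - g x))) \<le> (1/4) ^ n)"
  proof (rule energy_complete[OF pd Gm])
    fix f :: "real^'d \<Rightarrow> real^'d" assume f: "f \<in> borel_measurable ?M"
    have "(\<lambda>x. f x $ k) \<in> borel_measurable ?M" for k
      using f by (intro measurable_vec_nth) 
    then show "(\<lambda>x. f x \<bullet> (C x *v f x)) \<in> borel_measurable ?M" by (rule energy_measurable[OF C])
  next
    fix m n show "integrable ?M (\<lambda>x. (G m x - G n x) \<bullet> (C x *v (G m x - G n x)))" by (rule en(1))
  next
    fix m n :: nat assume mn: "n \<le> m"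
    have "r n \<le> r m" using rmono mn by (simp add: strict_mono_less_eq)
    then have "h0 \<Omega> C (\<lambda>x. \<psi> m x - \<psi> n x) < (1/4) ^ n"
      unfolding \<psi>_def using rN[of n] by (intro N0) auto
    then show "(LINT x|?M. (G m x - G n x) \<bullet> (C x *v (G m x - G n x))) \<le> (1/4) ^ n"
      unfolding en(2) by simp
  qed
  then obtain g where gm: "g \<in> borel_measurable ?M"
    and gi: "\<And>n. integrable ?M (\<lambda>x. (G n x - g x) \<bullet> (C x *v (G n x - g x)))"
    and gc: "\<And>n. (LINT x|?M. (G n x - g x) \<bullet> (C x *v (G n x - g x))) \<le> (1/4) ^ n" by blast
  have gk: "(\<lambda>x. g x $ k) \<in> borel_measurable ?M" for k using gm by (intro measurable_vec_nth)
  have Dnn: "AE x in ?M. 0 \<le> (G n x - g x) \<bullet> (C x *v (G n x - g x))" for n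
    using pd by eventually_elim (rule positive_definite_nonneg)
  have D0: "(\<lambda>n. LINT x|?M. (G n x - g x) \<bullet> (C x *v (G n x - g x))) \<longlonglongrightarrow> 0"
  proof (rule tendsto_sandwich[of "\<lambda>_. 0" _ _ "\<lambda>n. (1/4) ^ n"])
    show "(\<lambda>n. (1/4 :: real) ^ n) \<longlonglongrightarrow> 0" by (intro LIMSEQ_power_zero) simp
    show "\<forall>\<^sub>F n in sequentially. 0 \<le> (LINT x|?M. (G n x - g x) \<bullet> (C x *v (G n x - g x)))"
      by (intro always_eventually allI integral_nonneg_AE Dnn)
  qed (use gc in auto)
  have Gi: "integrable ?M (\<lambda>x. G n x \<bullet> (C x *v G n x))" for n
    unfolding G_def by (rule h0_energy(1)[OF C \<psi>(2) \<Omega>])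
  have Qi: "integrable ?M (\<lambda>x. g x \<bullet> (C x *v g x))"
  proof (rule Bochner_Integration.integrable_bound)
    show "integrable ?M (\<lambda>x. 2 * (G 0 x \<bullet> (C x *v G 0 x)) + 2 * ((G 0 x - g x) \<bullet> (C x *v (G 0 x - g x))))"
      using Gi[of 0] gi[of 0] by auto
    show "(\<lambda>x. g x \<bullet> (C x *v g x)) \<in> borel_measurable ?M" by (rule energy_measurable[OF C gk])
    show "AE x in ?M. norm (g x \<bullet> (C x *v g x)) \<le> norm (2 * (G 0 x \<bullet> (C x *v G 0 x)) + 2 * ((G 0 x - g x) \<bullet> (C x *v (G 0 x - g x))))"
      using pd
    proof eventually_elim
      case (elim x)
      note nn = positive_definite_nonneg[OF elim]
      have e1: "g x - G 0 x = - (G 0 x - g x)" by simp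
      have m: "A *v (- v) = - (A *v v)" for A :: "real^'d^'d" and v
        by (rule linear_neg[OF matrix_vector_mul_linear])
      have e2: "(g x - G 0 x) \<bullet> (C x *v (g x - G 0 x)) = (G 0 x - g x) \<bullet> (C x *v (G 0 x - g x))"
        unfolding e1 m inner_minus_left inner_minus_right minus_minus ..
      have "g x \<bullet> (C x *v g x) \<le> 2 * (G 0 x \<bullet> (C x *v G 0 x)) + 2 * ((G 0 x - g x) \<bullet> (C x *v (G 0 x - g x)))"
        using quadratic_split[OF nn, of 1 "G 0 x" "g x - G 0 x"] e2 by simp
      then show ?case using nn[of "g x"] by simp
    qed
  qed
  have "(\<lambda>n. LINT x|?M. G n x \<bullet> (C x *v G n x)) \<longlonglongrightarrow> (LINT x|?M. g x \<bullet> (C x *v g x))"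
    by (rule integral_tendsto_of_energy[OF pd Qi Gi gi D0])
  moreover have "(\<lambda>n. LINT x|?M. G n x \<bullet> (C x *v G n x)) \<longlonglongrightarrow> q"
    using \<psi>q h0_energy(2)[OF C \<psi>(2) \<Omega>] by (simp add: G_def)
  ultimately have q: "q = (LINT x|?M. g x \<bullet> (C x *v g x))" by (rule LIMSEQ_unique[rotated])
  \<comment> \<open>The ellipticity constant \<open>c\<close> of the compact set turns decay of the
    energy into L2 decay of each component of the gradient.\<close>
  have onK: "\<exists>c>0. \<forall>n. integrable (lebesgue_on K) (\<lambda>x. ((G n x - g x) $ k)\<^sup>2) \<and>
      (LINT x|lebesgue_on K. ((G n x - g x) $ k)\<^sup>2) \<le> (1/4) ^ n / c"
    if K: "compact K" "K \<subseteq> \<Omega>" for K k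
  proof -
    have KL: "K \<in> sets lebesgue" by (rule fmeasurableD[OF lmeasurable_compact[OF K(1)]])
    obtain c where c: "c > 0" "AE x in lebesgue_on K. \<forall>v. c * (norm v)\<^sup>2 \<le> v \<bullet> (C x *v v)"
      using lower_bound_on_compact[OF C K] by blast
    have "integrable (lebesgue_on K) (\<lambda>x. ((G n x - g x) $ k)\<^sup>2) \<and>
      (LINT x|lebesgue_on K. ((G n x - g x) $ k)\<^sup>2) \<le> (1/4) ^ n / c" for n
    proof -
      have "(\<lambda>x. (G n x - g x) $ k) \<in> borel_measurable ?M"
        using Gm[of n] gm by (intro measurable_vec_nth borel_measurable_diff)
      then have m: "(\<lambda>x. (G n x - g x) $ k) \<in> borel_measurable (lebesgue_on K)"
        by (rule measurable_restrict_mono[OF _ K(2)])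
      have "integrable (lebesgue_on K) (\<lambda>x. ((G n x - g x) $ k)\<^sup>2)"
        "(LINT x|lebesgue_on K. ((G n x - g x) $ k)\<^sup>2) \<le> (LINT x|?M. ((G n x - g x) \<bullet> (C x *v (G n x - g x))) / c)"
      proof (rule_tac [!] integral_lebesgue_on_subset_le[OF O(2) KL K(2)])
        show "AE x in lebesgue_on K. 0 \<le> ((G n x - g x) $ k)\<^sup>2 \<and> ((G n x - g x) $ k)\<^sup>2 \<le> (G n x - g x) \<bullet> (C x *v (G n x - g x)) / c"
          using c(2)
        proof eventually_elim
          case (elim x)
          have "((G n x - g x) $ k)\<^sup>2 \<le> (norm (G n x - g x))\<^sup>2"
            using component_le_norm_cart[of "G n x - g x" k] by (subst abs_le_square_iff[symmetric]) simp
          also have "\<dots> \<le> (G n x - g x) \<bullet> (C x *v (G n x - g x)) / c"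
            using elim c(1) by (simp add: pos_le_divide_eq mult.commute)
          finally show ?case by simp
        qed
        then show "AE x in lebesgue_on K. 0 \<le> ((G n x - g x) $ k)\<^sup>2 \<and> ((G n x - g x) $ k)\<^sup>2 \<le> (G n x - g x) \<bullet> (C x *v (G n x - g x)) / c" .
        show "integrable ?M (\<lambda>x. (G n x - g x) \<bullet> (C x *v (G n x - g x)) / c)" using gi by simp
        then show "integrable ?M (\<lambda>x. (G n x - g x) \<bullet> (C x *v (G n x - g x)) / c)" .
        show "AE x in ?M. 0 \<le> (G n x - g x) \<bullet> (C x *v (G n x - g x)) / c"
          using Dnn[of n] by eventually_elim (use c(1) in simp)
        then show "AE x in ?M. 0 \<le> (G n x - g x) \<bullet> (C x *v (G n x - g x)) / c" .
        show "(\<lambda>x. ((G n x - g x) $ k)\<^sup>2) \<in> borel_measurable (lebesgue_on K)" using m by (rule borel_measurable_power)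
        then show "(\<lambda>x. ((G n x - g x) $ k)\<^sup>2) \<in> borel_measurable (lebesgue_on K)" .
      qed
      moreover have "(LINT x|?M. ((G n x - g x) \<bullet> (C x *v (G n x - g x))) / c) \<le> (1/4) ^ n / c"
        using gc[of n] c(1) by (simp add: divide_right_mono)
      ultimately show ?thesis by linarith
    qed
    with c(1) show ?thesis by blast
  qed
  have W: "W12_loc_gradient \<Omega> u g"
    unfolding W12_loc_gradient_def
  proof (intro conjI allI ballI)
    show "u \<in> L2_loc \<Omega>"
      unfolding L2_loc_def using um integrable_lebesgue_on_subset[OF ui O(2) fmeasurableD[OF lmeasurable_compact]]
      by auto
    fix k
    have sub: "integrable (lebesgue_on K) (\<lambda>x. (g x $ k)\<^sup>2)" if K: "compact K" "K \<subseteq> \<Omega>" for K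
    proof -
      have KL: "K \<in> sets lebesgue" by (rule fmeasurableD[OF lmeasurable_compact[OF K(1)]])
      have m: "(\<lambda>x. g x $ k) \<in> borel_measurable (lebesgue_on K)" "(\<lambda>x. G 0 x $ k) \<in> borel_measurable (lebesgue_on K)"
        using measurable_restrict_mono[OF gk K(2)] measurable_restrict_mono[OF measurable_vec_nth[OF Gm] K(2)] by auto
      have "integrable (lebesgue_on K) (\<lambda>x. (G 0 x $ k - (G 0 x - g x) $ k)\<^sup>2)"
      proof (rule integrable_square_diff)
        show "integrable (lebesgue_on K) (\<lambda>x. (G 0 x $ k)\<^sup>2)"
          using integrable_lebesgue_on_subset[OF test_gradient_integrable[OF \<psi>(2) O(1), of 0 k k] O(2) KL K(2)]
          by (simp add: G_def power2_eq_square)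
        show "integrable (lebesgue_on K) (\<lambda>x. ((G 0 x - g x) $ k)\<^sup>2)" using onK[OF K, of k] by blast
      qed (use m in auto)
      then show ?thesis by simp
    qed
    then show "(\<lambda>x. g x $ k) \<in> L2_loc \<Omega>" using gk by (simp add: L2_loc_def)
    fix \<eta> assume \<eta>: "\<eta> \<in> test_functions \<Omega>"
    have \<eta>U: "\<eta> \<in> test_functions UNIV" by (rule test_functions_mono[OF _ \<eta>]) simp
    note p\<eta> = test_functions_partial[OF \<eta>U]
    have sq: "integrable ?M (\<lambda>x. (f x)\<^sup>2)" if "f \<in> test_functions UNIV" for f
      using integrable_lebesgue_on[OF test_function_integrable[OF test_functions_mult[OF that test_functions_Ck[OF that]]] O(1)]
      by (simp add: power2_eq_square)
    have me: "f \<in> borel_measurable ?M" if "f \<in> test_functions UNIV" for f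
      by (rule measurable_lebesgue_on[OF test_function_measurable[OF that]])
    have "(\<lambda>n. LINT x|?M. (\<psi> n x - u x) * partial k \<eta> x) \<longlonglongrightarrow> 0"
      by (rule L2_tendsto_zero[OF borel_measurable_diff[OF me[OF \<psi>(2)] um]
            integrable_square_diff[OF sq[OF \<psi>(2)] ui me[OF \<psi>(2)] um] \<psi>L me[OF p\<eta>] sq[OF p\<eta>]])
    moreover have "(LINT x|?M. (\<psi> n x - u x) * partial k \<eta> x) = (LINT x|?M. \<psi> n x * partial k \<eta> x) - (LINT x|?M. u x * partial k \<eta> x)" for n
      using L2_product(1)[OF me[OF \<psi>(2)] sq[OF \<psi>(2)] me[OF p\<eta>] sq[OF p\<eta>]] L2_product(1)[OF um ui me[OF p\<eta>] sq[OF p\<eta>]]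
      by (simp add: left_diff_distrib)
    ultimately have "(\<lambda>n. (LINT x|?M. \<psi> n x * partial k \<eta> x) - (LINT x|?M. u x * partial k \<eta> x)) \<longlonglongrightarrow> 0" by simp
    then have lim1: "(\<lambda>n. LINT x|?M. \<psi> n x * partial k \<eta> x) \<longlonglongrightarrow> (LINT x|?M. u x * partial k \<eta> x)"
      by (rule LIM_zero_cancel)
    obtain K where K: "compact K" "K \<subseteq> \<Omega>" "\<And>x. x \<notin> K \<Longrightarrow> \<eta> x = 0"
      using test_functions_support[OF \<eta>] by blast
    have KL: "K \<in> sets lebesgue" by (rule fmeasurableD[OF lmeasurable_compact[OF K(1)]])
    obtain c where c: "c > 0" "\<And>n. integrable (lebesgue_on K) (\<lambda>x. ((G n x - g x) $ k)\<^sup>2)"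
      "\<And>n. (LINT x|lebesgue_on K. ((G n x - g x) $ k)\<^sup>2) \<le> (1/4) ^ n / c"
      using onK[OF K(1,2), of k] by blast
    have Gn: "(\<lambda>x. (G n x - g x) $ k) \<in> borel_measurable (lebesgue_on K)" for n
    proof -
      have "(\<lambda>x. (G n x - g x) $ k) \<in> borel_measurable ?M"
        using Gm[of n] gm by (intro measurable_vec_nth borel_measurable_diff)
      then show ?thesis by (rule measurable_restrict_mono[OF _ K(2)])
    qed
    have \<eta>K: "\<eta> \<in> borel_measurable (lebesgue_on K)" by (rule measurable_lebesgue_on[OF test_function_measurable[OF \<eta>U]])
    have \<eta>2: "integrable (lebesgue_on K) (\<lambda>x. (\<eta> x)\<^sup>2)" by (rule integrable_lebesgue_on_subset[OF sq[OF \<eta>U] O(2) KL K(2)])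
    have "(\<lambda>n. LINT x|lebesgue_on K. ((G n x - g x) $ k) * \<eta> x) \<longlonglongrightarrow> 0"
    proof (rule L2_tendsto_zero[OF Gn c(2) _ \<eta>K \<eta>2])
      show "(\<lambda>n. LINT x|lebesgue_on K. ((G n x - g x) $ k)\<^sup>2) \<longlonglongrightarrow> 0"
      proof (rule tendsto_sandwich[of "\<lambda>_. 0" _ _ "\<lambda>n. (1/4) ^ n / c"])
        have "(\<lambda>n. (1/4 :: real) ^ n / c) \<longlonglongrightarrow> 0 / c" using c(1) by (intro tendsto_intros LIMSEQ_power_zero) auto
        then show "(\<lambda>n. (1/4 :: real) ^ n / c) \<longlonglongrightarrow> 0" by simp
      qed (use c(3) in auto)
    qed
    moreover have "(LINT x|lebesgue_on K. ((G n x - g x) $ k) * \<eta> x) = (LINT x|?M. G n x $ k * \<eta> x) - (LINT x|?M. g x $ k * \<eta> x)" for n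
    proof -
      have i1: "integrable (lebesgue_on K) (\<lambda>x. G n x $ k * \<eta> x)"
        using integrable_lebesgue_on_subset[OF L2_product(1)[OF me[OF test_functions_partial[OF \<psi>(2)]] sq[OF test_functions_partial[OF \<psi>(2)]] me[OF \<eta>U] sq[OF \<eta>U]] O(2) KL K(2)]
        by (simp add: G_def)
      have i2: "integrable (lebesgue_on K) (\<lambda>x. g x $ k * \<eta> x)"
        by (rule L2_product(1)[OF measurable_restrict_mono[OF gk K(2)] sub[OF K(1,2)] \<eta>K \<eta>2])
      have "(LINT x|lebesgue_on K. ((G n x - g x) $ k) * \<eta> x) = (LINT x|lebesgue_on K. G n x $ k * \<eta> x) - (LINT x|lebesgue_on K. g x $ k * \<eta> x)"
        using i1 i2 by (simp add: left_diff_distrib)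
      moreover have "(LINT x|?M. G n x $ k * \<eta> x) = (LINT x|lebesgue_on K. G n x $ k * \<eta> x)"
        "(LINT x|?M. g x $ k * \<eta> x) = (LINT x|lebesgue_on K. g x $ k * \<eta> x)"
        using K(3) by (auto intro!: integral_lebesgue_on_subset[OF O(2) KL K(2)])
      ultimately show ?thesis by simp
    qed
    ultimately have "(\<lambda>n. (LINT x|?M. G n x $ k * \<eta> x) - (LINT x|?M. g x $ k * \<eta> x)) \<longlonglongrightarrow> 0" by simp
    then have "(\<lambda>n. LINT x|?M. G n x $ k * \<eta> x) \<longlonglongrightarrow> (LINT x|?M. g x $ k * \<eta> x)" by (rule LIM_zero_cancel)
    then have "(\<lambda>n. - (LINT x|?M. G n x $ k * \<eta> x)) \<longlonglongrightarrow> - (LINT x|?M. g x $ k * \<eta> x)" by (rule tendsto_minus)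
    moreover have "(LINT x|?M. \<psi> n x * partial k \<eta> x) = - (LINT x|?M. G n x $ k * \<eta> x)" for n
      using test_function_weak_identity[OF test_functions_Ck[OF \<psi>(1)] \<eta> \<Omega>] by (simp add: G_def)
    ultimately have "(\<lambda>n. LINT x|?M. \<psi> n x * partial k \<eta> x) \<longlonglongrightarrow> - (LINT x|?M. g x $ k * \<eta> x)" by simp
    then show "(LINT x|?M. u x * partial k \<eta> x) = - (LINT x|?M. g x $ k * \<eta> x)"
      by (rule LIMSEQ_unique[OF lim1])
  qed
  have "integrable ?M (\<lambda>x. g x \<bullet> (C x *v g x) + (u x)\<^sup>2)"
    using Qi ui by (intro Bochner_Integration.integrable_add)
  with W q show "p \<in> hN_form \<Omega> C"
    unfolding p hN_form_def quadratic_form_sum mem_Collect_eq prod.case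
    by (intro exI[of _ g] conjI)
qed

section \<open>Approximation by test functions\<close>

lemma partial_reflect:
  assumes "f differentiable (at (x - y))"
  shows "partial k (\<lambda>y. f (x - y)) y = - partial k f (x - y)"
    and "(\<lambda>y. f (x - y)) differentiable (at y)"
proof -
  have s: "((\<lambda>y. x - y) has_derivative (\<lambda>h. - h)) (at y)"
    by (auto intro!: derivative_eq_intros)
  have D: "((\<lambda>y. f (x - y)) has_derivative (\<lambda>h. gradient f (x - y) \<bullet> (- h))) (at y)"
    using has_derivative_compose[OF s has_derivative_gradient[OF assms]] .
  show "partial k (\<lambda>y. f (x - y)) y = - partial k f (x - y)"
    by (subst partial_eqI[OF D]) (simp add: inner_axis)
  show "(\<lambda>y. f (x - y)) differentiable (at y)"
    using D by (auto simp: differentiable_def)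
qed

lemma Ck_reflect: "Ck n f \<Longrightarrow> Ck n (\<lambda>y. f (x - y))"
proof (induction n arbitrary: f)
  case 0
  then have "continuous_on UNIV f" by simp
  then have "continuous_on UNIV (\<lambda>y. f (x - y))"
    by (rule continuous_on_compose2) (auto intro!: continuous_intros)
  then show ?case by simp
next
  case (Suc n)
  have "partial k (\<lambda>y. f (x - y)) = (\<lambda>y. (-1) * partial k f (x - y))" for k
    using Suc.prems by (auto simp: partial_reflect)
  moreover have "Ck n (\<lambda>y. (-1) * partial k f (x - y))" for k
    using Suc by (intro Ck_cmult Suc.IH) auto
  moreover have "(\<lambda>y. f (x - y)) differentiable (at y)" for y
    using Suc.prems by (intro partial_reflect) auto
  ultimately show ?case by simp
qed

text \<open>Functions in the forms are only Lebesgue measurable, whereas convolution and its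
  estimates are set up for Borel functions. The representative vanishes off \<open>K\<close> at
  every point, not just almost everywhere, so that supports of convolutions can be read off.\<close>

lemma borel_representative:
  fixes f :: "'a::euclidean_space \<Rightarrow> real"
  assumes f: "f \<in> borel_measurable (lebesgue_on \<Omega>)" and \<Omega>: "\<Omega> \<in> sets borel" and K: "K \<in> sets borel" "K \<subseteq> \<Omega>"
    and z: "\<And>x. x \<notin> K \<Longrightarrow> f x = 0"
  shows "\<exists>f'. f' \<in> borel_measurable borel \<and> (\<forall>x. x \<notin> K \<longrightarrow> f' x = 0) \<and> (AE x in lebesgue. f x = f' x)"
proof -
  have "\<Omega> \<inter> space lebesgue \<in> sets lebesgue" using \<Omega> by (auto intro: sets_completionI_sets)
  then have "(\<lambda>x. indicator \<Omega> x *\<^sub>R f x) \<in> borel_measurable lebesgue"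
    using f borel_measurable_restrict_space_iff by blast
  moreover have "(\<lambda>x. indicator \<Omega> x *\<^sub>R f x) = f" using z K(2) by (fastforce simp: indicator_def)
  ultimately have "f \<in> borel_measurable lebesgue" by simp
  then obtain f0 where f0: "f0 \<in> borel_measurable lborel" "AE x in lborel. f x = f0 x"
    using completion_ex_borel_measurable_real by blast
  define f' where "f' x = indicator K x * f0 x" for x
  have "f' \<in> borel_measurable borel" using f0(1) K(1) unfolding f'_def by simp
  moreover have "f' x = 0" if "x \<notin> K" for x using that by (simp add: f'_def)
  moreover have "AE x in lebesgue. f x = f' x"
    using AE_completion[OF f0(2)] by eventually_elim (use z in \<open>auto simp: f'_def indicator_def\<close>)
  ultimately show ?thesis by blast
qed

lemma lebesgue_on_eq_lborel:
  fixes F F' :: "'a::euclidean_space \<Rightarrow> real"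
  assumes \<Omega>: "\<Omega> \<in> sets borel" and F: "F \<in> borel_measurable borel" "\<And>x. x \<notin> \<Omega> \<Longrightarrow> F x = 0"
    and F': "F' \<in> borel_measurable (lebesgue_on \<Omega>)" and eq: "AE x in lebesgue. x \<in> \<Omega> \<longrightarrow> F' x = F x"
  shows "(LINT x|lebesgue_on \<Omega>. F' x) = (LINT x|lborel. F x)"
    and "integrable (lebesgue_on \<Omega>) F' \<longleftrightarrow> integrable lborel F"
proof -
  have O: "\<Omega> \<inter> space lebesgue \<in> sets lebesgue" using \<Omega> by (auto intro: sets_completionI_sets)
  have m: "(\<lambda>x. indicator \<Omega> x *\<^sub>R F' x) \<in> borel_measurable lebesgue"
    using F' O borel_measurable_restrict_space_iff by blast
  have Fm: "F \<in> borel_measurable lebesgue" using F(1) by (intro measurable_completion) simp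
  have ae: "AE x in lebesgue. indicator \<Omega> x *\<^sub>R F' x = F x"
    using eq by eventually_elim (use F(2) in \<open>auto simp: indicator_def\<close>)
  have "(LINT x|lebesgue_on \<Omega>. F' x) = (LINT x|lebesgue. indicator \<Omega> x *\<^sub>R F' x)"
    by (rule integral_restrict_space[OF O])
  also have "\<dots> = (LINT x|lebesgue. F x)" by (rule integral_cong_AE[OF m Fm ae])
  also have "\<dots> = (LINT x|lborel. F x)" using F(1) by (intro integral_completion) simp
  finally show "(LINT x|lebesgue_on \<Omega>. F' x) = (LINT x|lborel. F x)" .
  have "integrable (lebesgue_on \<Omega>) F' \<longleftrightarrow> integrable lebesgue (\<lambda>x. indicator \<Omega> x *\<^sub>R F' x)"
    by (rule integrable_restrict_space[OF O])
  also have "\<dots> \<longleftrightarrow> integrable lebesgue F" by (rule integrable_cong_AE[OF m Fm ae])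
  also have "\<dots> \<longleftrightarrow> integrable lborel F" using F(1) by (intro integrable_completion) simp
  finally show "integrable (lebesgue_on \<Omega>) F' \<longleftrightarrow> integrable lborel F" .
qed

lemma integrable_of_square_integrable:
  fixes f :: "'a::euclidean_space \<Rightarrow> real"
  assumes f: "f \<in> borel_measurable borel" "integrable lborel (\<lambda>x. (f x)\<^sup>2)" and K: "compact K" "\<And>x. x \<notin> K \<Longrightarrow> f x = 0"
  shows "integrable lborel f"
proof (rule Bochner_Integration.integrable_bound[where f="\<lambda>x. indicator K x + (f x)\<^sup>2"])
  have "integrable lborel (indicator K :: 'a \<Rightarrow> real)"
    using K(1) emeasure_bounded_finite[OF compact_imp_bounded[OF K(1)]]
    by (intro integrable_real_indicator) (auto simp: borel_compact)
  then show "integrable lborel (\<lambda>x. indicator K x + (f x)\<^sup>2)" using f(2) by simp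
  have "\<bar>f x\<bar> \<le> indicator K x + (f x)\<^sup>2" for x
  proof (cases "x \<in> K")
    case True
    have "0 \<le> (\<bar>f x\<bar> - 1)\<^sup>2 + \<bar>f x\<bar>" by simp
    then have "\<bar>f x\<bar> \<le> 1 + (f x)\<^sup>2" by (simp add: power2_eq_square algebra_simps abs_mult_self_eq)
    then show ?thesis using True by simp
  qed (use K(2) in simp)
  then show "AE x in lborel. norm (f x) \<le> norm (indicator K x + (f x)\<^sup>2)"
    by (intro AE_I2) (auto simp: abs_of_nonneg indicator_def)
qed (use f in simp)

text \<open>Convolution commutes with the weak gradient. For \<open>x\<close> near \<open>K\<close>
  the reflected kernel y -> m(x - y) is a test function in \<open>\<Omega>\<close>, and the weak
  identity applied to it is the claim; for \<open>x\<close> far from \<open>K\<close> both sides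
  vanish because \<open>w\<close> and \<open>h k\<close> live on \<open>K\<close>.\<close>

lemma mollify_weak_gradient:
  fixes \<Omega> :: "(real^'d) set" and w :: "real^'d \<Rightarrow> real" and h :: "'d \<Rightarrow> real^'d \<Rightarrow> real"
  assumes \<Omega>: "open \<Omega>" and K: "compact K" "K \<subseteq> \<Omega>"
    and w: "w \<in> borel_measurable (lebesgue_on \<Omega>)" "integrable (lebesgue_on \<Omega>) (\<lambda>x. (w x)\<^sup>2)" "\<And>x. x \<notin> K \<Longrightarrow> w x = 0"
    and h: "\<And>k. h k \<in> borel_measurable (lebesgue_on \<Omega>)" "\<And>k. integrable (lebesgue_on \<Omega>) (\<lambda>x. (h k x)\<^sup>2)" "\<And>k x. x \<notin> K \<Longrightarrow> h k x = 0"
    and weak: "\<And>k \<phi>. \<phi> \<in> test_functions \<Omega> \<Longrightarrow>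
      (LINT x|lebesgue_on \<Omega>. w x * partial k \<phi> x) = - (LINT x|lebesgue_on \<Omega>. h k x * \<phi> x)"
    and e: "e > 0"
  shows "\<exists>\<phi>\<in>test_functions \<Omega>.
    integrable (lebesgue_on \<Omega>) (\<lambda>x. (\<phi> x - w x)\<^sup>2) \<and> (LINT x|lebesgue_on \<Omega>. (\<phi> x - w x)\<^sup>2) < e \<and>
    (\<forall>k. integrable (lebesgue_on \<Omega>) (\<lambda>x. (partial k \<phi> x - h k x)\<^sup>2) \<and> (LINT x|lebesgue_on \<Omega>. (partial k \<phi> x - h k x)\<^sup>2) < e)"
proof -
  have O: "\<Omega> \<in> sets borel" using \<Omega> by simp
  have Kb: "K \<in> sets borel" using K(1) by (rule borel_compact)
  obtain w' where w': "w' \<in> borel_measurable borel" "\<And>x. x \<notin> K \<Longrightarrow> w' x = 0" "AE x in lebesgue. w x = w' x"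
    using borel_representative[OF w(1) O Kb K(2) w(3)] by blast
  have "\<forall>k. \<exists>h'. h' \<in> borel_measurable borel \<and> (\<forall>x. x \<notin> K \<longrightarrow> h' x = 0) \<and> (AE x in lebesgue. h k x = h' x)"
    using borel_representative[OF h(1) O Kb K(2) h(3)] by blast
  then obtain h' where h': "\<And>k. h' k \<in> borel_measurable borel" "\<And>k x. x \<notin> K \<Longrightarrow> h' k x = 0" "\<And>k. AE x in lebesgue. h k x = h' k x"
    by metis
  note [measurable] = w'(1) h'(1)
  have out: "x \<notin> K" if "x \<notin> \<Omega>" for x using that K(2) by blast
  have w2: "integrable lborel (\<lambda>x. (w' x)\<^sup>2)"
    by (subst lebesgue_on_eq_lborel(2)[OF O, of _ "\<lambda>x. (w x)\<^sup>2", symmetric])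
       (use w w' out in \<open>auto elim!: eventually_mono\<close>)
  have h2: "integrable lborel (\<lambda>x. (h' k x)\<^sup>2)" for k
    by (subst lebesgue_on_eq_lborel(2)[OF O, of _ "\<lambda>x. (h k x)\<^sup>2", symmetric])
       (use h(1,2)[of k] h'(1,3)[of k] h(3) h'(2) out in \<open>auto elim!: eventually_mono\<close>)
  have w1: "integrable lborel w'" by (rule integrable_of_square_integrable[OF w'(1) w2 K(1) w'(2)])
  have h1: "integrable lborel (h' k)" for k by (rule integrable_of_square_integrable[OF h'(1) h2 K(1) h'(2)])
  have weak': "(LINT y|lborel. w' y * partial k \<phi> y) = - (LINT y|lborel. h' k y * \<phi> y)"
    if \<phi>: "\<phi> \<in> test_functions \<Omega>" for k \<phi>
  proof -
    note [measurable] = test_function_measurable[OF \<phi>] test_function_measurable[OF test_functions_partial[OF \<phi>]]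
    have "(LINT x|lebesgue_on \<Omega>. w x * partial k \<phi> x) = (LINT y|lborel. w' y * partial k \<phi> y)"
      by (rule lebesgue_on_eq_lborel(1)[OF O])
         (use w w' out measurable_lebesgue_on[OF test_function_measurable[OF test_functions_partial[OF \<phi>]]] in \<open>auto elim!: eventually_mono\<close>)
    moreover have "(LINT x|lebesgue_on \<Omega>. h k x * \<phi> x) = (LINT y|lborel. h' k y * \<phi> y)"
      by (rule lebesgue_on_eq_lborel(1)[OF O])
         (use h(1,2)[of k] h'(1,3)[of k] h(3) h'(2) out measurable_lebesgue_on[OF test_function_measurable[OF \<phi>]] in \<open>auto elim!: eventually_mono\<close>)
    ultimately show ?thesis using weak[OF \<phi>] by simp
  qed
  obtain \<rho> where \<rho>: "\<rho> > 0" "\<And>x y. x \<in> K \<Longrightarrow> y \<notin> \<Omega> \<Longrightarrow> \<rho> \<le> dist x y"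
  proof -
    have "closed (- \<Omega>)" "K \<inter> - \<Omega> = {}" using \<Omega> K(2) by auto
    then have "\<exists>d>0. \<forall>x\<in>K. \<forall>y\<in>- \<Omega>. d \<le> dist x y" using separate_compact_closed[OF K(1)] by blast
    then show ?thesis using that by blast
  qed
  have "\<forall>k. \<exists>\<epsilon>0>0. \<forall>\<epsilon>. 0 < \<epsilon> \<and> \<epsilon> < \<epsilon>0 \<longrightarrow>
    integrable lborel (\<lambda>x. (conv (mollifier \<epsilon>) (h' k) x - h' k x)\<^sup>2) \<and> (LINT x|lborel. (conv (mollifier \<epsilon>) (h' k) x - h' k x)\<^sup>2) < e"
    using conv_mollifier_L2[OF h1 h2 e] by blast
  from choice[OF this] obtain \<epsilon>h where "\<forall>k. \<epsilon>h k > 0 \<and> (\<forall>\<epsilon>. 0 < \<epsilon> \<and> \<epsilon> < \<epsilon>h k \<longrightarrow>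
    integrable lborel (\<lambda>x. (conv (mollifier \<epsilon>) (h' k) x - h' k x)\<^sup>2) \<and> (LINT x|lborel. (conv (mollifier \<epsilon>) (h' k) x - h' k x)\<^sup>2) < e)"
    by (elim exE)
  then have \<epsilon>h: "\<epsilon>h k > 0" "0 < \<epsilon> \<Longrightarrow> \<epsilon> < \<epsilon>h k \<Longrightarrow>
    integrable lborel (\<lambda>x. (conv (mollifier \<epsilon>) (h' k) x - h' k x)\<^sup>2) \<and> (LINT x|lborel. (conv (mollifier \<epsilon>) (h' k) x - h' k x)\<^sup>2) < e" for k \<epsilon>
    by blast+
  obtain \<epsilon>w where \<epsilon>w: "\<epsilon>w > 0" "\<And>\<epsilon>. 0 < \<epsilon> \<Longrightarrow> \<epsilon> < \<epsilon>w \<Longrightarrow>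
    integrable lborel (\<lambda>x. (conv (mollifier \<epsilon>) w' x - w' x)\<^sup>2) \<and> (LINT x|lborel. (conv (mollifier \<epsilon>) w' x - w' x)\<^sup>2) < e"
    using conv_mollifier_L2[OF w1 w2 e] by blast
  \<comment> \<open>One scale for \<open>w\<close> and for all of the finitely many components
    \<open>h k\<close>. The bound by \<rho>/4 keeps kernels that reach 3\<epsilon> from
    \<open>K\<close> inside \<open>\<Omega>\<close>.\<close>
  define \<mu> where "\<mu> = min (\<rho> / 4) (min \<epsilon>w (Min (range \<epsilon>h)))"
  define \<epsilon> where "\<epsilon> = \<mu> / 2"
  have "Min (range \<epsilon>h) > 0" using \<epsilon>h(1) by (subst Min_gr_iff) auto
  then have \<mu>: "\<mu> > 0" using \<rho>(1) \<epsilon>w(1) by (simp add: \<mu>_def)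
  have "\<mu> \<le> \<rho> / 4" "\<mu> \<le> \<epsilon>w" "\<mu> \<le> Min (range \<epsilon>h)"
    unfolding \<mu>_def by (rule min.cobounded1, (rule min.coboundedI2, rule min.cobounded1), (rule min.coboundedI2, rule min.cobounded2))
  moreover have "Min (range \<epsilon>h) \<le> \<epsilon>h k" for k by (rule Min_le) auto
  ultimately have \<mu>le: "\<mu> \<le> \<rho> / 4" "\<mu> \<le> \<epsilon>w" "\<mu> \<le> \<epsilon>h k" for k
    using order_trans by blast+
  have \<epsilon>: "0 < \<epsilon>" "4 * \<epsilon> < \<rho>" "\<epsilon> < \<epsilon>w" "\<epsilon> < \<epsilon>h k" for k
    using \<mu> \<mu>le(1,2) \<mu>le(3)[of k] \<rho>(1) unfolding \<epsilon>_def by linarith+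
  let ?m = "mollifier \<epsilon> :: real^'d \<Rightarrow> real"
  have mt: "?m \<in> test_functions UNIV" by (rule mollifier_test_function[OF \<epsilon>(1)])
  have mz: "?m x = 0" if "norm x \<ge> \<epsilon>" for x by (rule mollifier_zero[OF \<epsilon>(1) that])
  define L where "L = {x. infdist x K \<le> \<epsilon>}"
  define \<phi> where "\<phi> = conv ?m w'"
  have conv0: "conv ?m f x = 0" if f: "\<And>x. x \<notin> K \<Longrightarrow> f x = 0" and x: "\<And>y. y \<in> K \<Longrightarrow> \<epsilon> < dist x y" for f x
  proof -
    have "?m (x - y) * f y = 0" for y
      using f[of y] x[of y] mz[of "x - y"] by (cases "y \<in> K") (auto simp: dist_norm)
    then have eq: "(\<lambda>y. ?m (x - y) * f y) = (\<lambda>y. 0)" by blast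
    show ?thesis unfolding conv_def eq by simp
  qed
  have "\<exists>\<phi>\<in>test_functions \<Omega>. \<phi> = conv ?m w' \<and> (\<forall>k. partial k \<phi> = conv ?m (h' k))"
  proof (intro bexI[of _ \<phi>] conjI allI)
    show "\<phi> = conv ?m w'" by (simp add: \<phi>_def)
    define S where "S = {x + y |x y. x \<in> K \<and> y \<in> cball (0 :: real^'d) \<epsilon>}"
    have S: "compact S" unfolding S_def by (rule compact_sums[OF K(1) compact_cball])
    have inS: "x \<in> S" if "y \<in> K" "dist x y \<le> \<epsilon>" for x y
    proof -
      have "x - y \<in> cball 0 \<epsilon>" using that by (simp only: mem_cball_0 dist_norm)
      then have "x = y + (x - y) \<and> y \<in> K \<and> x - y \<in> cball 0 \<epsilon>" using that by simp
      then show ?thesis unfolding S_def by blast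
    qed
    have SO: "S \<subseteq> \<Omega>"
    proof
      fix x assume "x \<in> S"
      then obtain a b where ab: "x = a + b" "a \<in> K" "norm b \<le> \<epsilon>" by (auto simp: S_def)
      then have "dist a x < \<rho>" using \<epsilon> by (simp add: dist_norm)
      then show "x \<in> \<Omega>" using \<rho>(2)[OF ab(2), of x] by force
    qed
    show "\<phi> \<in> test_functions \<Omega>"
    proof (rule test_functionsI[OF _ S SO])
      show "Ck n \<phi>" for n unfolding \<phi>_def by (rule Ck_conv[OF mt w1])
      show "\<phi> x = 0" if "x \<notin> S" for x
        unfolding \<phi>_def
      proof (rule conv0[OF w'(2)])
        fix y assume "y \<in> K"
        then show "\<epsilon> < dist x y" using inS[of y x] that by (cases "dist x y \<le> \<epsilon>") auto
      qed
    qed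
    fix k
    show "partial k \<phi> = conv ?m (h' k)"
    proof
      fix x
      have pc: "partial k \<phi> x = (LINT y|lborel. partial k ?m (x - y) * w' y)"
        unfolding \<phi>_def partial_conv[OF mt w1] by (simp add: conv_def)
      show "partial k \<phi> x = conv ?m (h' k) x"
      \<comment> \<open>Within 2\<epsilon> of \<open>K\<close> the kernel ball stays within
        3\<epsilon> of \<open>K\<close>, hence in \<open>\<Omega>\<close>; beyond that it misses
        \<open>K\<close>.\<close>
      proof (cases "\<exists>y\<in>K. dist x y \<le> 2 * \<epsilon>")
        case True
        then obtain y0 where y0: "y0 \<in> K" "dist x y0 \<le> 2 * \<epsilon>" by blast
        define \<eta> where "\<eta> y = ?m (x - y)" for y
        have "\<eta> \<in> test_functions \<Omega>"
        proof (rule test_functionsI[of _ "cball x \<epsilon>"])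
          show "Ck n \<eta>" for n unfolding \<eta>_def by (rule Ck_reflect[OF test_functions_Ck[OF mt]])
          show "cball x \<epsilon> \<subseteq> \<Omega>"
          proof
            fix y assume "y \<in> cball x \<epsilon>"
            then have "dist y0 y < \<rho>" using y0(2) \<epsilon> dist_triangle[of y0 y x] by (simp add: dist_commute)
            then show "y \<in> \<Omega>" using \<rho>(2)[OF y0(1), of y] by force
          qed
          show "\<eta> y = 0" if "y \<notin> cball x \<epsilon>" for y
            unfolding \<eta>_def using that by (intro mz) (simp add: dist_norm)
        qed simp
        from weak'[OF this, of k] have "(LINT y|lborel. w' y * partial k \<eta> y) = - conv ?m (h' k) x"
          by (simp add: conv_def \<eta>_def mult.commute)
        moreover have "partial k \<eta> y = - partial k ?m (x - y)" for y
          unfolding \<eta>_def by (rule partial_reflect(1)[OF Ck_Suc_differentiable[OF test_functions_Ck[OF mt]]])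
        ultimately show ?thesis unfolding pc by (simp add: mult.commute)
      next
        case False
        then have far: "2 * \<epsilon> < dist x y" if "y \<in> K" for y using that by force
        have pz: "partial k ?m v = 0" if "norm v > \<epsilon>" for v
          by (rule partial_zero_outside[of "cball 0 \<epsilon>"]) (use that mz in auto)
        have "partial k ?m (x - y) * w' y = 0" for y
          using w'(2)[of y] far[of y] pz[of "x - y"] \<epsilon>(1) by (cases "y \<in> K") (auto simp: dist_norm)
        then have eq: "(\<lambda>y. partial k ?m (x - y) * w' y) = (\<lambda>y. 0)" by blast
        have "conv ?m (h' k) x = 0"
        proof (rule conv0[OF h'(2)])
          fix y assume "y \<in> K" then show "\<epsilon> < dist x y" using far[of y] \<epsilon>(1) by linarith
        qed
        then show ?thesis unfolding pc eq by simp
      qed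
    qed
  qed
  then obtain \<phi>' where \<phi>': "\<phi>' \<in> test_functions \<Omega>" "\<phi>' = conv ?m w'" "\<And>k. partial k \<phi>' = conv ?m (h' k)" by blast
  have \<phi>o: "\<phi>' x = 0" "partial k \<phi>' x = 0" if "x \<notin> \<Omega>" for x k
    using test_functions_support[OF \<phi>'(1)] that by blast+
  note [measurable] = test_function_measurable[OF \<phi>'(1)] test_function_measurable[OF test_functions_partial[OF \<phi>'(1)]]
  have mo: "\<phi>' \<in> borel_measurable (lebesgue_on \<Omega>)" "partial k \<phi>' \<in> borel_measurable (lebesgue_on \<Omega>)" for k
    using measurable_lebesgue_on[OF test_function_measurable[OF \<phi>'(1)]]
      measurable_lebesgue_on[OF test_function_measurable[OF test_functions_partial[OF \<phi>'(1)]]] by auto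
  show ?thesis
  proof (intro bexI[OF _ \<phi>'(1)] conjI allI)
    have m1: "(\<lambda>x. (\<phi>' x - w' x)\<^sup>2) \<in> borel_measurable borel" by measurable
    have m2: "(\<lambda>x. (\<phi>' x - w x)\<^sup>2) \<in> borel_measurable (lebesgue_on \<Omega>)" using mo(1) w(1) by simp
    have z: "(\<phi>' x - w' x)\<^sup>2 = 0" if "x \<notin> \<Omega>" for x using that \<phi>o(1) w'(2) out by simp
    have ae: "AE x in lebesgue. x \<in> \<Omega> \<longrightarrow> (\<phi>' x - w x)\<^sup>2 = (\<phi>' x - w' x)\<^sup>2"
      using w'(3) by eventually_elim simp
    show "integrable (lebesgue_on \<Omega>) (\<lambda>x. (\<phi>' x - w x)\<^sup>2)" "(LINT x|lebesgue_on \<Omega>. (\<phi>' x - w x)\<^sup>2) < e"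
      using lebesgue_on_eq_lborel[OF O m1 z m2 ae] \<epsilon>w(2)[OF \<epsilon>(1,3)] unfolding \<phi>'(2) by simp_all
    fix k
    have m1: "(\<lambda>x. (partial k \<phi>' x - h' k x)\<^sup>2) \<in> borel_measurable borel" by measurable
    have m2: "(\<lambda>x. (partial k \<phi>' x - h k x)\<^sup>2) \<in> borel_measurable (lebesgue_on \<Omega>)" using mo(2) h(1) by simp
    have z: "(partial k \<phi>' x - h' k x)\<^sup>2 = 0" if "x \<notin> \<Omega>" for x using that \<phi>o(2) h'(2) out by simp
    have ae: "AE x in lebesgue. x \<in> \<Omega> \<longrightarrow> (partial k \<phi>' x - h k x)\<^sup>2 = (partial k \<phi>' x - h' k x)\<^sup>2"
      using h'(3)[of k] by eventually_elim simp
    show "integrable (lebesgue_on \<Omega>) (\<lambda>x. (partial k \<phi>' x - h k x)\<^sup>2)" "(LINT x|lebesgue_on \<Omega>. (partial k \<phi>' x - h k x)\<^sup>2) < e"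
      using lebesgue_on_eq_lborel[OF O m1 z m2 ae] \<epsilon>h(2)[OF \<epsilon>(1,4)] unfolding \<phi>'(3) by simp_all
  qed
qed

section \<open>Products and smooth truncations of functions with a weak gradient\<close>

lemma integrable_lebesgue_on_superset:
  fixes f :: "'a::euclidean_space \<Rightarrow> real"
  assumes "integrable (lebesgue_on K) f" "\<Omega> \<in> sets lebesgue" "K \<in> sets lebesgue" "K \<subseteq> \<Omega>" "\<And>x. x \<notin> K \<Longrightarrow> f x = 0"
  shows "integrable (lebesgue_on \<Omega>) f"
proof -
  have "(\<lambda>x. indicator \<Omega> x *\<^sub>R f x) = (\<lambda>x. indicator K x *\<^sub>R f x)"
    using assms(4,5) by (fastforce simp: indicator_def)
  then show ?thesis using assms(1-3) by (simp add: integrable_restrict_space)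
qed

lemma test_function_bounded:
  assumes "\<phi> \<in> test_functions \<Omega>"
  shows "\<exists>B>0. \<forall>x. \<bar>\<phi> x\<bar> \<le> B"
proof -
  obtain K where K: "compact K" "\<And>x. x \<notin> K \<Longrightarrow> \<phi> x = 0"
    using test_functions_support[OF assms] by blast
  show ?thesis
    using compact_support_bounded[OF Ck_continuous[OF test_functions_Ck[OF assms, of 0]] K] by simp
qed

lemma L2_loc_times_test:
  assumes f: "f \<in> L2_loc \<Omega>" and \<phi>: "\<phi> \<in> test_functions \<Omega>" and \<Omega>: "open \<Omega>"
  shows "integrable (lebesgue_on \<Omega>) (\<lambda>x. f x * \<phi> x)"
    and "integrable (lebesgue_on \<Omega>) (\<lambda>x. (f x * \<phi> x)\<^sup>2)"
proof -
  have O: "\<Omega> \<in> sets lebesgue" using \<Omega> by (auto intro: sets_completionI_sets)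
  obtain K where K: "compact K" "K \<subseteq> \<Omega>" "\<And>x. x \<notin> K \<Longrightarrow> \<phi> x = 0"
    using test_functions_support[OF \<phi>] by blast
  have KL: "K \<in> sets lebesgue" by (rule fmeasurableD[OF lmeasurable_compact[OF K(1)]])
  have fK: "f \<in> borel_measurable (lebesgue_on K)" "integrable (lebesgue_on K) (\<lambda>x. (f x)\<^sup>2)"
    using f K(1,2) measurable_restrict_mono[OF _ K(2)] by (auto simp: L2_loc_def)
  have \<phi>K: "\<phi> \<in> borel_measurable (lebesgue_on K)" by (rule measurable_lebesgue_on[OF test_function_measurable[OF \<phi>]])
  have "\<phi> \<in> L2_loc K" by (rule test_function_L2_loc) (rule test_functions_mono[OF _ \<phi>], simp)
  then have \<phi>2: "integrable (lebesgue_on K) (\<lambda>x. (\<phi> x)\<^sup>2)" using K(1) by (simp add: L2_loc_def)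
  have "integrable (lebesgue_on K) (\<lambda>x. f x * \<phi> x)" by (rule L2_product(1)[OF fK \<phi>K \<phi>2])
  then show "integrable (lebesgue_on \<Omega>) (\<lambda>x. f x * \<phi> x)"
    by (rule integrable_lebesgue_on_superset[OF _ O KL K(2)]) (use K(3) in simp)
  obtain B where B: "\<And>x. \<bar>\<phi> x\<bar> \<le> B" using test_function_bounded[OF \<phi>] by blast
  have "integrable (lebesgue_on K) (\<lambda>x. (\<phi> x)\<^sup>2 * (f x)\<^sup>2)"
  proof (rule integrable_bounded_mult[OF fK(2), of _ "B\<^sup>2"])
    show "(\<lambda>x. (\<phi> x)\<^sup>2) \<in> borel_measurable (lebesgue_on K)" using \<phi>K by simp
    show "\<bar>(\<phi> x)\<^sup>2\<bar> \<le> B\<^sup>2" for x using power_mono[OF B[of x], of 2] by simp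
  qed
  then have "integrable (lebesgue_on K) (\<lambda>x. (f x * \<phi> x)\<^sup>2)" by (simp add: power_mult_distrib mult.commute)
  then show "integrable (lebesgue_on \<Omega>) (\<lambda>x. (f x * \<phi> x)\<^sup>2)"
    by (rule integrable_lebesgue_on_superset[OF _ O KL K(2)]) (use K(3) in simp)
qed

text \<open>The product of \<open>\<zeta>\<close> and \<open>\<phi>\<close> is itself a test
  function for \<open>u\<close>, and one term of its derivative is moved to the other side.
  Splitting the integrals is legitimate because local L2 functions times test functions are
  integrable on \<open>\<Omega>\<close>.\<close>

lemma weak_product_rule:
  assumes \<Omega>: "open \<Omega>" and W: "W12_loc_gradient \<Omega> u g" and \<zeta>: "\<zeta> \<in> test_functions \<Omega>" and \<phi>: "\<phi> \<in> test_functions \<Omega>"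
  shows "(LINT x|lebesgue_on \<Omega>. (u x * \<zeta> x) * partial k \<phi> x) =
    - (LINT x|lebesgue_on \<Omega>. (g x $ k * \<zeta> x + u x * partial k \<zeta> x) * \<phi> x)"
proof -
  have u: "u \<in> L2_loc \<Omega>" and g: "(\<lambda>x. g x $ k) \<in> L2_loc \<Omega>"
    and weak: "\<And>\<eta>. \<eta> \<in> test_functions \<Omega> \<Longrightarrow> (LINT x|lebesgue_on \<Omega>. u x * partial k \<eta> x) = - (LINT x|lebesgue_on \<Omega>. g x $ k * \<eta> x)"
    using W by (auto simp: W12_loc_gradient_def)
  define \<eta> where "\<eta> x = \<zeta> x * \<phi> x" for x
  have \<eta>: "\<eta> \<in> test_functions \<Omega>" unfolding \<eta>_def by (rule test_functions_mult[OF \<phi> test_functions_Ck[OF \<zeta>]])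
  have p\<eta>: "partial k \<eta> x = partial k \<zeta> x * \<phi> x + \<zeta> x * partial k \<phi> x" for x
    unfolding \<eta>_def by (rule partial_mult[OF Ck_Suc_differentiable[OF test_functions_Ck[OF \<zeta>]] Ck_Suc_differentiable[OF test_functions_Ck[OF \<phi>]]])
  have t: "(\<lambda>x. partial k \<zeta> x * \<phi> x) \<in> test_functions \<Omega>"
    by (rule test_functions_mult[OF \<phi> test_functions_Ck[OF test_functions_partial[OF \<zeta>]]])
  note i1 = L2_loc_times_test(1)[OF u test_functions_partial[OF \<eta>] \<Omega>, of k]
  note i2 = L2_loc_times_test(1)[OF u t \<Omega>]
  note i3 = L2_loc_times_test(1)[OF g \<eta> \<Omega>]
  have "(LINT x|lebesgue_on \<Omega>. (u x * \<zeta> x) * partial k \<phi> x) = (LINT x|lebesgue_on \<Omega>. u x * partial k \<eta> x - u x * (partial k \<zeta> x * \<phi> x))"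
    by (rule Bochner_Integration.integral_cong) (simp_all add: p\<eta> algebra_simps)
  also have "\<dots> = (LINT x|lebesgue_on \<Omega>. u x * partial k \<eta> x) - (LINT x|lebesgue_on \<Omega>. u x * (partial k \<zeta> x * \<phi> x))"
    by (rule Bochner_Integration.integral_diff[OF i1 i2])
  also have "\<dots> = - ((LINT x|lebesgue_on \<Omega>. g x $ k * \<eta> x) + (LINT x|lebesgue_on \<Omega>. u x * (partial k \<zeta> x * \<phi> x)))"
    by (simp add: weak[OF \<eta>])
  also have "(LINT x|lebesgue_on \<Omega>. g x $ k * \<eta> x) + (LINT x|lebesgue_on \<Omega>. u x * (partial k \<zeta> x * \<phi> x)) =
     (LINT x|lebesgue_on \<Omega>. g x $ k * \<eta> x + u x * (partial k \<zeta> x * \<phi> x))"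
    by (rule Bochner_Integration.integral_add[OF i3 i2, symmetric])
  also have "\<dots> = (LINT x|lebesgue_on \<Omega>. (g x $ k * \<zeta> x + u x * partial k \<zeta> x) * \<phi> x)"
    by (rule Bochner_Integration.integral_cong) (simp_all add: \<eta>_def algebra_simps)
  finally show ?thesis .
qed

text \<open>Up to sign the two functions are each other's derivatives, so neither can be treated
  without the other in an induction on the order.\<close>

lemma Ck_sin_cos:
  assumes q: "\<And>n. Ck n q"
  shows "Ck m (\<lambda>x. sin (q x)) \<and> Ck m (\<lambda>x. cos (q x))"
proof (induction m)
  case 0
  then show ?case using q[of 0] by (auto intro: continuous_on_sin continuous_on_cos)
next
  case (Suc m)
  have ps: "partial k (\<lambda>x. sin (q x)) = (\<lambda>x. cos (q x) * partial k q x)" for k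
    by (rule ext, rule Ck_one_compose(1)[OF DERIV_sin _ q]) (intro continuous_intros)
  have pc: "partial k (\<lambda>x. cos (q x)) = (\<lambda>x. - sin (q x) * partial k q x)" for k
    by (rule ext, rule Ck_one_compose(1)[OF DERIV_cos _ q]) (intro continuous_intros)
  have ds: "Ck (Suc 0) (\<lambda>x. sin (q x))"
    by (rule Ck_one_compose(2)[OF DERIV_sin _ q]) (intro continuous_intros)
  have dc: "Ck (Suc 0) (\<lambda>x. cos (q x))"
    by (rule Ck_one_compose(2)[OF DERIV_cos _ q]) (intro continuous_intros)
  have "Ck m (\<lambda>x. cos (q x) * partial k q x)" for k
    using Suc by (intro Ck_mult Ck_partial[OF q]) auto
  moreover have "Ck m (\<lambda>x. ((-1) * sin (q x)) * partial k q x)" for k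
    using Suc by (intro Ck_mult[OF Ck_cmult] Ck_partial[OF q]) auto
  ultimately show ?case using Ck_Suc_differentiable[OF ds] Ck_Suc_differentiable[OF dc] by (simp add: ps pc)
qed

text \<open>The mollified indicator of the 2\<epsilon>-neighbourhood of \<open>K\<close>. With
  \<epsilon> an eighth of a lower bound for the distance of \<open>K\<close> to the complement, the
  4\<epsilon>-neighbourhood that contains the support is still inside
  \<open>\<Omega>\<close>.\<close>

lemma test_plateau:
  fixes K :: "(real^'d) set"
  assumes K: "compact K" "K \<subseteq> \<Omega>" and \<Omega>: "open \<Omega>"
  shows "\<exists>\<zeta>\<in>test_functions \<Omega>. \<forall>x\<in>K. \<zeta> x = 1 \<and> gradient \<zeta> x = 0"
proof (cases "K = {}")
  case True
  have "(\<lambda>x. 0) \<in> test_functions \<Omega>" by (rule test_functionsI[of _ "{}"]) auto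
  then show ?thesis using True by blast
next
  case False
  obtain \<rho> where \<rho>: "\<rho> > 0" "\<And>x y. x \<in> K \<Longrightarrow> y \<notin> \<Omega> \<Longrightarrow> \<rho> \<le> dist x y"
  proof -
    have "closed (- \<Omega>)" "K \<inter> - \<Omega> = {}" using \<Omega> K(2) by auto
    then have "\<exists>d>0. \<forall>x\<in>K. \<forall>y\<in>- \<Omega>. d \<le> dist x y" using separate_compact_closed[OF K(1)] by blast
    then show ?thesis using that by blast
  qed
  define \<epsilon> where "\<epsilon> = \<rho> / 8"
  have \<epsilon>: "\<epsilon> > 0" using \<rho>(1) by (simp add: \<epsilon>_def)
  define A where "A = {x. infdist x K < 2 * \<epsilon>}"
  define S where "S = {x. infdist x K \<le> 4 * \<epsilon>}"
  have S: "compact S" unfolding S_def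
    by (rule compact_infdist_le) (use False K(1) \<epsilon> in auto)
  have "A \<subseteq> S" using \<epsilon> by (auto simp: A_def S_def)
  then have bA: "bounded A" using compact_imp_bounded[OF S] bounded_subset by blast
  have "open A" unfolding A_def by (intro open_Collect_less continuous_intros)
  then have A: "A \<in> sets borel \<and> bounded A \<and> \<epsilon> > 0" using bA \<epsilon> by simp
  have "\<exists>c. (\<forall>n. Ck n c) \<and> (\<forall>x. cball x \<epsilon> \<subseteq> A \<longrightarrow> c x = 1 \<and> gradient c x = 0) \<and> (\<forall>x. cball x \<epsilon> \<inter> A = {} \<longrightarrow> c x = 0)"
    using smooth_cutoff
    apply (elim exE conjE)
    apply (erule allE[where x=A], erule allE[where x=\<epsilon>], erule impE[OF _ A])
    apply (elim exE conjE)
    by blast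
  then obtain \<zeta> where \<zeta>s: "\<And>n. Ck n \<zeta>" and \<zeta>1: "\<And>x. cball x \<epsilon> \<subseteq> A \<Longrightarrow> \<zeta> x = 1 \<and> gradient \<zeta> x = 0"
    and \<zeta>0: "\<And>x. cball x \<epsilon> \<inter> A = {} \<Longrightarrow> \<zeta> x = 0" by blast
  have "S \<subseteq> \<Omega>"
  proof
    fix x assume "x \<in> S"
    obtain y where y: "y \<in> K" "infdist x K = dist x y"
      by (rule infdist_attains_inf[OF compact_imp_closed[OF K(1)] False, of x])
    have "dist y x < \<rho>" using \<open>x \<in> S\<close> y(2) \<rho>(1) by (simp add: S_def \<epsilon>_def dist_commute)
    then show "x \<in> \<Omega>" using \<rho>(2)[OF y(1), of x] by force
  qed
  have "\<zeta> \<in> test_functions \<Omega>"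
  proof (rule test_functionsI[OF \<zeta>s S \<open>S \<subseteq> \<Omega>\<close>])
    fix x assume x: "x \<notin> S"
    show "\<zeta> x = 0"
    proof (rule \<zeta>0, rule ccontr)
      assume "cball x \<epsilon> \<inter> A \<noteq> {}"
      then obtain y where "dist x y \<le> \<epsilon>" "infdist y K < 2 * \<epsilon>" by (auto simp: A_def)
      then show False using x \<epsilon> infdist_triangle[of x K y] by (simp add: S_def)
    qed
  qed
  moreover have "\<zeta> x = 1 \<and> gradient \<zeta> x = 0" if x: "x \<in> K" for x
  proof (rule \<zeta>1)
    show "cball x \<epsilon> \<subseteq> A"
    proof
      fix y assume "y \<in> cball x \<epsilon>"
      then have "infdist y K \<le> \<epsilon>" using infdist_le[OF x, of y] by (simp add: dist_commute)
      then show "y \<in> A" using \<epsilon> by (simp add: A_def)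
    qed
  qed
  ultimately show ?thesis by blast
qed

lemma sin_scaled_lipschitz:
  fixes a :: real
  assumes "a > 0"
  shows "\<bar>a * sin (s / a) - a * sin (t / a)\<bar> \<le> \<bar>s - t\<bar>"
proof -
  have "\<bar>sin (s / a) - sin (t / a)\<bar> \<le> \<bar>s / a - t / a\<bar>"
  proof -
    have "\<bar>sin (s / a) - sin (t / a)\<bar> = \<bar>2 * sin ((s / a - t / a) / 2) * cos ((s / a + t / a) / 2)\<bar>"
      by (subst sin_diff_sin) simp
    also have "\<dots> = 2 * \<bar>sin ((s / a - t / a) / 2)\<bar> * \<bar>cos ((s / a + t / a) / 2)\<bar>" by (simp add: abs_mult)
    also have "\<dots> \<le> 2 * \<bar>(s / a - t / a) / 2\<bar> * 1"
      by (intro mult_mono abs_sin_x_le_abs_x abs_cos_le_one) auto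
    finally show ?thesis by simp
  qed
  then have "a * \<bar>sin (s / a) - sin (t / a)\<bar> \<le> a * \<bar>s / a - t / a\<bar>" using assms by (intro mult_left_mono) auto
  also have "\<dots> = \<bar>s - t\<bar>" using assms by (simp add: diff_divide_distrib[symmetric])
  finally show ?thesis using assms by (simp add: abs_mult right_diff_distrib[symmetric])
qed

lemma square_sum3_le: "(a + b + c)\<^sup>2 \<le> 3 * (a\<^sup>2 + b\<^sup>2 + c\<^sup>2)" for a b c :: real
  using square_diff_le[of "a + b + c" 0 "b + c" c] by simp

lemma smooth_truncation_approx:
  fixes \<Omega> :: "(real^'d) set"
  assumes \<Omega>: "open \<Omega>" and W: "W12_loc_gradient \<Omega> u g" and \<zeta>: "\<zeta> \<in> test_functions \<Omega>" and a: "a > 0" and e: "e > 0"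
  shows "\<exists>\<phi>\<in>test_functions \<Omega>.
    integrable (lebesgue_on \<Omega>) (\<lambda>x. (\<phi> x - \<zeta> x * (a * sin (u x / a)))\<^sup>2) \<and>
    (LINT x|lebesgue_on \<Omega>. (\<phi> x - \<zeta> x * (a * sin (u x / a)))\<^sup>2) < e \<and>
    (\<forall>k. integrable (lebesgue_on \<Omega>) (\<lambda>x. (partial k \<phi> x - (a * sin (u x / a) * partial k \<zeta> x + \<zeta> x * (cos (u x / a) * g x $ k)))\<^sup>2) \<and>
      (LINT x|lebesgue_on \<Omega>. (partial k \<phi> x - (a * sin (u x / a) * partial k \<zeta> x + \<zeta> x * (cos (u x / a) * g x $ k)))\<^sup>2) < e)"
proof -
  let ?M = "lebesgue_on \<Omega>"
  have u: "u \<in> L2_loc \<Omega>" and g: "\<And>k. (\<lambda>x. g x $ k) \<in> L2_loc \<Omega>" using W by (auto simp: W12_loc_gradient_def)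
  have um: "u \<in> borel_measurable ?M" and gm: "\<And>k. (\<lambda>x. g x $ k) \<in> borel_measurable ?M"
    using u g by (auto simp: L2_loc_def)
  obtain K where K: "compact K" "K \<subseteq> \<Omega>" "\<And>x. x \<notin> K \<Longrightarrow> \<zeta> x = 0" "\<And>k x. x \<notin> K \<Longrightarrow> partial k \<zeta> x = 0"
    using test_functions_support[OF \<zeta>] by blast
  \<comment> \<open>Multiplying by a second cutoff that is 1 on the support of
    \<open>\<zeta>\<close> makes \<open>u\<close> square integrable on all of
    \<open>\<Omega>\<close> without changing it or its gradient where \<open>\<zeta>\<close> is
    nonzero.\<close>
  obtain \<zeta>' where \<zeta>': "\<zeta>' \<in> test_functions \<Omega>" and \<zeta>1: "\<And>x. x \<in> K \<Longrightarrow> \<zeta>' x = 1 \<and> gradient \<zeta>' x = 0"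
    using test_plateau[OF K(1,2) \<Omega>] by blast
  obtain K' where K': "compact K'" "K' \<subseteq> \<Omega>" "\<And>x. x \<notin> K' \<Longrightarrow> \<zeta>' x = 0" "\<And>k x. x \<notin> K' \<Longrightarrow> partial k \<zeta>' x = 0"
    using test_functions_support[OF \<zeta>'] by blast
  have tm: "\<phi> \<in> borel_measurable ?M" if "\<phi> \<in> test_functions \<Omega>" for \<phi>
    by (rule measurable_lebesgue_on[OF test_function_measurable[OF that]])
  note pm = tm[OF test_functions_partial]
  define w where "w x = u x * \<zeta>' x" for x
  define h where "h k x = g x $ k * \<zeta>' x + u x * partial k \<zeta>' x" for k x
  have wm: "w \<in> borel_measurable ?M" unfolding w_def using um tm[OF \<zeta>'] by simp
  have hm: "h k \<in> borel_measurable ?M" for k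
    unfolding h_def using um gm[of k] tm[OF \<zeta>'] pm[OF \<zeta>', of k] by simp
  have w2: "integrable ?M (\<lambda>x. (w x)\<^sup>2)" unfolding w_def by (rule L2_loc_times_test(2)[OF u \<zeta>' \<Omega>])
  have h2: "integrable ?M (\<lambda>x. (h k x)\<^sup>2)" for k
  proof -
    have "integrable ?M (\<lambda>x. (g x $ k * \<zeta>' x - (- (u x * partial k \<zeta>' x)))\<^sup>2)"
    proof (rule integrable_square_diff)
      show "integrable ?M (\<lambda>x. (g x $ k * \<zeta>' x)\<^sup>2)" by (rule L2_loc_times_test(2)[OF g \<zeta>' \<Omega>])
      show "integrable ?M (\<lambda>x. (- (u x * partial k \<zeta>' x))\<^sup>2)"
        using L2_loc_times_test(2)[OF u test_functions_partial[OF \<zeta>'] \<Omega>, of k] by simp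
    qed (use um gm[of k] tm[OF \<zeta>'] pm[OF \<zeta>', of k] in auto)
    then show ?thesis by (simp add: h_def)
  qed
  have "\<exists>\<phi>\<in>test_functions \<Omega>.
    integrable ?M (\<lambda>x. (\<phi> x - w x)\<^sup>2) \<and> (LINT x|?M. (\<phi> x - w x)\<^sup>2) < inverse (real (Suc n)) \<and>
    (\<forall>k. integrable ?M (\<lambda>x. (partial k \<phi> x - h k x)\<^sup>2) \<and> (LINT x|?M. (partial k \<phi> x - h k x)\<^sup>2) < inverse (real (Suc n)))" for n
  proof (rule mollify_weak_gradient[OF \<Omega> K'(1,2) wm w2 _ hm h2])
    show "w x = 0" if "x \<notin> K'" for x using K'(3)[OF that] by (simp add: w_def)
    show "h k x = 0" if "x \<notin> K'" for x k using K'(3,4)[OF that] by (simp add: h_def)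
    show "(LINT x|?M. w x * partial k \<phi> x) = - (LINT x|?M. h k x * \<phi> x)" if "\<phi> \<in> test_functions \<Omega>" for k \<phi>
      unfolding w_def h_def by (rule weak_product_rule[OF \<Omega> W \<zeta>' that])
  qed simp
  then have "\<forall>n. \<exists>\<phi>. \<phi> \<in> test_functions \<Omega> \<and>
    integrable ?M (\<lambda>x. (\<phi> x - w x)\<^sup>2) \<and> (LINT x|?M. (\<phi> x - w x)\<^sup>2) < inverse (real (Suc n)) \<and>
    (\<forall>k. integrable ?M (\<lambda>x. (partial k \<phi> x - h k x)\<^sup>2) \<and> (LINT x|?M. (partial k \<phi> x - h k x)\<^sup>2) < inverse (real (Suc n)))" by blast
  from choice[OF this] obtain v0 where "\<forall>n. v0 n \<in> test_functions \<Omega> \<and>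
    integrable ?M (\<lambda>x. (v0 n x - w x)\<^sup>2) \<and> (LINT x|?M. (v0 n x - w x)\<^sup>2) < inverse (real (Suc n)) \<and>
    (\<forall>k. integrable ?M (\<lambda>x. (partial k (v0 n) x - h k x)\<^sup>2) \<and> (LINT x|?M. (partial k (v0 n) x - h k x)\<^sup>2) < inverse (real (Suc n)))"
    by (elim exE)
  then have v0: "v0 n \<in> test_functions \<Omega>" "integrable ?M (\<lambda>x. (v0 n x - w x)\<^sup>2)" "(LINT x|?M. (v0 n x - w x)\<^sup>2) < inverse (real (Suc n))"
    "integrable ?M (\<lambda>x. (partial k (v0 n) x - h k x)\<^sup>2)" "(LINT x|?M. (partial k (v0 n) x - h k x)\<^sup>2) < inverse (real (Suc n))" for n k
    by blast+
  have to0: "X \<longlonglongrightarrow> 0" if "\<And>n. 0 \<le> X n" "\<And>n. X n < inverse (real (Suc n))" for X :: "nat \<Rightarrow> real"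
    by (rule tendsto_sandwich[OF _ _ tendsto_const LIMSEQ_inverse_real_of_nat])
       (intro always_eventually allI that(1) less_imp_le[OF that(2)])+
  have L0: "(\<lambda>n. LINT x|?M. (v0 n x - w x)\<^sup>2) \<longlonglongrightarrow> 0" by (rule to0[OF _ v0(3)]) simp
  have L1: "(\<lambda>n. LINT x|?M. (partial k (v0 n) x - h k x)\<^sup>2) \<longlonglongrightarrow> 0" for k by (rule to0[OF _ v0(5)]) simp
  have "\<exists>r::nat\<Rightarrow>nat. strict_mono r \<and> (AE x in ?M. (\<lambda>n. (v0 (r n) x - w x)\<^sup>2) \<longlonglongrightarrow> 0)"
    by (rule tendsto_L1_AE_subseq[OF v0(2)]) (use L0 in simp)
  then obtain r :: "nat \<Rightarrow> nat" where r: "strict_mono r" and ae: "AE x in ?M. (\<lambda>n. (v0 (r n) x - w x)\<^sup>2) \<longlonglongrightarrow> 0" by blast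
  define v where "v n = v0 (r n)" for n
  have v: "v n \<in> test_functions \<Omega>" "integrable ?M (\<lambda>x. (v n x - w x)\<^sup>2)" "integrable ?M (\<lambda>x. (partial k (v n) x - h k x)\<^sup>2)" for n k
    by (simp_all add: v_def v0)
  have vL: "(\<lambda>n. LINT x|?M. (v n x - w x)\<^sup>2) \<longlonglongrightarrow> 0" "(\<lambda>n. LINT x|?M. (partial k (v n) x - h k x)\<^sup>2) \<longlonglongrightarrow> 0" for k
    using LIMSEQ_subseq_LIMSEQ[OF L0 r] LIMSEQ_subseq_LIMSEQ[OF L1 r] by (simp_all add: o_def v_def)
  have vae: "AE x in ?M. (\<lambda>n. v n x) \<longlonglongrightarrow> w x"
    using ae
  proof eventually_elim
    case (elim x)
    have "(\<lambda>n. sqrt ((v n x - w x)\<^sup>2)) \<longlonglongrightarrow> sqrt 0" using elim unfolding v_def by (rule tendsto_real_sqrt)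
    then have "(\<lambda>n. \<bar>v n x - w x\<bar>) \<longlonglongrightarrow> 0" by simp
    then have "(\<lambda>n. v n x - w x) \<longlonglongrightarrow> 0" by (rule tendsto_rabs_zero_cancel)
    then show ?case by (rule LIM_zero_cancel)
  qed
  \<comment> \<open>The part of the gradient error in which only the argument of the cosine changes.
    It is at most 2|h| and tends to 0 almost everywhere.\<close>
  define D where "D k n x = (cos (v n x / a) - cos (w x / a)) * h k x" for k n x
  have Dm: "D k n \<in> borel_measurable ?M" for k n
    unfolding D_def using tm[OF v(1)] wm hm by simp
  have Dle: "(D k n x)\<^sup>2 \<le> 4 * (h k x)\<^sup>2" for k n x
  proof -
    have "\<bar>cos (v n x / a) - cos (w x / a)\<bar> \<le> 2"
      using abs_cos_le_one[of "v n x / a"] abs_cos_le_one[of "w x / a"] by linarith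
    then have "\<bar>cos (v n x / a) - cos (w x / a)\<bar>\<^sup>2 \<le> 2\<^sup>2" by (rule power_mono) simp
    then show ?thesis unfolding D_def power_mult_distrib by (intro mult_right_mono) auto
  qed
  have D2: "integrable ?M (\<lambda>x. (D k n x)\<^sup>2)" for k n
    by (rule Bochner_Integration.integrable_bound[OF integrable_mult_right[OF h2[of k], of 4]])
       (use Dm Dle in auto)
  have DL: "(\<lambda>n. LINT x|?M. (D k n x)\<^sup>2) \<longlonglongrightarrow> 0" for k
  proof -
    have "(\<lambda>n. LINT x|?M. (D k n x)\<^sup>2) \<longlonglongrightarrow> (LINT x|?M. 0 * w x)"
    proof (rule integral_dominated_convergence[where w="\<lambda>x. 4 * (h k x)\<^sup>2"])
      show "AE x in ?M. (\<lambda>n. (D k n x)\<^sup>2) \<longlonglongrightarrow> 0 * w x"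
        using vae
      proof eventually_elim
        case (elim x)
        have "(\<lambda>n. ((cos (v n x / a) - cos (w x / a)) * h k x)\<^sup>2) \<longlonglongrightarrow> ((cos (w x / a) - cos (w x / a)) * h k x)\<^sup>2"
          using a by (intro tendsto_intros elim) auto
        then show ?case by (simp add: D_def)
      qed
      show "integrable ?M (\<lambda>x. 4 * (h k x)\<^sup>2)" using h2 by simp
      show "AE x in ?M. norm ((D k n x)\<^sup>2) \<le> 4 * (h k x)\<^sup>2" for n using Dle by simp
    qed (use Dm in simp_all)
    then show ?thesis by simp
  qed
  obtain B where B: "B > 0" "\<And>x. \<bar>\<zeta> x\<bar> \<le> B" using test_function_bounded[OF \<zeta>] by blast
  have "\<forall>k. \<exists>B'>0. \<forall>x. \<bar>partial k \<zeta> x\<bar> \<le> B'" using test_function_bounded[OF test_functions_partial[OF \<zeta>]] by blast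
  from choice[OF this] obtain B' where "\<forall>k. 0 < B' k \<and> (\<forall>x. \<bar>partial k \<zeta> x\<bar> \<le> B' k)" by (elim exE)
  then have B': "\<And>k x. \<bar>partial k \<zeta> x\<bar> \<le> B' k" by blast
  define \<phi> where "\<phi> n x = \<zeta> x * (a * sin (v n x / a))" for n x
  have sm: "Ck m (\<lambda>x. a * sin (v n x / a))" "Ck m (\<lambda>x. sin (v n x / a))" for m n
  proof -
    have "Ck m (\<lambda>x. inverse a * v n x)" for m by (rule Ck_cmult[OF test_functions_Ck[OF v(1)]])
    then have "Ck m (\<lambda>x. sin (inverse a * v n x))" using Ck_sin_cos by blast
    then show "Ck m (\<lambda>x. sin (v n x / a))" by (simp add: divide_inverse mult.commute)
    then show "Ck m (\<lambda>x. a * sin (v n x / a))" by (rule Ck_cmult)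
  qed
  have \<phi>t: "\<phi> n \<in> test_functions \<Omega>" for n
    unfolding \<phi>_def using test_functions_mult[OF \<zeta> sm(1)] by (simp add: mult.commute)
  have p\<phi>: "partial k (\<phi> n) x = a * sin (v n x / a) * partial k \<zeta> x + \<zeta> x * (cos (v n x / a) * partial k (v n) x)" for k n x
  proof -
    have F: "((\<lambda>t. a * sin (t / a)) has_real_derivative cos (t / a)) (at t)" for t
      using a by (auto intro!: derivative_eq_intros)
    have cF: "continuous_on UNIV (\<lambda>t. cos (t / a))" using a by (intro continuous_intros) auto
    have "partial k (\<lambda>x. a * sin (v n x / a)) x = cos (v n x / a) * partial k (v n) x"
      by (rule Ck_one_compose(1)[OF F cF test_functions_Ck[OF v(1)]])
    then show ?thesis unfolding \<phi>_def
      by (subst partial_mult[OF Ck_Suc_differentiable[OF test_functions_Ck[OF \<zeta>]] Ck_Suc_differentiable[OF sm(1)]]) (simp add: mult.commute)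
  qed
  define E0 where "E0 n x = B\<^sup>2 * (v n x - w x)\<^sup>2" for n x
  \<comment> \<open>One term for each of the changes of the sine, of the gradient and of the cosine;
    the factor 3 comes from squaring a sum of three.\<close>
  define E1 where "E1 k n x = 3 * ((B' k)\<^sup>2 * (v n x - w x)\<^sup>2 + B\<^sup>2 * (partial k (v n) x - h k x)\<^sup>2 + B\<^sup>2 * (D k n x)\<^sup>2)" for k n x
  have E0: "integrable ?M (E0 n)" for n unfolding E0_def using v(2) by simp
  have E1: "integrable ?M (E1 k n)" for k n unfolding E1_def using v(2) v(3) D2 by simp
  have E0L: "(\<lambda>n. LINT x|?M. E0 n x) \<longlonglongrightarrow> 0"
    unfolding E0_def using tendsto_mult_left[OF vL(1), of "B\<^sup>2"] by simp
  have E1L: "(\<lambda>n. LINT x|?M. E1 k n x) \<longlonglongrightarrow> 0" for k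
  proof -
    have "(LINT x|?M. E1 k n x) = 3 * ((B' k)\<^sup>2 * (LINT x|?M. (v n x - w x)\<^sup>2) + B\<^sup>2 * (LINT x|?M. (partial k (v n) x - h k x)\<^sup>2) + B\<^sup>2 * (LINT x|?M. (D k n x)\<^sup>2))" for n
      unfolding E1_def using v(2)[of n] v(3) D2[of k n] by simp
    moreover have "(\<lambda>n. 3 * ((B' k)\<^sup>2 * (LINT x|?M. (v n x - w x)\<^sup>2) + B\<^sup>2 * (LINT x|?M. (partial k (v n) x - h k x)\<^sup>2) + B\<^sup>2 * (LINT x|?M. (D k n x)\<^sup>2)))
      \<longlonglongrightarrow> 3 * ((B' k)\<^sup>2 * 0 + B\<^sup>2 * 0 + B\<^sup>2 * 0)"
      by (intro tendsto_intros vL DL)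
    ultimately show ?thesis by simp
  qed
  have sl: "(a * sin (v n x / a) - a * sin (w x / a))\<^sup>2 \<le> (v n x - w x)\<^sup>2" for n x
    using sin_scaled_lipschitz[OF a] by (simp add: abs_le_square_iff)
  have le0: "(\<phi> n x - \<zeta> x * (a * sin (u x / a)))\<^sup>2 \<le> E0 n x" for n x
  proof (cases "x \<in> K")
    case True
    have "(\<phi> n x - \<zeta> x * (a * sin (u x / a)))\<^sup>2 = (\<zeta> x)\<^sup>2 * (a * sin (v n x / a) - a * sin (w x / a))\<^sup>2"
      using \<zeta>1[OF True] by (simp add: \<phi>_def w_def right_diff_distrib[symmetric] power_mult_distrib)
    also have "\<dots> \<le> B\<^sup>2 * (v n x - w x)\<^sup>2"
      using B(1) B(2)[of x] by (intro mult_mono sl) (auto simp: abs_le_square_iff[symmetric])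
    finally show ?thesis by (simp add: E0_def)
  qed (use K(3) in \<open>simp add: \<phi>_def E0_def\<close>)
  have le1: "(partial k (\<phi> n) x - (a * sin (u x / a) * partial k \<zeta> x + \<zeta> x * (cos (u x / a) * g x $ k)))\<^sup>2 \<le> E1 k n x" for k n x
  proof (cases "x \<in> K")
    case True
    have eq: "u x = w x" "g x $ k = h k x" using \<zeta>1[OF True] by (auto simp: w_def h_def vec_eq_iff)
    have "partial k (\<phi> n) x - (a * sin (u x / a) * partial k \<zeta> x + \<zeta> x * (cos (u x / a) * g x $ k)) =
      (a * sin (v n x / a) - a * sin (w x / a)) * partial k \<zeta> x + \<zeta> x * (cos (v n x / a) * (partial k (v n) x - h k x)) + \<zeta> x * D k n x"
      unfolding p\<phi> eq D_def by (simp add: algebra_simps)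
    then have "(partial k (\<phi> n) x - (a * sin (u x / a) * partial k \<zeta> x + \<zeta> x * (cos (u x / a) * g x $ k)))\<^sup>2 \<le>
      3 * (((a * sin (v n x / a) - a * sin (w x / a)) * partial k \<zeta> x)\<^sup>2 + (\<zeta> x * (cos (v n x / a) * (partial k (v n) x - h k x)))\<^sup>2 + (\<zeta> x * D k n x)\<^sup>2)"
      using square_sum3_le by simp
    also have "\<dots> \<le> E1 k n x"
    proof -
      have z2: "(\<zeta> x)\<^sup>2 \<le> B\<^sup>2" "(partial k \<zeta> x)\<^sup>2 \<le> (B' k)\<^sup>2"
        using power_mono[OF B(2)[of x], of 2] power_mono[OF B'[of k x], of 2] by simp_all
      have c2: "(cos (v n x / a))\<^sup>2 \<le> 1" using power_mono[OF abs_cos_le_one[of "v n x / a"], of 2] by simp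
      have t1: "((a * sin (v n x / a) - a * sin (w x / a)) * partial k \<zeta> x)\<^sup>2 \<le> (B' k)\<^sup>2 * (v n x - w x)\<^sup>2"
        unfolding power_mult_distrib using mult_mono[OF z2(2) sl[of n x]] by (simp add: mult.commute)
      have "(\<zeta> x * (cos (v n x / a) * (partial k (v n) x - h k x)))\<^sup>2 = (\<zeta> x)\<^sup>2 * ((cos (v n x / a))\<^sup>2 * (partial k (v n) x - h k x)\<^sup>2)"
        by (simp add: power_mult_distrib)
      also have "\<dots> \<le> B\<^sup>2 * (1 * (partial k (v n) x - h k x)\<^sup>2)"
        by (intro mult_mono z2 c2 order_refl mult_nonneg_nonneg) auto
      finally have t2: "(\<zeta> x * (cos (v n x / a) * (partial k (v n) x - h k x)))\<^sup>2 \<le> B\<^sup>2 * (partial k (v n) x - h k x)\<^sup>2" by simp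
      have t3: "(\<zeta> x * D k n x)\<^sup>2 \<le> B\<^sup>2 * (D k n x)\<^sup>2"
        unfolding power_mult_distrib by (intro mult_right_mono z2) auto
      show ?thesis unfolding E1_def by (intro mult_left_mono add_mono t1 t2 t3) simp
    qed
    finally show ?thesis .
  next
    case False
    then show ?thesis using K(3,4)[OF False] by (simp add: p\<phi> E1_def)
  qed
  have um2: "(\<lambda>x. sin (u x / a)) \<in> borel_measurable ?M" "(\<lambda>x. cos (u x / a)) \<in> borel_measurable ?M" using um by simp_all
  have m0: "(\<lambda>x. (\<phi> n x - \<zeta> x * (a * sin (u x / a)))\<^sup>2) \<in> borel_measurable ?M" for n
    using tm[OF \<phi>t] tm[OF \<zeta>] um2 by simp
  have m1: "(\<lambda>x. (partial k (\<phi> n) x - (a * sin (u x / a) * partial k \<zeta> x + \<zeta> x * (cos (u x / a) * g x $ k)))\<^sup>2) \<in> borel_measurable ?M" for k n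
    using pm[OF \<phi>t] tm[OF \<zeta>] pm[OF \<zeta>] um2 gm by simp
  have i0: "integrable ?M (\<lambda>x. (\<phi> n x - \<zeta> x * (a * sin (u x / a)))\<^sup>2)" for n
  proof (rule Bochner_Integration.integrable_bound[OF E0 m0])
    show "AE x in ?M. norm ((\<phi> n x - \<zeta> x * (a * sin (u x / a)))\<^sup>2) \<le> norm (E0 n x)"
      using order_trans[OF le0 abs_ge_self] by (intro AE_I2) simp
  qed
  have i1: "integrable ?M (\<lambda>x. (partial k (\<phi> n) x - (a * sin (u x / a) * partial k \<zeta> x + \<zeta> x * (cos (u x / a) * g x $ k)))\<^sup>2)" for k n
  proof (rule Bochner_Integration.integrable_bound[OF E1 m1])
    show "AE x in ?M. norm ((partial k (\<phi> n) x - (a * sin (u x / a) * partial k \<zeta> x + \<zeta> x * (cos (u x / a) * g x $ k)))\<^sup>2) \<le> norm (E1 k n x)"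
      using order_trans[OF le1 abs_ge_self] by (intro AE_I2) simp
  qed
  have "\<forall>\<^sub>F n in sequentially. (LINT x|?M. E0 n x) < e" using E0L e by (rule order_tendstoD(2))
  moreover have "\<forall>\<^sub>F n in sequentially. \<forall>k. (LINT x|?M. E1 k n x) < e"
    by (rule eventually_all_finite) (rule order_tendstoD(2)[OF E1L e])
  ultimately have "\<forall>\<^sub>F n in sequentially. (LINT x|?M. E0 n x) < e \<and> (\<forall>k. (LINT x|?M. E1 k n x) < e)"
    by eventually_elim auto
  then obtain n where n: "(LINT x|?M. E0 n x) < e" "\<And>k. (LINT x|?M. E1 k n x) < e"
    using eventually_happens by force
  show ?thesis
  proof (intro bexI[OF _ \<phi>t[of n]] conjI allI i0 i1)
    show "(LINT x|?M. (\<phi> n x - \<zeta> x * (a * sin (u x / a)))\<^sup>2) < e"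
      using Bochner_Integration.integral_mono[OF i0 E0 le0, of n] n(1) by linarith
    show "(LINT x|?M. (partial k (\<phi> n) x - (a * sin (u x / a) * partial k \<zeta> x + \<zeta> x * (cos (u x / a) * g x $ k)))\<^sup>2) < e" for k
      using Bochner_Integration.integral_mono[OF i1 E1 le1, of k n] n(2)[of k] by linarith
  qed
qed

section \<open>Cutting off near the boundary\<close>

text \<open>The indicator of the points of \<open>\<Omega>\<close> at distance above t = 2^(-j) from
  the boundary is mollified at scale t/4, so the transition takes place between 3t/4 and 5t/4. The
  set is first intersected with a ball because \<open>smooth_cutoff\<close> treats bounded sets;
  this is why the plateau is asserted only in \<open>ball 0 R\<close>.\<close>

lemma cutoff_from_boundary:
  fixes \<Omega> :: "(real^'d) set"
  assumes \<Omega>: "open \<Omega>"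
  shows "\<exists>M>0. \<forall>R j. \<exists>c. (\<forall>n. Ck n c) \<and> (\<forall>x. 0 \<le> c x \<and> c x \<le> 1 \<and> norm (gradient c x) \<le> M / (1/2) ^ j) \<and>
    (\<forall>x. x \<notin> \<Omega> \<or> infdist x (frontier \<Omega>) < 3/4 * (1/2) ^ j \<longrightarrow> c x = 0 \<and> gradient c x = 0) \<and>
    (\<forall>x\<in>\<Omega> \<inter> ball 0 R. infdist x (frontier \<Omega>) > 5/4 * (1/2) ^ j \<longrightarrow> c x = 1 \<and> gradient c x = 0)"
proof -
  obtain M0 where M0: "M0 > 0" and cut: "\<forall>(A :: (real^'d) set) \<epsilon>. A \<in> sets borel \<and> bounded A \<and> \<epsilon> > 0 \<longrightarrow>
     (\<exists>c. (\<forall>n. Ck n c) \<and> (\<forall>x. 0 \<le> c x \<and> c x \<le> 1 \<and> norm (gradient c x) \<le> M0 / \<epsilon>) \<and>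
       (\<forall>x. cball x \<epsilon> \<subseteq> A \<longrightarrow> c x = 1 \<and> gradient c x = 0) \<and>
       (\<forall>x. cball x \<epsilon> \<inter> A = {} \<longrightarrow> c x = 0 \<and> gradient c x = 0))"
    using smooth_cutoff by (elim exE conjE)
  show ?thesis
  proof (intro exI[of _ "4 * M0"] conjI allI)
    show "4 * M0 > 0" using M0 by simp
    fix R :: real and j :: nat
    define t :: real where "t = (1/2) ^ j"
    have t: "t > 0" "t \<le> 1" by (simp_all add: t_def power_le_one)
    define A where "A = {x \<in> \<Omega>. infdist x (frontier \<Omega>) > t} \<inter> ball 0 (R + 1)"
    have "open {x. infdist x (frontier \<Omega>) > t}" by (intro open_Collect_less continuous_intros)
    then have "open (\<Omega> \<inter> {x. infdist x (frontier \<Omega>) > t} \<inter> ball 0 (R + 1))" using \<Omega> by (intro open_Int) auto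
    also have "\<Omega> \<inter> {x. infdist x (frontier \<Omega>) > t} \<inter> ball 0 (R + 1) = A" by (auto simp: A_def)
    finally have A: "A \<in> sets borel" by (rule borel_open)
    have bA: "bounded A" by (rule bounded_subset[OF bounded_ball[of 0 "R + 1"]]) (simp add: A_def)
    have t4: "t / 4 > 0" using t by simp
    have "\<exists>c. (\<forall>n. Ck n c) \<and> (\<forall>x. 0 \<le> c x \<and> c x \<le> 1 \<and> norm (gradient c x) \<le> M0 / (t / 4)) \<and>
       (\<forall>x. cball x (t / 4) \<subseteq> A \<longrightarrow> c x = 1 \<and> gradient c x = 0) \<and>
       (\<forall>x. cball x (t / 4) \<inter> A = {} \<longrightarrow> c x = 0 \<and> gradient c x = 0)"
      using cut A bA t4 by meson
    then obtain c where c: "\<forall>n. Ck n c" "\<And>x. 0 \<le> c x \<and> c x \<le> 1 \<and> norm (gradient c x) \<le> M0 / (t / 4)"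
       "\<And>x. cball x (t / 4) \<subseteq> A \<Longrightarrow> c x = 1 \<and> gradient c x = 0"
       "\<And>x. cball x (t / 4) \<inter> A = {} \<Longrightarrow> c x = 0 \<and> gradient c x = 0" by blast
    have lip: "infdist x (frontier \<Omega>) \<le> infdist y (frontier \<Omega>) + dist x y" for x y
      by (rule infdist_triangle)
    show "\<exists>c. (\<forall>n. Ck n c) \<and> (\<forall>x. 0 \<le> c x \<and> c x \<le> 1 \<and> norm (gradient c x) \<le> 4 * M0 / (1/2) ^ j) \<and>
      (\<forall>x. x \<notin> \<Omega> \<or> infdist x (frontier \<Omega>) < 3/4 * (1/2) ^ j \<longrightarrow> c x = 0 \<and> gradient c x = 0) \<and>
      (\<forall>x\<in>\<Omega> \<inter> ball 0 R. infdist x (frontier \<Omega>) > 5/4 * (1/2) ^ j \<longrightarrow> c x = 1 \<and> gradient c x = 0)"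
      unfolding t_def[symmetric]
    proof (intro exI[of _ c] conjI allI ballI impI)
      show "Ck n c" for n using c(1) by blast
      show "0 \<le> c x" "c x \<le> 1" for x using c(2) by blast+
      show "norm (gradient c x) \<le> 4 * M0 / t" for x using c(2)[of x] by (simp add: mult.commute)
      have z: "c x = 0 \<and> gradient c x = 0" if x: "x \<notin> \<Omega> \<or> infdist x (frontier \<Omega>) < 3/4 * t" for x
      proof (rule c(4), rule ccontr)
        assume "cball x (t / 4) \<inter> A \<noteq> {}"
        then obtain y where y: "dist x y \<le> t / 4" "y \<in> \<Omega>" "infdist y (frontier \<Omega>) > t" by (auto simp: A_def)
        \<comment> \<open>A point within t/4 of the set is closer to \<open>y\<close> than the
          frontier is, so it lies in \<open>\<Omega>\<close>; this settles the alternative that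
          \<open>x\<close> is outside \<open>\<Omega>\<close>.\<close>
        have "dist y x < infdist y (frontier \<Omega>)" using y(1,3) t by (simp add: dist_commute)
        then have "x \<in> \<Omega>" by (rule inside_of_ball[OF y(2)])
        then have "infdist x (frontier \<Omega>) < 3/4 * t" using x by blast
        then show False using lip[of y x] y by (simp add: dist_commute)
      qed
      then show "x \<notin> \<Omega> \<or> infdist x (frontier \<Omega>) < 3/4 * t \<Longrightarrow> c x = 0"
        "x \<notin> \<Omega> \<or> infdist x (frontier \<Omega>) < 3/4 * t \<Longrightarrow> gradient c x = 0" for x by blast+
      have o: "c x = 1 \<and> gradient c x = 0" if x: "x \<in> \<Omega> \<inter> ball 0 R" "infdist x (frontier \<Omega>) > 5/4 * t" for x
      proof (rule c(3), rule subsetI)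
        fix y assume "y \<in> cball x (t / 4)"
        then have y: "dist x y \<le> t / 4" by simp
        have "dist x y < infdist x (frontier \<Omega>)" using y x(2) t by linarith
        then have "y \<in> \<Omega>" using x(1) by (intro inside_of_ball[of x \<Omega> y]) auto
        moreover have "infdist y (frontier \<Omega>) > t" using lip[of x y] x(2) y by linarith
        moreover have "dist 0 y < R + 1" using x(1) y t dist_triangle[of 0 y x] by (simp add: dist_commute)
        ultimately show "y \<in> A" by (simp add: A_def)
      qed
      then show "x \<in> \<Omega> \<inter> ball 0 R \<Longrightarrow> 5/4 * t < infdist x (frontier \<Omega>) \<Longrightarrow> c x = 1"
        "x \<in> \<Omega> \<inter> ball 0 R \<Longrightarrow> 5/4 * t < infdist x (frontier \<Omega>) \<Longrightarrow> gradient c x = 0" for x by blast+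
    qed
  qed
qed

lemma partial_sum:
  assumes "finite I" "\<And>i. i \<in> I \<Longrightarrow> f i differentiable (at x)"
  shows "partial k (\<lambda>x. \<Sum>i\<in>I. f i x) x = (\<Sum>i\<in>I. partial k (f i) x)"
proof -
  have "((\<lambda>x. \<Sum>i\<in>I. f i x) has_derivative (\<lambda>h. \<Sum>i\<in>I. gradient (f i) x \<bullet> h)) (at x)"
    using assms by (intro has_derivative_sum has_derivative_gradient) auto
  then have "partial k (\<lambda>x. \<Sum>i\<in>I. f i x) x = (\<Sum>i\<in>I. gradient (f i) x \<bullet> axis k 1)" by (rule partial_eqI)
  then show ?thesis by (simp add: inner_axis)
qed

text \<open>5/4 of the next dyadic number is 5/8 of the present one, which is below 3/4.\<close>

lemma dyadic_shells_disjoint: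
  fixes d :: real
  assumes "3/4 * (1/2) ^ i \<le> d" "d \<le> 5/4 * (1/2) ^ i" "3/4 * (1/2) ^ j \<le> d" "d \<le> 5/4 * (1/2) ^ j"
  shows "i = j"
proof (rule ccontr)
  have *: False if "i < j" "3/4 * (1/2) ^ i \<le> d" "d \<le> 5/4 * (1/2) ^ j" for i j
  proof -
    have "(1/2::real) ^ j \<le> (1/2) ^ Suc i" using that(1) by (intro power_decreasing) auto
    moreover have "(0::real) < (1/2) ^ i" by simp
    ultimately show False using that(2,3) by simp
  qed
  assume "i \<noteq> j"
  then show False using *[of i j] *[of j i] assms by linarith
qed

text \<open>
  Averaging \<open>N\<close> consecutive dyadic cutoffs: their gradients live on disjoint shells and each has
  energy of order \<open>1\<close> at most, so that the average has energy of order \<open>1 / N\<close>.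
\<close>

lemma boundary_cutoff:
  fixes \<Omega> :: "(real^'d) set" and C :: "real^'d \<Rightarrow> real^'d^'d"
  assumes \<Omega>: "open \<Omega>" "frontier \<Omega> \<noteq> {}" and reg: "ahlfors_regular (frontier \<Omega>) s"
    and C: "admissible_coefficients \<Omega> C" and deg: "degenerate_at_boundary \<Omega> C \<delta>"
    and \<delta>: "0 \<le> \<delta>" "2 - real CARD('d) + s \<le> \<delta>"
  shows "\<exists>c\<ge>0. \<exists>N0. \<forall>N\<ge>N0. \<exists>\<eta>. (\<forall>n. Ck n \<eta>) \<and> (\<forall>x. 0 \<le> \<eta> x \<and> \<eta> x \<le> 1) \<and>
     (\<forall>x. x \<notin> \<Omega> \<or> infdist x (frontier \<Omega>) \<le> 1/2 * (1/2) ^ (2 * N) \<longrightarrow> \<eta> x = 0) \<and>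
     (\<forall>x\<in>\<Omega> \<inter> ball 0 R. infdist x (frontier \<Omega>) > 5/4 * (1/2) ^ N \<longrightarrow> \<eta> x = 1) \<and>
     integrable (lebesgue_on \<Omega>) (\<lambda>x. indicator (ball 0 R) x * (gradient \<eta> x \<bullet> (C x *v gradient \<eta> x))) \<and>
     (LINT x|lebesgue_on \<Omega>. indicator (ball 0 R) x * (gradient \<eta> x \<bullet> (C x *v gradient \<eta> x))) \<le> c / real N"
proof -
  let ?\<Gamma> = "frontier \<Omega>"
  define t :: "nat \<Rightarrow> real" where "t j = (1/2) ^ j" for j
  have t0: "t j > 0" "t j \<le> 1" for j by (simp_all add: t_def power_le_one)
  obtain M where M: "M > 0" and cut: "\<forall>R j. \<exists>c. (\<forall>n. Ck n c) \<and> (\<forall>x. 0 \<le> c x \<and> c x \<le> 1 \<and> norm (gradient c x) \<le> M / (1/2) ^ j) \<and>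
    (\<forall>x. x \<notin> \<Omega> \<or> infdist x ?\<Gamma> < 3/4 * (1/2) ^ j \<longrightarrow> c x = 0 \<and> gradient c x = 0) \<and>
    (\<forall>x\<in>\<Omega> \<inter> ball 0 R. infdist x ?\<Gamma> > 5/4 * (1/2) ^ j \<longrightarrow> c x = 1 \<and> gradient c x = 0)"
    using cutoff_from_boundary[OF \<Omega>(1)] by (elim exE conjE)
  from choice[OF spec[OF cut, of R]] obtain c where c: "\<forall>j. (\<forall>n. Ck n (c j)) \<and> (\<forall>x. 0 \<le> c j x \<and> c j x \<le> 1 \<and> norm (gradient (c j) x) \<le> M / (1/2) ^ j) \<and>
    (\<forall>x. x \<notin> \<Omega> \<or> infdist x ?\<Gamma> < 3/4 * (1/2) ^ j \<longrightarrow> c j x = 0 \<and> gradient (c j) x = 0) \<and>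
    (\<forall>x\<in>\<Omega> \<inter> ball 0 R. infdist x ?\<Gamma> > 5/4 * (1/2) ^ j \<longrightarrow> c j x = 1 \<and> gradient (c j) x = 0)" by (elim exE)
  have cS: "Ck n (c j)" for n j using c by blast
  have c01: "0 \<le> c j x" "c j x \<le> 1" "norm (gradient (c j) x) \<le> M / t j" for j x using c by (auto simp: t_def)
  have c0: "c j x = 0" "gradient (c j) x = 0" if "x \<notin> \<Omega> \<or> infdist x ?\<Gamma> < 3/4 * t j" for j x using c that by (auto simp: t_def)
  have c1: "c j x = 1" "gradient (c j) x = 0" if "x \<in> \<Omega> \<inter> ball 0 R" "infdist x ?\<Gamma> > 5/4 * t j" for j x
    using c that by (auto simp: t_def)
  obtain z where z: "z \<in> ?\<Gamma>" using \<Omega>(2) by blast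
  \<comment> \<open>This bounded piece contains \<open>z\<close>, hence is nonempty, and contains
    every boundary point within distance 1 of \<open>ball 0 R\<close>.\<close>
  define A where "A = ?\<Gamma> \<inter> cball 0 (\<bar>R\<bar> + 2 + norm z)"
  have A: "A \<subseteq> ?\<Gamma>" "bounded A" "A \<noteq> {}"
    using z by (auto simp: A_def intro: bounded_subset[OF bounded_cball[of 0 "\<bar>R\<bar> + 2 + norm z"]])
  obtain a b r where b: "b > 0" and r: "r > 0" and up: "AE x in lebesgue_on \<Omega>. x \<in> boundary_layer \<Omega> A r \<longrightarrow>
           (\<forall>v. a * infdist x ?\<Gamma> powr \<delta> * (norm v)\<^sup>2 \<le> v \<bullet> (C x *v v) \<and>
                v \<bullet> (C x *v v) \<le> b * infdist x ?\<Gamma> powr \<delta> * (norm v)\<^sup>2)"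
    using degenerate_at_boundaryD[OF deg A] by blast
  \<comment> \<open>The range up to 3/2 covers the layers \<open>S j\<close> of width 3/2 t_j. They
    are defined by a strict inequality, and the factor 3/2 above 5/4 makes them contain the closed
    shells.\<close>
  obtain K where K: "K > 0" and vol: "\<forall>\<tau>. 0 < \<tau> \<and> \<tau> \<le> 3/2 \<longrightarrow>
      emeasure lborel {y \<in> ball (0::real^'d) R. infdist y ?\<Gamma> < \<tau>} \<le> ennreal (K * \<tau> powr (real CARD('d) - s))"
    using boundary_layer_volume[OF reg frontier_closed \<Omega>(2), where T="3/2" and ?x0.0=0 and R=R] by (elim exE conjE)
  have "(\<lambda>n. 5/4 * (1/2::real) ^ n) \<longlonglongrightarrow> 5/4 * 0" by (intro tendsto_mult_left LIMSEQ_power_zero) simp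
  then have "\<forall>\<^sub>F n in sequentially. 5/4 * (1/2::real) ^ n < min 1 r" using r by (intro order_tendstoD(2)) auto
  then obtain N1 where N1: "5/4 * t n < min 1 r" if "n \<ge> N1" for n by (auto simp: eventually_sequentially t_def)
  define k where "k = real CARD('d) - s"
  \<comment> \<open>A bound for the energy of one dyadic cutoff in \<open>ball 0 R\<close> that is
    free of the scale: degeneracy, squared gradient and volume constants, with the rounding factors
    5/4 and 3/2.\<close>
  define q where "q = b * (5/4) powr \<delta> * M\<^sup>2 * (K * (3/2) powr k)"
  have q: "q \<ge> 0" unfolding q_def using b M K by (intro mult_nonneg_nonneg) auto
  show ?thesis
  proof (intro exI[of _ q] conjI q exI[of _ "max 1 N1"] allI impI)
    fix N assume "N \<ge> max 1 N1"
    then have N: "N \<ge> 1" "N \<ge> N1" by auto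
    \<comment> \<open>\<open>N\<close> consecutive scales starting at \<open>N\<close> itself, so
      that the region where the average differs from 1 also shrinks to the boundary as
      \<open>N\<close> grows.\<close>
    define J where "J = {N..<2 * N}"
    have J: "finite J" "card J = N" by (auto simp: J_def)
    define \<eta> where "\<eta> x = inverse (real N) * (\<Sum>j\<in>J. c j x)" for x
    have \<eta>S: "Ck n \<eta>" for n unfolding \<eta>_def[abs_def] by (intro Ck_cmult Ck_sum J cS)
    have sumd: "(\<lambda>x. \<Sum>j\<in>J. c j x) differentiable (at x)" for x
      by (rule Ck_Suc_differentiable[of 0]) (intro Ck_sum J cS)
    have g\<eta>: "gradient \<eta> x = inverse (real N) *\<^sub>R (\<Sum>j\<in>J. gradient (c j) x)" for x
      unfolding vec_eq_iff \<eta>_def[abs_def]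
      using partial_cmult[OF sumd] partial_sum[OF J(1) Ck_Suc_differentiable[OF cS]] by simp
    have tJ: "t (2 * N) \<le> t j" "t j \<le> t N" "j \<ge> N1" if "j \<in> J" for j
      using that N by (auto simp: J_def t_def intro!: power_decreasing)
    define w where "w j = (inverse (real N))\<^sup>2 * (b * (5/4 * t j) powr \<delta> * (M / t j)\<^sup>2)" for j
    have w0: "w j \<ge> 0" for j unfolding w_def using b by (intro mult_nonneg_nonneg) auto
    define S where "S j = {y \<in> ball (0::real^'d) R. infdist y ?\<Gamma> < 3/2 * t j}" for j
    have SB: "S j \<in> sets borel" for j unfolding S_def by (rule layer_borel)
    have bound: "AE x in lebesgue_on \<Omega>. indicator (ball 0 R) x * (gradient \<eta> x \<bullet> (C x *v gradient \<eta> x)) \<le> (\<Sum>j\<in>J. w j * indicator (S j) x)"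
    proof -
      have "AE x in lebesgue_on \<Omega>. x \<in> \<Omega>" by (rule AE_I2) simp
      then show ?thesis using up
      proof eventually_elim
        case (elim x)
        have nn: "0 \<le> (\<Sum>j\<in>J. w j * indicator (S j) x)" using w0 by (intro sum_nonneg mult_nonneg_nonneg) auto
        show ?case
        proof (cases "x \<in> ball 0 R \<and> gradient \<eta> x \<noteq> 0")
          case False then show ?thesis using nn by (auto simp: indicator_def)
        next
          case True
          then have xR: "x \<in> \<Omega> \<inter> ball 0 R" using elim by blast
          have "(\<Sum>j\<in>J. gradient (c j) x) \<noteq> 0" using True by (auto simp: g\<eta>)
          \<comment> \<open>At most one summand has a nonzero gradient at \<open>x\<close>, so
            squaring the sum produces no cross terms.\<close>
          then obtain i where i: "i \<in> J" "gradient (c i) x \<noteq> 0" by (meson sum.neutral)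
          have sh: "3/4 * t j \<le> infdist x ?\<Gamma>" "infdist x ?\<Gamma> \<le> 5/4 * t j" if "gradient (c j) x \<noteq> 0" for j
            using c0(2)[of x j] c1(2)[OF xR, of j] that by (meson not_less)+
          have "gradient (c j) x = 0" if "j \<noteq> i" for j
            using dyadic_shells_disjoint[of i "infdist x ?\<Gamma>" j] sh[OF i(2)] sh[of j] that by (auto simp: t_def)
          then have "(\<Sum>j\<in>J. gradient (c j) x) = (\<Sum>j\<in>{i}. gradient (c j) x)"
            using i(1) J(1) by (intro sum.mono_neutral_right) auto
          then have g: "gradient \<eta> x = inverse (real N) *\<^sub>R gradient (c i) x" by (simp add: g\<eta>)
          obtain y where y: "y \<in> ?\<Gamma>" "infdist x ?\<Gamma> = dist x y"
            using infdist_attains_inf[OF frontier_closed \<Omega>(2)] by blast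
          have d: "dist x y < min 1 r" using sh(2)[OF i(2)] N1[OF tJ(3)[OF i(1)]] y(2) by linarith
          have "norm y \<le> norm x + dist x y" by (metis dist_norm dist_commute norm_triangle_sub)
          have "norm y \<le> \<bar>R\<bar> + 2 + norm z" 
          proof -
            have "dist x y < 1" "norm x < R" using d xR by simp_all
            then show ?thesis using \<open>norm y \<le> norm x + dist x y\<close> norm_ge_zero[of z] by linarith
          qed
          then have yA: "y \<in> A" using y(1) by (simp add: A_def)
          then have "infdist x A < r" using infdist_le[OF yA, of x] d by linarith
          then have xl: "x \<in> boundary_layer \<Omega> A r" using xR closure_subset by (auto simp: boundary_layer_def)
          have "gradient \<eta> x \<bullet> (C x *v gradient \<eta> x) \<le> b * infdist x ?\<Gamma> powr \<delta> * (norm (gradient \<eta> x))\<^sup>2"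
            using elim(2) xl by blast
          also have "\<dots> \<le> b * (5/4 * t i) powr \<delta> * (inverse (real N) * (M / t i))\<^sup>2"
          proof (intro mult_mono power_mono)
            show "infdist x ?\<Gamma> powr \<delta> \<le> (5/4 * t i) powr \<delta>" using sh[OF i(2)] \<delta>(1) by (intro powr_mono2) (auto simp: infdist_nonneg)
            show "norm (gradient \<eta> x) \<le> inverse (real N) * (M / t i)"
              unfolding g norm_scaleR using c01(3)[of i x] by (intro mult_mono) auto
          qed (use b in auto)
          also have "\<dots> = w i" unfolding w_def power_mult_distrib by (simp add: ac_simps)
          also have "\<dots> = w i * indicator (S i) x" using xR sh[OF i(2)] t0(1)[of i] by (simp add: S_def)
          also have "\<dots> \<le> (\<Sum>j\<in>J. w j * indicator (S j) x)"
            by (rule member_le_sum[OF i(1)]) (use w0 J in auto)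
          finally show ?thesis using True by simp
        qed
      qed
    qed
    have gm: "(\<lambda>x. gradient \<eta> x $ k) \<in> borel_measurable (lebesgue_on \<Omega>)" for k
      unfolding gradient_nth
      by (intro measurable_lebesgue_on borel_measurable_continuous_onI) (rule Ck_continuous[OF Ck_partial[OF \<eta>S, of 0]])
    have Em: "(\<lambda>x. gradient \<eta> x \<bullet> (C x *v gradient \<eta> x)) \<in> borel_measurable (lebesgue_on \<Omega>)"
      by (rule energy_measurable[OF C gm])
    have Im: "(\<lambda>x. indicator (ball 0 R) x * (gradient \<eta> x \<bullet> (C x *v gradient \<eta> x))) \<in> borel_measurable (lebesgue_on \<Omega>)"
      by (intro borel_measurable_times Em measurable_lebesgue_on borel_measurable_indicator) simp
    have Enn: "AE x in lebesgue_on \<Omega>. 0 \<le> indicator (ball 0 R) x * (gradient \<eta> x \<bullet> (C x *v gradient \<eta> x))"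
    proof -
      have "AE x in lebesgue_on \<Omega>. positive_definite (C x)" using C by (simp add: admissible_coefficients_def)
      then show ?thesis by eventually_elim (intro mult_nonneg_nonneg positive_definite_nonneg, auto)
    qed
    have Sf: "integrable lborel (\<lambda>x. w j * indicator (S j) x)" "(LINT x|lborel. w j * indicator (S j) x) \<le> inverse (real N) * (q / real N)" if j: "j \<in> J" for j
    proof -
      have v: "emeasure lborel (S j) \<le> ennreal (K * (3/2 * t j) powr k)"
        unfolding S_def k_def by (rule vol[rule_format]) (use t0[of j] in simp)
      then have fin: "emeasure lborel (S j) < \<infinity>" by (rule le_less_trans) simp
      show "integrable lborel (\<lambda>x. w j * indicator (S j) x)" using SB fin by (intro integrable_mult_right integrable_real_indicator) auto
      have "measure lborel (S j) \<le> K * (3/2 * t j) powr k"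
        using v K unfolding measure_def by (intro enn2real_leI) auto
      then have "w j * measure lborel (S j) \<le> w j * (K * (3/2 * t j) powr k)" by (intro mult_left_mono w0)
      also have "\<dots> = (inverse (real N))\<^sup>2 * q * (t j powr \<delta> * t j powr k / (t j)\<^sup>2)"
      proof -
        have e: "(5/4 * t j) powr \<delta> = (5/4) powr \<delta> * t j powr \<delta>" "(3/2 * t j) powr k = (3/2) powr k * t j powr k"
          by (rule powr_mult)+
        show ?thesis unfolding w_def q_def e power_divide by (simp add: ac_simps)
      qed
      also have "\<dots> = (inverse (real N))\<^sup>2 * q * t j powr (\<delta> + k - 2)"
        using t0(1)[of j] by (simp add: powr_add powr_diff)
      \<comment> \<open>The exponent is nonnegative precisely by the threshold condition on
        \<delta>, and the scales are at most 1.\<close>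
      also have "\<dots> \<le> (inverse (real N))\<^sup>2 * q * 1"
        using t0[of j] \<delta>(2) q by (intro mult_left_mono powr_le1) (auto simp: k_def)
      finally show "(LINT x|lborel. w j * indicator (S j) x) \<le> inverse (real N) * (q / real N)"
        using SB by (simp add: power2_eq_square divide_inverse ac_simps)
    qed
    have W: "integrable lborel (\<lambda>x. \<Sum>j\<in>J. w j * indicator (S j) x)" using Sf(1) by (rule Bochner_Integration.integrable_sum)
    have \<Omega>b: "\<Omega> \<in> sets borel" using \<Omega>(1) by (rule borel_open)
    have W': "integrable (lebesgue_on \<Omega>) (\<lambda>x. \<Sum>j\<in>J. w j * indicator (S j) x)"
      by (rule integrable_lebesgue_on[OF W \<Omega>b])
    have W0: "0 \<le> (\<Sum>j\<in>J. w j * indicator (S j) x)" for x :: "real^'d" using w0 by (intro sum_nonneg mult_nonneg_nonneg) auto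
    have II: "integrable (lebesgue_on \<Omega>) (\<lambda>x. indicator (ball 0 R) x * (gradient \<eta> x \<bullet> (C x *v gradient \<eta> x)))"
    proof (rule Bochner_Integration.integrable_bound[OF W' Im])
      show "AE x in lebesgue_on \<Omega>. norm (indicator (ball 0 R) x * (gradient \<eta> x \<bullet> (C x *v gradient \<eta> x))) \<le> norm (\<Sum>j\<in>J. w j * indicator (S j) x)"
        using bound Enn
      proof eventually_elim
        case (elim x)
        show ?case unfolding real_norm_def abs_of_nonneg[OF elim(2)] by (rule order_trans[OF elim(1) abs_ge_self])
      qed
    qed
    have "(LINT x|lebesgue_on \<Omega>. indicator (ball 0 R) x * (gradient \<eta> x \<bullet> (C x *v gradient \<eta> x))) \<le> (LINT x|lebesgue_on \<Omega>. (\<Sum>j\<in>J. w j * indicator (S j) x))"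
      by (rule integral_mono_AE[OF II W' bound])
    also have "\<dots> = (LINT x|lborel. indicator \<Omega> x *\<^sub>R (\<Sum>j\<in>J. w j * indicator (S j) x))"
    proof -
      have m: "(\<lambda>x. indicator \<Omega> x *\<^sub>R (\<Sum>j\<in>J. w j * indicator (S j) x)) \<in> borel_measurable lborel" using \<Omega>b SB by simp
      have "\<Omega> \<inter> space lebesgue \<in> sets lebesgue" using \<Omega>b by (auto intro: sets_completionI_sets)
      then show ?thesis by (simp only: integral_restrict_space integral_completion[OF m])
    qed
    also have "\<dots> \<le> (LINT x|lborel. (\<Sum>j\<in>J. w j * indicator (S j) x))"
    proof (rule Bochner_Integration.integral_mono[OF _ W])
      show "integrable lborel (\<lambda>x. indicator \<Omega> x *\<^sub>R (\<Sum>j\<in>J. w j * indicator (S j) x))"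
        by (rule integrable_mult_indicator[OF _ W]) (use \<Omega>b in simp)
      show "indicator \<Omega> x *\<^sub>R (\<Sum>j\<in>J. w j * indicator (S j) x) \<le> (\<Sum>j\<in>J. w j * indicator (S j) x)" for x
        using W0[of x] by (simp add: indicator_def)
    qed
    also have "\<dots> = (\<Sum>j\<in>J. (LINT x|lborel. w j * indicator (S j) x))" by (rule Bochner_Integration.integral_sum[OF Sf(1)])
    also have "\<dots> \<le> (\<Sum>j\<in>J. inverse (real N) * (q / real N))" by (intro sum_mono Sf(2))
    also have "\<dots> = q / real N" using N J(2) by (simp add: divide_inverse mult.commute)
    finally have LL: "(LINT x|lebesgue_on \<Omega>. indicator (ball 0 R) x * (gradient \<eta> x \<bullet> (C x *v gradient \<eta> x))) \<le> q / real N" .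
    show "\<exists>\<eta>. (\<forall>n. Ck n \<eta>) \<and> (\<forall>x. 0 \<le> \<eta> x \<and> \<eta> x \<le> 1) \<and>
     (\<forall>x. x \<notin> \<Omega> \<or> infdist x ?\<Gamma> \<le> 1/2 * (1/2) ^ (2 * N) \<longrightarrow> \<eta> x = 0) \<and>
     (\<forall>x\<in>\<Omega> \<inter> ball 0 R. infdist x ?\<Gamma> > 5/4 * (1/2) ^ N \<longrightarrow> \<eta> x = 1) \<and>
     integrable (lebesgue_on \<Omega>) (\<lambda>x. indicator (ball 0 R) x * (gradient \<eta> x \<bullet> (C x *v gradient \<eta> x))) \<and>
     (LINT x|lebesgue_on \<Omega>. indicator (ball 0 R) x * (gradient \<eta> x \<bullet> (C x *v gradient \<eta> x))) \<le> q / real N"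
      unfolding t_def[symmetric]
    proof (intro exI[of _ \<eta>] conjI allI impI ballI \<eta>S II LL)
      fix x
      show "0 \<le> \<eta> x" unfolding \<eta>_def using c01 by (intro mult_nonneg_nonneg sum_nonneg) auto
      have "(\<Sum>j\<in>J. c j x) \<le> (\<Sum>j\<in>J. 1)" by (intro sum_mono c01)
      then have "\<eta> x \<le> inverse (real N) * real N" unfolding \<eta>_def using J(2) by (intro mult_left_mono) auto
      then show "\<eta> x \<le> 1" using N by simp
      show "\<eta> x = 0" if x: "x \<notin> \<Omega> \<or> infdist x ?\<Gamma> \<le> 1/2 * t (2 * N)"
      proof -
        have "c j x = 0" if "j \<in> J" for j
          using x tJ(1)[OF that] t0(1)[of j] by (intro c0) linarith
        then show ?thesis by (simp add: \<eta>_def)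
      qed
      show "\<eta> x = 1" if x: "x \<in> \<Omega> \<inter> ball 0 R" "5/4 * t N < infdist x ?\<Gamma>"
      proof -
        have "c j x = 1" if "j \<in> J" for j
          by (rule c1(1)[OF x(1)]) (use x(2) tJ(2)[OF that] in linarith)
        then show ?thesis using N J by (simp add: \<eta>_def)
      qed
    qed
  qed
qed

section \<open>Approximation of the maximal form\<close>

lemma energy_upper_bound:
  fixes C :: "real^'d \<Rightarrow> real^'d^'d"
  assumes C: "admissible_coefficients \<Omega> C"
  shows "\<exists>\<Lambda>\<ge>0. AE x in lebesgue_on \<Omega>. \<forall>v. v \<bullet> (C x *v v) \<le> \<Lambda> * (norm v)\<^sup>2"
proof -
  have "\<forall>k l. \<exists>M. AE x in lebesgue_on \<Omega>. \<bar>C x $ k $ l\<bar> \<le> M"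
    using C by (simp add: admissible_coefficients_def L_infinity_def)
  then obtain M where M: "\<And>k l. AE x in lebesgue_on \<Omega>. \<bar>C x $ k $ l\<bar> \<le> M k l" by metis
  have "AE x in lebesgue_on \<Omega>. \<forall>k l. \<bar>C x $ k $ l\<bar> \<le> M k l"
    by (intro eventually_all_finite M)
  then have "AE x in lebesgue_on \<Omega>. \<forall>v. v \<bullet> (C x *v v) \<le> (\<Sum>k\<in>UNIV. \<Sum>l\<in>UNIV. \<bar>M k l\<bar>) * (norm v)\<^sup>2"
  proof eventually_elim
    case (elim x)
    show ?case
    proof
      fix v :: "real^'d"
      have "C x $ k $ l * v $ k * v $ l \<le> \<bar>M k l\<bar> * (norm v)\<^sup>2" for k l
      proof -
        have "C x $ k $ l * v $ k * v $ l \<le> \<bar>C x $ k $ l\<bar> * (\<bar>v $ k\<bar> * \<bar>v $ l\<bar>)"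
          by (metis abs_ge_self abs_mult mult.assoc)
        also have "\<dots> \<le> \<bar>M k l\<bar> * (norm v * norm v)"
          using elim by (intro mult_mono component_le_norm_cart) (auto intro: order_trans[OF _ abs_ge_self])
        finally show ?thesis by (simp add: power2_eq_square)
      qed
      then show "v \<bullet> (C x *v v) \<le> (\<Sum>k\<in>UNIV. \<Sum>l\<in>UNIV. \<bar>M k l\<bar>) * (norm v)\<^sup>2"
        unfolding quadratic_form_sum sum_distrib_right by (intro sum_mono) auto
    qed
  qed
  moreover have "0 \<le> (\<Sum>k\<in>UNIV. \<Sum>l\<in>UNIV. \<bar>M k l\<bar>)" by (intro sum_nonneg) auto
  ultimately show ?thesis by blast
qed

lemma quadratic_form_scaleR: "(a *\<^sub>R v) \<bullet> (A *v (a *\<^sub>R v)) = a\<^sup>2 * (v \<bullet> (A *v v))" for v :: "real^'d"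
  by (simp add: linear_scale[OF matrix_vector_mul_linear] power2_eq_square)

lemma quadratic_add_le:
  fixes A :: "real^'d^'d"
  assumes "positive_definite A"
  shows "(a + b) \<bullet> (A *v (a + b)) \<le> 2 * (a \<bullet> (A *v a)) + 2 * (b \<bullet> (A *v b))"
  using quadratic_split[of A 1 a b] positive_definite_nonneg[OF assms] by simp

text \<open>A product of a cutoff at infinity and one at the boundary. The energy density of the
  first is bounded and lives where |x| >= n, but it does not get small; the second is as cheap as
  desired on the ball containing the support of the first. The cube anticipates the factor (n + 1)^2
  contributed by the truncation height.\<close>

lemma exhausting_cutoff:
  fixes \<Omega> :: "(real^'d) set" and C :: "real^'d \<Rightarrow> real^'d^'d"
  assumes \<Omega>: "open \<Omega>" "frontier \<Omega> \<noteq> {}" and reg: "ahlfors_regular (frontier \<Omega>) s"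
    and C: "admissible_coefficients \<Omega> C" and deg: "degenerate_at_boundary \<Omega> C \<delta>"
    and \<delta>: "0 \<le> \<delta>" "2 - real CARD('d) + s \<le> \<delta>"
  shows "\<exists>B\<ge>0. \<forall>n::nat. \<exists>\<zeta> D. \<zeta> \<in> test_functions \<Omega> \<and> (\<forall>x. 0 \<le> \<zeta> x \<and> \<zeta> x \<le> 1) \<and>
     (\<forall>x\<in>\<Omega>. norm x < real n \<and> infdist x (frontier \<Omega>) > 5/4 * (1/2) ^ n \<longrightarrow> \<zeta> x = 1) \<and>
     integrable (lebesgue_on \<Omega>) D \<and> (LINT x|lebesgue_on \<Omega>. D x) \<le> 1 / real (Suc n) ^ 3 \<and>
     (AE x in lebesgue_on \<Omega>. 0 \<le> D x \<and> gradient \<zeta> x \<bullet> (C x *v gradient \<zeta> x) \<le> B * indicator {x. real n \<le> norm x} x + D x)"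
proof -
  let ?\<Gamma> = "frontier \<Omega>"
  obtain M where M: "M > 0" and cut: "\<forall>(A :: (real^'d) set) \<epsilon>. A \<in> sets borel \<and> bounded A \<and> \<epsilon> > 0 \<longrightarrow>
     (\<exists>c. (\<forall>n. Ck n c) \<and> (\<forall>x. 0 \<le> c x \<and> c x \<le> 1 \<and> norm (gradient c x) \<le> M / \<epsilon>) \<and>
       (\<forall>x. cball x \<epsilon> \<subseteq> A \<longrightarrow> c x = 1 \<and> gradient c x = 0) \<and>
       (\<forall>x. cball x \<epsilon> \<inter> A = {} \<longrightarrow> c x = 0 \<and> gradient c x = 0))"
    using smooth_cutoff by (elim exE conjE)
  obtain \<Lambda> where \<Lambda>: "\<Lambda> \<ge> 0" and up: "AE x in lebesgue_on \<Omega>. \<forall>v. v \<bullet> (C x *v v) \<le> \<Lambda> * (norm v)\<^sup>2"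
    using energy_upper_bound[OF C] by blast
  have pd: "AE x in lebesgue_on \<Omega>. positive_definite (C x)" using C by (simp add: admissible_coefficients_def)
  show ?thesis
  proof (intro exI[of _ "2 * (\<Lambda> * M\<^sup>2)"] conjI allI)
    show "0 \<le> 2 * (\<Lambda> * M\<^sup>2)" using \<Lambda> by simp
    fix n :: nat
    have "ball (0::real^'d) (real n + 1) \<in> sets borel \<and> bounded (ball (0::real^'d) (real n + 1)) \<and> (1::real) > 0" by simp
    then have "\<exists>c. (\<forall>n. Ck n c) \<and> (\<forall>x. 0 \<le> c x \<and> c x \<le> 1 \<and> norm (gradient c x) \<le> M / 1) \<and>
       (\<forall>x. cball x 1 \<subseteq> ball (0::real^'d) (real n + 1) \<longrightarrow> c x = 1 \<and> gradient c x = 0) \<and>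
       (\<forall>x. cball x 1 \<inter> ball (0::real^'d) (real n + 1) = {} \<longrightarrow> c x = 0 \<and> gradient c x = 0)"
      using cut by meson
    then obtain \<psi> where \<psi>: "\<And>n. Ck n \<psi>" "\<And>x. 0 \<le> \<psi> x \<and> \<psi> x \<le> 1 \<and> norm (gradient \<psi> x) \<le> M"
       "\<And>x. cball x 1 \<subseteq> ball (0::real^'d) (real n + 1) \<Longrightarrow> \<psi> x = 1 \<and> gradient \<psi> x = 0"
       "\<And>x. cball x 1 \<inter> ball (0::real^'d) (real n + 1) = {} \<Longrightarrow> \<psi> x = 0 \<and> gradient \<psi> x = 0" by auto
    have \<psi>1: "\<psi> x = 1 \<and> gradient \<psi> x = 0" if "norm x < real n" for x
    proof (rule \<psi>(3), rule subsetI)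
      fix y assume "y \<in> cball x 1"
      then have "dist x y \<le> 1" by simp
      then show "y \<in> ball 0 (real n + 1)" using that dist_triangle[of 0 y x] by simp
    qed
    have \<psi>0: "\<psi> x = 0 \<and> gradient \<psi> x = 0" if "norm x \<ge> real n + 2" for x
    proof (rule \<psi>(4), rule ccontr)
      assume "cball x 1 \<inter> ball 0 (real n + 1) \<noteq> {}"
      then obtain y where "dist x y \<le> 1" "dist 0 y < real n + 1" by auto
      then show False using that dist_triangle[of 0 x y] by (simp add: dist_commute)
    qed
    define R where "R = real n + 2"
    obtain c N0 where c: "c \<ge> 0" and bc: "\<forall>N\<ge>N0. \<exists>\<eta>. (\<forall>n. Ck n \<eta>) \<and> (\<forall>x. 0 \<le> \<eta> x \<and> \<eta> x \<le> 1) \<and>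
     (\<forall>x. x \<notin> \<Omega> \<or> infdist x ?\<Gamma> \<le> 1/2 * (1/2) ^ (2 * N) \<longrightarrow> \<eta> x = 0) \<and>
     (\<forall>x\<in>\<Omega> \<inter> ball 0 R. infdist x ?\<Gamma> > 5/4 * (1/2) ^ N \<longrightarrow> \<eta> x = 1) \<and>
     integrable (lebesgue_on \<Omega>) (\<lambda>x. indicator (ball 0 R) x * (gradient \<eta> x \<bullet> (C x *v gradient \<eta> x))) \<and>
     (LINT x|lebesgue_on \<Omega>. indicator (ball 0 R) x * (gradient \<eta> x \<bullet> (C x *v gradient \<eta> x))) \<le> c / real N"
      using boundary_cutoff[OF \<Omega> reg C deg \<delta>, of R] by (elim exE conjE)
    \<comment> \<open>The constant \<open>c\<close> depends on \<open>R\<close>, hence on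
      \<open>n\<close>; the number of averaged scales is therefore chosen after
      \<open>n\<close>.\<close>
    obtain N2 :: nat where N2: "2 * c * real (Suc n) ^ 3 \<le> real N2" using real_arch_simple by blast
    define N where "N = Suc (max N0 (max n N2))"
    have N: "N \<ge> N0" "n \<le> N" "2 * c * real (Suc n) ^ 3 \<le> real N" "real N > 0" using N2 by (auto simp: N_def)
    obtain \<eta> where e: "\<forall>n. Ck n \<eta>" "\<forall>x. 0 \<le> \<eta> x \<and> \<eta> x \<le> 1"
      "\<forall>x. x \<notin> \<Omega> \<or> infdist x ?\<Gamma> \<le> 1/2 * (1/2) ^ (2 * N) \<longrightarrow> \<eta> x = 0"
      "\<forall>x\<in>\<Omega> \<inter> ball 0 R. infdist x ?\<Gamma> > 5/4 * (1/2) ^ N \<longrightarrow> \<eta> x = 1"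
      "integrable (lebesgue_on \<Omega>) (\<lambda>x. indicator (ball 0 R) x * (gradient \<eta> x \<bullet> (C x *v gradient \<eta> x)))"
      "(LINT x|lebesgue_on \<Omega>. indicator (ball 0 R) x * (gradient \<eta> x \<bullet> (C x *v gradient \<eta> x))) \<le> c / real N"
      using mp[OF spec[OF bc, of N] N(1)] by (elim exE conjE)
    note \<eta> = spec[OF e(1)] spec[OF e(2)] mp[OF spec[OF e(3)]] mp[OF bspec[OF e(4)]] e(5) e(6)
    define \<zeta> where "\<zeta> x = \<psi> x * \<eta> x" for x
    define D where "D x = 2 * (indicator (ball 0 R) x * (gradient \<eta> x \<bullet> (C x *v gradient \<eta> x)))" for x
    define K where "K = closure \<Omega> \<inter> {x. 1/2 * (1/2) ^ (2 * N) \<le> infdist x ?\<Gamma>} \<inter> cball 0 R"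
    have "closed {x. 1/2 * (1/2) ^ (2 * N) \<le> infdist x ?\<Gamma>}" by (intro closed_Collect_le continuous_intros)
    then have K: "compact K" unfolding K_def by (intro closed_Int_compact closed_Int) auto
    have "K \<subseteq> \<Omega>"
    proof
      fix x assume x: "x \<in> K"
      have "(0::real) < 1/2 * (1/2) ^ (2 * N)" by simp
      also have "\<dots> \<le> infdist x ?\<Gamma>" using x unfolding K_def by blast
      finally have "0 < infdist x ?\<Gamma>" .
      then have "x \<notin> ?\<Gamma>" by auto
      then show "x \<in> \<Omega>" using x \<Omega>(1) by (auto simp: K_def frontier_def interior_open)
    qed
    have \<zeta>t: "\<zeta> \<in> test_functions \<Omega>"
    proof (rule test_functionsI[OF _ K \<open>K \<subseteq> \<Omega>\<close>])
      show "Ck m \<zeta>" for m unfolding \<zeta>_def[abs_def] by (intro Ck_mult \<psi>(1) \<eta>(1))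
      fix x assume "x \<notin> K"
      then consider "x \<notin> \<Omega>" | "infdist x ?\<Gamma> \<le> 1/2 * (1/2) ^ (2 * N)" | "norm x \<ge> R"
        unfolding K_def using closure_subset by force
      then show "\<zeta> x = 0" unfolding \<zeta>_def using \<eta>(3)[of x] \<psi>0[of x] by cases (auto simp: R_def)
    qed
    have g\<zeta>: "gradient \<zeta> x = \<eta> x *\<^sub>R gradient \<psi> x + \<psi> x *\<^sub>R gradient \<eta> x" for x
      unfolding vec_eq_iff \<zeta>_def[abs_def]
      using partial_mult[OF Ck_Suc_differentiable[OF \<psi>(1)] Ck_Suc_differentiable[OF \<eta>(1)]] by (simp add: mult.commute)
    have "AE x in lebesgue_on \<Omega>. 0 \<le> D x \<and> gradient \<zeta> x \<bullet> (C x *v gradient \<zeta> x) \<le> 2 * (\<Lambda> * M\<^sup>2) * indicator {x. real n \<le> norm x} x + D x"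
      using up pd
    proof eventually_elim
      case (elim x)
      have nn: "0 \<le> gradient f x \<bullet> (C x *v gradient f x)" for f by (rule positive_definite_nonneg[OF elim(2)])
      have "gradient \<zeta> x \<bullet> (C x *v gradient \<zeta> x) \<le> 2 * ((\<eta> x)\<^sup>2 * (gradient \<psi> x \<bullet> (C x *v gradient \<psi> x))) + 2 * ((\<psi> x)\<^sup>2 * (gradient \<eta> x \<bullet> (C x *v gradient \<eta> x)))"
        unfolding g\<zeta> using quadratic_add_le[OF elim(2), of "\<eta> x *\<^sub>R gradient \<psi> x" "\<psi> x *\<^sub>R gradient \<eta> x"]
        unfolding quadratic_form_scaleR .
      moreover have "(\<eta> x)\<^sup>2 * (gradient \<psi> x \<bullet> (C x *v gradient \<psi> x)) \<le> \<Lambda> * M\<^sup>2 * indicator {x. real n \<le> norm x} x"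
      proof (cases "norm x < real n")
        case False
        have "(\<eta> x)\<^sup>2 * (gradient \<psi> x \<bullet> (C x *v gradient \<psi> x)) \<le> 1 * (\<Lambda> * (norm (gradient \<psi> x))\<^sup>2)"
          using elim(1) \<eta>(2)[of x] nn by (intro mult_mono power_le_one) auto
        also have "\<dots> \<le> 1 * (\<Lambda> * M\<^sup>2)" using \<psi>(2)[of x] \<Lambda> by (intro mult_left_mono power_mono) auto
        finally show ?thesis using False by simp
      qed (use \<psi>1[of x] in simp)
      moreover have "(\<psi> x)\<^sup>2 * (gradient \<eta> x \<bullet> (C x *v gradient \<eta> x)) \<le> indicator (ball 0 R) x * (gradient \<eta> x \<bullet> (C x *v gradient \<eta> x))"
      proof (cases "norm x < R")
        case True
        have "(\<psi> x)\<^sup>2 \<le> 1" using \<psi>(2)[of x] by (intro power_le_one) auto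
        then show ?thesis using True nn by (intro mult_right_mono) auto
      qed (use \<psi>0[of x] in \<open>simp add: R_def\<close>)
      moreover have "0 \<le> D x" unfolding D_def using nn[of \<eta>] by (intro mult_nonneg_nonneg) auto
      ultimately show ?case unfolding D_def by linarith
    qed
    moreover have "\<zeta> x = 1" if "x \<in> \<Omega>" "norm x < real n" "infdist x ?\<Gamma> > 5/4 * (1/2) ^ n" for x
    proof -
      have "(1/2::real) ^ N \<le> (1/2) ^ n" using N by (intro power_decreasing) auto
      then have "\<eta> x = 1" using that by (intro \<eta>(4)) (auto simp: R_def elim: le_less_trans[rotated])
      then show ?thesis using \<psi>1[OF that(2)] by (simp add: \<zeta>_def)
    qed
    moreover have "0 \<le> \<zeta> x" "\<zeta> x \<le> 1" for x
      using \<psi>(2)[of x] \<eta>(2)[of x] by (auto simp: \<zeta>_def intro: mult_le_one)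
    moreover have "integrable (lebesgue_on \<Omega>) D" unfolding D_def using \<eta>(5) by (rule integrable_mult_right)
    moreover have "(LINT x|lebesgue_on \<Omega>. D x) \<le> 1 / real (Suc n) ^ 3"
    proof -
      have "(LINT x|lebesgue_on \<Omega>. D x) \<le> 2 * (c / real N)" unfolding D_def using \<eta>(6) by simp
      also have "\<dots> \<le> 1 / real (Suc n) ^ 3" using N(3,4) by (simp add: field_simps del: of_nat_Suc)
      finally show ?thesis .
    qed
    ultimately show "\<exists>\<zeta> D. \<zeta> \<in> test_functions \<Omega> \<and> (\<forall>x. 0 \<le> \<zeta> x \<and> \<zeta> x \<le> 1) \<and>
     (\<forall>x\<in>\<Omega>. norm x < real n \<and> infdist x ?\<Gamma> > 5/4 * (1/2) ^ n \<longrightarrow> \<zeta> x = 1) \<and>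
     integrable (lebesgue_on \<Omega>) D \<and> (LINT x|lebesgue_on \<Omega>. D x) \<le> 1 / real (Suc n) ^ 3 \<and>
     (AE x in lebesgue_on \<Omega>. 0 \<le> D x \<and> gradient \<zeta> x \<bullet> (C x *v gradient \<zeta> x) \<le> 2 * (\<Lambda> * M\<^sup>2) * indicator {x. real n \<le> norm x} x + D x)"
      using \<zeta>t by (intro exI[of _ \<zeta>] exI[of _ D]) auto
  qed
qed

lemma scaled_sin_tendsto: "(\<lambda>n. real (Suc n) * sin (c / real (Suc n))) \<longlonglongrightarrow> c"
proof -
  have "((\<lambda>t. sin (c * t)) has_real_derivative c) (at 0)" by (auto intro!: derivative_eq_intros)
  then have "(\<lambda>h. (sin (c * (0 + h)) - sin (c * 0)) / h) \<midarrow>0\<rightarrow> c" by (rule DERIV_D)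
  then have L: "((\<lambda>h. sin (c * h) / h) \<longlongrightarrow> c) (at 0)" by simp
  have "filterlim (\<lambda>n. inverse (real (Suc n))) (at 0) sequentially"
    unfolding filterlim_at using LIMSEQ_inverse_real_of_nat by simp
  from filterlim_compose[OF L this] show ?thesis by (simp add: divide_inverse mult.commute)
qed

text \<open>The truncation height must tend to infinity to recover \<open>u\<close>, but its square
  multiplies the energy of the boundary cutoff. Heights n + 1 against cutoff energies (n + 1)^(-3)
  leave 1/(n + 1).\<close>

lemma hN_subset_hD:
  fixes \<Omega> :: "(real^'d) set" and C :: "real^'d \<Rightarrow> real^'d^'d"
  assumes \<Omega>: "open \<Omega>" "frontier \<Omega> \<noteq> {}" and reg: "ahlfors_regular (frontier \<Omega>) s"
    and C: "admissible_coefficients \<Omega> C" and deg: "degenerate_at_boundary \<Omega> C \<delta>"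
    and \<delta>: "0 \<le> \<delta>" "2 - real CARD('d) + s \<le> \<delta>"
  shows "hN_form \<Omega> C \<subseteq> hD_form \<Omega> C"
proof
  let ?\<Gamma> = "frontier \<Omega>" and ?M = "lebesgue_on \<Omega>"
  fix p assume "p \<in> hN_form \<Omega> C"
  then obtain u q g where p: "p = (u, q)" and W: "W12_loc_gradient \<Omega> u g"
    and I: "integrable ?M (\<lambda>x. g x \<bullet> (C x *v g x) + (u x)\<^sup>2)" and q: "q = (LINT x|?M. g x \<bullet> (C x *v g x))"
    unfolding hN_form_def quadratic_form_sum by blast
  have um: "u \<in> borel_measurable ?M" and gm: "\<And>k. (\<lambda>x. g x $ k) \<in> borel_measurable ?M"
    using W by (auto simp: W12_loc_gradient_def L2_loc_def)
  have pd: "AE x in ?M. positive_definite (C x)" using C by (simp add: admissible_coefficients_def)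
  have Qm: "(\<lambda>x. g x \<bullet> (C x *v g x)) \<in> borel_measurable ?M" by (rule energy_measurable[OF C gm])
  have Qi: "integrable ?M (\<lambda>x. g x \<bullet> (C x *v g x))"
    by (rule Bochner_Integration.integrable_bound[OF I Qm], use pd in eventually_elim)
       (simp add: positive_definite_nonneg abs_of_nonneg)
  have ui: "integrable ?M (\<lambda>x. (u x)\<^sup>2)"
    using Bochner_Integration.integrable_diff[OF I Qi] by simp
  have uL2: "u \<in> L2 \<Omega>" using um ui by (simp add: L2_def)
  obtain \<Lambda> where \<Lambda>: "\<Lambda> \<ge> 0" and up: "AE x in ?M. \<forall>v. v \<bullet> (C x *v v) \<le> \<Lambda> * (norm v)\<^sup>2"
    using energy_upper_bound[OF C] by blast
  obtain B where B: "B \<ge> 0" and ex: "\<forall>n::nat. \<exists>\<zeta> D. \<zeta> \<in> test_functions \<Omega> \<and> (\<forall>x. 0 \<le> \<zeta> x \<and> \<zeta> x \<le> 1) \<and>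
     (\<forall>x\<in>\<Omega>. norm x < real n \<and> infdist x ?\<Gamma> > 5/4 * (1/2) ^ n \<longrightarrow> \<zeta> x = 1) \<and>
     integrable ?M D \<and> (LINT x|?M. D x) \<le> 1 / real (Suc n) ^ 3 \<and>
     (AE x in ?M. 0 \<le> D x \<and> gradient \<zeta> x \<bullet> (C x *v gradient \<zeta> x) \<le> B * indicator {x. real n \<le> norm x} x + D x)"
    using exhausting_cutoff[OF \<Omega> reg C deg \<delta>] by (elim exE conjE)
  from choice[OF ex] obtain \<zeta> where "\<forall>n. \<exists>D. \<zeta> n \<in> test_functions \<Omega> \<and> (\<forall>x. 0 \<le> \<zeta> n x \<and> \<zeta> n x \<le> 1) \<and>
     (\<forall>x\<in>\<Omega>. norm x < real n \<and> infdist x ?\<Gamma> > 5/4 * (1/2) ^ n \<longrightarrow> \<zeta> n x = 1) \<and>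
     integrable ?M D \<and> (LINT x|?M. D x) \<le> 1 / real (Suc n) ^ 3 \<and>
     (AE x in ?M. 0 \<le> D x \<and> gradient (\<zeta> n) x \<bullet> (C x *v gradient (\<zeta> n) x) \<le> B * indicator {x. real n \<le> norm x} x + D x)" by (elim exE)
  from choice[OF this] obtain D where zD: "\<forall>n. \<zeta> n \<in> test_functions \<Omega> \<and> (\<forall>x. 0 \<le> \<zeta> n x \<and> \<zeta> n x \<le> 1) \<and>
     (\<forall>x\<in>\<Omega>. norm x < real n \<and> infdist x ?\<Gamma> > 5/4 * (1/2) ^ n \<longrightarrow> \<zeta> n x = 1) \<and>
     integrable ?M (D n) \<and> (LINT x|?M. D n x) \<le> 1 / real (Suc n) ^ 3 \<and>
     (AE x in ?M. 0 \<le> D n x \<and> gradient (\<zeta> n) x \<bullet> (C x *v gradient (\<zeta> n) x) \<le> B * indicator {x. real n \<le> norm x} x + D n x)" by (elim exE)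
  have \<zeta>: "\<zeta> n \<in> test_functions \<Omega>" "0 \<le> \<zeta> n x" "\<zeta> n x \<le> 1" "integrable ?M (D n)" "(LINT x|?M. D n x) \<le> 1 / real (Suc n) ^ 3"
    "AE x in ?M. 0 \<le> D n x \<and> gradient (\<zeta> n) x \<bullet> (C x *v gradient (\<zeta> n) x) \<le> B * indicator {x. real n \<le> norm x} x + D n x" for n x
    using zD by auto
  have \<zeta>1: "\<forall>\<^sub>F n in sequentially. \<zeta> n x = 1" if x: "x \<in> \<Omega>" for x
  proof -
    have "x \<notin> ?\<Gamma>" using x \<Omega>(1) by (simp add: frontier_def interior_open)
    then have "infdist x ?\<Gamma> > 0"
      using infdist_pos_not_in_closed[OF frontier_closed \<Omega>(2)] by blast
    moreover have "(\<lambda>n. 5/4 * (1/2::real) ^ n) \<longlonglongrightarrow> 5/4 * 0" by (intro tendsto_mult_left LIMSEQ_power_zero) simp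
    ultimately have "\<forall>\<^sub>F n in sequentially. 5/4 * (1/2::real) ^ n < infdist x ?\<Gamma>" by (intro order_tendstoD(2)) auto
    moreover have "\<forall>\<^sub>F n in sequentially. norm x < real n"
      using filterlim_real_sequentially by (simp add: filterlim_at_top_dense)
    ultimately show ?thesis by eventually_elim (use zD x in blast)
  qed
  have \<zeta>m: "\<zeta> n \<in> borel_measurable ?M" "partial k (\<zeta> n) \<in> borel_measurable ?M" for n k
    by (intro measurable_lebesgue_on borel_measurable_continuous_onI Ck_continuous[of 0] test_functions_Ck[OF \<zeta>(1)]
        test_functions_Ck[OF test_functions_partial[OF \<zeta>(1)]])+
  define a where "a n = real (Suc n)" for n
  have a: "a n > 0" for n by (simp add: a_def)
  define F where "F n x = a n * sin (u x / a n)" for n x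
  define w where "w n x = \<zeta> n x * F n x" for n x
  define h where "h n x = F n x *\<^sub>R gradient (\<zeta> n) x + (\<zeta> n x * cos (u x / a n)) *\<^sub>R g x" for n x
  \<comment> \<open>Two bounds for two places: by |u| where the cutoff at infinity varies, so that
    the tail of u^2 appears, and by the height \<open>a n\<close> where the boundary cutoff
    varies.\<close>
  have F2: "(F n x)\<^sup>2 \<le> (u x)\<^sup>2" "(F n x)\<^sup>2 \<le> (a n)\<^sup>2" for n x
  proof -
    have "\<bar>F n x\<bar> \<le> \<bar>u x\<bar>" using sin_scaled_lipschitz[OF a, of n "u x" 0] by (simp add: F_def)
    then show "(F n x)\<^sup>2 \<le> (u x)\<^sup>2" by (simp add: abs_le_square_iff)
    have "(sin (u x / a n))\<^sup>2 \<le> 1" using power_mono[OF abs_sin_le_one[of "u x / a n"], of 2] by simp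
    then show "(F n x)\<^sup>2 \<le> (a n)\<^sup>2" unfolding F_def power_mult_distrib using mult_left_mono[of _ 1 "(a n)\<^sup>2"] by simp
  qed
  have Fm: "F n \<in> borel_measurable ?M" "(\<lambda>x. cos (u x / a n)) \<in> borel_measurable ?M" for n
    unfolding F_def[abs_def] using um by simp_all
  have hm: "(\<lambda>x. h n x $ k) \<in> borel_measurable ?M" for n k
    unfolding h_def using Fm \<zeta>m gm by simp
  have "\<forall>n. \<exists>\<phi>. \<phi> \<in> test_functions \<Omega> \<and> (integrable ?M (\<lambda>x. (\<phi> x - w n x)\<^sup>2) \<and> (LINT x|?M. (\<phi> x - w n x)\<^sup>2) < 1 / a n) \<and>
     (\<forall>k. integrable ?M (\<lambda>x. (partial k \<phi> x - h n x $ k)\<^sup>2) \<and> (LINT x|?M. (partial k \<phi> x - h n x $ k)\<^sup>2) < 1 / a n)"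
  proof
    fix n
    have "1 / a n > 0" using a by simp
    have hw: "a n * sin (u x / a n) * partial k (\<zeta> n) x + \<zeta> n x * (cos (u x / a n) * g x $ k) = h n x $ k"
      "\<zeta> n x * (a n * sin (u x / a n)) = w n x" for k x
      by (simp_all add: h_def F_def w_def)
    from smooth_truncation_approx[OF \<Omega>(1) W \<zeta>(1)[of n] a[of n] \<open>1 / a n > 0\<close>, unfolded hw]
    show "\<exists>\<phi>. \<phi> \<in> test_functions \<Omega> \<and> (integrable ?M (\<lambda>x. (\<phi> x - w n x)\<^sup>2) \<and> (LINT x|?M. (\<phi> x - w n x)\<^sup>2) < 1 / a n) \<and>
     (\<forall>k. integrable ?M (\<lambda>x. (partial k \<phi> x - h n x $ k)\<^sup>2) \<and> (LINT x|?M. (partial k \<phi> x - h n x $ k)\<^sup>2) < 1 / a n)" by blast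
  qed
  from choice[OF this] obtain \<phi> where phi: "\<forall>n. \<phi> n \<in> test_functions \<Omega> \<and> (integrable ?M (\<lambda>x. (\<phi> n x - w n x)\<^sup>2) \<and> (LINT x|?M. (\<phi> n x - w n x)\<^sup>2) < 1 / a n) \<and>
     (\<forall>k. integrable ?M (\<lambda>x. (partial k (\<phi> n) x - h n x $ k)\<^sup>2) \<and> (LINT x|?M. (partial k (\<phi> n) x - h n x $ k)\<^sup>2) < 1 / a n)" by (elim exE)
  have \<phi>: "\<phi> n \<in> test_functions \<Omega>" "integrable ?M (\<lambda>x. (\<phi> n x - w n x)\<^sup>2)" "(LINT x|?M. (\<phi> n x - w n x)\<^sup>2) \<le> 1 / a n"
    "integrable ?M (\<lambda>x. (partial k (\<phi> n) x - h n x $ k)\<^sup>2)" "(LINT x|?M. (partial k (\<phi> n) x - h n x $ k)\<^sup>2) \<le> 1 / a n" for n k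
    using phi by (auto intro: less_imp_le)
  have \<phi>m: "\<phi> n \<in> borel_measurable ?M" "partial k (\<phi> n) \<in> borel_measurable ?M" for n k
    by (intro measurable_lebesgue_on borel_measurable_continuous_onI Ck_continuous[of 0] test_functions_Ck[OF \<phi>(1)]
        test_functions_Ck[OF test_functions_partial[OF \<phi>(1)]])+
  have a0: "(\<lambda>n. 1 / a n) \<longlonglongrightarrow> 0" unfolding a_def using LIMSEQ_inverse_real_of_nat by (simp add: divide_inverse)
  have xO: "AE x in ?M. x \<in> \<Omega>" by (rule AE_I2) simp

  have L2lim: "(\<lambda>n. LINT x|?M. (\<phi> n x - u x)\<^sup>2) \<longlonglongrightarrow> 0"
  proof -
    \<comment> \<open>Since |w n| <= |F n| <= |u|, one majorant serves for all \<open>n\<close>; at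
      each point of \<open>\<Omega>\<close> the cutoff is eventually 1 and the truncation tends to
      \<open>u\<close>.\<close>
    have le4: "(w n x - u x)\<^sup>2 \<le> 4 * (u x)\<^sup>2" for n x
    proof -
      have "\<bar>F n x\<bar> \<le> \<bar>u x\<bar>" using F2(1)[of n x] by (simp add: abs_le_square_iff)
      moreover have "\<bar>w n x\<bar> \<le> 1 * \<bar>F n x\<bar>" unfolding w_def abs_mult using \<zeta>(2,3)[of n x] by (intro mult_right_mono) auto
      ultimately have "\<bar>w n x - u x\<bar> \<le> \<bar>2 * u x\<bar>" by linarith
      then have "(w n x - u x)\<^sup>2 \<le> (2 * u x)\<^sup>2" by (simp only: abs_le_square_iff)
      then show ?thesis by (simp add: power_mult_distrib)
    qed
    have wm: "(\<lambda>x. (w n x - u x)\<^sup>2) \<in> borel_measurable ?M" for n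
      unfolding w_def using Fm \<zeta>m um by simp
    have wi: "integrable ?M (\<lambda>x. (w n x - u x)\<^sup>2)" for n
      by (rule Bochner_Integration.integrable_bound[OF integrable_mult_right[OF ui, of 4] wm]) (use le4 in auto)
    have "(\<lambda>n. LINT x|?M. (w n x - u x)\<^sup>2) \<longlonglongrightarrow> (LINT x|?M. 0 * u x)"
    proof (rule integral_dominated_convergence[where w="\<lambda>x. 4 * (u x)\<^sup>2"])
      show "AE x in ?M. (\<lambda>n. (w n x - u x)\<^sup>2) \<longlonglongrightarrow> 0 * u x"
        using xO
      proof eventually_elim
        case (elim x)
        have "(\<lambda>n. (F n x - u x)\<^sup>2) \<longlonglongrightarrow> (u x - u x)\<^sup>2"
          unfolding F_def a_def by (intro tendsto_intros scaled_sin_tendsto)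
        then have "(\<lambda>n. (F n x - u x)\<^sup>2) \<longlonglongrightarrow> 0 * u x" by simp
        moreover have "\<forall>\<^sub>F n in sequentially. (F n x - u x)\<^sup>2 = (w n x - u x)\<^sup>2"
          using \<zeta>1[OF elim] by eventually_elim (simp add: w_def)
        ultimately show ?case by (rule Lim_transform_eventually)
      qed
      show "integrable ?M (\<lambda>x. 4 * (u x)\<^sup>2)" using ui by simp
      show "AE x in ?M. norm ((w n x - u x)\<^sup>2) \<le> 4 * (u x)\<^sup>2" for n using le4 by simp
    qed (use wm um in simp_all)
    then have wL: "(\<lambda>n. LINT x|?M. (w n x - u x)\<^sup>2) \<longlonglongrightarrow> 0" by simp
    have pw: "(\<phi> n x - u x)\<^sup>2 \<le> 2 * (\<phi> n x - w n x)\<^sup>2 + 2 * (w n x - u x)\<^sup>2" for n x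
      using zero_le_power2[of "(\<phi> n x - w n x) - (w n x - u x)"] by (simp add: power2_eq_square algebra_simps)
    have si: "integrable ?M (\<lambda>x. 2 * (\<phi> n x - w n x)\<^sup>2 + 2 * (w n x - u x)\<^sup>2)" for n using \<phi>(2) wi by simp
    have bi: "integrable ?M (\<lambda>x. (\<phi> n x - u x)\<^sup>2)" for n
      by (rule Bochner_Integration.integrable_bound[OF si[of n]]) (use \<phi>m um pw in auto)
    have b: "(LINT x|?M. (\<phi> n x - u x)\<^sup>2) \<le> 2 * (1 / a n) + 2 * (LINT x|?M. (w n x - u x)\<^sup>2)" for n
    proof -
      have "(LINT x|?M. (\<phi> n x - u x)\<^sup>2) \<le> (LINT x|?M. 2 * (\<phi> n x - w n x)\<^sup>2 + 2 * (w n x - u x)\<^sup>2)"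
        by (rule Bochner_Integration.integral_mono[OF bi si pw])
      also have "\<dots> = 2 * (LINT x|?M. (\<phi> n x - w n x)\<^sup>2) + 2 * (LINT x|?M. (w n x - u x)\<^sup>2)"
        using \<phi>(2) wi by simp
      finally show ?thesis using \<phi>(3)[of n] by linarith
    qed
    have l: "(\<lambda>n. 2 * (1 / a n) + 2 * (LINT x|?M. (w n x - u x)\<^sup>2)) \<longlonglongrightarrow> 2 * 0 + 2 * 0"
      by (intro tendsto_add tendsto_mult_left a0 wL)
    show ?thesis
    proof (rule tendsto_sandwich[OF _ _ tendsto_const[of 0]])
      show "\<forall>\<^sub>F n in sequentially. 0 \<le> (LINT x|?M. (\<phi> n x - u x)\<^sup>2)" by simp
      show "\<forall>\<^sub>F n in sequentially. (LINT x|?M. (\<phi> n x - u x)\<^sup>2) \<le> 2 * (1 / a n) + 2 * (LINT x|?M. (w n x - u x)\<^sup>2)"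
        by (intro always_eventually allI b)
    qed (use l in simp)
  qed

  define E where "E n x = (gradient (\<phi> n) x - g x) \<bullet> (C x *v (gradient (\<phi> n) x - g x))" for n x
  define T where "T n x = (\<zeta> n x * cos (u x / a n) - 1)\<^sup>2 * (g x \<bullet> (C x *v g x))" for n x
  define U where "U n x = indicator {x. real n \<le> norm x} x * (u x)\<^sup>2" for n and x :: "real^'d"
  \<comment> \<open>The majorant of \<open>E n\<close>, term by term: the mollification error, the
    tail of u^2 from the cutoff at infinity, the boundary cutoff times the squared height, and the
    loss of energy of \<open>g\<close> through cutoff and truncation.\<close>
  define Z where "Z n x = 2 * \<Lambda> * (\<Sum>k\<in>UNIV. (partial k (\<phi> n) x - h n x $ k)\<^sup>2) + 4 * (B * U n x + (a n)\<^sup>2 * D n x) + 4 * T n x" for n x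
  have Em: "E n \<in> borel_measurable ?M" for n
    unfolding E_def[abs_def] by (rule energy_measurable[OF C]) (use \<phi>m gm in simp)
  have E0: "AE x in ?M. 0 \<le> E n x" for n
    using pd unfolding E_def by eventually_elim (rule positive_definite_nonneg)
  have EZ: "AE x in ?M. E n x \<le> Z n x" for n
    using pd up \<zeta>(6)[of n]
  proof eventually_elim
    case (elim x)
    let ?Q = "\<lambda>v. v \<bullet> (C x *v v)"
    let ?i = "indicator {x. real n \<le> norm x} x :: real"
    have nn: "0 \<le> ?Q v" for v by (rule positive_definite_nonneg[OF elim(1)])
    have 1: "E n x \<le> 2 * ?Q (gradient (\<phi> n) x - h n x) + 2 * ?Q (h n x - g x)"
      unfolding E_def using quadratic_add_le[OF elim(1), of "gradient (\<phi> n) x - h n x" "h n x - g x"] by simp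
    have "?Q (gradient (\<phi> n) x - h n x) \<le> \<Lambda> * (norm (gradient (\<phi> n) x - h n x))\<^sup>2" using elim(2) by blast
    also have "(norm (gradient (\<phi> n) x - h n x))\<^sup>2 = (\<Sum>k\<in>UNIV. (partial k (\<phi> n) x - h n x $ k)\<^sup>2)"
      unfolding power2_norm_eq_inner inner_vec_def by (simp add: power2_eq_square)
    finally have 2: "?Q (gradient (\<phi> n) x - h n x) \<le> \<Lambda> * (\<Sum>k\<in>UNIV. (partial k (\<phi> n) x - h n x $ k)\<^sup>2)" .
    have "h n x - g x = F n x *\<^sub>R gradient (\<zeta> n) x + (\<zeta> n x * cos (u x / a n) - 1) *\<^sub>R g x"
      by (simp add: h_def algebra_simps)
    then have 3: "?Q (h n x - g x) \<le> 2 * ((F n x)\<^sup>2 * ?Q (gradient (\<zeta> n) x)) + 2 * T n x"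
      using quadratic_add_le[OF elim(1), of "F n x *\<^sub>R gradient (\<zeta> n) x" "(\<zeta> n x * cos (u x / a n) - 1) *\<^sub>R g x"]
      unfolding quadratic_form_scaleR T_def by simp
    have "(F n x)\<^sup>2 * ?Q (gradient (\<zeta> n) x) \<le> (F n x)\<^sup>2 * (B * ?i + D n x)"
      using elim(3) by (intro mult_left_mono) auto
    also have "\<dots> = (B * ?i) * (F n x)\<^sup>2 + (F n x)\<^sup>2 * D n x" by (simp add: algebra_simps)
    also have "\<dots> \<le> (B * ?i) * (u x)\<^sup>2 + (a n)\<^sup>2 * D n x"
      using elim(3) B F2[of n x] by (intro add_mono mult_left_mono mult_right_mono) auto
    finally have 4: "(F n x)\<^sup>2 * ?Q (gradient (\<zeta> n) x) \<le> B * U n x + (a n)\<^sup>2 * D n x"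
      by (simp add: U_def mult.assoc)
    have "e \<le> 2 * b * s + 4 * y + 4 * t" if "e \<le> 2 * v + 2 * r" "v \<le> b * s" "r \<le> 2 * f + 2 * t" "f \<le> y" for e b s y t v r f :: real
    proof -
      have "2 * b * s = 2 * (b * s)" by simp
      then show ?thesis using that by linarith
    qed
    from this[OF 1 2 3 4] show ?case unfolding Z_def .
  qed
  have Um: "U n \<in> borel_measurable ?M" for n
  proof -
    have "{x. real n \<le> norm x} \<in> sets (borel :: (real^'d) measure)"
      by (intro borel_closed closed_Collect_le continuous_intros)
    then have "(\<lambda>x. indicator {x. real n \<le> norm x} x :: real) \<in> borel_measurable ?M"
      by (intro measurable_lebesgue_on borel_measurable_indicator)
    then show ?thesis unfolding U_def[abs_def] using um by (intro borel_measurable_times borel_measurable_power)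
  qed
  have Tm: "T n \<in> borel_measurable ?M" for n unfolding T_def[abs_def] using Fm \<zeta>m Qm by simp
  have Ule: "\<bar>U n x\<bar> \<le> (u x)\<^sup>2" for n x by (simp add: U_def indicator_def)
  have Tle: "AE x in ?M. \<bar>T n x\<bar> \<le> 4 * (g x \<bullet> (C x *v g x))" for n
    using pd
  proof eventually_elim
    case (elim x)
    have nn: "0 \<le> g x \<bullet> (C x *v g x)" by (rule positive_definite_nonneg[OF elim])
    have "\<bar>\<zeta> n x * cos (u x / a n)\<bar> \<le> 1 * 1"
      unfolding abs_mult using \<zeta>(2,3)[of n x] by (intro mult_mono abs_cos_le_one) auto
    then have "\<bar>\<zeta> n x * cos (u x / a n) - 1\<bar> \<le> \<bar>2\<bar>" by linarith
    then have "(\<zeta> n x * cos (u x / a n) - 1)\<^sup>2 \<le> 2\<^sup>2" by (simp only: abs_le_square_iff)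
    then have "T n x \<le> 4 * (g x \<bullet> (C x *v g x))" unfolding T_def using nn by (intro mult_right_mono) auto
    moreover have "0 \<le> T n x" unfolding T_def using nn by (intro mult_nonneg_nonneg) auto
    ultimately show ?case by simp
  qed
  have Ui: "integrable ?M (U n)" for n
    by (rule Bochner_Integration.integrable_bound[OF ui Um]) (use Ule in auto)
  have Ti: "integrable ?M (T n)" for n
  proof (rule Bochner_Integration.integrable_bound[OF integrable_mult_right[OF Qi, of 4] Tm])
    show "AE x in ?M. norm (T n x) \<le> norm (4 * (g x \<bullet> (C x *v g x)))"
      using Tle[of n] by eventually_elim (simp add: order_trans[OF _ abs_ge_self])
  qed
  have UL: "(\<lambda>n. LINT x|?M. U n x) \<longlonglongrightarrow> 0"
  proof -
    have "(\<lambda>n. LINT x|?M. U n x) \<longlonglongrightarrow> (LINT x|?M. 0 * u x)"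
    proof (rule integral_dominated_convergence[where w="\<lambda>x. (u x)\<^sup>2"])
      show "AE x in ?M. (\<lambda>n. U n x) \<longlonglongrightarrow> 0 * u x"
      proof (rule AE_I2)
        fix x :: "real^'d"
        have "\<forall>\<^sub>F n in sequentially. norm x < real n"
          using filterlim_real_sequentially by (simp add: filterlim_at_top_dense)
        then have "\<forall>\<^sub>F n in sequentially. U n x = 0" by eventually_elim (simp add: U_def)
        then show "(\<lambda>n. U n x) \<longlonglongrightarrow> 0 * u x" by (simp add: tendsto_eventually)
      qed
    qed (use Um um Ule ui in simp_all)
    then show ?thesis by simp
  qed
  have TL: "(\<lambda>n. LINT x|?M. T n x) \<longlonglongrightarrow> 0"
  proof -
    have "(\<lambda>n. LINT x|?M. T n x) \<longlonglongrightarrow> (LINT x|?M. 0 * u x)"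
    proof (rule integral_dominated_convergence[where w="\<lambda>x. 4 * (g x \<bullet> (C x *v g x))"])
      show "AE x in ?M. (\<lambda>n. T n x) \<longlonglongrightarrow> 0 * u x"
        using xO
      proof eventually_elim
        case (elim x)
        have "(\<lambda>n. cos (u x * (1 / a n))) \<longlonglongrightarrow> cos (u x * 0)" by (intro tendsto_intros a0)
        then have c: "(\<lambda>n. cos (u x / a n)) \<longlonglongrightarrow> 1" by simp
        have "(\<lambda>n. (1 * cos (u x / a n) - 1)\<^sup>2 * (g x \<bullet> (C x *v g x))) \<longlonglongrightarrow> (1 * 1 - 1)\<^sup>2 * (g x \<bullet> (C x *v g x))"
          by (intro tendsto_intros c)
        then have "(\<lambda>n. (1 * cos (u x / a n) - 1)\<^sup>2 * (g x \<bullet> (C x *v g x))) \<longlonglongrightarrow> 0 * u x" by simp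
        moreover have "\<forall>\<^sub>F n in sequentially. (1 * cos (u x / a n) - 1)\<^sup>2 * (g x \<bullet> (C x *v g x)) = T n x"
          using \<zeta>1[OF elim] by eventually_elim (simp add: T_def)
        ultimately show ?case by (rule Lim_transform_eventually)
      qed
      show "AE x in ?M. norm (T n x) \<le> 4 * (g x \<bullet> (C x *v g x))" for n using Tle[of n] by simp
    qed (use Tm um Qi in simp_all)
    then show ?thesis by simp
  qed
  have Zi: "integrable ?M (Z n)" for n
    unfolding Z_def[abs_def] using \<phi>(4) Ui Ti \<zeta>(4)
    by (intro Bochner_Integration.integrable_add integrable_mult_right Bochner_Integration.integrable_sum) auto
  have Ei: "integrable ?M (E n)" for n
  proof (rule Bochner_Integration.integrable_bound[OF Zi Em])
    show "AE x in ?M. norm (E n x) \<le> norm (Z n x)" using EZ[of n] E0[of n] by eventually_elim simp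
  qed
  have Ele: "(LINT x|?M. E n x) \<le> 2 * \<Lambda> * (real CARD('d) * (1 / a n)) + 4 * (B * (LINT x|?M. U n x) + 1 / a n) + 4 * (LINT x|?M. T n x)" for n
  proof -
    have "(LINT x|?M. E n x) \<le> (LINT x|?M. Z n x)" by (rule integral_mono_AE[OF Ei Zi EZ])
    also have "\<dots> = 2 * \<Lambda> * (\<Sum>k\<in>UNIV. LINT x|?M. (partial k (\<phi> n) x - h n x $ k)\<^sup>2) + 4 * (B * (LINT x|?M. U n x) + (a n)\<^sup>2 * (LINT x|?M. D n x)) + 4 * (LINT x|?M. T n x)"
      unfolding Z_def using \<phi>(4) Ui Ti \<zeta>(4) by simp
    also have "\<dots> \<le> 2 * \<Lambda> * (real CARD('d) * (1 / a n)) + 4 * (B * (LINT x|?M. U n x) + 1 / a n) + 4 * (LINT x|?M. T n x)"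
    proof (intro add_mono mult_left_mono order_refl)
      show "(\<Sum>k\<in>UNIV. LINT x|?M. (partial k (\<phi> n) x - h n x $ k)\<^sup>2) \<le> real CARD('d) * (1 / a n)"
        by (rule sum_bounded_above[where A="UNIV :: 'd set", OF \<phi>(5)])
      have "(a n)\<^sup>2 * (LINT x|?M. D n x) \<le> (a n)\<^sup>2 * (1 / a n ^ 3)"
        using \<zeta>(5)[of n] by (intro mult_left_mono) (auto simp: a_def)
      also have "\<dots> = 1 / a n" using a[of n] by (simp add: field_simps power2_eq_square power3_eq_cube)
      finally show "(a n)\<^sup>2 * (LINT x|?M. D n x) \<le> 1 / a n" .
    qed (use \<Lambda> B in auto)
    finally show ?thesis .
  qed
  have EL: "(\<lambda>n. LINT x|?M. E n x) \<longlonglongrightarrow> 0"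
  proof (rule tendsto_sandwich[OF _ _ tendsto_const[of 0]])
    show "\<forall>\<^sub>F n in sequentially. 0 \<le> (LINT x|?M. E n x)"
      by (intro always_eventually allI integral_nonneg_AE E0)
    show "\<forall>\<^sub>F n in sequentially. (LINT x|?M. E n x) \<le> 2 * \<Lambda> * (real CARD('d) * (1 / a n)) + 4 * (B * (LINT x|?M. U n x) + 1 / a n) + 4 * (LINT x|?M. T n x)"
      by (intro always_eventually allI Ele)
    have "(\<lambda>n. 2 * \<Lambda> * (real CARD('d) * (1 / a n)) + 4 * (B * (LINT x|?M. U n x) + 1 / a n) + 4 * (LINT x|?M. T n x)) \<longlonglongrightarrow>
      2 * \<Lambda> * (real CARD('d) * 0) + 4 * (B * 0 + 0) + 4 * 0"
      by (intro tendsto_add tendsto_mult_left a0 UL TL)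
    then show "(\<lambda>n. 2 * \<Lambda> * (real CARD('d) * (1 / a n)) + 4 * (B * (LINT x|?M. U n x) + 1 / a n) + 4 * (LINT x|?M. T n x)) \<longlonglongrightarrow> 0" by simp
  qed

  have tU: "f \<in> test_functions UNIV" if "f \<in> test_functions \<Omega>" for f
    using that by (auto simp: test_functions_def)
  have h0\<phi>: "(\<lambda>n. h0 \<Omega> C (\<phi> n)) \<longlonglongrightarrow> q"
    unfolding q h0_energy(2)[OF C tU[OF \<phi>(1)] \<Omega>(1)]
    by (rule integral_tendsto_of_energy[OF pd Qi h0_energy(1)[OF C tU[OF \<phi>(1)] \<Omega>(1)] Ei[unfolded E_def[abs_def]] EL[unfolded E_def]])
  \<comment> \<open>Both approximants are compared with \<open>g\<close>, so the energy of their
    difference is controlled by their two separate errors.\<close>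
  have cauchy: "h0 \<Omega> C (\<lambda>x. \<phi> m x - \<phi> n x) \<le> 2 * (LINT x|?M. E m x) + 2 * (LINT x|?M. E n x)" for m n
  proof -
    let ?f = "\<lambda>x. \<phi> m x - \<phi> n x"
    have t: "?f \<in> test_functions UNIV" by (intro tU test_functions_diff \<phi>(1))
    have gf: "gradient ?f x = (gradient (\<phi> m) x - g x) + (g x - gradient (\<phi> n) x)" for x
      unfolding vec_eq_iff using partial_diff[OF Ck_Suc_differentiable[OF test_functions_Ck[OF \<phi>(1)]] Ck_Suc_differentiable[OF test_functions_Ck[OF \<phi>(1)]]]
      by simp
    have "h0 \<Omega> C ?f = (LINT x|?M. gradient ?f x \<bullet> (C x *v gradient ?f x))" by (rule h0_energy(2)[OF C t \<Omega>(1)])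
    also have "\<dots> \<le> (LINT x|?M. 2 * E m x + 2 * E n x)"
    proof (rule integral_mono_AE[OF h0_energy(1)[OF C t \<Omega>(1)]])
      show "integrable ?M (\<lambda>x. 2 * E m x + 2 * E n x)" using Ei by simp
      show "AE x in ?M. gradient ?f x \<bullet> (C x *v gradient ?f x) \<le> 2 * E m x + 2 * E n x"
        using pd
      proof eventually_elim
        case (elim x)
        have "(g x - gradient (\<phi> n) x) \<bullet> (C x *v (g x - gradient (\<phi> n) x)) = E n x"
          unfolding E_def quadratic_form_sum by (intro sum.cong refl) (simp add: algebra_simps)
        then show ?case unfolding gf
          using quadratic_add_le[OF elim, of "gradient (\<phi> m) x - g x" "g x - gradient (\<phi> n) x"] by (simp add: E_def)
      qed
    qed
    also have "\<dots> = 2 * (LINT x|?M. E m x) + 2 * (LINT x|?M. E n x)" using Ei by simp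
    finally show ?thesis .
  qed
  have "\<exists>N. \<forall>m\<ge>N. \<forall>n\<ge>N. h0 \<Omega> C (\<lambda>x. \<phi> m x - \<phi> n x) < e" if e: "e > 0" for e
  proof -
    have "\<forall>\<^sub>F n in sequentially. (LINT x|?M. E n x) < e / 4" using EL e by (intro order_tendstoD(2)) auto
    then obtain N where N: "\<And>n. n \<ge> N \<Longrightarrow> (LINT x|?M. E n x) < e / 4" by (auto simp: eventually_sequentially)
    have "h0 \<Omega> C (\<lambda>x. \<phi> m x - \<phi> n x) < e" if "m \<ge> N" "n \<ge> N" for m n
      using cauchy[of m n] N[OF that(1)] N[OF that(2)] by linarith
    then show ?thesis by blast
  qed
  then have "(u, q) \<in> hD_form \<Omega> C"
    unfolding hD_form_def using uL2 \<phi>(1) L2lim h0\<phi> by blast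
  then show "p \<in> hD_form \<Omega> C" by (simp add: p)
qed

theorem theorem1p1:
  fixes \<Omega> :: "(real^'d) set"
    and C :: "real^'d \<Rightarrow> real^'d^'d"
    and s \<delta> :: real
  assumes "is_domain \<Omega>"
    and "frontier \<Omega> \<noteq> {}"
    and "0 < s" and "s < real CARD('d)"
    and "ahlfors_regular (frontier \<Omega>) s"
    and "real CARD('d) - 1 \<le> s \<Longrightarrow>
           \<exists>z\<in>frontier \<Omega>. \<exists>R>0. uniform_in \<Omega> (\<Omega> \<inter> ball z R)"
    and "admissible_coefficients \<Omega> C"
    and "0 \<le> \<delta>"
    and "degenerate_at_boundary \<Omega> C \<delta>"
  shows "markov_unique \<Omega> C \<longleftrightarrow> \<delta> \<ge> 1 + (s - (real CARD('d) - 1))"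
proof -
  let ?\<Gamma> = "frontier \<Omega>"
  have op: "open \<Omega>" using assms(1) by (simp add: is_domain_def)
  show ?thesis
  proof
    assume mu: "markov_unique \<Omega> C"
    show "\<delta> \<ge> 1 + (s - (real CARD('d) - 1))"
    proof (rule ccontr)
      assume "\<not> \<delta> \<ge> 1 + (s - (real CARD('d) - 1))"
      then have \<delta>: "\<delta> < 2 - real CARD('d) + s" by simp
      have "\<exists>z \<rho> L \<kappa> M N j1 P D. z \<in> ?\<Gamma> \<and> \<rho> > 0 \<and> L > 0 \<and> \<kappa> > 0 \<and> M \<ge> 0 \<and> N \<ge> 0 \<and> chains_to_boundary \<Omega> s \<delta> z \<rho> L \<kappa> M N j1 P D"
      proof (cases "real CARD('d) - 1 \<le> s")
        case True
        then obtain z R where z: "z \<in> ?\<Gamma>" "R > 0" "uniform_in \<Omega> (\<Omega> \<inter> ball z R)" using assms(6) by blast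
        from chains_uniform[OF assms(1,2,5,8) z] z(1) show ?thesis by blast
      next
        case False
        obtain z where z: "z \<in> ?\<Gamma>" using assms(2) by blast
        have "s < real CARD('d) - 1" using False by simp
        from chains_thin_boundary[OF assms(1,2,5) this assms(8) \<delta> z]
        obtain N where N: "N \<ge> 0" "chains_to_boundary \<Omega> s \<delta> z 1 1 1 (2 ^ CARD('d)) N 0 (\<lambda>j x. x) (\<lambda>j. UNIV)" by blast
        have "(0::real) \<le> 2 ^ CARD('d)" by simp
        then show ?thesis using z N zero_less_one by blast
      qed
      then obtain z \<rho> L \<kappa> M N j1 P D where "z \<in> ?\<Gamma>" "\<rho> > 0" "L > 0" "\<kappa> > 0" "M \<ge> 0" "N \<ge> 0"
        "chains_to_boundary \<Omega> s \<delta> z \<rho> L \<kappa> M N j1 P D" by blast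
      from capacity_obstruction[OF assms(1,2,4,5,7,9) \<delta> this] mu show False by blast
    qed
  next
    assume "\<delta> \<ge> 1 + (s - (real CARD('d) - 1))"
    then have \<delta>: "2 - real CARD('d) + s \<le> \<delta>" by simp
    show "markov_unique \<Omega> C"
      unfolding markov_unique_def
      using hD_subset_hN[OF op assms(7)] hN_subset_hD[OF op assms(2,5,7,9,8) \<delta>] by blast
  qed
qed

end
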